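(* Let $0<\epsilon<1$. Given an unweighted rank-$r$ multi-hypergraph $H$ on $n$ vertices and at most $m$ hyperedges, whose maximum multiplicity of a hyperedge is at least $w^\star$, there exists a fully dynamic data structure that deterministically maintains a $(1+\epsilon)$-approximation to the densest subhypergraph problem. The worst-case update time is $O\big(\max\{(64r\epsilon^{-2}\log n)/w^\star,1\}\cdot r\epsilon^{-4}\log^2 n\log m\big)$ per hyperedge insertion or deletion. The worst-case query times for max-density and densest-subset queries are $O(1)$ and $O(\beta+\log n)$ respectively, where $\beta$ is the output size.
   Context: A multi-hypergraph $H=(V,E)$ has a multiset $E$ of hyperedges (nonempty subsets of $V$); the multiplicity of a hyperedge is its number of copies, and the rank is the maximum number of vertices of a hyperedge. For nonempty $U\subseteq V$, $E[U]$ is the multiset of hyperedges contained in $U$ and the density is $\rho_H(U)=|E[U]|/|U|$ (copies counted with multiplicity); $\rho^*(H)=\max_U\rho_H(U)$. In the fully dynamic setting, each update inserts or deletes one (copy of a) hyperedge. A max-density query asks for $\rho^*(H)$ and a densest-subset query asks for a subset of maximum density. A data structure maintains a $(1+\epsilon)$-approximation if every max-density query is answered with a value in $[\rho^*/(1+\epsilon),\rho^*]$ and every densest-subset query with a subset $U$ with $\rho_H(U)\in[\rho^*/(1+\epsilon),\rho^*]$. *)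

theory Defs
  imports Complex_Main "HOL-Library.Multiset"
begin

section \<open>Multi-hypergraphs and density\<close>

text \<open>A multi-hypergraph is given by its vertex set \<open>V\<close> and its multiset \<open>E\<close> of hyperedges.\<close>

definition multi_hypergraph :: "'a set \<Rightarrow> 'a set multiset \<Rightarrow> bool" where
  "multi_hypergraph V E \<longleftrightarrow> finite V \<and> (\<forall>e \<in># E. e \<noteq> {} \<and> e \<subseteq> V)"

definition rank :: "'a set multiset \<Rightarrow> nat" where
  "rank E = Max (insert 0 (card ` set_mset E))"

definition max_multiplicity :: "'a set multiset \<Rightarrow> nat" where
  "max_multiplicity E = Max (insert 0 (count E ` set_mset E))"

definition induced_edges :: "'a set multiset \<Rightarrow> 'a set \<Rightarrow> 'a set multiset" where
  "induced_edges E U = {# e \<in># E. e \<subseteq> U #}"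

definition density :: "'a set multiset \<Rightarrow> 'a set \<Rightarrow> real" where
  "density E U = real (size (induced_edges E U)) / real (card U)"

definition max_density :: "'a set \<Rightarrow> 'a set multiset \<Rightarrow> real" where
  "max_density V E = Max (density E ` {U. U \<subseteq> V \<and> U \<noteq> {}})"


section \<open>A word RAM\<close>

text \<open>
  The cost model is the standard unit-cost word RAM: memory cells hold words of \<open>W\<close> bits, are
  addressed by words and are initially zero; arithmetic is modulo \<open>2 ^ W\<close>. Every instruction costs
  one step, including reading one word of input and writing one word of output. The first operand
  of an instruction that computes a value is the destination cell. \<open>Load i j\<close> and \<open>Store i j\<close> are the
  indirect accesses \<open>M[i] := M[M[j]]\<close> and \<open>M[M[i]] := M[j]\<close>. A run halts when the program counter
  leaves the program. \<open>Read\<close> delivers 0 once the input is used up.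
\<close>

datatype arith = Add | Sub | Mul | Quot | Rem

datatype instr =
    Const nat nat
  | Move nat nat
  | Load nat nat
  | Store nat nat
  | Arith arith nat nat nat
  | Jump nat
  | Jump_less nat nat nat
  | Read nat
  | Write nat

type_synonym program = "instr list"
type_synonym memory = "nat \<Rightarrow> nat"

record config =
  pc :: nat
  mem :: memory
  inp :: "nat list"
  outp :: "nat list"

fun arith_sem :: "nat \<Rightarrow> arith \<Rightarrow> nat \<Rightarrow> nat \<Rightarrow> nat" where
  "arith_sem W Add x y = (x + y) mod 2 ^ W"
| "arith_sem W Sub x y = (x + 2 ^ W - y) mod 2 ^ W"
| "arith_sem W Mul x y = (x * y) mod 2 ^ W"
| "arith_sem W Quot x y = x div y"
| "arith_sem W Rem x y = x mod y"

definition set_cell :: "nat \<Rightarrow> nat \<Rightarrow> nat \<Rightarrow> config \<Rightarrow> config" where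
  "set_cell W i v c = c\<lparr>pc := Suc (pc c), mem := (mem c)(i := v mod 2 ^ W)\<rparr>"

fun exec_instr :: "nat \<Rightarrow> instr \<Rightarrow> config \<Rightarrow> config" where
  "exec_instr W (Const i v) c = set_cell W i v c"
| "exec_instr W (Move i j) c = set_cell W i (mem c j) c"
| "exec_instr W (Load i j) c = set_cell W i (mem c (mem c j)) c"
| "exec_instr W (Store i j) c = set_cell W (mem c i) (mem c j) c"
| "exec_instr W (Arith f i j k) c = set_cell W i (arith_sem W f (mem c j) (mem c k)) c"
| "exec_instr W (Jump l) c = c\<lparr>pc := l\<rparr>"
| "exec_instr W (Jump_less i j l) c = c\<lparr>pc := (if mem c i < mem c j then l else Suc (pc c))\<rparr>"
| "exec_instr W (Read i) c =
     (case inp c of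
        [] \<Rightarrow> set_cell W i 0 c
      | x # xs \<Rightarrow> (set_cell W i x c)\<lparr>inp := xs\<rparr>)"
| "exec_instr W (Write i) c = c\<lparr>pc := Suc (pc c), outp := outp c @ [mem c i]\<rparr>"

definition halted :: "program \<Rightarrow> config \<Rightarrow> bool" where
  "halted P c \<longleftrightarrow> length P \<le> pc c"

definition step :: "nat \<Rightarrow> program \<Rightarrow> config \<Rightarrow> config" where
  "step W P c = (if halted P c then c else exec_instr W (P ! pc c) c)"

text \<open>
  \<open>runs W P M xs M' ys t\<close>: started at its first instruction with memory \<open>M\<close> and input \<open>xs\<close>, the
  program halts after exactly \<open>t\<close> steps, leaving memory \<open>M'\<close> and having written \<open>ys\<close>.
\<close>

definition runs ::
  "nat \<Rightarrow> program \<Rightarrow> memory \<Rightarrow> nat list \<Rightarrow> memory \<Rightarrow> nat list \<Rightarrow> nat \<Rightarrow> bool" where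
  "runs W P M xs M' ys t \<longleftrightarrow>
     (let c = (\<lambda>s. (step W P ^^ s) \<lparr>pc = 0, mem = M, inp = xs, outp = []\<rparr>)
      in (\<forall>s<t. \<not> halted P (c s)) \<and> halted P (c t) \<and> mem (c t) = M' \<and> outp (c t) = ys)"


section \<open>The dynamic densest subhypergraph problem\<close>

text \<open>The hypergraphs a data structure is promised to see at all times, with vertices \<open>0, \<dots>, n - 1\<close>;
  \<open>m\<close> bounds the number of hyperedges counted with multiplicity.\<close>

definition admissible :: "nat \<Rightarrow> nat \<Rightarrow> nat \<Rightarrow> nat \<Rightarrow> nat set multiset \<Rightarrow> bool" where
  "admissible n m r w E \<longleftrightarrow>
     multi_hypergraph {..<n} E \<and> rank E \<le> r \<and> size E \<le> m \<and> w \<le> max_multiplicity E"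

datatype operation = Insert "nat set" | Delete "nat set" | Max_Density | Densest_Subset

fun apply_op :: "operation \<Rightarrow> nat set multiset \<Rightarrow> nat set multiset" where
  "apply_op (Insert e) E = add_mset e E"
| "apply_op (Delete e) E = E - {#e#}"
| "apply_op Max_Density E = E"
| "apply_op Densest_Subset E = E"

fun deletes_present :: "operation \<Rightarrow> nat set multiset \<Rightarrow> bool" where
  "deletes_present (Delete e) E \<longleftrightarrow> e \<in># E"
| "deletes_present _ E \<longleftrightarrow> True"

definition legal :: "nat \<Rightarrow> nat \<Rightarrow> nat \<Rightarrow> nat \<Rightarrow> operation \<Rightarrow> nat set multiset \<Rightarrow> bool" where
  "legal n m r w p E \<longleftrightarrow> deletes_present p E \<and> admissible n m r w (apply_op p E)"

text \<open>
  A single program serves all operations; the first input word selects the operation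
  (0 for the initialisation).
\<close>

definition encode_edge :: "nat set \<Rightarrow> nat list" where
  "encode_edge e = card e # sorted_list_of_set e"

fun encode_op :: "operation \<Rightarrow> nat list" where
  "encode_op (Insert e) = 1 # encode_edge e"
| "encode_op (Delete e) = 2 # encode_edge e"
| "encode_op Max_Density = [3]"
| "encode_op Densest_Subset = [4]"

text \<open>
  Words have \<open>\<Theta>(log (n + m + r + 1/\<epsilon>))\<close> bits. This keeps the memory polynomial in these parameters,
  so that neither a word nor a table of answers can encode arbitrarily much. The real number \<open>\<epsilon>\<close> is
  handed to the program as a fixed-point number, rounded down to the precision of a word.
\<close>

definition word_size :: "nat \<Rightarrow> real \<Rightarrow> nat \<Rightarrow> nat \<Rightarrow> nat \<Rightarrow> nat" where
  "word_size k \<epsilon> n m r = k * nat \<lceil>log 2 (real n + real m + real r + 1 / \<epsilon>)\<rceil>"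

definition encode_init ::
  "nat \<Rightarrow> real \<Rightarrow> nat \<Rightarrow> nat \<Rightarrow> nat \<Rightarrow> nat \<Rightarrow> nat set list \<Rightarrow> nat list" where
  "encode_init W \<epsilon> n m r w es =
     [0, nat \<lfloor>\<epsilon> * 2 ^ W\<rfloor>, n, m, r, w, length es] @ concat (map encode_edge es)"

text \<open>
  \<open>reachable W P \<epsilon> n m r w M E\<close>: for some initial admissible hypergraph, presented to the
  initialisation in some order on a blank memory, and some legal sequence of operations (queries
  may change the memory as well), the current hypergraph is \<open>E\<close> and the current memory is \<open>M\<close>.
\<close>

inductive reachable ::
  "nat \<Rightarrow> program \<Rightarrow> real \<Rightarrow> nat \<Rightarrow> nat \<Rightarrow> nat \<Rightarrow> nat \<Rightarrow> memory \<Rightarrow> nat set multiset \<Rightarrow> bool"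
  for W P \<epsilon> n m r w where
  init: "admissible n m r w (mset es) \<Longrightarrow>
         runs W P (\<lambda>_. 0) (encode_init W \<epsilon> n m r w es) M ys t \<Longrightarrow>
         reachable W P \<epsilon> n m r w M (mset es)"
| oper: "reachable W P \<epsilon> n m r w M E \<Longrightarrow> legal n m r w p E \<Longrightarrow>
         runs W P M (encode_op p) M' ys t \<Longrightarrow>
         reachable W P \<epsilon> n m r w M' (apply_op p E)"

text \<open>A max-density query is answered with a fraction, a densest-subset query with a list of the
  vertices of the subset.\<close>

fun correct_answer :: "real \<Rightarrow> nat \<Rightarrow> nat set multiset \<Rightarrow> operation \<Rightarrow> nat list \<Rightarrow> bool" where
  "correct_answer \<epsilon> n E Max_Density ys \<longleftrightarrow>
     (\<exists>a b. ys = [a, b] \<and> b \<noteq> 0 \<and>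
        real a / real b \<in> {max_density {..<n} E / (1 + \<epsilon>) .. max_density {..<n} E})"
| "correct_answer \<epsilon> n E Densest_Subset ys \<longleftrightarrow>
     distinct ys \<and> set ys \<noteq> {} \<and> set ys \<subseteq> {..<n} \<and>
     density E (set ys) \<in> {max_density {..<n} E / (1 + \<epsilon>) .. max_density {..<n} E}"
| "correct_answer \<epsilon> n E _ ys \<longleftrightarrow> True"

text \<open>\<open>P\<close> initialises on every admissible hypergraph, and in every reachable state every legal
  operation terminates with a correct answer.\<close>

definition maintains_densest ::
  "nat \<Rightarrow> program \<Rightarrow> real \<Rightarrow> nat \<Rightarrow> nat \<Rightarrow> nat \<Rightarrow> nat \<Rightarrow> bool" where
  "maintains_densest W P \<epsilon> n m r w \<longleftrightarrow>
     (\<forall>es. admissible n m r w (mset es) \<longrightarrow>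
        (\<exists>M ys t. runs W P (\<lambda>_. 0) (encode_init W \<epsilon> n m r w es) M ys t)) \<and>
     (\<forall>M E p. reachable W P \<epsilon> n m r w M E \<longrightarrow> legal n m r w p E \<longrightarrow>
        (\<exists>M' ys t. runs W P M (encode_op p) M' ys t \<and> correct_answer \<epsilon> n E p ys))"

text \<open>\<open>op_time W P \<epsilon> n m r w p \<beta> t\<close>: some legal execution of the operation \<open>p\<close> takes \<open>t\<close> steps and
  outputs \<open>\<beta>\<close> words.\<close>

definition op_time ::
  "nat \<Rightarrow> program \<Rightarrow> real \<Rightarrow> nat \<Rightarrow> nat \<Rightarrow> nat \<Rightarrow> nat \<Rightarrow> operation \<Rightarrow> nat \<Rightarrow> nat \<Rightarrow> bool" where
  "op_time W P \<epsilon> n m r w p \<beta> t \<longleftrightarrow>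
     (\<exists>M E M' ys. reachable W P \<epsilon> n m r w M E \<and> legal n m r w p E \<and>
        runs W P M (encode_op p) M' ys t \<and> \<beta> = length ys)"

text \<open>Logarithms in time bounds are truncated from below so that an \<open>O\<close>-bound does not degenerate to
  0 when its argument is 1; for \<open>x \<ge> 2\<close> this is the binary logarithm.\<close>

definition lg :: "nat \<Rightarrow> real" where
  "lg x = log 2 (real (max 2 x))"

end

theory Submission
  imports Defs "HOL-Library.Sublist"
begin

text \<open>
  Every hyperedge is replaced by \<open>D\<close> copies, which makes the densest subhypergraph very dense. Each copy is
  owned by one of its vertices, and the load of a vertex is the number of copies it owns. Suppose that
  the load of the owner of a copy exceeds the loads of its other vertices at most by the factor
  \<open>1 + 1 / b\<close> and a constant. The largest load bounds the density of every set from above, because the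
  copies inside a set are owned by its vertices. It is nearly attained: going down from the largest load in
  steps of this size, the number of vertices above the level cannot always grow by the factor
  \<open>1 + 1 / q\<close>, and at a level where it does not, nearly all the load of these vertices comes from
  copies inside the set they form. An update repairs the balance along a chain of copies whose loads change
  geometrically. The vertices of a copy know the load of its owner only up to a delay: a change of
  a load refreshes \<open>4 * b\<close> copies in round-robin order.
\<close>

section \<open>A structured language compiled to the word RAM\<close>

text \<open>A change of a load cannot touch all copies at its vertex, so the neighbours work with
  levels that may be off by a relative error of about \<open>1 / (4 * b)\<close>. A deletion step
  probes two buckets of copies sorted by vertex and level; an insertion step scans
  \<open>4 * b\<close> copies. Charging the full rank to every scan would give
  \<open>log (m * n)\<close> where only \<open>log m\<close> is allowed. The remedy: copies met at a
  high load are small, because the loads of their vertices sum to at most the number of copies, and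
  the sizes telescope against \<open>potential\<close>. The constants: \<open>q\<close> lies between
  \<open>4 / \<epsilon>\<close> and \<open>16 / \<epsilon>\<close>, \<open>h\<close> is about
  \<open>log n\<close>, and \<open>b = 4 * q ^ 2 * h\<close>. The additive slack adds up over the
  descent, and is negligible only if the largest load is at least \<open>8 * q ^ 2 * h\<close>. A
  hyperedge of multiplicity \<open>w\<close> forces a load of at least \<open>D * w / R\<close>, and
  \<open>D\<close> is the smallest number with \<open>D * w > 8 * R * q ^ 2 * h\<close>. This is the
  origin of the factor \<open>max (r * log n / (\<epsilon> ^ 2 * w)) 1\<close>.\<close>

datatype expr = Lit nat | Var nat | Elem nat expr | Bin arith expr expr | Top

datatype cmd =
 Skip
 | Assign nat expr
 | Put nat expr expr
 | Seq cmd cmd  (infixr ";;" 60)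
 | Cond expr expr cmd cmd
 | While expr expr cmd
 | Input nat
 | Output expr

text \<open>The cells are divided into registers (addresses \<open>64 * v\<close>), temporaries of the expression
 evaluation (\<open>64 * d + 1\<close>), and the interleaved arrays \<open>a = 2, \<dots>, 63\<close> (\<open>64 * i + a\<close>).\<close>

record store =
 regs :: "nat => nat"
 arrs :: "nat => nat => nat"
 ins :: "nat list"
 outs :: "nat list"

fun arith_nat :: "arith => nat => nat => nat" where
 "arith_nat Add x y = x + y"
| "arith_nat Sub x y = x - y"
| "arith_nat Mul x y = x * y"
| "arith_nat Quot x y = x div y"
| "arith_nat Rem x y = x mod y"

primrec ev :: "nat => store => expr => nat" where
 "ev W s (Lit n) = n"
| "ev W s (Var v) = regs s v"
| "ev W s (Elem a e) = arrs s a (ev W s e)"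
| "ev W s (Bin f e1 e2) = arith_nat f (ev W s e1) (ev W s e2)"
| "ev W s Top = 2 ^ W - 1"

text \<open>Numbers below \<open>bnd W\<close> remain words after the multiplication by 64 of the
  address layout. Keeping all sums and products below it also rules out wrap-around.\<close>

definition bnd :: "nat => nat" where
 "bnd W = 2 ^ W div 64"

fun arith_ok :: "nat => arith => nat => nat => bool" where
 "arith_ok W Add x y \<longleftrightarrow> x + y < bnd W"
| "arith_ok W Sub x y \<longleftrightarrow> y <= x"
| "arith_ok W Mul x y \<longleftrightarrow> x * y < bnd W"
| "arith_ok W Quot x y \<longleftrightarrow> True"
| "arith_ok W Rem x y \<longleftrightarrow> True"

primrec ok :: "nat => store => expr => bool" where
 "ok W s (Lit n) \<longleftrightarrow> n < bnd W"
| "ok W s (Var v) \<longleftrightarrow> True"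
| "ok W s (Elem a e) \<longleftrightarrow> 1 < bnd W & 2 <= a & a < 64 & ok W s e & ev W s e < bnd W"
| "ok W s (Bin f e1 e2) \<longleftrightarrow> ok W s e1 & ok W s e2 & arith_ok W f (ev W s e1) (ev W s e2)"
| "ok W s Top \<longleftrightarrow> True"

primrec cost :: "expr => nat" where
 "cost (Lit n) = 1"
| "cost (Var v) = 1"
| "cost (Elem a e) = cost e + 5"
| "cost (Bin f e1 e2) = cost e1 + cost e2 + 1"
| "cost Top = 3"

text \<open>The argument of type \<open>nat\<close> is fuel for the unrolling. With no fuel left the
  precondition is \<open>False\<close>, so the existential quantifier over \<open>j\<close> in the
  clause for \<open>While\<close> expresses termination.\<close>

primrec witer :: "nat => expr => expr => ((store => real => bool) => store => real => bool) =>
 (store => real => bool) => nat => store => real => bool" where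
 "witer W a b F Q 0 s k \<longleftrightarrow> False"
| "witer W a b F Q (Suc j) s k \<longleftrightarrow> ok W s a & ok W s b & real (cost a + cost b + 2) <= k &
  (if ev W s a < ev W s b then F (witer W a b F Q j) s (k - real (cost a + cost b + 2))
  else Q s (k - real (cost a + cost b + 2)))"

text \<open>Weakest preconditions with time credits: the postcondition also sees the credits left.\<close>

primrec wp :: "nat => cmd => (store => real => bool) => store => real => bool" where
 "wp W Skip Q s k \<longleftrightarrow> Q s k"
| "wp W (Assign v e) Q s k \<longleftrightarrow> ok W s e & real (cost e + 1) <= k &
  Q (s(|regs := (regs s)(v := ev W s e)|)) (k - real (cost e + 1))"
| "wp W (Put a i e) Q s k \<longleftrightarrow> 1 < bnd W & 2 <= a & a < 64 & ok W s i & ok W s e & ev W s i < bnd W &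
  real (cost i + cost e + 5) <= k &
  Q (s(|arrs := (arrs s)(a := (arrs s a)(ev W s i := ev W s e))|)) (k - real (cost i + cost e + 5))"
| "wp W (Seq c1 c2) Q s k \<longleftrightarrow> wp W c1 (wp W c2 Q) s k"
| "wp W (Cond a b c1 c2) Q s k \<longleftrightarrow> ok W s a & ok W s b & real (cost a + cost b + 2) <= k &
  (if ev W s a < ev W s b then wp W c1 Q s (k - real (cost a + cost b + 2))
  else wp W c2 Q s (k - real (cost a + cost b + 2)))"
| "wp W (While a b c) Q s k \<longleftrightarrow> (\<exists>j. witer W a b (wp W c) Q j s k)"
| "wp W (Input v) Q s k \<longleftrightarrow> 1 <= k & (case ins s of
  [] => Q (s(|regs := (regs s)(v := 0)|)) (k - 1)
  | x # xs => x < 2 ^ W & Q (s(|regs := (regs s)(v := x), ins := xs|)) (k - 1))"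
| "wp W (Output e) Q s k \<longleftrightarrow> ok W s e & real (cost e + 1) <= k &
  Q (s(|outs := outs s @ [ev W s e]|)) (k - real (cost e + 1))"

text \<open>\<open>d\<close> is the depth of the evaluation stack, and the value ends up in the
  temporary \<open>64 * d + 1\<close>. \<open>Top\<close> is produced as 0 - 1 modulo
  \<open>2 ^ W\<close>, since a program that is fixed for all \<open>W\<close> cannot contain the
  constant.\<close>

primrec ce :: "expr => nat => instr list" where
 "ce (Lit n) d = [Const (64 * d + 1) n]"
| "ce (Var v) d = [Move (64 * d + 1) (64 * v)]"
| "ce (Elem a e) d = ce e d @ [Const (64 * Suc d + 1) 64,
  Arith Mul (64 * d + 1) (64 * d + 1) (64 * Suc d + 1), Const (64 * Suc d + 1) a,
  Arith Add (64 * d + 1) (64 * d + 1) (64 * Suc d + 1), Load (64 * d + 1) (64 * d + 1)]"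
| "ce (Bin f e1 e2) d = ce e1 d @ ce e2 (Suc d) @
  [Arith f (64 * d + 1) (64 * d + 1) (64 * Suc d + 1)]"
| "ce Top d = [Const (64 * d + 1) 0, Const (64 * Suc d + 1) 1,
  Arith Sub (64 * d + 1) (64 * d + 1) (64 * Suc d + 1)]"

text \<open>\<open>p\<close> is the address of the generated code, needed because jumps are
  absolute. A conditional lays out its else branch first, directly behind the test.\<close>

primrec cc :: "cmd => nat => instr list" where
 "cc Skip p = []"
| "cc (Assign v e) p = ce e 0 @ [Move (64 * v) 1]"
| "cc (Put a i e) p = ce i 0 @ [Const 65 64, Arith Mul 1 1 65, Const 65 a, Arith Add 1 1 65] @
  ce e 1 @ [Store 1 65]"
| "cc (Seq c1 c2) p = cc c1 p @ cc c2 (p + length (cc c1 p))"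
| "cc (Cond a b c1 c2) p = (let g = ce a 0 @ ce b 1; p2 = p + length g + 1; z2 = cc c2 p2;
  p1 = p2 + length z2 + 1; z1 = cc c1 p1
  in g @ [Jump_less 1 65 p1] @ z2 @ [Jump (p1 + length z1)] @ z1)"
| "cc (While a b c) p = (let g = ce a 0 @ ce b 1; p1 = p + length g + 2; z = cc c p1
  in g @ [Jump_less 1 65 p1, Jump (p1 + length z + 1)] @ z @ [Jump p])"
| "cc (Input v) p = [Read (64 * v)]"
| "cc (Output e) p = ce e 0 @ [Write 1]"

section \<open>Placement of code and simulation by the compiled program\<close>

definition code_at :: "program => nat => instr list => bool" where
 "code_at P p z \<longleftrightarrow> (\<exists>pre suf. P = pre @ z @ suf & length pre = p)"

lemma code_at_append: "code_at P p (z1 @ z2) \<longleftrightarrow> code_at P p z1 & code_at P (p + length z1) z2"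
proof
 assume "code_at P p (z1 @ z2)"
 then obtain pre suf where P: "P = pre @ (z1 @ z2) @ suf" "length pre = p"
 unfolding code_at_def by blast
 have "P = pre @ z1 @ (z2 @ suf)" "P = (pre @ z1) @ z2 @ suf" "length (pre @ z1) = p + length z1"
 using P by auto
 then show "code_at P p z1 & code_at P (p + length z1) z2"
 using P(2) unfolding code_at_def by blast
next
 assume "code_at P p z1 & code_at P (p + length z1) z2"
 then obtain pre suf pre' suf' where P: "P = pre @ z1 @ suf" "length pre = p"
 "P = pre' @ z2 @ suf'" "length pre' = p + length z1"
 unfolding code_at_def by blast
 then have "pre' = pre @ z1"
 by (metis append.assoc append_eq_append_conv length_append)
 then show "code_at P p (z1 @ z2)"
 using P unfolding code_at_def by auto
qed

lemma code_at_Cons: "code_at P p (i # z) \<longleftrightarrow> code_at P p [i] & code_at P (Suc p) z"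
 using code_at_append[of P p "[i]" z] by simp

lemma code_at_single: "code_at P p [i] \<longleftrightarrow> p < length P & P ! p = i"
proof
 assume "p < length P & P ! p = i"
 then have "P = take p P @ [i] @ drop (Suc p) P"
 by (metis append_Cons append_Nil id_take_nth_drop)
 then show "code_at P p [i]"
 using \<open>p < length P & P ! p = i\<close> unfolding code_at_def
 by (metis length_take min.absorb4)
qed (auto simp: code_at_def)

lemma step_at: "code_at P (pc c) [i] ==> step W P c = exec_instr W i c"
 by (simp add: code_at_single step_def halted_def)

text \<open>Temporaries are left unconstrained, which makes them free for every evaluation. The
  bound concerns all cells, temporaries included, so that moving the content of a cell is exact
  despite the reduction modulo \<open>2 ^ W\<close>.\<close>

definition rel :: "nat => store => config => bool" where
 "rel W s c \<longleftrightarrow> (\<forall>v. mem c (64 * v) = regs s v) &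
  (\<forall>a i. 2 <= a --> a < 64 --> mem c (64 * i + a) = arrs s a i) &
  inp c = ins s & outp c = outs s & (\<forall>j. mem c j < 2 ^ W)"

definition reach :: "nat => program => config => nat => config => bool" where
 "reach W P c t c' \<longleftrightarrow> (step W P ^^ t) c = c'"

lemma reach_trans: "reach W P c t c' ==> reach W P c' t' c'' ==> reach W P c (t + t') c''"
 unfolding reach_def by (subst add.commute) (simp add: funpow_add)

lemma reach_step: "code_at P (pc c) [i] ==> reach W P c 1 (exec_instr W i c)"
 unfolding reach_def by (simp add: step_at)

lemma reach_step_Suc:
 "reach W P c t c' ==> code_at P (pc c') [i] ==> reach W P c (Suc t) (exec_instr W i c')"
 using reach_trans[OF _ reach_step] by force

lemma length_ce: "length (ce e d) = cost e"
 by (induction e arbitrary: d) auto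

lemma addr_inj:
 assumes "a < 64" "a' < 64"
 shows "64 * i + a = 64 * i' + a' \<longleftrightarrow> i = i' & a = (a'::nat)"
proof
 assume h: "64 * i + a = 64 * i' + a'"
 have "(64 * i + a) mod 64 = a" "(64 * i' + a') mod 64 = a'"
 using assms by simp_all
 with h show "i = i' & a = a'" by simp
qed simp

lemma addr_neq:
 "Suc (64 * d) \<noteq> 64 * v" "64 * v \<noteq> Suc (64 * d)"
 "2 <= a ==> a < 64 ==> 64 * i + a \<noteq> Suc (64 * d)"
 "2 <= a ==> a < 64 ==> 64 * i + a \<noteq> 64 * v"
 "2 <= a ==> a < 64 ==> 64 * v \<noteq> 64 * i + a"
 for a :: nat
 using addr_inj[of 1 0 d v] addr_inj[of 0 1 v d] addr_inj[of a 1 i d] addr_inj[of a 0 i v]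
 addr_inj[of 0 a v i]
 by simp_all

lemma bnd_mult: "64 * bnd W <= 2 ^ W"
 unfolding bnd_def by simp

lemma addr_lt:
 assumes "i < bnd W"
 shows "a < 64 ==> 64 * i + a < 2 ^ W" "64 * i < 2 ^ W" "i < 2 ^ W"
 using assms bnd_mult[of W] by linarith+

lemma rel_temp: "rel W s c ==> rel W s (set_cell W (64 * d + 1) x c)"
 unfolding rel_def set_cell_def by (auto simp: addr_neq)

lemma rel_pc: "rel W s c ==> rel W s (c(|pc := p|))"
 unfolding rel_def by auto

text \<open>The last conjunct protects the temporaries of smaller depth: the first operand of a
  binary operation survives the evaluation of the second one, which runs one level deeper.\<close>

lemma exec_ce:
 assumes "code_at P (pc c) (ce e d)" "rel W s c" "ok W s e"
 shows "\<exists>c'. reach W P c (cost e) c' & pc c' = pc c + cost e & rel W s c' &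
 mem c' (64 * d + 1) = ev W s e & (\<forall>d'<d. mem c' (64 * d' + 1) = mem c (64 * d' + 1))"
 using assms
proof (induction e arbitrary: d c)
 case (Lit n)
 have "reach W P c 1 (exec_instr W (Const (64 * d + 1) n) c)"
 using Lit by (intro reach_step) simp
 moreover have "n < 2 ^ W" using Lit addr_lt by simp
 ultimately show ?case
 using rel_temp[OF Lit(2), of d n]
 by (intro exI[of _ "exec_instr W (Const (64 * d + 1) n) c"]) (auto simp: set_cell_def)
next
 case (Var v)
 have "reach W P c 1 (exec_instr W (Move (64 * d + 1) (64 * v)) c)"
 using Var by (intro reach_step) simp
 moreover have "mem c (64 * v) = regs s v" "regs s v < 2 ^ W" using Var(2) unfolding rel_def by metis+
 ultimately show ?case
 using rel_temp[OF Var(2), of d "regs s v"]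
 by (intro exI[of _ "exec_instr W (Move (64 * d + 1) (64 * v)) c"]) (auto simp: set_cell_def)
next
 case (Elem a e)
 let ?t = "64 * d + 1" and ?u = "64 * Suc d + 1"
 obtain c1 where c1: "reach W P c (cost e) c1" "pc c1 = pc c + cost e" "rel W s c1"
 "mem c1 ?t = ev W s e" "\<forall>d'<d. mem c1 (64 * d' + 1) = mem c (64 * d' + 1)"
 using Elem.IH[of c d] Elem.prems by (auto simp: code_at_append)
 let ?c2 = "exec_instr W (Const ?u 64) c1"
 let ?c3 = "exec_instr W (Arith Mul ?t ?t ?u) ?c2"
 let ?c4 = "exec_instr W (Const ?u a) ?c3"
 let ?c5 = "exec_instr W (Arith Add ?t ?t ?u) ?c4"
 let ?c6 = "exec_instr W (Load ?t ?t) ?c5"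
 have ats: "code_at P (pc c + cost e) [Const ?u 64]" "code_at P (Suc (pc c + cost e)) [Arith Mul ?t ?t ?u]"
 "code_at P (Suc (Suc (pc c + cost e))) [Const ?u a]"
 "code_at P (Suc (Suc (Suc (pc c + cost e)))) [Arith Add ?t ?t ?u]"
 "code_at P (Suc (Suc (Suc (Suc (pc c + cost e))))) [Load ?t ?t]"
 using Elem.prems(1) by (simp_all only: ce.simps code_at_append length_ce)
  (simp_all only: code_at_Cons[of _ _ _ "_ # _"])
 have rc: "reach W P c (Suc (Suc (Suc (Suc (Suc (cost e)))))) ?c6"
 by (intro reach_step_Suc c1(1)) (use ats c1(2) in \<open>simp_all add: set_cell_def\<close>)
 have lt: "64 * ev W s e + a < 2 ^ W" "64 < (2::nat) ^ W" "64 * ev W s e < 2 ^ W" "a < 2 ^ W"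
 "ev W s e < 2 ^ W"
 proof -
 have e: "ev W s e < bnd W" "a < 64" "2 <= a" using Elem.prems(3) by auto
 then show "64 * ev W s e + a < 2 ^ W" "64 * ev W s e < 2 ^ W" "ev W s e < 2 ^ W" using addr_lt by auto
 have "1 < bnd W" using Elem.prems(3) by simp
 then show "64 < (2::nat) ^ W" using bnd_mult[of W] by linarith
 then show "a < 2 ^ W" using e by linarith
 qed
 have m: "mem c1 (64 * ev W s e + a) = arrs s a (ev W s e)"
 using c1(3) Elem.prems(3) unfolding rel_def by auto
 have neq: "64 * ev W s e + a \<noteq> ?t" "64 * ev W s e + a \<noteq> ?u"
 using addr_neq(3)[of a _ d] addr_neq(3)[of a _ "Suc d"] Elem.prems(3) by auto
 have lt2: "arrs s a (ev W s e) < 2 ^ W" using m c1(3) unfolding rel_def by metis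
 have r2: "rel W s ?c2"
 using rel_temp[OF c1(3), of "Suc d" 64] by simp
 have "rel W s ?c3" 
 using rel_temp[OF r2, of d] by simp
 then have "rel W s ?c4" 
 using rel_temp[of W s ?c3 "Suc d"] by simp
 then have "rel W s ?c5" 
 using rel_temp[of W s ?c4 "d"] by simp
 then have "rel W s ?c6" 
 using rel_temp[of W s ?c5 "d"] by simp
 moreover have "mem ?c6 ?t = arrs s a (ev W s e)"
 using lt lt2 m neq c1(4) by (simp add: set_cell_def mult.commute)
 moreover have "pc ?c6 = pc c + cost (Elem a e)"
 using c1(2) by (simp add: set_cell_def)
 moreover have "\<forall>d'<d. mem ?c6 (64 * d' + 1) = mem c (64 * d' + 1)"
 using c1(5) by (simp add: set_cell_def)
 ultimately show ?case
 using rc by (intro exI[of _ ?c6]) (simp add: eval_nat_numeral)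
next
 case (Bin f e1 e2)
 let ?t = "64 * d + 1" and ?u = "64 * Suc d + 1"
 obtain c1 where c1: "reach W P c (cost e1) c1" "pc c1 = pc c + cost e1" "rel W s c1"
 "mem c1 ?t = ev W s e1" "\<forall>d'<d. mem c1 (64 * d' + 1) = mem c (64 * d' + 1)"
 using Bin.IH(1)[of c d] Bin.prems by (auto simp: code_at_append)
 obtain c2 where c2: "reach W P c1 (cost e2) c2" "pc c2 = pc c1 + cost e2" "rel W s c2"
 "mem c2 ?u = ev W s e2" "\<forall>d'<Suc d. mem c2 (64 * d' + 1) = mem c1 (64 * d' + 1)"
 using Bin.IH(2)[of c1 "Suc d"] Bin.prems c1 by (auto simp: code_at_append length_ce)
 let ?c3 = "exec_instr W (Arith f ?t ?t ?u) c2"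
 have "code_at P (pc c2) [Arith f ?t ?t ?u]"
 using Bin.prems(1) c1(2) c2(2) by (simp add: code_at_append length_ce add.assoc)
 then have rc: "reach W P c (Suc (cost e1 + cost e2)) ?c3"
 by (rule reach_step_Suc[OF reach_trans[OF c1(1) c2(1)]])
 have m1: "mem c2 ?t = ev W s e1" using c2(5) c1(4) by simp
 have "ev W s e1 < 2 ^ W" "ev W s e2 < 2 ^ W" using c2(3,4) m1 unfolding rel_def by metis+
 moreover have "arith_ok W f (ev W s e1) (ev W s e2)" using Bin.prems(3) by simp
 ultimately have v: "arith_sem W f (ev W s e1) (ev W s e2) mod 2 ^ W = arith_nat f (ev W s e1) (ev W s e2)"
 proof (induction f)
 case Sub
 have gen: "(x + w - y) mod w = x - y" if "y <= x" "x < w" for x y w :: nat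
 proof -
  have eq: "x + w - y = (x - y) + w" using that by linarith
  have "x - y < w" using that by linarith
  then show ?thesis unfolding eq by simp
 qed
 show ?case using gen[of "ev W s e2" "ev W s e1" "2 ^ W"] Sub by simp
 next
 case Quot then show ?case by (simp add: le_less_trans[OF div_le_dividend])
 next
 case Rem then show ?case by (simp add: le_less_trans[OF mod_less_eq_dividend])
 next
 case Add then show ?case using addr_lt(3)[of "ev W s e1 + ev W s e2" W] by simp
 next
 case Mul then show ?case using addr_lt(3)[of "ev W s e1 * ev W s e2" W] by simp
 qed
 have "rel W s ?c3" "pc ?c3 = pc c + cost (Bin f e1 e2)"
 using rel_temp[OF c2(3), of d] c2(2) c1(2) by (simp, simp add: set_cell_def)
 moreover have "mem ?c3 ?t = ev W s (Bin f e1 e2)"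
 using v m1 c2(4) by (simp add: set_cell_def)
 moreover have "\<forall>d'<d. mem ?c3 (64 * d' + 1) = mem c (64 * d' + 1)"
 using c1(5) c2(5) by (simp add: set_cell_def)
 ultimately show ?case
 using rc by (intro exI[of _ ?c3]) simp
next
 case Top
 let ?t = "64 * d + 1" and ?u = "64 * Suc d + 1"
 let ?c2 = "exec_instr W (Const ?t 0) c"
 let ?c3 = "exec_instr W (Const ?u 1) ?c2"
 let ?c4 = "exec_instr W (Arith Sub ?t ?t ?u) ?c3"
 have ats: "code_at P (pc c) [Const ?t 0]" "code_at P (Suc (pc c)) [Const ?u 1]"
 "code_at P (Suc (Suc (pc c))) [Arith Sub ?t ?t ?u]"
 using Top(1) by (simp_all only: ce.simps code_at_Cons[of _ _ _ "_ # _"])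
 have rc: "reach W P c (Suc (Suc 1)) ?c4"
 by (intro reach_step_Suc reach_step) (use ats in \<open>simp_all add: set_cell_def\<close>)
 have "rel W s ?c2" using rel_temp[OF Top(2), of d 0] by simp
 then have "rel W s ?c3" using rel_temp[of W s ?c2 "Suc d" 1] by simp
 then have "rel W s ?c4" using rel_temp[of W s ?c3 "d"] by simp
 moreover have "(2 ^ W - 1 mod 2 ^ W) mod 2 ^ W = (2::nat) ^ W - 1"
 by (cases W) (simp_all add: mod_less)
 ultimately show ?case
 using rc by (intro exI[of _ ?c4]) (simp add: set_cell_def eval_nat_numeral)
qed

lemma at_guard:
 assumes "code_at P (pc cf) (ce a 0 @ ce b 1 @ z)" "rel W s cf" "ok W s a" "ok W s b"
 obtains cf' where "reach W P cf (cost a + cost b) cf'" "pc cf' = pc cf + (cost a + cost b)"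
 "rel W s cf'" "mem cf' 1 = ev W s a" "mem cf' 65 = ev W s b" "code_at P (pc cf') z"
proof -
 have at: "code_at P (pc cf) (ce a 0)" "code_at P (pc cf + cost a) (ce b 1)"
 "code_at P (pc cf + cost a + cost b) z"
 using assms(1) by (auto simp: code_at_append length_ce)
 obtain c1 where c1: "reach W P cf (cost a) c1" "pc c1 = pc cf + cost a" "rel W s c1"
 "mem c1 1 = ev W s a"
 using exec_ce[OF at(1) assms(2,3)] by auto
 obtain c2 where c2: "reach W P c1 (cost b) c2" "pc c2 = pc c1 + cost b" "rel W s c2"
 "mem c2 65 = ev W s b" "mem c2 1 = mem c1 1"
 using exec_ce[of P c1 b 1 W s] at(2) c1 assms(4) by auto
 show thesis
 using that[OF reach_trans[OF c1(1) c2(1)]] c1 c2 at(3) by (simp add: add.assoc)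
qed

lemma rel_assign:
 "rel W s c ==> rel W (s(|regs := (regs s)(v := x mod 2 ^ W)|)) (set_cell W (64 * v) x c)"
 unfolding rel_def set_cell_def by (auto simp: addr_neq)

lemma rel_put:
 "rel W s c ==> 2 <= a ==> a < 64 ==>
 rel W (s(|arrs := (arrs s)(a := (arrs s a)(i := x mod 2 ^ W))|)) (set_cell W (64 * i + a) x c)"
 unfolding rel_def set_cell_def by (auto simp: addr_neq addr_inj)

text \<open>Every run from the command's weakest precondition is simulated by the compiled code within
 the consumed credits.\<close>

lemma exec_cc:
 assumes "wp W c Q s k" "rel W s cf" "code_at P (pc cf) (cc c (pc cf))"
 shows "\<exists>t cf' s' k'. reach W P cf t cf' & pc cf' = pc cf + length (cc c (pc cf)) & rel W s' cf' &
 Q s' k' & real t + k' <= k"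
 using assms
proof (induction c arbitrary: Q s k cf)
 case Skip
 then show ?case
 by (intro exI[of _ 0] exI[of _ cf] exI[of _ s] exI[of _ k]) (auto simp: reach_def)
next
 case (Assign v e)
 have at: "code_at P (pc cf) (ce e 0)" "code_at P (pc cf + cost e) [Move (64 * v) 1]"
 using Assign.prems(3) by (auto simp: code_at_append length_ce)
 obtain c1 where c1: "reach W P cf (cost e) c1" "pc c1 = pc cf + cost e" "rel W s c1"
 "mem c1 1 = ev W s e"
 using exec_ce[OF at(1) Assign.prems(2)] Assign.prems(1) by auto
 let ?c2 = "exec_instr W (Move (64 * v) 1) c1"
 have "reach W P cf (Suc (cost e)) ?c2"
 by (rule reach_step_Suc[OF c1(1)]) (use at(2) c1(2) in simp)
 moreover have "ev W s e < 2 ^ W" using c1(3,4) unfolding rel_def by metis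
 then have "rel W (s(|regs := (regs s)(v := ev W s e)|)) ?c2"
 using rel_assign[OF c1(3), of v "ev W s e"] c1(4) by simp
 moreover have "pc ?c2 = pc cf + length (cc (Assign v e) (pc cf))"
 using c1(2) by (simp add: set_cell_def length_ce)
 ultimately show ?case
 using Assign.prems(1) by (intro exI[of _ "Suc (cost e)"] exI[of _ ?c2] exI conjI) auto
next
 case (Put a i e)
 let ?m = "[Const 65 64, Arith Mul 1 1 65, Const 65 a, Arith Add 1 1 65]"
 have pre: "1 < bnd W" "2 <= a" "a < 64" "ok W s i" "ok W s e" "ev W s i < bnd W"
 using Put.prems(1) by auto
 have Suc4: "Suc (Suc (Suc (Suc x))) = x + 4" for x by simp
 have at: "code_at P (pc cf) (ce i 0)" "code_at P (pc cf + cost i) ?m"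
 "code_at P (pc cf + cost i + 4) (ce e 1)" "code_at P (pc cf + cost i + 4 + cost e) [Store 1 65]"
 using Put.prems(3) unfolding cc.simps code_at_append length_ce
 by (simp_all add: Suc4 add.assoc)
 obtain c1 where c1: "reach W P cf (cost i) c1" "pc c1 = pc cf + cost i" "rel W s c1"
 "mem c1 1 = ev W s i"
 using exec_ce[OF at(1) Put.prems(2) pre(4)] by auto
 let ?c2 = "exec_instr W (Const 65 64) c1"
 let ?c3 = "exec_instr W (Arith Mul 1 1 65) ?c2"
 let ?c4 = "exec_instr W (Const 65 a) ?c3"
 let ?c5 = "exec_instr W (Arith Add 1 1 65) ?c4"
 have ats: "code_at P (pc c1) [Const 65 64]" "code_at P (Suc (pc c1)) [Arith Mul 1 1 65]"
 "code_at P (Suc (Suc (pc c1))) [Const 65 a]" "code_at P (Suc (Suc (Suc (pc c1)))) [Arith Add 1 1 65]"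
 using at(2) c1(2) by (simp_all add: code_at_Cons[of _ _ _ "_ # _"])
 have r5: "reach W P cf (Suc (Suc (Suc (Suc (cost i))))) ?c5"
 by (intro reach_step_Suc c1(1)) (use ats in \<open>simp_all add: set_cell_def\<close>)
 have lt: "64 * ev W s i + a < 2 ^ W" "64 * ev W s i < 2 ^ W" "ev W s i < 2 ^ W"
 using addr_lt[OF pre(6)] pre by auto
 have "64 < (2::nat) ^ W" using pre(1) bnd_mult[of W] by linarith
 moreover from this have "a < 2 ^ W" using pre by linarith
 ultimately have m5: "mem ?c5 1 = 64 * ev W s i + a"
 using lt c1(4) by (simp add: set_cell_def mult.commute)
 have "rel W s ?c2" using rel_temp[OF c1(3), of 1 64] by simp
 then have "rel W s ?c3" using rel_temp[of W s ?c2 0] by simp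
 then have "rel W s ?c4" using rel_temp[of W s ?c3 1 a] by simp
 then have rel5: "rel W s ?c5" using rel_temp[of W s ?c4 0] by simp
 have pc5: "pc ?c5 = pc cf + cost i + 4" using c1(2) by (simp add: set_cell_def)
 obtain c6 where c6: "reach W P ?c5 (cost e) c6" "pc c6 = pc cf + cost i + 4 + cost e" "rel W s c6"
 "mem c6 65 = ev W s e" "mem c6 1 = mem ?c5 1"
 using exec_ce[of P ?c5 e 1 W s] at(3) rel5 pre pc5 by auto
 let ?c7 = "exec_instr W (Store 1 65) c6"
 have "reach W P cf (Suc (Suc (Suc (Suc (Suc (cost i)))) + cost e)) ?c7"
 using reach_step_Suc[OF reach_trans[OF r5 c6(1)], of "Store 1 65"] at(4) c6(2) by simp
 then have "reach W P cf (cost i + cost e + 5) ?c7" by (simp add: eval_nat_numeral)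
 moreover have "ev W s e < 2 ^ W" using c6(3,4) unfolding rel_def by metis
 then have "rel W (s(|arrs := (arrs s)(a := (arrs s a)(ev W s i := ev W s e))|)) ?c7"
 using rel_put[OF c6(3) pre(2,3), of "ev W s i" "ev W s e"] c6(4,5) m5 by simp
 moreover have "pc ?c7 = pc cf + length (cc (Put a i e) (pc cf))"
 using c6(2) by (simp add: set_cell_def length_ce)
 ultimately show ?case
 using Put.prems(1)
 by (intro exI[of _ "cost i + cost e + 5"] exI[of _ ?c7] exI conjI) auto
next
 case (Seq c1 c2)
 obtain t1 cf1 s1 k1 where 1: "reach W P cf t1 cf1" "pc cf1 = pc cf + length (cc c1 (pc cf))"
 "rel W s1 cf1" "wp W c2 Q s1 k1" "real t1 + k1 <= k"
 using Seq.IH(1)[of "wp W c2 Q" s k cf] Seq.prems by (auto simp: code_at_append)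
 obtain t2 cf2 s2 k2 where 2: "reach W P cf1 t2 cf2" "pc cf2 = pc cf1 + length (cc c2 (pc cf1))"
 "rel W s2 cf2" "Q s2 k2" "real t2 + k2 <= k1"
 using Seq.IH(2)[OF 1(4,3)] Seq.prems(3) 1(2) by (auto simp: code_at_append)
 then show ?case
 using reach_trans[OF 1(1) 2(1)] 1
 by (intro exI[of _ "t1 + t2"] exI[of _ cf2] exI[of _ s2] exI[of _ k2]) auto
next
 case (Cond a b c1 c2)
 define p2 where "p2 = pc cf + cost a + cost b + 1"
 define p1 where "p1 = p2 + length (cc c2 p2) + 1"
 let ?k = "k - real (cost a + cost b + 2)"
 have code: "cc (Cond a b c1 c2) (pc cf) = ce a 0 @ ce b 1 @ [Jump_less 1 65 p1] @ cc c2 p2 @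
  [Jump (p1 + length (cc c1 p1))] @ cc c1 p1"
 by (simp add: p1_def p2_def Let_def length_ce add.assoc)
 have len: "length (cc (Cond a b c1 c2) (pc cf)) + pc cf = p1 + length (cc c1 p1)"
 unfolding code by (simp add: p1_def p2_def length_ce)
 obtain cg where cg: "reach W P cf (cost a + cost b) cg" "pc cg = pc cf + (cost a + cost b)"
 "rel W s cg" "mem cg 1 = ev W s a" "mem cg 65 = ev W s b"
 "code_at P (pc cg) ([Jump_less 1 65 p1] @ cc c2 p2 @ [Jump (p1 + length (cc c1 p1))] @ cc c1 p1)"
 using at_guard[OF Cond.prems(3)[unfolded code] Cond.prems(2)] Cond.prems(1) by auto
 have at: "code_at P (pc cg) [Jump_less 1 65 p1]" "code_at P p2 (cc c2 p2)"
 "code_at P (p2 + length (cc c2 p2)) [Jump (p1 + length (cc c1 p1))]" "code_at P p1 (cc c1 p1)"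
 using cg(6) unfolding code_at_append using cg(2) by (simp_all add: p1_def p2_def add.assoc)
 let ?c1 = "exec_instr W (Jump_less 1 65 p1) cg"
 have r1: "reach W P cf (Suc (cost a + cost b)) ?c1"
 by (rule reach_step_Suc[OF cg(1) at(1)])
 have rel1: "rel W s ?c1" using rel_pc[OF cg(3)] by simp
 show ?case
 proof (cases "ev W s a < ev W s b")
 case True
 then have pc1: "pc ?c1 = p1" using cg by simp
 obtain t cf' s' k' where 2: "reach W P ?c1 t cf'" "pc cf' = p1 + length (cc c1 p1)"
  "rel W s' cf'" "Q s' k'" "real t + k' <= ?k"
  using Cond.IH(1)[of Q s ?k ?c1] rel1 pc1 at Cond.prems(1) True by auto
 then show ?thesis
  using reach_trans[OF r1 2(1)] len
  by (intro exI[of _ "Suc (cost a + cost b) + t"] exI[of _ cf'] exI[of _ s'] exI[of _ k']) auto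
 next
 case False
 then have pc1: "pc ?c1 = p2" using cg by (simp add: p2_def)
 obtain t cf' s' k' where 2: "reach W P ?c1 t cf'" "pc cf' = p2 + length (cc c2 p2)"
  "rel W s' cf'" "Q s' k'" "real t + k' <= ?k"
  using Cond.IH(2)[of Q s ?k ?c1] rel1 pc1 at Cond.prems(1) False by auto
 let ?j = "Jump (p1 + length (cc c1 p1))"
 have "reach W P cf (Suc (Suc (cost a + cost b) + t)) (exec_instr W ?j cf')"
  using reach_step_Suc[OF reach_trans[OF r1 2(1)], of ?j] at(3) 2(2) by simp
 then show ?thesis
  using 2 len rel_pc[OF 2(3)]
  by (intro exI[of _ "Suc (Suc (cost a + cost b) + t)"] exI[of _ "exec_instr W ?j cf'"]
   exI[of _ s'] exI[of _ k']) auto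
 qed
next
 case (While a b c)
 define p where "p = pc cf"
 define p1 where "p1 = p + cost a + cost b + 2"
 let ?g = "real (cost a + cost b + 2)"
 let ?e = "p1 + length (cc c p1) + 1"
 have code: "cc (While a b c) p = ce a 0 @ ce b 1 @ [Jump_less 1 65 p1] @ [Jump ?e] @ cc c p1 @ [Jump p]"
 by (simp add: p1_def Let_def length_ce add.assoc)
 have len: "p + length (cc (While a b c) p) = ?e"
 unfolding code by (simp add: p1_def length_ce)
 \<comment> \<open>The structural induction covers one execution of the body; its repetitions need
   an inner induction on the fuel of \<open>witer\<close>.\<close>
 have *: "\<exists>t cf' s' k'. reach W P cf t cf' & pc cf' = ?e & rel W s' cf' & Q s' k' & real t + k' <= k"
 if "witer W a b (wp W c) Q j s k" "rel W s cf" "pc cf = p" "code_at P p (cc (While a b c) p)" for j s k cf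
 using that
 proof (induction j arbitrary: s k cf)
 case (Suc j)
 have ok: "ok W s a" "ok W s b" "?g <= k" using Suc.prems(1) by auto
 obtain cg where cg: "reach W P cf (cost a + cost b) cg" "pc cg = p + (cost a + cost b)"
  "rel W s cg" "mem cg 1 = ev W s a" "mem cg 65 = ev W s b"
  "code_at P (pc cg) ([Jump_less 1 65 p1] @ [Jump ?e] @ cc c p1 @ [Jump p])"
  using at_guard[of P cf a b _ W s] Suc.prems(2-4) ok unfolding code by metis
 have at: "code_at P (pc cg) [Jump_less 1 65 p1]" "code_at P (Suc (pc cg)) [Jump ?e]"
  "code_at P p1 (cc c p1)" "code_at P (p1 + length (cc c p1)) [Jump p]"
  using cg(6) unfolding code_at_append using cg(2) by (simp_all add: p1_def add.assoc)
 let ?c1 = "exec_instr W (Jump_less 1 65 p1) cg"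
 have r1: "reach W P cf (Suc (cost a + cost b)) ?c1"
  by (rule reach_step_Suc[OF cg(1) at(1)])
 have rel1: "rel W s ?c1" using rel_pc[OF cg(3)] by simp
 show ?case
 proof (cases "ev W s a < ev W s b")
  case True
  then have pc1: "pc ?c1 = p1" using cg by simp
  obtain t cf' s' k' where 2: "reach W P ?c1 t cf'" "pc cf' = p1 + length (cc c p1)"
  "rel W s' cf'" "witer W a b (wp W c) Q j s' k'" "real t + k' <= k - ?g"
  using While.IH[of "witer W a b (wp W c) Q j" s "k - ?g" ?c1] rel1 pc1 at Suc.prems(1) True by auto
  let ?c3 = "exec_instr W (Jump p) cf'"
  have r3: "reach W P cf (Suc (Suc (cost a + cost b) + t)) ?c3"
  using reach_step_Suc[OF reach_trans[OF r1 2(1)], of "Jump p"] at(4) 2(2) by simp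
  have "rel W s' ?c3" using rel_pc[OF 2(3)] by simp
  then obtain t' cf'' s'' k'' where 4: "reach W P ?c3 t' cf''" "pc cf'' = ?e"
  "rel W s'' cf''" "Q s'' k''" "real t' + k'' <= k'"
  using Suc.IH[OF 2(4), of ?c3] Suc.prems(4) by auto
  show ?thesis
  using reach_trans[OF r3 4(1)] 4 2(5)
  by (intro exI[of _ "Suc (Suc (cost a + cost b) + t) + t'"] exI[of _ cf''] exI[of _ s'']
   exI[of _ k'']) auto
 next
  case False
  then have pc1: "pc ?c1 = Suc (pc cg)" using cg by simp
  have "reach W P cf (Suc (Suc (cost a + cost b))) (exec_instr W (Jump ?e) ?c1)"
  by (rule reach_step_Suc[OF r1]) (use pc1 at in simp)
  then show ?thesis
  using Suc.prems(1) False rel_pc[OF rel1]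
  by (intro exI[of _ "Suc (Suc (cost a + cost b))"] exI[of _ "exec_instr W (Jump ?e) ?c1"]
   exI[of _ s] exI[of _ "k - ?g"]) auto
 qed
 qed simp
 show ?case
 using While.prems *[of _ s k cf] len unfolding p_def by auto
next
 case (Input v)
 let ?c = "exec_instr W (Read (64 * v)) cf"
 have "reach W P cf 1 ?c" using Input.prems(3) by (intro reach_step) simp
 have i: "inp cf = ins s" using Input.prems(2) unfolding rel_def by simp
 show ?case
 proof (cases "ins s")
 case Nil
 then show ?thesis
  using Input.prems(1) i rel_assign[OF Input.prems(2), of v 0] \<open>reach W P cf 1 ?c\<close>
  by (intro exI[of _ 1] exI[of _ ?c] exI[of _ "s(|regs := (regs s)(v := 0)|)"] exI[of _ "k - 1"])
  (auto simp: set_cell_def)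
 next
 case (Cons x xs)
 have "rel W (s(|regs := (regs s)(v := x), ins := xs|)) ?c"
  using rel_assign[OF Input.prems(2), of v x] Cons i Input.prems(1) unfolding rel_def by auto
 then show ?thesis
  using Input.prems(1) i Cons \<open>reach W P cf 1 ?c\<close>
  by (intro exI[of _ 1] exI[of _ ?c] exI[of _ "s(|regs := (regs s)(v := x), ins := xs|)"] exI[of _ "k - 1"])
  (auto simp: set_cell_def)
 qed
next
 case (Output e)
 have at: "code_at P (pc cf) (ce e 0)" "code_at P (pc cf + cost e) [Write 1]"
 using Output.prems(3) by (auto simp: code_at_append length_ce)
 obtain c1 where c1: "reach W P cf (cost e) c1" "pc c1 = pc cf + cost e" "rel W s c1"
 "mem c1 1 = ev W s e"
 using exec_ce[OF at(1) Output.prems(2)] Output.prems(1) by auto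
 let ?c2 = "exec_instr W (Write 1) c1"
 have "reach W P cf (Suc (cost e)) ?c2"
 by (rule reach_step_Suc[OF c1(1)]) (use at(2) c1(2) in simp)
 moreover have "rel W (s(|outs := outs s @ [ev W s e]|)) ?c2"
 using c1(3,4) unfolding rel_def by auto
 moreover have "pc ?c2 = pc cf + length (cc (Output e) (pc cf))"
 using c1(2) by (simp add: length_ce)
 ultimately show ?case
 using Output.prems(1) by (intro exI[of _ "Suc (cost e)"] exI[of _ ?c2] exI conjI) auto
qed

section \<open>Runs of the machine obtained from weakest preconditions\<close>

lemma halted_stays: "halted P c ==> (step W P ^^ t) c = c"
 by (induction t) (auto simp: step_def)

text \<open>\<open>runs\<close> refers to the first halting time. It may be smaller than the length
  of the given computation, because a halted configuration only repeats itself.\<close>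

lemma runs_reach:
 assumes "reach W P (|pc = 0, mem = M, inp = xs, outp = []|) t c" "halted P c"
 shows "\<exists>t'\<le>t. runs W P M xs (mem c) (outp c) t'"
proof -
 let ?c = "%s. (step W P ^^ s) (|pc = 0, mem = M, inp = xs, outp = []|)"
 define t' where "t' = (LEAST s. halted P (?c s))"
 have "halted P (?c t)" using assms unfolding reach_def by simp
 then have t': "halted P (?c t')" "t' <= t" "\<forall>s<t'. \<not> halted P (?c s)"
 unfolding t'_def by (auto intro: LeastI Least_le dest: not_less_Least)
 have "?c t = (step W P ^^ (t - t')) (?c t')"
 using t'(2) by (metis funpow_add le_add_diff_inverse2 o_apply)
 then have "?c t' = c" using halted_stays[OF t'(1)] assms(1) unfolding reach_def by simp
 then show ?thesis using t' unfolding runs_def Let_def by auto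
qed

text \<open>Reachability speaks of arbitrary runs, while the simulation exhibits one; determinism
  identifies the two.\<close>

lemma runs_det:
 assumes "runs W P M xs M1 y1 t1" "runs W P M xs M2 y2 t2"
 shows "M1 = M2 & y1 = y2 & t1 = t2"
proof -
 have "t1 = t2"
 using assms unfolding runs_def Let_def by (meson linorder_neqE_nat)
 then show ?thesis using assms unfolding runs_def Let_def by auto
qed

lemma runs_wp:
 assumes "wp W c (%s' k'. Q s' & 0 <= k') s k"
 "rel W s (|pc = 0, mem = M, inp = xs, outp = []|)"
 shows "\<exists>M' ys t s' p zs. runs W (cc c 0) M xs M' ys t & real t <= k & Q s' &
 rel W s' (|pc = p, mem = M', inp = zs, outp = ys|)"
proof -
 let ?c = "(|pc = 0, mem = M, inp = xs, outp = []|)"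
 have "code_at (cc c 0) (pc ?c) (cc c (pc ?c))" unfolding code_at_def by auto
 from exec_cc[OF assms this] obtain t cf s' k' where
 1: "reach W (cc c 0) ?c t cf" "pc cf = length (cc c 0)" "rel W s' cf" "Q s'" "0 <= k'" "real t + k' <= k"
 by auto
 from runs_reach[OF 1(1)] 1(2) obtain t' where "t' <= t" "runs W (cc c 0) M xs (mem cf) (outp cf) t'"
 by (auto simp: halted_def)
 moreover have "rel W s' (|pc = pc cf, mem = mem cf, inp = inp cf, outp = outp cf|)"
 using 1(3) by (simp add: rel_def)
 moreover have "real t' <= k" using \<open>t' <= t\<close> 1(5,6) by linarith
 ultimately show ?thesis using 1(4) by blast
qed

section \<open>Frames and specifications\<close>

text \<open>\<open>lo c\<close> is a lower bound of the registers that \<open>c\<close> modifies and \<open>wr c\<close> the set of its arrays.\<close>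

primrec lo :: "cmd => nat" where
 "lo Skip = 99"
| "lo (Assign v e) = v"
| "lo (Put a i e) = 99"
| "lo (Seq c1 c2) = min (lo c1) (lo c2)"
| "lo (Cond a b c1 c2) = min (lo c1) (lo c2)"
| "lo (While a b c) = lo c"
| "lo (Input v) = v"
| "lo (Output e) = 99"

primrec wr :: "cmd => nat set" where
 "wr Skip = {}"
| "wr (Assign v e) = {}"
| "wr (Put a i e) = {a}"
| "wr (Seq c1 c2) = wr c1 \<union> wr c2"
| "wr (Cond a b c1 c2) = wr c1 \<union> wr c2"
| "wr (While a b c) = wr c"
| "wr (Input v) = {}"
| "wr (Output e) = {}"

primrec pure :: "cmd => bool" where
 "pure Skip \<longleftrightarrow> True"
| "pure (Assign v e) \<longleftrightarrow> True"
| "pure (Put a i e) \<longleftrightarrow> True"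
| "pure (Seq c1 c2) \<longleftrightarrow> pure c1 & pure c2"
| "pure (Cond a b c1 c2) \<longleftrightarrow> pure c1 & pure c2"
| "pure (While a b c) \<longleftrightarrow> pure c"
| "pure (Input v) \<longleftrightarrow> False"
| "pure (Output e) \<longleftrightarrow> False"

text \<open>The convention behind it: callers keep their live data in low registers, subroutines
  work in high ones. The value 99 of \<open>lo\<close>, above every register in use, stands for no
  modified register.\<close>

definition frame :: "cmd => store => store => bool" where
 "frame c s s' \<longleftrightarrow> (\<forall>v<lo c. regs s' v = regs s v) & (\<forall>a. a \<notin> wr c --> arrs s' a = arrs s a) &
  (pure c --> ins s' = ins s & outs s' = outs s)"

lemma frameD:
 assumes "frame c s s'"
 shows "v < lo c ==> regs s' v = regs s v" "a \<notin> wr c ==> arrs s' a = arrs s a"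
 "pure c ==> ins s' = ins s" "pure c ==> outs s' = outs s"
 using assms unfolding frame_def by auto

text \<open>A consequence rule in which the frame and the decrease of the credits come for free, so
  that specifications need not list what a command preserves.\<close>

lemma wp_frame_mono:
 assumes "wp W c Q s k" "\<And>s' k'. Q s' k' ==> frame c s s' ==> k' <= k ==> Q' s' k'"
 shows "wp W c Q' s k"
 using assms
proof (induction c arbitrary: Q Q' s k)
 case (Seq c1 c2)
 show ?case
 unfolding wp.simps
 proof (rule Seq.IH(1))
 show "wp W c1 (wp W c2 Q) s k" using Seq.prems by simp
 fix s1 k1 assume 1: "wp W c2 Q s1 k1" "frame c1 s s1" "k1 <= k"
 show "wp W c2 Q' s1 k1"
  by (rule Seq.IH(2)[OF 1(1)], rule Seq.prems(2)) (use 1 in \<open>auto simp: frame_def\<close>)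
 qed
next
 case (Cond a b c1 c2)
 show ?case
 using Cond.prems(1) unfolding wp.simps
 by (auto split: if_splits elim!: Cond.IH intro!: Cond.prems(2) simp: frame_def)
next
 case (While a b c)
 then obtain j where "witer W a b (wp W c) Q j s k" by auto
 then have "witer W a b (wp W c) Q' j s k"
 using While.prems(2)
 proof (induction j arbitrary: s k)
 case (Suc j)
 let ?k = "k - real (cost a + cost b + 2)"
 have "wp W c (witer W a b (wp W c) Q' j) s ?k" if "wp W c (witer W a b (wp W c) Q j) s ?k"
 proof (rule While.IH[OF that])
  fix s1 k1 assume 1: "witer W a b (wp W c) Q j s1 k1" "frame c s s1" "k1 <= ?k"
  show "witer W a b (wp W c) Q' j s1 k1"
  by (rule Suc.IH[OF 1(1)], rule Suc.prems(2)) (use 1 in \<open>auto simp: frame_def\<close>)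
 qed
 moreover have "Q' s ?k" if "Q s ?k"
  by (rule Suc.prems(2)[OF that]) (auto simp: frame_def)
 ultimately show ?case using Suc.prems(1) by auto
 qed simp
 then show ?case by auto
next
 case Skip
 then show ?case by (simp add: frame_def)
next
 case (Input v)
 then show ?case by (auto split: list.splits simp: frame_def)
qed (auto simp: frame_def)

text \<open>Surplus credits pass through a command unspent, which turns a specification for one
  budget into one for every larger budget.\<close>

lemma wp_shift:
 assumes "wp W c Q s k" "0 <= d"
 shows "wp W c (%s' k'. Q s' (k' - d)) s (k + d)"
 using assms(1)
proof (induction c arbitrary: Q s k)
 case (Seq c1 c2)
 then have "wp W c1 (%s' k'. wp W c2 Q s' (k' - d)) s (k + d)" by auto
 then show ?case
 unfolding wp.simps
 by (rule wp_frame_mono) (use Seq.IH(2) in fastforce)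
next
 case (Cond a b c1 c2)
 then show ?case
 using Cond.IH[of Q s "k - real (cost a + cost b + 2)"] assms(2)
 by (auto simp: algebra_simps split: if_splits)
next
 case (While a b c)
 then obtain j where "witer W a b (wp W c) Q j s k" by auto
 then have "witer W a b (wp W c) (%s' k'. Q s' (k' - d)) j s (k + d)"
 proof (induction j arbitrary: s k)
 case (Suc j)
 let ?k = "k - real (cost a + cost b + 2)"
 have eq: "k + d - real (cost a + cost b + 2) = ?k + d" by simp
 have "wp W c (witer W a b (wp W c) (%s' k'. Q s' (k' - d)) j) s (?k + d)"
  if "wp W c (witer W a b (wp W c) Q j) s ?k"
  by (rule wp_frame_mono[OF While.IH[OF that]]) (use Suc.IH in fastforce)
 then show ?case using Suc.prems assms(2) unfolding witer.simps eq by auto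
 qed simp
 then show ?case by auto
next
 case (Input v)
 then show ?case using assms(2) by (auto split: list.splits simp: algebra_simps)
qed (use assms(2) in \<open>auto simp: algebra_simps\<close>)

text \<open>Total correctness: a command whose precondition holds does have a final state. The loop
  rule uses this to obtain a state after the body from a mere specification of the body.\<close>

lemma wp_False: "\<not> wp W c (%_ _. False) s k"
proof (induction c arbitrary: s k)
 case (Seq c1 c2)
 then show ?case by (auto dest: wp_frame_mono[where Q' = "%_ _. False"])
next
 case (While a b c)
 have "\<not> witer W a b (wp W c) (%_ _. False) j s k" for j
 proof (induction j arbitrary: s k)
 case (Suc j)
 then have "\<not> wp W c (witer W a b (wp W c) (%_ _. False) j) s k" for s k
  using While.IH by (auto dest: wp_frame_mono[where Q' = "%_ _. False"])
 then show ?case by auto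
 qed simp
 then show ?case by auto
qed (auto split: list.splits)

definition spec :: "nat => cmd => store => real => (store => bool) => bool" where
 "spec W c s T Q \<longleftrightarrow> wp W c (%s' k'. Q s' & 0 <= k') s T"

lemma spec_wp:
 assumes "spec W c s T Q" "T <= k" "\<And>s' k'. Q s' ==> frame c s s' ==> k - T <= k' ==> R s' k'"
 shows "wp W c R s k"
 using wp_shift[OF assms(1)[unfolded spec_def], of "k - T"] assms(2)
 by (auto elim!: wp_frame_mono intro!: assms(3))

lemma spec_conseq:
 assumes "spec W c s T Q" "T <= T'" "\<And>s'. Q s' ==> frame c s s' ==> Q' s'"
 shows "spec W c s T' Q'"
 unfolding spec_def by (rule spec_wp[OF assms(1,2)]) (use assms(2,3) in auto)

lemma spec_seq:
 assumes "spec W c s U R" "\<And>s'. R s' ==> frame c s s' ==> spec W d s' V Q"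
 "U + V <= T" "0 <= V"
 shows "spec W (c ;; d) s T Q"
 unfolding spec_def wp.simps
proof (rule spec_wp[OF assms(1)])
 fix s' k' assume 1: "R s'" "frame c s s'" "T - U <= k'"
 show "wp W d (%s' k'. Q s' & 0 <= k') s' k'"
 by (rule spec_wp[OF assms(2)[OF 1(1,2)]]) (use 1 assms in auto)
qed (use assms in auto)

lemma spec_cond:
 assumes "ok W s a" "ok W s b" "real (cost a + cost b + 2) + T1 <= T" "0 <= T1"
 "ev W s a < ev W s b ==> spec W c1 s T1 Q"
 "\<not> ev W s a < ev W s b ==> spec W c2 s T1 Q"
 shows "spec W (Cond a b c1 c2) s T Q"
proof -
 have "ev W s a < ev W s b ==> spec W c1 s (T - real (cost a + cost b + 2)) Q"
 "\<not> ev W s a < ev W s b ==> spec W c2 s (T - real (cost a + cost b + 2)) Q"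
 using assms(3) by (auto intro: spec_conseq[OF assms(5)] spec_conseq[OF assms(6)])
 then show ?thesis using assms(1-4) unfolding spec_def by auto
qed

text \<open>\<open>f\<close> is at once the time budget and the variant. Each round lowers it by the
  time of the body and the positive cost of the guard, and it never falls below that cost, so there
  are finitely many rounds.\<close>

lemma spec_while:
 assumes "Inv s"
 "\<And>s. Inv s ==> ok W s a & ok W s b & real (cost a + cost b + 2) <= f s"
 "\<And>s. Inv s ==> ev W s a < ev W s b ==>
  \<exists>T\<ge>0. spec W c s T (%s'. Inv s' & f s' + T + real (cost a + cost b + 2) <= f s)"
 shows "spec W (While a b c) s (f s) (%s'. Inv s' & \<not> ev W s' a < ev W s' b)"
proof -
 let ?g = "real (cost a + cost b + 2)"
 let ?Q = "%s' k'. (Inv s' & \<not> ev W s' a < ev W s' b) & 0 <= k'"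
 have "\<exists>j. witer W a b (wp W c) ?Q j s k" if "Inv s" "f s <= k" "f s < real j" for j s k
 proof -
 have "witer W a b (wp W c) ?Q j s k" using that
 proof (induction j arbitrary: s k)
  case 0
  then show ?case using assms(2)[of s] by simp
 next
  case (Suc j)
  note o = assms(2)[OF Suc.prems(1)]
  show ?case
  proof (cases "ev W s a < ev W s b")
  case True
  then obtain T where T: "0 <= T" "spec W c s T (%s'. Inv s' & f s' + T + ?g <= f s)"
   using assms(3)[OF Suc.prems(1)] by blast
  have "wp W c (witer W a b (wp W c) ?Q j) s (k - ?g)"
  proof (rule spec_wp[OF T(2)])
   \<comment> \<open>The time of the body must fit into the budget before the body is run. A final
     state exists by \<open>wp_False\<close>, and there \<open>f\<close> is still at least the cost
     of a guard.\<close>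
   have "\<exists>s'. Inv s' & f s' + T + ?g <= f s"
   proof (rule ccontr)
   assume "\<nexists>s'. Inv s' & f s' + T + ?g <= f s"
   then have "wp W c (%_ _. False) s T"
    using T(2) unfolding spec_def by (auto elim!: wp_frame_mono)
   then show False using wp_False by blast
   qed
   then obtain s1 where "Inv s1" "f s1 + T + ?g <= f s" by blast
   then show "T <= k - ?g"
   using Suc.prems(2) assms(2)[of s1] by linarith
   fix s' k' assume 1: "Inv s' & f s' + T + ?g <= f s" "k - ?g - T <= k'"
   show "witer W a b (wp W c) ?Q j s' k'"
   by (rule Suc.IH) (use 1 Suc.prems T in auto)
  qed
  then show ?thesis using True o Suc.prems by simp
  next
  case False
  then show ?thesis using o Suc.prems by simp
  qed
 qed
 then show ?thesis by blast
 qed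
 from this[OF assms(1), of "f s"] reals_Archimedean2[of "f s"]
 show ?thesis unfolding spec_def by auto
qed

text \<open>The bound \<open>e\<close> is evaluated anew in every round; \<open>spec_for\<close>
  therefore asks for its constancy under the invariant.\<close>

definition For :: "nat => expr => cmd => cmd" where
 "For v e c = Assign v (Lit 0) ;; While (Var v) e (c ;; Assign v (Bin Add (Var v) (Lit 1)))"

lemma lo_For [simp]: "lo (For v e c) = min v (lo c)"
 and wr_For [simp]: "wr (For v e c) = wr c"
 and pure_For [simp]: "pure (For v e c) = pure c"
 by (auto simp: For_def)

lemma spec_for:
 assumes start: "Inv 0 (s(|regs := (regs s)(v := 0)|))"
 and guard: "\<And>i s. i <= N ==> Inv i s ==> regs s v = i ==> ok W s e & ev W s e = N"
 and bound: "N < bnd W" "0 <= \<tau>"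
 and body: "\<And>i s. i < N ==> Inv i s ==> regs s v = i ==>
  spec W c s \<tau> (%s'. regs s' v = i & Inv (Suc i) (s'(|regs := (regs s')(v := Suc i)|)))"
 and T: "real N * (\<tau> + real (cost e) + 7) + real (cost e) + 5 <= T"
 shows "spec W (For v e c) s T (%s'. Inv N s' & regs s' v = N)"
 unfolding For_def
proof (rule spec_seq[where R = "%s'. Inv 0 s' & regs s' v = 0" and U = 2 and V = "T - 2"])
 show "spec W (Assign v (Lit 0)) s 2 (%s'. Inv 0 s' & regs s' v = 0)"
 using start bound unfolding spec_def by simp
 let ?g = "real (cost (Var v) + cost e + 2)"
 let ?f = "%s. real (N - regs s v) * (\<tau> + real (cost e) + 7) + ?g"
 let ?I = "%s. regs s v <= N & Inv (regs s v) s"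
 fix s' assume s': "Inv 0 s' & regs s' v = 0"
 have "spec W (While (Var v) e (c ;; Assign v (Bin Add (Var v) (Lit 1)))) s' (?f s')
 (%s. ?I s & \<not> ev W s (Var v) < ev W s e)"
 proof (rule spec_while)
 show "?I s'" using s' by simp
 next
 fix s assume I: "?I s"
 then have "ok W s e" using guard by blast
 moreover have "0 <= real (N - regs s v) * (\<tau> + real (cost e) + 7)" using bound by simp
 ultimately show "ok W s (Var v) & ok W s e & ?g <= ?f s" by simp
 next
 fix s assume I: "?I s" and lt: "ev W s (Var v) < ev W s e"
 let ?i = "regs s v"
 have iN: "?i < N" using guard[of ?i s] I lt by auto
 have "spec W (c ;; Assign v (Bin Add (Var v) (Lit 1))) s (\<tau> + 4)
  (%s'. ?I s' & ?f s' + (\<tau> + 4) + ?g <= ?f s)"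
 proof (rule spec_seq)
  show "spec W c s \<tau> (%s'. regs s' v = ?i & Inv (Suc ?i) (s'(|regs := (regs s')(v := Suc ?i)|)))"
  by (rule body) (use I iN in auto)
  fix s1 assume s1: "regs s1 v = ?i & Inv (Suc ?i) (s1(|regs := (regs s1)(v := Suc ?i)|))"
  have "real (N - ?i) = real (N - Suc ?i) + 1" using iN by simp
  then have "?f s = real (N - Suc ?i) * (\<tau> + real (cost e) + 7) + ?g + (\<tau> + real (cost e) + 7)"
  by (simp add: algebra_simps)
  then show "spec W (Assign v (Bin Add (Var v) (Lit 1))) s1 4
   (%s'. ?I s' & ?f s' + (\<tau> + 4) + ?g <= ?f s)"
  using s1 iN bound unfolding spec_def by simp
 qed auto
 then show "\<exists>T\<ge>0. spec W (c ;; Assign v (Bin Add (Var v) (Lit 1))) s T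
  (%s'. ?I s' & ?f s' + T + ?g <= ?f s)"
  using bound by (intro exI[of _ "\<tau> + 4"]) simp
 qed
 then show "spec W (While (Var v) e (c ;; Assign v (Bin Add (Var v) (Lit 1)))) s' (T - 2)
 (%s'. Inv N s' & regs s' v = N)"
 proof (rule spec_conseq)
 show "?f s' <= T - 2" using T s' by simp
 fix s assume *: "?I s & \<not> ev W s (Var v) < ev W s e"
 then show "Inv N s & regs s v = N" using guard[of "regs s v" s] by auto
 qed
next
 have "0 <= real N * (\<tau> + real (cost e) + 7)" using bound by simp
 then show "0 <= T - 2" using T by linarith
qed auto

section \<open>Lists in ring buffers and bags\<close>

abbreviation (input) add_expr (infixl "\<boxplus>" 65) where "e \<boxplus> f \<equiv> Bin Add e f"
abbreviation (input) sub_expr (infixl "\<boxminus>" 65) where "e \<boxminus> f \<equiv> Bin Sub e f"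
abbreviation (input) mul_expr (infixl "\<boxtimes>" 70) where "e \<boxtimes> f \<equiv> Bin Mul e f"
abbreviation (input) quot_expr (infixl "\<oslash>" 70) where "e \<oslash> f \<equiv> Bin Quot e f"
abbreviation (input) rem_expr (infixl "\<odot>" 70) where "e \<odot> f \<equiv> Bin Rem e f"

text \<open>List \<open>q\<close> occupies the cells \<open>q * c, \<dots>, q * c + c - 1\<close> of \<open>D\<close>, cyclically from offset \<open>H q\<close> on;
 \<open>P\<close> maps an element to its offset.\<close>

definition ring :: "nat => (nat => nat) => (nat => nat) => (nat => nat) => (nat => nat) =>
 (nat => nat list) => bool" where
 "ring c L H D P Ls \<longleftrightarrow>
  (\<forall>q. L q = length (Ls q) & H q < c & distinct (Ls q) &
  (\<forall>i<length (Ls q). Ls q ! i < c & D (q * c + (H q + i) mod c) = Ls q ! i &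
   P (Ls q ! i) = (H q + i) mod c)) &
  (\<forall>q q'. q \<noteq> q' --> set (Ls q) \<inter> set (Ls q') = {})"

lemma ringD:
 assumes "ring c L H D P Ls"
 shows "L q = length (Ls q)" "H q < c" "distinct (Ls q)" "i < length (Ls q) ==> Ls q ! i < c"
 "i < length (Ls q) ==> D (q * c + (H q + i) mod c) = Ls q ! i"
 "i < length (Ls q) ==> P (Ls q ! i) = (H q + i) mod c"
 "x \<in> set (Ls q) ==> x \<in> set (Ls q') ==> q = q'"
 "x \<in> set (Ls q) ==> x < c"
 using assms unfolding ring_def by (blast, blast, blast, blast, blast, blast, blast, metis in_set_conv_nth)

lemma mod_shift_neq:
 fixes h i j c :: nat
 assumes "i < j" "j < i + c"
 shows "(h + i) mod c \<noteq> (h + j) mod c"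
proof
 assume "(h + i) mod c = (h + j) mod c"
 then have "c dvd (h + j) - (h + i)" using assms by (metis add_le_cancel_left less_imp_le mod_eq_dvd_iff_nat)
 then have "c dvd j - i" by simp
 then show False using assms by (auto dest: dvd_imp_le)
qed

lemma mod_shift_inj:
 fixes h i j c :: nat
 assumes "i < c" "j < c"
 shows "(h + i) mod c = (h + j) mod c \<longleftrightarrow> i = j"
 using mod_shift_neq[of i j c h] mod_shift_neq[of j i c h] assms
 by (cases i j rule: linorder_cases) simp_all

lemma block_inj:
 fixes c :: nat
 assumes "i < c" "j < c"
 shows "q * c + i = q' * c + j \<longleftrightarrow> q = q' & i = j"
proof
 assume "q * c + i = q' * c + j"
 then have "(q * c + i) div c = (q' * c + j) div c" "(q * c + i) mod c = (q' * c + j) mod c" by simp_all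
 then show "q = q' & i = j" using assms by simp
qed simp

text \<open>The elements of a list are distinct numbers below \<open>c\<close>, so a block of
  \<open>c\<close> cells never overflows.\<close>

lemma ring_length:
 assumes "ring c L H D P Ls"
 shows "length (Ls q) <= c"
proof -
 have "set (Ls q) \<subseteq> {..<c}" using ringD(8)[OF assms] by auto
 then have "card (set (Ls q)) <= c" using card_mono[OF finite_lessThan, of "set (Ls q)" c] by simp
 then show ?thesis using ringD(3)[OF assms] by (simp add: distinct_card)
qed

lemma ring_length_less:
 assumes "ring c L H D P Ls" "e < c" "e \<notin> set (Ls q)"
 shows "length (Ls q) < c"
proof -
 have "insert e (set (Ls q)) \<subseteq> {..<c}" using ringD(8)[OF assms(1)] assms by auto
 then have "card (insert e (set (Ls q))) <= c"
 using card_mono[OF finite_lessThan, of "insert e (set (Ls q))" c] by simp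
 then show ?thesis using ringD(3)[OF assms(1)] assms(3) by (simp add: distinct_card)
qed

lemma ring_push:
 assumes "ring c L H D P Ls" "e < c" "\<And>q'. e \<notin> set (Ls q')"
 shows "ring c (L(q := Suc (L q))) H (D(q * c + (H q + L q) mod c := e)) (P(e := (H q + L q) mod c))
 (Ls(q := Ls q @ [e]))"
proof -
 note r = ringD[OF assms(1)]
 note len = ring_length[OF assms(1)] ring_length_less[OF assms(1,2,3)]
 have c: "0 < c" using assms(2) by simp
 have ne: "Ls q' ! i \<noteq> e" if "i < length (Ls q')" for q' i
 using assms(3) that nth_mem by metis
 have idx: "q' * c + (H q' + i) mod c \<noteq> q * c + (H q + length (Ls q)) mod c"
 if "i < length (Ls q')" for q' i
 using that len c by (subst block_inj) (auto simp: mod_shift_inj order.strict_trans2)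
 show ?thesis
 unfolding ring_def using r assms c ne idx idx[of _ q]
 by (auto simp: nth_append less_Suc_eq)
qed

text \<open>The gap is filled with the last element, so every remaining element keeps its position
  or moves to a smaller one. The last conjunct records this: bounds that tighten with the queue
  position survive a removal.\<close>

definition removed :: "nat => nat list => nat list => bool" where
 "removed e xs ys \<longleftrightarrow> length xs = Suc (length ys) & set ys = set xs - {e} & distinct ys &
  (\<forall>i<length ys. \<exists>j\<ge>i. j < length xs & ys ! i = xs ! j)"

lemma removed_update:
 assumes "distinct xs" "p < length xs"
 shows "removed (xs ! p) xs ((butlast xs)[p := last xs])"
proof -
 let ?ys = "(butlast xs)[p := last xs]" and ?n = "length xs - 1"
 have "xs \<noteq> []" using assms by auto
 then have nth: "?ys ! i = (if i = p then xs ! ?n else xs ! i)" if "i < ?n" for i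
 using that assms(2) by (auto simp: nth_list_update last_conv_nth nth_butlast)
 have inj: "xs ! i = xs ! j \<longleftrightarrow> i = j" if "i < length xs" "j < length xs" for i j
 using assms(1) that nth_eq_iff_index_eq by blast
 have "distinct ?ys"
 unfolding distinct_conv_nth
 proof (intro allI impI)
 fix i j assume "i < length ?ys" "j < length ?ys" "i \<noteq> j"
 then show "?ys ! i \<noteq> ?ys ! j" using nth inj by auto
 qed
 moreover have "set ?ys = set xs - {xs ! p}"
 proof (rule set_eqI)
 fix x
 show "x \<in> set ?ys \<longleftrightarrow> x \<in> set xs - {xs ! p}"
 proof
  assume "x \<in> set ?ys"
  then obtain i where i: "i < ?n" "x = ?ys ! i" by (auto simp: in_set_conv_nth)
  then show "x \<in> set xs - {xs ! p}" using nth[OF i(1)] inj assms(2) by (auto split: if_splits)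
 next
  assume "x \<in> set xs - {xs ! p}"
  then obtain i where i: "i < length xs" "x = xs ! i" "i \<noteq> p" by (auto simp: in_set_conv_nth)
  show "x \<in> set ?ys"
  proof (cases "i = ?n")
  case True
  then have "p < ?n" using i assms(2) by linarith
  then show ?thesis using nth[of p] i True
   by (metis length_butlast length_list_update nth_mem)
  next
  case False
  then have "i < ?n" using i by linarith
  then show ?thesis using nth[of i] i by (metis length_butlast length_list_update nth_mem)
  qed
 qed
 qed
 moreover have "\<exists>j\<ge>i. j < length xs & ?ys ! i = xs ! j" if "i < ?n" for i
 proof (cases "i = p")
 case True
 then show ?thesis using nth[OF that] that by (intro exI[of _ "?n"]) auto
 next
 case False
 then show ?thesis using nth[OF that] that by (intro exI[of _ i]) auto
 qed
 ultimately show ?thesis using assms(2) unfolding removed_def by auto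
qed

lemma ring_remove:
 assumes "ring c L H D P Ls" "e \<in> set (Ls q)"
 and l: "L q = Suc l" and f: "f = D (q * c + (H q + l) mod c)"
 shows "\<exists>ys. removed e (Ls q) ys &
 ring c (L(q := l)) H (D(q * c + P e := f)) (P(f := P e)) (Ls(q := ys))"
proof -
 note r = ringD[OF assms(1)]
 obtain p where p: "p < length (Ls q)" "e = Ls q ! p" using assms(2) by (auto simp: in_set_conv_nth)
 let ?xs = "Ls q"
 let ?n = "length ?xs - 1"
 let ?ys = "(butlast ?xs)[p := last ?xs]"
 have c: "0 < c" using r(2)[of q] by simp
 have fx: "f = ?xs ! ?n" using f l r(1)[of q] r(5)[of ?n q] p by simp
 have Pe: "P e = (H q + p) mod c" using r(6)[of p q] p by simp
 have ys: "removed e ?xs ?ys" using removed_update[OF r(3) p(1)] p(2) by simp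
 have ne: "?xs \<noteq> []" using p by auto
 have nth: "?ys ! i = (if i = p then f else ?xs ! i)" if "i < ?n" for i
 using that p fx ne by (auto simp: nth_list_update last_conv_nth nth_butlast)
 have inj: "?xs ! i = ?xs ! j \<longleftrightarrow> i = j" if "i < length ?xs" "j < length ?xs" for i j
 using r(3) that nth_eq_iff_index_eq by blast
 have idx: "q' * c + (H q' + i) mod c = q * c + (H q + p) mod c \<longleftrightarrow> q' = q & i = p"
 if "i < length (Ls q')" for q' i
 using that c p(1) ring_length[OF assms(1), of q'] ring_length[OF assms(1), of q]
 by (subst block_inj) (auto simp: mod_shift_inj order.strict_trans2)
 have f_in: "f \<in> set ?xs" using fx p(1) by simp
 have "ring c (L(q := l)) H (D(q * c + P e := f)) (P(f := P e)) (Ls(q := ?ys))"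
 unfolding ring_def
 proof (intro conjI allI impI)
 fix q' i assume i: "i < length ((Ls(q := ?ys)) q')"
 show "(Ls(q := ?ys)) q' ! i < c"
  using i nth[of i] r(4)[of i q'] r(4)[of ?n q] fx p(1) by (auto split: if_splits)
 show "(D(q * c + P e := f)) (q' * c + (H q' + i) mod c) = (Ls(q := ?ys)) q' ! i"
  using i nth[of i] r(5)[of i q'] idx[of i q'] Pe by (auto split: if_splits)
 show "(P(f := P e)) ((Ls(q := ?ys)) q' ! i) = (H q' + i) mod c"
 proof (cases "q' = q")
  case True
  then show ?thesis using i nth[of i] r(6)[of i q] Pe fx inj[of i ?n] by auto
 next
  case False
  then have "Ls q' ! i \<noteq> f" using r(7)[of f q q'] f_in i by auto
  then show ?thesis using False i r(6)[of i q'] by simp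
 qed
 next
 fix q1 q2 :: nat assume "q1 \<noteq> q2"
 then show "set ((Ls(q := ?ys)) q1) \<inter> set ((Ls(q := ?ys)) q2) = {}"
  using ys r(7) unfolding removed_def by auto
 next
 fix q' show "(L(q := l)) q' = length ((Ls(q := ?ys)) q')" using r(1)[of q'] r(1)[of q] l ne by (cases "q' = q") simp_all
 have "distinct ?ys" using ys unfolding removed_def by blast
 then show "distinct ((Ls(q := ?ys)) q')" using r(3)[of q'] by simp
 show "H q' < c" by (rule r(2))
 qed
 then show ?thesis using ys by blast
qed

lemma ring_rotate:
 assumes "ring c L H D P Ls" "Ls q = e # xs"
 and h: "h = (H q + 1) mod c"
 shows "ring c L (H(q := h)) (D(q * c + (h + length xs) mod c := e))
 (P(e := (h + length xs) mod c)) (Ls(q := xs @ [e]))"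
proof -
 note r = ringD[OF assms(1)]
 have c: "0 < c" using r(2)[of q] by simp
 let ?n = "length xs"
 have n: "?n < c" using ring_length[OF assms(1), of q] assms(2) by simp
 have hi: "(h + i) mod c = (H q + Suc i) mod c" for i
 unfolding h by (simp add: mod_add_left_eq)
 have xs: "xs ! i = Ls q ! Suc i" if "i < ?n" for i using assms(2) that by simp
 have e: "e = Ls q ! 0" using assms(2) by simp
 have e_in: "e \<in> set (Ls q)" "e \<notin> set xs" using assms(2) r(3)[of q] by auto
 show ?thesis
 unfolding ring_def
 proof (intro conjI allI impI)
 fix q' i assume i: "i < length ((Ls(q := xs @ [e])) q')"
 show "(Ls(q := xs @ [e])) q' ! i < c"
 proof -
  have "set ((Ls(q := xs @ [e])) q') \<subseteq> set (Ls q')" using assms(2) by auto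
  then show ?thesis using r(8)[of _ q'] i nth_mem by blast
 qed
 show "(D(q * c + (h + ?n) mod c := e)) (q' * c + ((H(q := h)) q' + i) mod c) = (Ls(q := xs @ [e])) q' ! i"
 proof (cases "q' = q")
  case True
  show ?thesis
  proof (cases "i = ?n")
  case False
  then have "i < ?n" using i True by simp
  then have "(h + i) mod c \<noteq> (h + ?n) mod c" using n by (simp add: mod_shift_inj)
  then show ?thesis using True \<open>i < ?n\<close> r(5)[of "Suc i" q] assms(2)
   by (simp add: nth_append hi)
  qed (use True in simp)
 next
  case False
  then have "q' * c + (H q' + i) mod c \<noteq> q * c + (h + ?n) mod c"
  using c by (subst block_inj) auto
  then show ?thesis using False i r(5)[of i q'] by simp
 qed
 show "(P(e := (h + ?n) mod c)) ((Ls(q := xs @ [e])) q' ! i) = ((H(q := h)) q' + i) mod c"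
 proof (cases "q' = q")
  case True
  show ?thesis
  proof (cases "i = ?n")
  case False
  then have "i < ?n" using i True by simp
  moreover from this have "xs ! i \<noteq> e" using e_in(2) nth_mem[of i xs] by auto
  ultimately show ?thesis using True r(6)[of "Suc i" q] assms(2)
   by (simp add: nth_append hi)
  qed (use True in simp)
 next
  case False
  then have "Ls q' ! i \<noteq> e" using r(7)[of e q q'] e_in i by auto
  then show ?thesis using False i r(6)[of i q'] by simp
 qed
 next
 fix q1 q2 :: nat assume "q1 \<noteq> q2"
 then show "set ((Ls(q := xs @ [e])) q1) \<inter> set ((Ls(q := xs @ [e])) q2) = {}"
  using r(7)[of _ q1 q2] r(7)[of _ q q2] r(7)[of _ q1 q] assms(2)
  by auto
 next
 fix q'
 show "L q' = length ((Ls(q := xs @ [e])) q')" using r(1)[of q'] assms(2) by simp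
 show "(H(q := h)) q' < c" using r(2)[of q'] c h by simp
 show "distinct ((Ls(q := xs @ [e])) q')" using r(3)[of q'] r(3)[of q] assms(2) by simp
 qed
qed

definition lrep :: "nat => nat => store => (nat => nat list) => bool" where
 "lrep c a s Ls \<longleftrightarrow> ring c (arrs s a) (arrs s (a + 1)) (arrs s (a + 2)) (arrs s (a + 3)) Ls"

text \<open>Calling convention: the list in register 60, the element in register 61; register 9 holds the
 capacity.\<close>

definition lpush :: "nat => cmd" where
 "lpush a =
  Assign 62 ((Elem (a + 1) (Var 60) \<boxplus> Elem a (Var 60)) \<odot> Var 9) ;;
  Put (a + 2) (Var 60 \<boxtimes> Var 9 \<boxplus> Var 62) (Var 61) ;;
  Put (a + 3) (Var 61) (Var 62) ;;
  Put a (Var 60) (Elem a (Var 60) \<boxplus> Lit 1)"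

definition lremove :: "nat => cmd" where
 "lremove a =
  Put a (Var 60) (Elem a (Var 60) \<boxminus> Lit 1) ;;
  Assign 62 ((Elem (a + 1) (Var 60) \<boxplus> Elem a (Var 60)) \<odot> Var 9) ;;
  Assign 62 (Elem (a + 2) (Var 60 \<boxtimes> Var 9 \<boxplus> Var 62)) ;;
  Assign 63 (Elem (a + 3) (Var 61)) ;;
  Put (a + 2) (Var 60 \<boxtimes> Var 9 \<boxplus> Var 63) (Var 62) ;;
  Put (a + 3) (Var 62) (Var 63)"

definition lfirst :: "nat => cmd" where
 "lfirst a = Assign 61 (Elem (a + 2) (Var 60 \<boxtimes> Var 9 \<boxplus> Elem (a + 1) (Var 60)))"

definition lrotate :: "nat => cmd" where
 "lrotate a =
  lfirst a ;;
  Put (a + 1) (Var 60) ((Elem (a + 1) (Var 60) \<boxplus> Lit 1) \<odot> Var 9) ;;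
  Assign 62 ((Elem (a + 1) (Var 60) \<boxplus> Elem a (Var 60) \<boxminus> Lit 1) \<odot> Var 9) ;;
  Put (a + 2) (Var 60 \<boxtimes> Var 9 \<boxplus> Var 62) (Var 61) ;;
  Put (a + 3) (Var 61) (Var 62)"

lemma lpush_frame [simp]: "lo (lpush a) = 62" "wr (lpush a) = {a, a + 2, a + 3}" "pure (lpush a)"
 by (auto simp: lpush_def)

lemma lremove_frame [simp]: "lo (lremove a) = 62" "wr (lremove a) = {a, a + 2, a + 3}" "pure (lremove a)"
 by (auto simp: lremove_def)

lemma lfirst_frame [simp]: "lo (lfirst a) = 61" "wr (lfirst a) = {}" "pure (lfirst a)"
 by (auto simp: lfirst_def)

lemma lrotate_frame [simp]: "lo (lrotate a) = 61" "wr (lrotate a) = {a + 1, a + 2, a + 3}" "pure (lrotate a)"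
 by (auto simp: lrotate_def)

definition fits :: "nat => nat => nat => nat => bool" where
 "fits W c a q \<longleftrightarrow> 100 < bnd W & 2 * c < bnd W & q * c + c <= bnd W & 2 <= a & a + 3 < 64"

lemma fitsD:
 assumes "fits W c a q" "x < c"
 shows "q * c + x < bnd W" "x < bnd W" "q < bnd W" "q * c < bnd W" "y < c ==> x + y < bnd W"
proof -
 have f: "2 * c < bnd W" "q * c + c <= bnd W" using assms unfolding fits_def by auto
 have c: "1 <= c" using assms(2) by simp
 then have "q <= q * c" by simp
 then show "q * c + x < bnd W" "x < bnd W" "q < bnd W" "q * c < bnd W" "y < c ==> x + y < bnd W"
 using f assms(2) c by linarith+
qed

lemma lpush_spec:
 assumes "lrep c a s Ls" "fits W c a q" "regs s 60 = q" "regs s 61 = e" "regs s 9 = c" "e < c"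
 "\<And>q'. e \<notin> set (Ls q')"
 shows "spec W (lpush a) s 60 (%s'. lrep c a s' (Ls(q := Ls q @ [e])))"
proof -
 let ?x = "(arrs s (a + 1) q + arrs s a q) mod c"
 note r = assms(1)[unfolded lrep_def]
 have h: "arrs s (a + 1) q < c" "arrs s a q < c"
 using ringD(1,2)[OF r, of q] ring_length_less[OF r assms(6,7)] by auto
 then have x: "?x < c" by simp
 have s1: "Suc (arrs s a q) < bnd W" using h assms(2) unfolding fits_def by linarith
 have "100 < bnd W" "2 <= a" "a < 61" using assms(2) unfolding fits_def by auto
 then show ?thesis
 using fitsD(3)[OF assms(2) x] fitsD(4)[OF assms(2) x] fitsD(1)[OF assms(2) x] fitsD(2)[OF assms(2) x]
  fitsD(2)[OF assms(2,6)] fitsD(5)[OF assms(2) h] s1 assms(3-5) ring_push[OF r assms(6,7), of q]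
 unfolding lpush_def spec_def lrep_def by (simp add: add.commute)
qed

lemma lremove_spec:
 assumes "lrep c a s Ls" "fits W c a q" "regs s 60 = q" "regs s 61 = e" "regs s 9 = c" "e \<in> set (Ls q)"
 shows "spec W (lremove a) s 80 (%s'. \<exists>ys. removed e (Ls q) ys & lrep c a s' (Ls(q := ys)))"
proof -
 note r = assms(1)[unfolded lrep_def]
 have L: "arrs s a q = length (Ls q)" "arrs s a q <= c" "0 < arrs s a q"
 using ringD(1)[OF r, of q] ring_length[OF r, of q] assms(6) by auto
 then obtain l where l: "arrs s a q = Suc l" using gr0_implies_Suc by blast
 let ?x = "(arrs s (a + 1) q + l) mod c"
 let ?f = "arrs s (a + 2) (q * c + ?x)"
 have h: "arrs s (a + 1) q < c" "l < c" using L l ringD(2)[OF r, of q] by auto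
 then have x: "?x < c" by simp
 have e: "e < c" using ringD(8)[OF r assms(6)] .
 have f: "?f < c" using ringD(5)[OF r, of l q] ringD(4)[OF r, of l q] L l by simp
 have P: "arrs s (a + 3) e < c"
 using assms(6) ringD(6)[OF r] ringD(2)[OF r, of q] by (metis in_set_conv_nth mod_less_divisor not_less_zero neq0_conv)
 obtain ys where "removed e (Ls q) ys" "ring c ((arrs s a)(q := l)) (arrs s (a + 1))
  ((arrs s (a + 2))(q * c + arrs s (a + 3) e := ?f)) ((arrs s (a + 3))(?f := arrs s (a + 3) e)) (Ls(q := ys))"
 using ring_remove[OF r assms(6) l refl] by blast
 moreover have "100 < bnd W" "2 <= a" "a < 61" using assms(2) unfolding fits_def by auto
 ultimately show ?thesis
 using fitsD(3)[OF assms(2) x] fitsD(4)[OF assms(2) x] fitsD(1)[OF assms(2) x] fitsD(2)[OF assms(2) x]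
  fitsD(1)[OF assms(2) P] fitsD(2)[OF assms(2) e] fitsD(2)[OF assms(2) f] fitsD(5)[OF assms(2) h] l assms(3-5)
 unfolding lremove_def spec_def lrep_def by auto
qed

lemma lfirst_spec:
 assumes "lrep c a s Ls" "fits W c a q" "regs s 60 = q" "regs s 9 = c" "Ls q \<noteq> []"
 shows "spec W (lfirst a) s 20 (%s'. regs s' 61 = hd (Ls q))"
proof -
 note r = assms(1)[unfolded lrep_def]
 have h: "arrs s (a + 1) q < c" using ringD(2)[OF r, of q] by auto
 have "hd (Ls q) = arrs s (a + 2) (q * c + arrs s (a + 1) q)"
 using ringD(5)[OF r, of 0 q] assms(5) h by (simp add: hd_conv_nth)
 moreover have "100 < bnd W" "2 <= a" "a < 61" using assms(2) unfolding fits_def by auto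
 ultimately show ?thesis
 using fitsD[OF assms(2)] h assms unfolding lfirst_def spec_def by simp
qed

lemma lrotate_spec:
 assumes "lrep c a s Ls" "fits W c a q" "regs s 60 = q" "regs s 9 = c" "Ls q = e # xs"
 shows "spec W (lrotate a) s 80 (%s'. regs s' 61 = e & lrep c a s' (Ls(q := xs @ [e])))"
proof -
 note r = assms(1)[unfolded lrep_def]
 let ?h = "(arrs s (a + 1) q + 1) mod c"
 let ?x = "(?h + length xs) mod c"
 have L: "arrs s a q = Suc (length xs)" "arrs s a q <= c"
 using ringD(1)[OF r, of q] ring_length[OF r, of q] assms(5) by auto
 have h: "arrs s (a + 1) q < c" using ringD(2)[OF r, of q] by auto
 then have x: "?x < c" "?h < c" by auto
 have e: "e < c" using ringD(8)[OF r, of e q] assms(5) by simp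
 have e': "e = arrs s (a + 2) (q * c + arrs s (a + 1) q)"
 using ringD(5)[OF r, of 0 q] assms(5) h by simp
 have b: "2 * c < bnd W" using assms(2) unfolding fits_def by auto
 have k: "?h + arrs s a q < bnd W" "arrs s (a + 1) q + 1 < bnd W" using b x h L by linarith+
 have "100 < bnd W" "2 <= a" "a < 61" using assms(2) unfolding fits_def by auto
 then show ?thesis
 using fitsD(1)[OF assms(2) x(1)] fitsD(1)[OF assms(2) h] fitsD(3)[OF assms(2) e] fitsD(2)[OF assms(2) e]
  e' k L(1) assms(3-5) ring_rotate[OF r assms(5) refl]
 unfolding lrotate_def lfirst_def spec_def lrep_def by simp
qed

lemma lrep_cong:
 assumes "arrs s' a = arrs s a" "arrs s' (a + 1) = arrs s (a + 1)" "arrs s' (a + 2) = arrs s (a + 2)"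
 "arrs s' (a + 3) = arrs s (a + 3)"
 shows "lrep c a s' Ls \<longleftrightarrow> lrep c a s Ls"
 using assms unfolding lrep_def by simp

text \<open>A family of bags over a common element space: \<open>F e\<close> is the bag that contains \<open>e\<close>.\<close>

definition brep :: "nat => nat => store => (nat => nat option) => bool" where
 "brep c a s F \<longleftrightarrow> (\<exists>Ls. lrep c a s Ls & (\<forall>q e. e \<in> set (Ls q) \<longleftrightarrow> F e = Some q))"

lemma brep_cong:
 assumes "arrs s' a = arrs s a" "arrs s' (a + 1) = arrs s (a + 1)" "arrs s' (a + 2) = arrs s (a + 2)"
 "arrs s' (a + 3) = arrs s (a + 3)"
 shows "brep c a s' F \<longleftrightarrow> brep c a s F"
 using lrep_cong[OF assms] unfolding brep_def by simp

lemma brep_nonempty: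
 assumes "brep c a s F"
 shows "0 < arrs s a q \<longleftrightarrow> (\<exists>e. F e = Some q)"
proof -
 obtain Ls where Ls: "lrep c a s Ls" "\<And>q e. e \<in> set (Ls q) \<longleftrightarrow> F e = Some q"
 using assms unfolding brep_def by blast
 have "arrs s a q = length (Ls q)" using ringD(1)[OF Ls(1)[unfolded lrep_def]] by simp
 moreover have "length (Ls q) > 0 \<longleftrightarrow> (\<exists>e. e \<in> set (Ls q))" by (cases "Ls q") auto
 ultimately show ?thesis using Ls(2) by auto
qed

lemma bpush_spec:
 assumes "brep c a s F" "fits W c a q" "regs s 60 = q" "regs s 61 = e" "regs s 9 = c" "e < c"
 "F e = None"
 shows "spec W (lpush a) s 60 (%s'. brep c a s' (F(e := Some q)))"
proof -
 obtain Ls where Ls: "lrep c a s Ls" "\<And>q e. e \<in> set (Ls q) \<longleftrightarrow> F e = Some q"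
 using assms unfolding brep_def by blast
 have "\<And>q'. e \<notin> set (Ls q')" using Ls(2) assms(7) by auto
 from lpush_spec[OF Ls(1) assms(2-6) this] show ?thesis
 proof (rule spec_conseq)
 fix s' assume "lrep c a s' (Ls(q := Ls q @ [e]))"
 moreover have "x \<in> set ((Ls(q := Ls q @ [e])) q') \<longleftrightarrow> (F(e := Some q)) x = Some q'" for q' x
  using Ls(2) assms(7) by auto
 ultimately show "brep c a s' (F(e := Some q))" unfolding brep_def by blast
 qed simp
qed

lemma bremove_spec:
 assumes "brep c a s F" "fits W c a q" "regs s 60 = q" "regs s 61 = e" "regs s 9 = c" "F e = Some q"
 shows "spec W (lremove a) s 80 (%s'. brep c a s' (F(e := None)))"
proof -
 obtain Ls where Ls: "lrep c a s Ls" "\<And>q e. e \<in> set (Ls q) \<longleftrightarrow> F e = Some q"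
 using assms unfolding brep_def by blast
 have "e \<in> set (Ls q)" using Ls(2) assms(6) by auto
 from lremove_spec[OF Ls(1) assms(2-5) this] show ?thesis
 proof (rule spec_conseq)
 fix s' assume "\<exists>ys. removed e (Ls q) ys & lrep c a s' (Ls(q := ys))"
 then obtain ys where ys: "removed e (Ls q) ys" "lrep c a s' (Ls(q := ys))" by blast
 have "set ys = set (Ls q) - {e}" using ys(1) unfolding removed_def by blast
 then have "x \<in> set ((Ls(q := ys)) q') \<longleftrightarrow> (F(e := None)) x = Some q'" for q' x
  using Ls(2) assms(6) by auto
 then show "brep c a s' (F(e := None))" using ys(2) unfolding brep_def by blast
 qed simp
qed

lemma bfirst_spec:
 assumes "brep c a s F" "fits W c a q" "regs s 60 = q" "regs s 9 = c" "F e = Some q"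
 shows "spec W (lfirst a) s 20 (%s'. F (regs s' 61) = Some q)"
proof -
 obtain Ls where Ls: "lrep c a s Ls" "\<And>q e. e \<in> set (Ls q) \<longleftrightarrow> F e = Some q"
 using assms unfolding brep_def by blast
 then have ne: "Ls q \<noteq> []" using assms(5) by force
 show ?thesis
 by (rule spec_conseq[OF lfirst_spec[OF Ls(1) assms(2-4) ne]]) (use Ls(2) ne hd_in_set in force)+
qed

text \<open>Blank memory already represents empty lists, so the initialisation need not touch
  them.\<close>

lemma brep_empty:
 assumes "\<And>i. arrs s a i = 0" "\<And>i. arrs s (a + 1) i = 0" "0 < c"
 shows "brep c a s (%_. None)" "lrep c a s (%_. [])"
 using assms unfolding brep_def lrep_def ring_def by (auto intro!: exI[of _ "%_. []"])

section \<open>Vertices in decreasing order of their load\<close>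

text \<open>\<open>ord\<close> lists the vertices, \<open>rnk\<close> is its inverse, and \<open>cnt d\<close> counts the vertices of load at
 least \<open>d\<close>.\<close>

definition sorted_by :: "nat => (nat => nat) => (nat => nat) => (nat => nat) => (nat => nat) => bool" where
 "sorted_by n ord rnk load cnt \<longleftrightarrow>
  (\<forall>i<n. ord i < n & rnk (ord i) = i) & (\<forall>v<n. rnk v < n & ord (rnk v) = v) &
  (\<forall>d. cnt d <= n) & (\<forall>i<n. \<forall>d. i < cnt d \<longleftrightarrow> d <= load (ord i))"

lemma sorted_byD:
 assumes "sorted_by n ord rnk load cnt"
 shows "i < n ==> ord i < n" "i < n ==> rnk (ord i) = i" "v < n ==> rnk v < n" "v < n ==> ord (rnk v) = v"
 "cnt d <= n" "i < n ==> i < cnt d \<longleftrightarrow> d <= load (ord i)"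
 using assms unfolding sorted_by_def by blast+

lemma sorted_by_swap:
 assumes s: "sorted_by n ord rnk load cnt" and v: "v < n" and i: "i < n" and eq: "load (ord i) = load v"
 shows "sorted_by n (ord(i := v, rnk v := ord i)) (rnk(v := i, ord i := rnk v)) load cnt"
proof -
 note d = sorted_byD[OF s]
 have ord_eq: "ord j = v \<longleftrightarrow> j = rnk v" "ord j = ord i \<longleftrightarrow> j = i" if "j < n" for j
 using d v i that by metis+
 show ?thesis
 unfolding sorted_by_def
 proof (intro conjI allI impI)
 fix j assume j: "j < n"
 show "(ord(i := v, rnk v := ord i)) j < n" using d v i j by simp
 show "(rnk(v := i, ord i := rnk v)) ((ord(i := v, rnk v := ord i)) j) = j"
  using d(2)[OF j] d(4)[OF v] i v j ord_eq[OF j] by auto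
 show "j < cnt e \<longleftrightarrow> e <= load ((ord(i := v, rnk v := ord i)) j)" for e
  using d(6)[OF j, of e] d(4)[OF v] eq by auto
 next
 fix u assume u: "u < n"
 show "(rnk(v := i, ord i := rnk v)) u < n" using d(3)[OF u] d(3)[OF v] i by simp
 show "(ord(i := v, rnk v := ord i)) ((rnk(v := i, ord i := rnk v)) u) = u"
  using d(4)[OF u] d(4)[OF v] d(2)[OF i] by auto
 qed (rule d(5))
qed

text \<open>The vertices of load greater than that of \<open>v\<close> occupy the positions below
  \<open>i\<close>, so position \<open>i\<close> is the first one of the load class of
  \<open>v\<close>. Once \<open>v\<close> has been swapped there, one more unit of load keeps the
  order, and only one count changes.\<close>

lemma sorted_by_inc:
 assumes s: "sorted_by n ord rnk load cnt" and v: "v < n" and i: "i = cnt (load v + 1)"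
 shows "i < n" "sorted_by n (ord(i := v, rnk v := ord i)) (rnk(v := i, ord i := rnk v))
 (load(v := load v + 1)) (cnt(load v + 1 := i + 1))"
proof -
 note d = sorted_byD[OF s]
 have "\<not> rnk v < i" using d(6)[of "rnk v" "load v + 1"] d(3,4)[OF v] i by auto
 moreover have j: "rnk v < n" "rnk v < cnt (load v)" using d(6)[of "rnk v" "load v"] d(3,4)[OF v] by auto
 ultimately show i': "i < n" by simp
 have "load (ord i) = load v"
 using d(6)[OF i', of "load v"] d(6)[OF i', of "load v + 1"] \<open>\<not> rnk v < i\<close> j i by auto
 note t = sorted_byD[OF sorted_by_swap[OF s v i' this]]
 show "sorted_by n (ord(i := v, rnk v := ord i)) (rnk(v := i, ord i := rnk v))
 (load(v := load v + 1)) (cnt(load v + 1 := i + 1))"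
 unfolding sorted_by_def
 proof (intro conjI allI impI)
 let ?ord = "ord(i := v, rnk v := ord i)"
 fix j assume j: "j < n"
 have "?ord j = v \<longleftrightarrow> j = i"
  using d j v i' by (metis (no_types, opaque_lifting) fun_upd_apply)
 then show "j < (cnt(load v + 1 := i + 1)) e \<longleftrightarrow> e <= (load(v := load v + 1)) (?ord j)" for e
  using t(6)[OF j, of e] t(6)[OF j, of "load v + 1"] t(6)[OF j, of "load v"] i
  by (cases "j = i"; cases "e = load v + 1") auto
 qed (use t d i' in auto)
qed

text \<open>\<open>cnt (load v)\<close> counts the vertices up to the end of the load class of
  \<open>v\<close>, so position \<open>i\<close> is the last one of this class and leaving the class
  from there keeps the order.\<close>

lemma sorted_by_dec:
 assumes s: "sorted_by n ord rnk load cnt" and v: "v < n" and i: "cnt (load v) = i + 1"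
 and pos: "0 < load v"
 shows "i < n" "sorted_by n (ord(i := v, rnk v := ord i)) (rnk(v := i, ord i := rnk v))
 (load(v := load v - 1)) (cnt(load v := i))"
proof -
 note d = sorted_byD[OF s]
 show i': "i < n" using d(5)[of "load v"] i by simp
 have j: "rnk v < n" "rnk v <= i" using d(6)[of "rnk v" "load v"] d(3,4)[OF v] i by auto
 have "\<not> rnk v < cnt (load v + 1)" using d(6)[of "rnk v" "load v + 1"] d(3,4)[OF v] by auto
 then have "load (ord i) = load v"
 using d(6)[OF i', of "load v"] d(6)[OF i', of "load v + 1"] j i by auto
 note t = sorted_byD[OF sorted_by_swap[OF s v i' this]]
 show "sorted_by n (ord(i := v, rnk v := ord i)) (rnk(v := i, ord i := rnk v))
 (load(v := load v - 1)) (cnt(load v := i))"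
 unfolding sorted_by_def
 proof (intro conjI allI impI)
 let ?ord = "ord(i := v, rnk v := ord i)"
 fix j assume j: "j < n"
 have "?ord j = v \<longleftrightarrow> j = i"
  using d j v i' by (metis (no_types, opaque_lifting) fun_upd_apply)
 then show "j < (cnt(load v := i)) e \<longleftrightarrow> e <= (load(v := load v - 1)) (?ord j)" for e
  using t(6)[OF j, of e] t(6)[OF j, of "load v"] t(6)[OF j, of "load v - 1"] i pos
  by (cases "j = i"; cases "e = load v") auto
 qed (use t d i' in auto)
qed

lemma sorted_by_dec_pos:
 assumes s: "sorted_by n ord rnk load cnt" and v: "v < n"
 shows "0 < cnt (load v)"
 using sorted_byD(3,4)[OF s v] sorted_byD(6)[OF s, of "rnk v" "load v"] by auto

text \<open>The vertices above a level form an initial segment of \<open>ord\<close>. An answer is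
  therefore determined by its cardinality and can be output without a search.\<close>

lemma sorted_by_prefix:
 assumes "sorted_by n ord rnk load cnt"
 shows "ord ` {..<cnt d} = {v. v < n & d <= load v}" "inj_on ord {..<n}"
 "card {v. v < n & d <= load v} = cnt d"
proof -
 note r = sorted_byD[OF assms]
 show 1: "ord ` {..<cnt d} = {v. v < n & d <= load v}"
 proof (intro set_eqI iffI)
 fix v assume "v \<in> ord ` {..<cnt d}"
 then obtain i where i: "i < cnt d" "v = ord i" by auto
 then have "i < n" using r(5)[of d] by simp
 then show "v \<in> {v. v < n & d <= load v}" using r(1)[of i] r(6)[of i d] i by auto
 next
 fix v assume "v \<in> {v. v < n & d <= load v}"
 then show "v \<in> ord ` {..<cnt d}"
  using r(3)[of v] r(4)[of v] r(6)[of "rnk v" d] by (intro image_eqI[of _ _ "rnk v"]) auto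
 qed
 show 2: "inj_on ord {..<n}" by (rule inj_on_inverseI[of _ rnk]) (use r in auto)
 have "inj_on ord {..<cnt d}" by (rule inj_on_subset[OF 2]) (use r(5)[of d] in auto)
 then show "card {v. v < n & d <= load v} = cnt d" using 1 card_image by fastforce
qed

definition srep :: "nat => store => bool" where
 "srep n s \<longleftrightarrow> sorted_by n (arrs s 40) (arrs s 41) (arrs s 42) (arrs s 43)"

lemma srep_cong:
 "arrs s' 40 = arrs s 40 ==> arrs s' 41 = arrs s 41 ==> arrs s' 42 = arrs s 42 ==>
 arrs s' 43 = arrs s 43 ==> srep n s' \<longleftrightarrow> srep n s"
 unfolding srep_def by simp

definition swap_to :: cmd where
 "swap_to =
  Assign 63 (Elem 40 (Var 62)) ;; Assign 64 (Elem 41 (Var 60)) ;;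
  Put 40 (Var 62) (Var 60) ;; Put 41 (Var 60) (Var 62) ;;
  Put 40 (Var 64) (Var 63) ;; Put 41 (Var 63) (Var 64)"

definition inc_load :: cmd where
 "inc_load =
  Assign 61 (Elem 42 (Var 60) \<boxplus> Lit 1) ;; Assign 62 (Elem 43 (Var 61)) ;; swap_to ;;
  Put 43 (Var 61) (Var 62 \<boxplus> Lit 1) ;; Put 42 (Var 60) (Var 61)"

definition dec_load :: cmd where
 "dec_load =
  Assign 61 (Elem 42 (Var 60)) ;; Assign 62 (Elem 43 (Var 61) \<boxminus> Lit 1) ;; swap_to ;;
  Put 43 (Var 61) (Var 62) ;; Put 42 (Var 60) (Var 61 \<boxminus> Lit 1)"

lemma inc_load_frame [simp]: "lo inc_load = 61" "wr inc_load = {40, 41, 42, 43}" "pure inc_load"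
 by (auto simp: inc_load_def swap_to_def)

lemma dec_load_frame [simp]: "lo dec_load = 61" "wr dec_load = {40, 41, 42, 43}" "pure dec_load"
 by (auto simp: dec_load_def swap_to_def)

lemma inc_load_spec:
 assumes "srep n s" "regs s 60 = v" "v < n" "n + 100 < bnd W" "arrs s 42 v + 1 < bnd W"
 shows "spec W inc_load s 100 (%s'. srep n s' & arrs s' 42 = (arrs s 42)(v := arrs s 42 v + 1))"
proof -
 note r = assms(1)[unfolded srep_def]
 let ?i = "arrs s 43 (arrs s 42 v + 1)"
 note inc = sorted_by_inc[OF r assms(3) refl]
 have "?i < n" by (rule inc)
 moreover have "arrs s 40 ?i < n" "arrs s 41 v < n"
 using sorted_byD(1)[OF r inc(1)] sorted_byD(3)[OF r assms(3)] by auto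
 ultimately show ?thesis
 using inc(2) assms unfolding inc_load_def swap_to_def spec_def srep_def by simp
qed

lemma dec_load_spec:
 assumes "srep n s" "regs s 60 = v" "v < n" "n + 100 < bnd W" "arrs s 42 v < bnd W" "0 < arrs s 42 v"
 shows "spec W dec_load s 100 (%s'. srep n s' & arrs s' 42 = (arrs s 42)(v := arrs s 42 v - 1))"
proof -
 note r = assms(1)[unfolded srep_def]
 obtain i where i: "arrs s 43 (arrs s 42 v) = Suc i"
 using sorted_by_dec_pos[OF r assms(3)] gr0_implies_Suc by blast
 then have i': "arrs s 43 (arrs s 42 v) = i + 1" by simp
 note dec = sorted_by_dec[OF r assms(3) i' assms(6)]
 have "i < n" by (rule dec)
 moreover have "arrs s 40 i < n" "arrs s 41 v < n"
 using sorted_byD(1)[OF r dec(1)] sorted_byD(3)[OF r assms(3)] by auto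
 ultimately show ?thesis
 using dec(2) i assms unfolding dec_load_def swap_to_def spec_def srep_def by simp
qed

section \<open>Approximately locally optimal orientations\<close>

text \<open>\<open>X\<close> is the set of oriented copies, \<open>vs x\<close> lists the vertices of the copy \<open>x\<close>, and \<open>own x\<close> is
 the vertex that carries it. A vertex in \<open>H\<close> has a hole: its load counts one copy that is in
 transit. \<open>Q1 u\<close> and \<open>Q2 u\<close> are the two round-robin queues of the copies carried by \<open>u\<close>.\<close>

definition valid :: "nat => nat => nat list => bool" where
 "valid n r xs \<longleftrightarrow> xs \<noteq> [] & distinct xs & set xs \<subseteq> {..<n} & length xs <= r"

definition orientation :: "nat => nat => nat => nat set => (nat => nat list) => (nat => nat) =>
 (nat => nat) => nat set => (nat => nat list) => (nat => nat list) => bool" where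
 "orientation n r N X vs own load H Q1 Q2 \<longleftrightarrow>
  X \<subseteq> {..<N} & (\<forall>x\<in>X. valid n r (vs x) & own x \<in> set (vs x)) & H \<subseteq> {..<n} &
  (\<forall>u. distinct (Q1 u) & set (Q1 u) = {x \<in> X. own x = u}) &
  (\<forall>u. distinct (Q2 u) & set (Q2 u) = {x \<in> X. own x = u}) &
  (\<forall>u<n. load u = card {x \<in> X. own x = u} + (if u \<in> H then 1 else 0))"

text \<open>The constant 3 absorbs the rounding of \<open>L div b\<close>, the delay of the levels
  and a unit change of a load. It also keeps chains progressing at loads below \<open>b\<close>,
  where the quotient vanishes.\<close>

definition threshold :: "nat => nat => nat" where
 "threshold b L = L + L div b + 3"

text \<open>\<open>lev x\<close> is the possibly outdated load of the owner that the other vertices of \<open>x\<close> know. The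
 queue positions bound how far it is off: a copy at position \<open>i\<close> is refreshed before the load has
 changed by more than \<open>i / (4 * b) + 1\<close>.\<close>

definition leveled :: "nat => nat set => (nat => nat list) => (nat => nat) => (nat => nat) =>
 (nat => nat list) => (nat => nat list) => bool" where
 "leveled b X vs lev load Q1 Q2 \<longleftrightarrow>
  (\<forall>x\<in>X. \<forall>v\<in>set (vs x). lev x <= threshold b (load v)) &
  (\<forall>u. \<forall>i<length (Q1 u). 4 * b * load u + i < (4 * b + 1) * lev (Q1 u ! i)) &
  (\<forall>u. \<forall>i<length (Q2 u). (4 * b - 1) * lev (Q2 u ! i) + i < 4 * b * load u)"

lemma orientationD:
 assumes "orientation n r N X vs own load H Q1 Q2"
 shows "X \<subseteq> {..<N}" "x \<in> X ==> valid n r (vs x)" "x \<in> X ==> own x \<in> set (vs x)" "H \<subseteq> {..<n}"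
 "distinct (Q1 u)" "set (Q1 u) = {x \<in> X. own x = u}" "distinct (Q2 u)" "set (Q2 u) = {x \<in> X. own x = u}"
 "u < n ==> load u = card {x \<in> X. own x = u} + (if u \<in> H then 1 else 0)"
 "x \<in> X ==> own x < n"
 "length (Q1 u) = card {x \<in> X. own x = u}" "length (Q2 u) = card {x \<in> X. own x = u}" "finite X"
proof -
 show *: "X \<subseteq> {..<N}" "x \<in> X ==> valid n r (vs x)" "x \<in> X ==> own x \<in> set (vs x)" "H \<subseteq> {..<n}"
 "distinct (Q1 u)" "set (Q1 u) = {x \<in> X. own x = u}" "distinct (Q2 u)" "set (Q2 u) = {x \<in> X. own x = u}"
 "u < n ==> load u = card {x \<in> X. own x = u} + (if u \<in> H then 1 else 0)"
 using assms unfolding orientation_def by blast+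
 show "x \<in> X ==> own x < n" using * unfolding valid_def by auto
 show "length (Q1 u) = card {x \<in> X. own x = u}" using *(5,6) distinct_card by metis
 show "length (Q2 u) = card {x \<in> X. own x = u}" using *(7,8) distinct_card by metis
 show "finite X" using *(1) finite_subset by blast
qed

lemma leveledD:
 assumes "leveled b X vs lev load Q1 Q2"
 shows "x \<in> X ==> v \<in> set (vs x) ==> lev x <= threshold b (load v)"
 "i < length (Q1 u) ==> 4 * b * load u + i < (4 * b + 1) * lev (Q1 u ! i)"
 "i < length (Q2 u) ==> (4 * b - 1) * lev (Q2 u ! i) + i < 4 * b * load u"
 using assms unfolding leveled_def by blast+

lemma threshold_mono: "L <= L' ==> threshold b L <= threshold b L'"
 unfolding threshold_def by (simp add: add_mono div_le_mono)

text \<open>The load stays as it is and the departed copy is counted as a hole instead. Hence the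
  inner steps of a chain change no load and need no refresh; only its end does.\<close>

lemma orientation_detach:
 assumes o: "orientation n r N X vs own load H Q1 Q2" and x: "x \<in> X" "own x = u" "u \<notin> H"
 and ys: "removed x (Q1 u) ys1" "removed x (Q2 u) ys2"
 shows "orientation n r N (X - {x}) vs own load (insert u H) (Q1(u := ys1)) (Q2(u := ys2))"
proof -
 note d = orientationD[OF o]
 have *: "{y \<in> X - {x}. own y = v} = {y \<in> X. own y = v} - (if v = u then {x} else {})" for v
 using x by auto
 have "card {y \<in> X. own y = u} = Suc (card ({y \<in> X. own y = u} - {x}))"
 by (rule card.remove) (use d(13) x in auto)
 then have "card {y \<in> X - {x}. own y = v} + (if v \<in> insert u H then 1 else 0) =
  card {y \<in> X. own y = v} + (if v \<in> H then 1 else 0)" for v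
 using x unfolding * by auto
 then show ?thesis
 unfolding orientation_def using d ys x d(10)[OF x(1)] unfolding removed_def by auto
qed

text \<open>Under \<open>removed\<close> queue positions only decrease, and both queue bounds are
  weaker at smaller positions.\<close>

lemma leveled_detach:
 assumes l: "leveled b X vs lev load Q1 Q2"
 and ys: "removed x (Q1 u) ys1" "removed x (Q2 u) ys2"
 shows "leveled b (X - {x}) vs lev load (Q1(u := ys1)) (Q2(u := ys2))"
 unfolding leveled_def
proof (intro conjI allI impI ballI)
 fix v i assume i: "i < length ((Q1(u := ys1)) v)"
 show "4 * b * load v + i < (4 * b + 1) * lev ((Q1(u := ys1)) v ! i)"
 proof (cases "v = u")
 case True
 then obtain j where "i <= j" "j < length (Q1 u)" "ys1 ! i = Q1 u ! j"
  using ys(1) i unfolding removed_def by auto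
 then show ?thesis using leveledD(2)[OF l, of j u] True by simp
 qed (use i leveledD(2)[OF l] in simp)
next
 fix v i assume i: "i < length ((Q2(u := ys2)) v)"
 show "(4 * b - 1) * lev ((Q2(u := ys2)) v ! i) + i < 4 * b * load v"
 proof (cases "v = u")
 case True
 then obtain j where "i <= j" "j < length (Q2 u)" "ys2 ! i = Q2 u ! j"
  using ys(2) i unfolding removed_def by auto
 then show ?thesis using leveledD(3)[OF l, of j u] True by simp
 qed (use i leveledD(3)[OF l] in simp)
qed (use leveledD(1)[OF l] in auto)

lemma orientation_attach:
 assumes o: "orientation n r N X vs own load H Q1 Q2"
 and x: "x < N" "x \<notin> X" "valid n r (vs x)" "u \<in> set (vs x)" "u \<in> H"
 shows "orientation n r N (insert x X) vs (own(x := u)) load (H - {u})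
 (Q1(u := Q1 u @ [x])) (Q2(u := Q2 u @ [x]))"
proof -
 note d = orientationD[OF o]
 have *: "{y \<in> insert x X. (own(x := u)) y = v} = (if v = u then insert x {y \<in> X. own y = v} else {y \<in> X. own y = v})" for v
 using x by auto
 have "finite {y \<in> X. own y = u}" using d(13) by simp
 then have "card {y \<in> insert x X. (own(x := u)) y = v} + (if v \<in> H - {u} then 1 else 0) =
  card {y \<in> X. own y = v} + (if v \<in> H then 1 else 0)" for v
 using x unfolding * by auto
 then show ?thesis
 unfolding orientation_def using d x by auto
qed

text \<open>The copy enters at the last position \<open>load u - 1\<close> with the exact level
  \<open>L = load u\<close>. Both queue bounds then hold with a margin of one:
  \<open>4 * b * L + (L - 1) < (4 * b + 1) * L\<close>, and likewise for \<open>Q2\<close>.\<close>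

lemma leveled_attach:
 assumes o: "orientation n r N X vs own load H Q1 Q2" and l: "leveled b X vs lev load Q1 Q2"
 and x: "x \<notin> X" "u \<in> H" "\<And>v. v \<in> set (vs x) ==> load u <= threshold b (load v)"
 and b: "0 < b"
 shows "leveled b (insert x X) vs (lev(x := load u)) load (Q1(u := Q1 u @ [x])) (Q2(u := Q2 u @ [x]))"
proof -
 note d = orientationD[OF o]
 have u: "u < n" using d(4) x by auto
 have len: "load u = Suc (length (Q1 u))" "load u = Suc (length (Q2 u))"
 using d(9)[OF u] d(11,12)[of u] x by auto
 have ne: "Q1 v ! i \<noteq> x" if "i < length (Q1 v)" for v i
 using d(6)[of v] nth_mem[OF that] x by auto
 have ne2: "Q2 v ! i \<noteq> x" if "i < length (Q2 v)" for v i
 using d(8)[of v] nth_mem[OF that] x by auto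
 show ?thesis
 unfolding leveled_def
 proof (intro conjI allI impI ballI)
 fix y v assume "y \<in> insert x X" "v \<in> set (vs y)"
 then show "(lev(x := load u)) y <= threshold b (load v)"
  using x leveledD(1)[OF l] by (cases "y = x") auto
 next
 fix v i assume i: "i < length ((Q1(u := Q1 u @ [x])) v)"
 show "4 * b * load v + i < (4 * b + 1) * (lev(x := load u)) ((Q1(u := Q1 u @ [x])) v ! i)"
  using i ne[of i v] leveledD(2)[OF l, of i v] len by (auto simp: nth_append less_Suc_eq)
 next
 fix v i assume i: "i < length ((Q2(u := Q2 u @ [x])) v)"
 have "(4 * b - 1) * load u + length (Q2 u) < 4 * b * load u"
 proof -
  have "4 * b * load u = (4 * b - 1) * load u + load u"
  using b by (metis One_nat_def Suc_pred add.commute mult_Suc nat_0_less_mult_iff zero_less_numeral)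
  then show ?thesis using len by linarith
 qed
 then show "(4 * b - 1) * (lev(x := load u)) ((Q2(u := Q2 u @ [x])) v ! i) + i < 4 * b * load v"
  using i ne2[of i v] leveledD(3)[OF l, of i v] by (auto simp: nth_append less_Suc_eq)
 qed
qed

lemma pred_mult_add:
 fixes k m :: nat
 assumes "0 < k"
 shows "k * m = (k - 1) * m + m"
 using assms by (cases k) auto

lemma nth_rotated:
 assumes "i < length xs" "\<not> k + i < length xs"
 shows "(drop k xs @ take k xs) ! i \<in> set (take k xs)"
proof -
 have "(drop k xs @ take k xs) ! i = take k xs ! (i - length (drop k xs))"
 using assms by (auto simp: nth_append)
 moreover have "i - length (drop k xs) < length (take k xs)" using assms by auto
 ultimately show ?thesis by (metis nth_mem)
qed

lemma orientation_raise:
 assumes o: "orientation n r N X vs own load H Q1 Q2" and u: "u < n" "u \<notin> H"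
 shows "orientation n r N X vs own (load(u := load u + 1)) (insert u H) (Q1(u := drop k (Q1 u) @ take k (Q1 u))) Q2"
proof -
 note d = orientationD[OF o]
 have "mset (drop k (Q1 u) @ take k (Q1 u)) = mset (Q1 u)"
 by (metis append_take_drop_id mset_append union_commute)
 then have "distinct (drop k (Q1 u) @ take k (Q1 u))" "set (drop k (Q1 u) @ take k (Q1 u)) = set (Q1 u)"
 using d(5)[of u] by (metis mset_eq_imp_distinct_iff, metis mset_eq_setD)
 then show ?thesis
 unfolding orientation_def using d u by auto
qed

text \<open>An increase adds \<open>4 * b\<close> to the left side of the first queue bound, and the
  rotation pays for it by advancing every copy that is not refreshed by \<open>4 * b\<close>
  positions. A shorter queue is refreshed entirely. \<open>Q1\<close> guards against levels that are
  too low and is rotated by increases only, \<open>Q2\<close> guards against levels that are too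
  high and is rotated by decreases only, so alternating changes starve no copy.\<close>

lemma leveled_raise:
 assumes o: "orientation n r N X vs own load H Q1 Q2" and l: "leveled b X vs lev load Q1 Q2"
 and u: "u < n" "u \<notin> H" and k: "k = min (4 * b) (load u)" and b: "0 < b"
 and sc: "\<And>x v. x \<in> set (take k (Q1 u)) ==> v \<in> set (vs x) ==> load u + 1 <= threshold b (load v)"
 and lev': "lev' = (%x. if x \<in> set (take k (Q1 u)) then load u + 1 else lev x)"
 shows "leveled b X vs lev' (load(u := load u + 1)) (Q1(u := drop k (Q1 u) @ take k (Q1 u))) Q2"
proof -
 note d = orientationD[OF o]
 have len: "load u = length (Q1 u)" "load u = length (Q2 u)"
 using d(9)[OF u(1)] d(11,12)[of u] u by auto
 have own: "own x = u" if "x \<in> set (take k (Q1 u))" for x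
 using in_set_takeD[OF that] d(6)[of u] by auto
 have not_take: "Q1 u ! (k + i) \<notin> set (take k (Q1 u))" if "k + i < length (Q1 u)" for i
 proof
 assume "Q1 u ! (k + i) \<in> set (take k (Q1 u))"
 then obtain j where "j < k" "j < length (Q1 u)" "Q1 u ! j = Q1 u ! (k + i)"
  by (auto simp: in_set_conv_nth)
 then show False using d(5)[of u] that nth_eq_iff_index_eq by fastforce
 qed
 show ?thesis
 unfolding leveled_def
 proof (intro conjI allI impI ballI)
 fix x v assume x: "x \<in> X" "v \<in> set (vs x)"
 have "threshold b (load v) <= threshold b ((load(u := load u + 1)) v)"
  by (rule threshold_mono) simp
 moreover have "lev' x <= threshold b (load v)"
  using leveledD(1)[OF l x] sc[of x v] x unfolding lev' by auto
 ultimately show "lev' x <= threshold b ((load(u := load u + 1)) v)" by linarith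
 next
 fix v i assume i: "i < length ((Q1(u := drop k (Q1 u) @ take k (Q1 u))) v)"
 show "4 * b * (load(u := load u + 1)) v + i < (4 * b + 1) * lev' ((Q1(u := drop k (Q1 u) @ take k (Q1 u))) v ! i)"
 proof (cases "v = u")
  case False
  then have "Q1 v ! i \<notin> set (take k (Q1 u))"
  using own[of "Q1 v ! i"] d(6)[of v] nth_mem[of i "Q1 v"] i by auto
  then show ?thesis using False i leveledD(2)[OF l, of i v] unfolding lev' by simp
 next
  case True
  show ?thesis
  proof (cases "k + i < length (Q1 u)")
  case lt: True
  then have "k = 4 * b" using k len by auto
  moreover have "(drop k (Q1 u) @ take k (Q1 u)) ! i = Q1 u ! (k + i)" using lt by (simp add: nth_append less_diff_conv add.commute)
  ultimately show ?thesis
   using True leveledD(2)[OF l lt] not_take[OF lt] unfolding lev' by (simp add: algebra_simps)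
  next
  case False
  then have "(drop k (Q1 u) @ take k (Q1 u)) ! i \<in> set (take k (Q1 u))"
   using i True by (intro nth_rotated) auto
  moreover have "i < load u + 1" using i True len by simp
  ultimately show ?thesis using True unfolding lev' by (simp add: algebra_simps)
  qed
 qed
 next
 fix v i assume i: "i < length (Q2 v)"
 show "(4 * b - 1) * lev' (Q2 v ! i) + i < 4 * b * (load(u := load u + 1)) v"
 proof (cases "Q2 v ! i \<in> set (take k (Q1 u))")
  case True
  then have "v = u" using own[of "Q2 v ! i"] d(8)[of v] nth_mem[OF i] by auto
  moreover have "4 * b * (load u + 1) = (4 * b - 1) * (load u + 1) + (load u + 1)"
  by (rule pred_mult_add) (use b in simp)
  ultimately show ?thesis using True i len unfolding lev' by simp
 next
  case False
  have "4 * b * load v <= 4 * b * (load(u := load u + 1)) v" by simp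
  moreover have "(4 * b - 1) * lev (Q2 v ! i) + i < 4 * b * load v" using leveledD(3)[OF l i] .
  ultimately show ?thesis using False unfolding lev' by (simp only: if_False)
 qed
 qed
qed

lemma orientation_lower:
 assumes o: "orientation n r N X vs own load H Q1 Q2" and u: "u \<in> H"
 shows "orientation n r N X vs own (load(u := load u - 1)) (H - {u}) Q1 (Q2(u := drop k (Q2 u) @ take k (Q2 u)))"
proof -
 note d = orientationD[OF o]
 have "mset (drop k (Q2 u) @ take k (Q2 u)) = mset (Q2 u)"
 by (metis append_take_drop_id mset_append union_commute)
 then have "distinct (drop k (Q2 u) @ take k (Q2 u))" "set (drop k (Q2 u) @ take k (Q2 u)) = set (Q2 u)"
 using d(7)[of u] by (metis mset_eq_imp_distinct_iff, metis mset_eq_setD)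
 then show ?thesis
 unfolding orientation_def using d u by auto
qed

text \<open>Decreases refresh with a minimum, so no level grows and the thresholds at the other
  vertices need no check. Only the lowered threshold at \<open>u\<close> itself could be violated,
  which the premise on the copies through \<open>u\<close> excludes.\<close>

lemma leveled_lower:
 assumes o: "orientation n r N X vs own load H Q1 Q2" and l: "leveled b X vs lev load Q1 Q2"
 and u: "u \<in> H" and k: "k = min (4 * b) (load u - 1)" and b: "0 < b"
 and sc: "\<And>x. x \<in> X ==> u \<in> set (vs x) ==> lev x <= threshold b (load u - 1)"
 and lev': "lev' = (%x. if x \<in> set (take k (Q2 u)) then min (lev x) (load u - 1) else lev x)"
 shows "leveled b X vs lev' (load(u := load u - 1)) Q1 (Q2(u := drop k (Q2 u) @ take k (Q2 u)))"
proof -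
 note d = orientationD[OF o]
 have un: "u < n" using u d(4) by auto
 have len: "load u = Suc (length (Q1 u))" "load u = Suc (length (Q2 u))"
 using d(9)[OF un] d(11,12)[of u] u by auto
 have own: "own x = u" if "x \<in> set (take k (Q2 u))" for x
 using in_set_takeD[OF that] d(8)[of u] by auto
 have not_take: "Q2 u ! (k + i) \<notin> set (take k (Q2 u))" if "k + i < length (Q2 u)" for i
 proof
 assume "Q2 u ! (k + i) \<in> set (take k (Q2 u))"
 then obtain j where "j < k" "j < length (Q2 u)" "Q2 u ! j = Q2 u ! (k + i)"
  by (auto simp: in_set_conv_nth)
 then show False using d(7)[of u] that nth_eq_iff_index_eq by fastforce
 qed
 have b4: "4 * b * m = (4 * b - 1) * m + m" for m
 by (rule pred_mult_add) (use b in simp)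
 show ?thesis
 unfolding leveled_def
 proof (intro conjI allI impI ballI)
 fix x v assume x: "x \<in> X" "v \<in> set (vs x)"
 have "lev' x <= lev x" unfolding lev' by simp
 then show "lev' x <= threshold b ((load(u := load u - 1)) v)"
  using leveledD(1)[OF l x] sc[of x] x by (cases "v = u") auto
 next
 fix v i assume i: "i < length (Q1 v)"
 note lq = leveledD(2)[OF l i]
 show "4 * b * (load(u := load u - 1)) v + i < (4 * b + 1) * lev' (Q1 v ! i)"
 proof (cases "Q1 v ! i \<in> set (take k (Q2 u)) & load u - 1 < lev (Q1 v ! i)")
  case True
  then have "v = u" using own[of "Q1 v ! i"] d(6)[of v] nth_mem[OF i] by auto
  then show ?thesis using True i len unfolding lev' by simp
 next
  case False
  then have "lev' (Q1 v ! i) = lev (Q1 v ! i)" unfolding lev' by auto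
  moreover have "4 * b * (load(u := load u - 1)) v <= 4 * b * load v" by simp
  ultimately show ?thesis using lq by (metis add_le_cancel_right le_less_trans)
 qed
 next
 fix v i assume i: "i < length ((Q2(u := drop k (Q2 u) @ take k (Q2 u))) v)"
 show "(4 * b - 1) * lev' ((Q2(u := drop k (Q2 u) @ take k (Q2 u))) v ! i) + i < 4 * b * (load(u := load u - 1)) v"
 proof (cases "v = u")
  case False
  then have "Q2 v ! i \<notin> set (take k (Q2 u))"
  using own[of "Q2 v ! i"] d(8)[of v] nth_mem[of i "Q2 v"] i by auto
  then show ?thesis using False i leveledD(3)[OF l, of i v] unfolding lev' by simp
 next
  case True
  show ?thesis
  proof (cases "k + i < length (Q2 u)")
  case lt: True
  then have "k = 4 * b" using k len by auto
  moreover have "(drop k (Q2 u) @ take k (Q2 u)) ! i = Q2 u ! (k + i)" using lt by (simp add: nth_append less_diff_conv add.commute)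
  moreover have "4 * b * load u = 4 * b * (load u - 1) + 4 * b" using len by simp
  ultimately show ?thesis
   using True leveledD(3)[OF l lt] not_take[OF lt] unfolding lev' by simp
  next
  case False
  let ?y = "(drop k (Q2 u) @ take k (Q2 u)) ! i"
  have "?y \<in> set (take k (Q2 u))"
   using i True False by (intro nth_rotated) auto
  then have "lev' ?y <= load u - 1" unfolding lev' by simp
  then have "(4 * b - 1) * lev' ?y <= (4 * b - 1) * (load u - 1)" by simp
  moreover have "i < load u - 1" using i True len by simp
  ultimately have "(4 * b - 1) * lev' ?y + i < 4 * b * (load u - 1)"
   using b4[of "load u - 1"] by linarith
  then show ?thesis using True by simp
  qed
 qed
 qed
qed

section \<open>Growth of loads along chains and sizes of copies at high loads\<close>

lemma level_load:
 assumes "orientation n r N X vs own load H Q1 Q2" "leveled b X vs lev load Q1 Q2" "x \<in> X"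
 shows "4 * b * load (own x) < (4 * b + 1) * lev x" "(4 * b - 1) * lev x < 4 * b * load (own x)"
proof -
 note d = orientationD[OF assms(1)]
 have "x \<in> set (Q1 (own x))" "x \<in> set (Q2 (own x))" using d(6,8)[of "own x"] assms(3) by auto
 then obtain i j where "i < length (Q1 (own x))" "Q1 (own x) ! i = x"
 "j < length (Q2 (own x))" "Q2 (own x) ! j = x" by (auto simp: in_set_conv_nth)
 then show "4 * b * load (own x) < (4 * b + 1) * lev x" "(4 * b - 1) * lev x < 4 * b * load (own x)"
 using leveledD(2,3)[OF assms(2)] by fastforce+
qed

lemma div_real_bounds:
 assumes "0 < b"
 shows "real (L div b) <= real L / real b" "real L / real b < real (L div b) + 1"
proof -
 have "real L = real (b * (L div b) + L mod b)" by simp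
 then have L: "real L = real b * real (L div b) + real (L mod b)"
 unfolding of_nat_add of_nat_mult .
 show "real (L div b) <= real L / real b" using L assms by (simp add: field_simps)
 have "real (L mod b) < real b" using assms by simp
 then show "real L / real b < real (L div b) + 1" using L assms by (simp add: field_simps)
qed

lemma threshold_real:
 assumes "0 < b"
 shows "real (threshold b L) <= real L + real L / real b + 3"
 "real L + real L / real b + 2 < real (threshold b L)"
 using div_real_bounds[OF assms, of L] unfolding threshold_def by simp_all

text \<open>Along the chain of a deletion the loads grow geometrically.\<close>

lemma chain_up:
 assumes o: "orientation n r N X vs own load H Q1 Q2" and l: "leveled b X vs lev load Q1 Q2"
 and y: "y \<in> X" "threshold b (L - 1) < lev y" and b: "0 < b" and L: "0 < L"
 shows "real L + real L / (2 * real b) + 1 <= real (load (own y))"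
proof -
 let ?b = "real b" and ?L = "real L" and ?v = "real (lev y)" and ?w = "real (load (own y))"
 have b1: "1 <= ?b" using b by simp
 have "L - 1 = b * ((L - 1) div b) + (L - 1) mod b" by simp
 moreover have "(L - 1) mod b < b" using b by simp
 ultimately have "L <= b * ((L - 1) div b) + b" using L by linarith
 then have "?L <= ?b * real ((L - 1) div b) + ?b"
 by (metis of_nat_add of_nat_le_iff of_nat_mult)
 moreover have "L + (L - 1) div b + 3 <= lev y" using y(2) L unfolding threshold_def by linarith
 then have "?L + real ((L - 1) div b) + 3 <= ?v" by linarith
 then have "?b * (?L + real ((L - 1) div b) + 3) <= ?b * ?v" using b1 by (intro mult_left_mono) auto
 \<comment> \<open>This is \<open>lev y >= L + L / b + 2\<close> without denominators. Passing from
   the level to the true load of the owner loses at most the factor \<open>1 - 1 / (4 * b)\<close>,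
   which still leaves a growth of \<open>L / (2 * b) + 1\<close>.\<close>
 ultimately have v: "?b * ?L + ?L + 2 * ?b <= ?b * ?v" by (simp add: algebra_simps)
 have "(4 * b - 1) * lev y < 4 * b * load (own y)" by (rule level_load(2)[OF o l y(1)])
 then have "real ((4 * b - 1) * lev y) < real (4 * b * load (own y))" by linarith
 then have "(4 * ?b - 1) * ?v < 4 * ?b * ?w" using b by (simp add: of_nat_diff)
 then have "?b * ((4 * ?b - 1) * ?v) <= ?b * (4 * ?b * ?w)" using b by (intro mult_left_mono) auto
 moreover have "(4 * ?b - 1) * (?b * ?L + ?L + 2 * ?b) <= (4 * ?b - 1) * (?b * ?v)"
 using v b1 by (intro mult_left_mono) auto
 ultimately have "(4 * ?b - 1) * (?b * ?L + ?L + 2 * ?b) <= 4 * ?b * ?b * ?w" by (simp add: algebra_simps)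
 moreover have "(4 * ?b - 1) * (?b * ?L + ?L + 2 * ?b) =
  4 * (?b * (?b * ?L)) + 3 * (?b * ?L) + 8 * (?b * ?b) - ?L - 2 * ?b" by (simp add: algebra_simps)
 moreover have "1 * ?L <= ?b * ?L" "1 * ?b <= ?b * ?b" using b1 by (intro mult_right_mono; simp)+
 moreover have "4 * ?b * ?b * (?L + ?L / (2 * ?b) + 1) = 4 * (?b * (?b * ?L)) + 2 * (?b * ?L) + 4 * (?b * ?b)"
 using b by (simp add: field_simps)
 ultimately have "4 * ?b * ?b * (?L + ?L / (2 * ?b) + 1) <= 4 * ?b * ?b * ?w"
 using b1 by linarith
 then show ?thesis using b by (simp add: mult_le_cancel_left)
qed

lemma sum_load:
 assumes o: "orientation n r N X vs own load H Q1 Q2" and S: "S \<subseteq> {..<n}"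
 shows "(\<Sum>v\<in>S. load v) = card {x \<in> X. own x \<in> S} + card (H \<inter> S)"
proof -
 note d = orientationD[OF o]
 have fin: "finite S" using S finite_subset by blast
 have "(\<Sum>v\<in>S. load v) = (\<Sum>v\<in>S. card {x \<in> X. own x = v}) + (\<Sum>v\<in>S. if v \<in> H then 1 else 0)"
 unfolding sum.distrib[symmetric] by (rule sum.cong) (use d(9) S in auto)
 moreover have "(\<Sum>v\<in>S. card {x \<in> X. own x = v}) = card (\<Union>v\<in>S. {x \<in> X. own x = v})"
 by (rule card_UN_disjoint[symmetric]) (use fin d(13) in auto)
 moreover have "(\<Union>v\<in>S. {x \<in> X. own x = v}) = {x \<in> X. own x \<in> S}" by auto
 moreover have "(\<Sum>v\<in>S. if v \<in> H then 1 else 0) = card (H \<inter> S)"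
 using fin by (simp add: sum.If_cases Int_commute)
 ultimately show ?thesis by simp
qed

lemma load_le:
 assumes "orientation n r N X vs own load H Q1 Q2" "u < n"
 shows "load u <= card X + (if u \<in> H then 1 else 0)"
 using orientationD(9,13)[OF assms(1)] assms(2) card_mono[of X "{x \<in> X. own x = u}"] by auto

text \<open>Each vertex of \<open>ys\<close> carries roughly a quarter of \<open>L\<close>, and all
  loads together are bounded by the copies and the holes. A hyperedge met at a high load is
  therefore small.\<close>

lemma edge_size:
 assumes o: "orientation n r N X vs own load H Q1 Q2" and ys: "valid n r ys"
 and L: "\<And>v. v \<in> set ys ==> L <= 4 * load v + 6"
 shows "length ys * L <= 4 * (card X + card H) + 6 * r"
proof -
 have ys': "distinct ys" "set ys \<subseteq> {..<n}" "length ys <= r" using ys unfolding valid_def by auto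
 note d = orientationD[OF o]
 have "length ys * L = (\<Sum>v\<in>set ys. L)" using ys'(1) by (simp add: distinct_card)
 also have "\<dots> <= (\<Sum>v\<in>set ys. 4 * load v + 6)" by (rule sum_mono) (use L in auto)
 also have "\<dots> = 4 * (\<Sum>v\<in>set ys. load v) + 6 * length ys"
 using ys'(1) by (simp add: sum.distrib sum_distrib_left distinct_card)
 also have "(\<Sum>v\<in>set ys. load v) = card {x \<in> X. own x \<in> set ys} + card (H \<inter> set ys)"
 by (rule sum_load[OF o ys'(2)])
 also have "card {x \<in> X. own x \<in> set ys} <= card X" using d(13) by (intro card_mono) auto
 also have "card (H \<inter> set ys) <= card H" using d(4) finite_subset by (intro card_mono) auto
 finally show ?thesis using ys'(3) by simp
qed

text \<open>For \<open>b >= 1\<close> the threshold condition gives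
  \<open>lev y <= 2 * load v + 3\<close>, and the delay costs less than another factor 2.\<close>

lemma scanned_load:
 assumes o: "orientation n r N X vs own load H Q1 Q2" and l: "leveled b X vs lev load Q1 Q2"
 and y: "y \<in> X" "v \<in> set (vs y)" and b: "0 < b"
 shows "load (own y) <= 4 * load v + 6"
proof -
 have "load v div b <= load v" by (rule div_le_dividend)
 then have "lev y <= 2 * load v + 3" using leveledD(1)[OF l y] unfolding threshold_def by linarith
 moreover have "4 * b * load (own y) < 4 * b * (2 * lev y)"
 proof -
 have "(4 * b + 1) * lev y <= 8 * b * lev y" using b by (intro mult_right_mono) auto
 then have "4 * b * load (own y) < 8 * b * lev y" using level_load(1)[OF o l y(1)] by linarith
 then show ?thesis by simp
 qed
 then have "load (own y) < 2 * lev y" using b by (simp only: mult_less_cancel1)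
 ultimately show ?thesis by linarith
qed

text \<open>With \<open>x = L + b\<close> this is, up to an additive constant, twice the integral of
  \<open>2 * r * \<Lambda> / (x + \<Lambda>)\<close> against \<open>b / x\<close>: the first factor
  bounds the size of a copy at load \<open>L\<close>, and a step of a chain changes \<open>x\<close>
  by about \<open>x / b\<close>. The antiderivative of
  \<open>\<Lambda> / (x * (x + \<Lambda>))\<close> is \<open>- ln (1 + \<Lambda> / x)\<close>. The
  constant term makes the value at load 0 vanish.\<close>

definition potential :: "nat => nat => real => real => real" where
 "potential b r \<Lambda> L = 4 * real b * real r * (ln (1 + \<Lambda> / real b) - ln (1 + \<Lambda> / (L + real b)))"

lemma ratio_minus_one:
 fixes a a' l :: real
 assumes "0 < a" "0 < a'" "0 < l"
 shows "(1 + l / a') / (1 + l / a) - 1 = l * (a - a') / (a' * (a + l))"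
proof -
 have "1 + l / a = (a + l) / a" "1 + l / a' = (a' + l) / a'" using assms by (simp_all add: field_simps)
 moreover have "a + l \<noteq> 0" using assms by simp
 ultimately show ?thesis using assms by (simp add: divide_simps) (simp add: algebra_simps)
qed

text \<open>The drop pays for the size bound at the larger load \<open>L\<close>. For
  \<open>a = L + b\<close> and \<open>a' = L' + b\<close> the threshold gives
  \<open>a' <= b * (a - a')\<close>, so the quotient of the arguments of the two logarithms exceeds
  1 by at least \<open>w\<close>. The spare factor 2 in the potential pays for
  \<open>w / 2 <= ln (1 + w)\<close>.\<close>

lemma potential_step:
 assumes b: "0 < b" and \<Lambda>: "0 < \<Lambda>" and L: "threshold b L' <= L"
 shows "potential b r \<Lambda> (real L') + 2 * real r * \<Lambda> / (real L + real b + \<Lambda>) <= potential b r \<Lambda> (real L)"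
proof -
 let ?b = "real b" and ?a = "real L + real b" and ?a' = "real L' + real b"
 have b1: "1 <= ?b" using b by simp
 have pos: "0 < ?a" "0 < ?a'" using b by auto
 have "real L' + real L' / ?b + 1 <= real L" using threshold_real(2)[OF b, of L'] L by linarith
 then have "?b * (real L' + real L' / ?b + 1) <= ?b * real L" using b by (intro mult_left_mono) auto
 then have step: "?a' <= ?b * (?a - ?a')" using b by (simp add: algebra_simps)
 define z where "z = (1 + \<Lambda> / ?a') / (1 + \<Lambda> / ?a) - 1"
 define w where "w = \<Lambda> / (?b * (?a + \<Lambda>))"
 have z_eq: "z = \<Lambda> * (?a - ?a') / (?a' * (?a + \<Lambda>))"
 unfolding z_def by (rule ratio_minus_one[OF pos \<Lambda>])
 have wz: "w <= z"
 proof -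
 have "w = \<Lambda> * ?a' / (?a' * (?b * (?a + \<Lambda>)))" unfolding w_def using pos by simp
 also have "\<dots> <= \<Lambda> * (?b * (?a - ?a')) / (?a' * (?b * (?a + \<Lambda>)))"
  using step \<Lambda> pos b by (intro divide_right_mono mult_left_mono) auto
 also have "\<dots> = ?b * (\<Lambda> * (?a - ?a')) / (?b * (?a' * (?a + \<Lambda>)))" by (simp only: mult.left_commute)
 also have "\<dots> = z" unfolding z_eq using b by simp
 finally show ?thesis .
 qed
 have w: "0 < w" "w <= 1"
 proof -
 show "0 < w" unfolding w_def using \<Lambda> pos b by simp
 have "1 * (?a + \<Lambda>) <= ?b * (?a + \<Lambda>)" using b1 pos \<Lambda> by (intro mult_right_mono) auto
 then have "?a + \<Lambda> <= ?b * (?a + \<Lambda>)" by (simp only: mult_1)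
 then have "\<Lambda> <= ?b * (?a + \<Lambda>)" using pos(1) by (meson le_add_same_cancel2 less_imp_le order_trans)
 then show "w <= 1" unfolding w_def using \<Lambda> pos b by (simp add: field_simps)
 qed
 have "w / 2 <= ln (1 + w)"
 proof -
 have "ln (inverse (1 + w)) <= inverse (1 + w) - 1" using w by (intro ln_le_minus_one) simp
 then have "1 - inverse (1 + w) <= ln (1 + w)" using w by (simp add: ln_inverse)
 moreover have "w / 2 <= 1 - inverse (1 + w)" using w by (simp add: field_simps)
 ultimately show ?thesis by linarith
 qed
 also have "ln (1 + w) <= ln (1 + z)" using wz w by simp
 also have "1 + z = (1 + \<Lambda> / ?a') / (1 + \<Lambda> / ?a)" unfolding z_def by simp
 also have "ln \<dots> = ln (1 + \<Lambda> / ?a') - ln (1 + \<Lambda> / ?a)"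
 using pos \<Lambda> by (intro ln_divide_pos) (simp_all add: add_pos_pos divide_pos_pos)
 finally have "4 * ?b * real r * (w / 2) <= 4 * ?b * real r * (ln (1 + \<Lambda> / ?a') - ln (1 + \<Lambda> / ?a))"
 by (intro mult_left_mono) auto
 moreover have "4 * ?b * real r * (w / 2) = 2 * real r * \<Lambda> / (?a + \<Lambda>)"
 proof -
 have "4 * B * R * (l / (B * Z) / 2) = 2 * R * l / Z" if "B \<noteq> 0" for B R l Z :: real
  using that by (cases "Z = 0") (simp_all add: field_simps)
 moreover have "?b \<noteq> 0" using b by simp
 ultimately show ?thesis unfolding w_def .
 qed
 ultimately show ?thesis unfolding potential_def by (simp add: algebra_simps)
qed

lemma potential_bounds:
 assumes "0 < b" "0 < \<Lambda>" "0 <= L"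
 shows "0 <= potential b r \<Lambda> L" "potential b r \<Lambda> L <= 4 * real b * real r * ln (1 + \<Lambda> / real b)"
proof -
 have "\<Lambda> / (L + real b) <= \<Lambda> / real b" using assms by (intro divide_left_mono) auto
 moreover have "0 <= \<Lambda> / (L + real b)" using assms by simp
 ultimately have "0 <= ln (1 + \<Lambda> / (L + real b))" "ln (1 + \<Lambda> / (L + real b)) <= ln (1 + \<Lambda> / real b)"
 by auto
 then show "0 <= potential b r \<Lambda> L" "potential b r \<Lambda> L <= 4 * real b * real r * ln (1 + \<Lambda> / real b)"
 unfolding potential_def by (auto intro!: mult_left_mono)
qed

text \<open>Merges the trivial bound \<open>r\<close>, effective at small \<open>L\<close>, with the
  decay in \<open>1 / L\<close>. \<open>\<Lambda>\<close> is chosen such that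
  \<open>r * \<Lambda> = 4 * M + 6 * r + r * b\<close>; the factor 2 comes from adding the two
  bounds.\<close>

lemma edge_size_real:
 assumes "length ys * L <= 4 * M + 6 * r" "length ys <= r" "0 < b" "0 < r"
 and \<Lambda>: "\<Lambda> = 4 * real M / real r + 6 + real b"
 shows "real (length ys) <= 2 * real r * \<Lambda> / (real L + real b + \<Lambda>)"
proof -
 let ?k = "real (length ys)"
 have "real (length ys * L) <= real (4 * M + 6 * r)" using assms(1) of_nat_le_iff by blast
 then have 1: "?k * real L <= 4 * real M + 6 * real r" by simp
 have 2: "?k * real b <= real r * real b" "?k * \<Lambda> <= real r * \<Lambda>"
 using assms(2) \<Lambda> by (auto intro!: mult_right_mono)
 have "4 * real M + 6 * real r + real r * real b = real r * \<Lambda>"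
 unfolding \<Lambda> using assms(4) by (simp add: algebra_simps)
 then have "?k * (real L + real b + \<Lambda>) <= 2 * real r * \<Lambda>" using 1 2 by (simp add: algebra_simps)
 moreover have "0 < real L + real b + \<Lambda>" unfolding \<Lambda> using assms by (simp add: add_nonneg_pos)
 ultimately show ?thesis by (simp add: field_simps)
qed

text \<open>Turns the multiplicative slack into an additive one. With
  \<open>lev y <= 2 * \<Delta>\<close> the delay costs at most \<open>\<Delta> / (2 * b)\<close> and
  the threshold \<open>\<Delta> / b + 3\<close>; rounded up, this is the width of the steps in which
  the search for an answer descends.\<close>

lemma load_gap:
 assumes o: "orientation n r N X vs own load H Q1 Q2" and l: "leveled b X vs lev load Q1 Q2"
 and y: "y \<in> X" "v \<in> set (vs y)" and b: "0 < b" and \<Delta>: "\<And>v. v < n ==> load v <= \<Delta>"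
 shows "load (own y) <= load v + ((2 * \<Delta>) div b + 4)"
proof -
 let ?b = "real b" and ?v = "real (lev y)" and ?u = "real (load (own y))" and ?D = "real \<Delta>"
 note d = orientationD[OF o]
 have vn: "v < n" using d(2)[OF y(1)] y(2) unfolding valid_def by auto
 have b1: "1 <= ?b" using b by simp
 have "real (4 * b * load (own y)) < real ((4 * b + 1) * lev y)"
 "real ((4 * b - 1) * lev y) < real (4 * b * load (own y))"
 using level_load[OF o l y(1)] of_nat_less_iff by blast+
 then have 1: "4 * ?b * ?u < (4 * ?b + 1) * ?v" and 2: "(4 * ?b - 1) * ?v < 4 * ?b * ?u"
 using b by (simp_all add: of_nat_diff algebra_simps)
 have "?u <= ?D" "real (load v) <= ?D" using \<Delta> d(10)[OF y(1)] vn by auto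
 have "?v <= 2 * ?D"
 proof (rule ccontr)
 assume "\<not> ?v <= 2 * ?D"
 then have "(4 * ?b - 1) * (2 * ?D) <= (4 * ?b - 1) * ?v" using b1 by (intro mult_left_mono) auto
 moreover have "4 * ?b * ?u <= 4 * ?b * ?D" using \<open>?u <= ?D\<close> b by simp
 moreover have "1 * ?D <= ?b * ?D" using b1 by (intro mult_right_mono) auto
 ultimately show False using 2 by (simp add: algebra_simps)
 qed
 then have "?v / (4 * ?b) <= (2 * ?D) / (4 * ?b)" using b by (intro divide_right_mono) auto
 moreover have "?u < ?v + ?v / (4 * ?b)" using 1 b by (simp add: field_simps)
 ultimately have "?u < ?v + ?D / (2 * ?b)" by simp
 moreover have "real (lev y) <= real (threshold b (load v))" using leveledD(1)[OF l y] by simp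
 then have "?v <= real (load v) + real (load v) / ?b + 3" using threshold_real(1)[OF b, of "load v"] by linarith
 moreover have "real (load v) / ?b <= ?D / ?b" using \<open>real (load v) <= ?D\<close> b by (intro divide_right_mono) auto
 ultimately have "?u < real (load v) + ?D / (2 * ?b) + ?D / ?b + 3" by linarith
 moreover have "?D / (2 * ?b) <= ?D / ?b" using b by (intro divide_left_mono) auto
 moreover have "real (2 * \<Delta>) / ?b < real ((2 * \<Delta>) div b) + 1" by (rule div_real_bounds(2)[OF b])
 ultimately have "?u < real (load v) + (real ((2 * \<Delta>) div b) + 4)" by simp
 then show ?thesis by linarith
qed

lemma density_upper:
 assumes o: "orientation n r N X vs own load {} Q1 Q2" and U: "U \<subseteq> {..<n}"
 and \<Delta>: "\<And>v. v < n ==> load v <= \<Delta>"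
 shows "card {x \<in> X. set (vs x) \<subseteq> U} <= \<Delta> * card U"
proof -
 note d = orientationD[OF o]
 have "card {x \<in> X. set (vs x) \<subseteq> U} <= card {x \<in> X. own x \<in> U}"
 using d(3,13) by (intro card_mono) auto
 also have "\<dots> = (\<Sum>v\<in>U. load v)" using sum_load[OF o U] by simp
 also have "\<dots> <= (\<Sum>v\<in>U. \<Delta>)" using \<Delta> U by (intro sum_mono) auto
 finally show ?thesis by (simp add: mult.commute)
qed

text \<open>By \<open>load_gap\<close> a copy owned at or above level \<open>D\<close> has all its
  vertices at or above \<open>D'\<close>, one step lower, and so counts inside that set. Here
  \<open>D\<close> is a level and not a number of copies. The choice of \<open>b\<close> and the
  size of \<open>\<Delta>\<close> keep \<open>D\<close> at least
  \<open>\<Delta> * (1 - 1 / q)\<close>, and passing from the smaller vertex set to the larger one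
  loses the factor \<open>q / (q + 1)\<close>.\<close>

lemma density_lower:
 assumes o: "orientation n r N X vs own load {} Q1 Q2" and l: "leveled b X vs lev load Q1 Q2"
 and \<Delta>: "\<And>v. v < n ==> load v <= \<Delta>" and b: "b = 4 * q ^ 2 * h" "0 < b"
 and big: "8 * q ^ 2 * h <= \<Delta>"
 and d': "\<Delta> <= D + i * ((2 * \<Delta>) div b + 4)" "i <= q * h" "D' = D - ((2 * \<Delta>) div b + 4)"
 and cnt: "q * card {v. v < n & D' <= load v} <= (q + 1) * card {v. v < n & D <= load v}"
 shows "\<Delta> * (q - 1) * card {v. v < n & D' <= load v} \<le>
 (q + 1) * card {x \<in> X. set (vs x) \<subseteq> {v. v < n & D' <= load v}}"
proof -
 note d = orientationD[OF o]
 let ?st = "(2 * \<Delta>) div b + 4"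
 let ?S = "{v. v < n & D <= load v}" and ?U = "{v. v < n & D' <= load v}"
 let ?c = "card {x \<in> X. set (vs x) \<subseteq> ?U}"
 have q: "0 < q" "0 < h" using b by (auto intro: gr0I)
 have "D * card ?S = (\<Sum>v\<in>?S. D)" by simp
 also have "\<dots> <= (\<Sum>v\<in>?S. load v)" by (rule sum_mono) auto
 also have "\<dots> = card {x \<in> X. own x \<in> ?S}" by (subst sum_load[OF o]) auto
 also have "\<dots> <= ?c"
 proof (rule card_mono)
 show "{x \<in> X. own x \<in> ?S} \<subseteq> {x \<in> X. set (vs x) \<subseteq> ?U}"
 proof safe
  fix x v assume x: "x \<in> X" "own x < n" "D <= load (own x)" "v \<in> set (vs x)"
  then show "v < n" using d(2)[OF x(1)] unfolding valid_def by auto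
  have "load (own x) <= load v + ?st" by (rule load_gap[OF o l x(1,4) b(2) \<Delta>])
  then show "D' <= load v" using x(3) d'(3) by linarith
 qed
 qed (use d(13) in simp)
 finally have 1: "D * card ?S <= ?c" .
 \<comment> \<open>The whole descent is at most \<open>\<Delta> / q\<close>: the proportional part
   of the step width and its constant 4 contribute at most \<open>\<Delta> / (2 * q)\<close>
   each.\<close>
 have "q * ((2 * \<Delta>) div b + 4) * i <= q * ((2 * \<Delta>) div b + 4) * (q * h)" using d'(2) by simp
 also have "\<dots> = q ^ 2 * h * ((2 * \<Delta>) div b) + 4 * q ^ 2 * h" by (simp add: algebra_simps power2_eq_square)
 finally have "2 * (q * ?st * i) <= 2 * (q ^ 2 * h * ((2 * \<Delta>) div b)) + 8 * q ^ 2 * h" by simp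
 moreover have "b * ((2 * \<Delta>) div b) <= 2 * \<Delta>" by simp
 then have "2 * (q ^ 2 * h * ((2 * \<Delta>) div b)) <= \<Delta>" unfolding b(1) by (simp add: algebra_simps)
 ultimately have "q * ?st * i <= \<Delta>" using big by linarith
 moreover have "q * \<Delta> <= q * (D + i * ?st)" using d'(1) by simp
 ultimately have "q * \<Delta> <= q * D + \<Delta>" by (simp add: algebra_simps)
 then have 2: "\<Delta> * (q - 1) <= D * q" by (simp add: diff_mult_distrib2 mult.commute)
 have "\<Delta> * (q - 1) * card ?U <= D * q * card ?U" using 2 by simp
 also have "\<dots> <= D * ((q + 1) * card ?S)" using cnt by (simp add: mult.assoc)
 also have "\<dots> = (q + 1) * (D * card ?S)" by (simp only: mult.left_commute)
 also have "\<dots> <= (q + 1) * ?c" using 1 by (intro mult_left_mono) auto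
 finally show ?thesis .
qed

text \<open>By Bernoulli's inequality \<open>q\<close> factors \<open>1 + 1 / q\<close> at least
  double a number, so more than \<open>q * h\<close> of them would exceed
  \<open>2 ^ h\<close>.\<close>

lemma growth_bound:
 fixes q h i n c :: nat
 assumes "0 < q" "n <= 2 ^ h" "(1 + 1 / real q) ^ i <= real n"
 shows "i <= q * h"
proof (rule ccontr)
 assume "\<not> i <= q * h"
 then have i: "q * h + 1 <= i" by simp
 let ?g = "1 + 1 / real q"
 have g: "1 < ?g" using assms(1) by simp
 have "1 + real q * (1 / real q) <= ?g ^ q" by (rule Bernoulli_inequality) (use assms(1) in \<open>simp add: field_simps\<close>)
 then have "2 <= ?g ^ q" using assms(1) by simp
 then have "2 ^ h <= (?g ^ q) ^ h" by (intro power_mono) auto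
 then have "2 ^ h <= ?g ^ (q * h)" by (simp add: power_mult)
 also have "\<dots> < ?g ^ (q * h + 1)" using g by (intro power_strict_increasing) auto
 also have "\<dots> <= ?g ^ i" using g i by (intro power_increasing) auto
 also have "\<dots> <= real n" by (rule assms(3))
 also have "\<dots> <= 2 ^ h" using assms(2) by (metis of_nat_le_iff of_nat_numeral of_nat_power)
 finally show False by simp
qed

section \<open>Implementation of the elementary moves\<close>

lemma spec_assign:
 assumes "ok W s e" "spec W c (s(|regs := (regs s)(v := ev W s e)|)) T' Q" "T' + real (cost e + 1) <= T" "0 <= T'"
 shows "spec W (Assign v e ;; c) s T Q"
 using assms unfolding spec_def
 by (auto elim!: spec_wp[unfolded spec_def, where T = T', rotated 1] simp: spec_def)
 (rule spec_wp[unfolded spec_def, where T = T'], auto)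

lemma spec_assign_iff:
 "spec W (Assign v e ;; c) s T Q \<longleftrightarrow> ok W s e & real (cost e + 1) <= T &
  spec W c (s(|regs := (regs s)(v := ev W s e)|)) (T - real (cost e + 1)) Q"
 unfolding spec_def by simp

lemma arrs_only [simp]:
 "lrep c a (s(|regs := f|)) Ls = lrep c a s Ls" "brep c a (s(|regs := f|)) F = brep c a s F"
 "srep n (s(|regs := f|)) = srep n s"
 by (rule lrep_cong brep_cong srep_cong; simp)+

text \<open>Array 48 is a table with rows of length \<open>R\<close>. The slot
  \<open>x * R + j\<close> doubles as the name, in the bags, of the incidence of copy
  \<open>x\<close> with its \<open>j\<close>-th vertex.\<close>

definition verts :: "nat => store => nat => nat list" where
 "verts R s x = map (%j. arrs s 48 (x * R + j)) [0..<arrs s 49 x]"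

lemma verts_cong: "arrs s' 48 = arrs s 48 ==> arrs s' 49 = arrs s 49 ==> verts R s' = verts R s"
 unfolding verts_def by simp

lemma verts_regs [simp]: "verts R (s(|regs := f|)) = verts R s"
 by (rule verts_cong) auto

lemma verts_nth: "j < arrs s 49 x ==> verts R s x ! j = arrs s 48 (x * R + j)"
 "length (verts R s x) = arrs s 49 x"
 unfolding verts_def by auto

text \<open>An incidence with vertex \<open>v\<close> of a copy of level \<open>l\<close> lies in
  bag \<open>v * LM + l\<close>. A vertex thus finds a copy of a given level in constant time, at
  the price that a change of a level moves all incidences of the copy.\<close>

definition placement :: "nat => nat => nat set => (nat => nat list) => (nat => nat) => nat => nat option" where
 "placement R LM X vs lev e =
  (if e div R \<in> X & e mod R < length (vs (e div R))
  then Some (vs (e div R) ! (e mod R) * LM + lev (e div R)) else None)"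

definition argmin_load :: cmd where
 "argmin_load = Assign 51 (Elem 48 (Var 50 \<boxtimes> Var 1)) ;;
  For 52 (Elem 49 (Var 50))
  (Assign 53 (Elem 48 (Var 50 \<boxtimes> Var 1 \<boxplus> Var 52)) ;;
  Cond (Elem 42 (Var 53)) (Elem 42 (Var 51)) (Assign 51 (Var 53)) Skip)"

definition attach_in :: cmd where
 "attach_in =
  For 52 (Elem 49 (Var 50))
  (Assign 60 (Elem 48 (Var 50 \<boxtimes> Var 1 \<boxplus> Var 52) \<boxtimes> Var 5 \<boxplus> Var 54) ;;
  Assign 61 (Var 50 \<boxtimes> Var 1 \<boxplus> Var 52) ;; lpush 10) ;;
  Put 51 (Var 50) (Var 54)"

definition detach_in :: cmd where
 "detach_in =
  Assign 54 (Elem 51 (Var 50)) ;;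
  For 52 (Elem 49 (Var 50))
  (Assign 60 (Elem 48 (Var 50 \<boxtimes> Var 1 \<boxplus> Var 52) \<boxtimes> Var 5 \<boxplus> Var 54) ;;
  Assign 61 (Var 50 \<boxtimes> Var 1 \<boxplus> Var 52) ;; lremove 10)"

definition detach :: cmd where
 "detach = Assign 60 (Elem 50 (Var 50)) ;; Assign 61 (Var 50) ;; lremove 14 ;; lremove 18 ;; detach_in"

definition attach :: cmd where
 "attach = Put 50 (Var 50) (Var 55) ;; Assign 54 (Elem 42 (Var 55)) ;; Assign 60 (Var 55) ;;
  Assign 61 (Var 50) ;; lpush 14 ;; lpush 18 ;; attach_in"

lemma moves_frame [simp]:
 "lo argmin_load = 51" "wr argmin_load = {}" "pure argmin_load"
 "lo attach_in = 52" "wr attach_in = {10, 12, 13, 51}" "pure attach_in"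
 "lo detach_in = 52" "wr detach_in = {10, 12, 13}" "pure detach_in"
 "lo detach = 52" "wr detach = {10, 12, 13, 14, 16, 17, 18, 20, 21}" "pure detach"
 "lo attach = 52" "wr attach = {10, 12, 13, 14, 16, 17, 18, 20, 21, 50, 51}" "pure attach"
 by (auto simp: argmin_load_def attach_in_def detach_in_def detach_def attach_def)

text \<open>\<open>NX\<close> bounds the number of copies and \<open>NN\<close> the number of trie
  nodes besides the root. \<open>LM\<close> exceeds the threshold of every load up to
  \<open>NX\<close>, so the bags of different vertices do not collide, and \<open>c\<close> exceeds
  every element number, so one capacity serves all families of lists.\<close>

locale hyper =
 fixes W n R b q h D NX NN LM c :: nat
 assumes n_pos: "0 < n" and R_pos: "0 < R" and b_pos: "0 < b" and NX_pos: "0 < NX"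
 and LM_eq: "LM = 2 * NX + 10" and c_eq: "c = NX * R + NN + 1"
 and n_bnd: "n + 100 < bnd W" and in_bnd: "(n * LM + NN + 1) * c <= bnd W" and c_bnd: "2 * c < bnd W"
 and b_bnd: "4 * b + 4 < bnd W"
begin

definition par :: "store => bool" where
 "par s \<longleftrightarrow> regs s 0 = n & regs s 1 = R & regs s 2 = b & regs s 3 = q & regs s 4 = D & regs s 5 = LM &
  regs s 6 = NX & regs s 7 = NN & regs s 8 = h & regs s 9 = c"

lemma par_update [simp]: "10 <= v ==> par (s(|regs := f(v := x)|)) = par (s(|regs := f|))"
 "par (s(|regs := regs s|)) = par s"
 unfolding par_def by simp_all

lemma par_arrs [simp]: "par (s(|arrs := f|)) = par s"
 unfolding par_def by simp

lemma parD:
 assumes "par s"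
 shows "regs s 0 = n" "regs s (Suc 0) = R" "regs s 2 = b" "regs s 3 = q" "regs s 4 = D" "regs s 5 = LM"
 "regs s 6 = NX" "regs s 7 = NN" "regs s 8 = h" "regs s 9 = c"
 using assms unfolding par_def by auto

lemma par_frame: "frame C s s' ==> 10 <= lo C ==> par s' = par s"
 unfolding par_def using frameD(1)[of C s s'] by simp

abbreviation vs where "vs \<equiv> verts R"

lemma incidence_lt: "x < NX ==> j < R ==> x * R + j < c" "x < NX ==> j < R ==> x * R + j < bnd W"
 "x < NX ==> x * R < bnd W" "x < NX ==> x < c" "x < NX ==> x < bnd W"
proof -
 assume x: "x < NX"
 have "(x + 1) * R <= NX * R" using x by (intro mult_right_mono) auto
 then have 1: "x * R + R <= NX * R" by simp
 then show "j < R ==> x * R + j < c" using c_eq by linarith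
 then show "j < R ==> x * R + j < bnd W" using c_bnd by linarith
 show "x * R < bnd W" using 1 c_eq c_bnd R_pos by linarith
 have "NX * 1 <= NX * R" using R_pos by (intro mult_left_mono) auto
 then show "x < c" using x c_eq by linarith
 then show "x < bnd W" using c_bnd by linarith
qed

lemma fits_le:
 assumes "p < n * LM + NN + 1" "2 <= a" "a + 3 < 64"
 shows "fits W c a p"
proof -
 have "(p + 1) * c <= (n * LM + NN + 1) * c" using assms(1) by (intro mult_right_mono) auto
 moreover have "(p + 1) * c = p * c + c" by simp
 ultimately have "p * c + c <= bnd W" using in_bnd by linarith
 then show ?thesis using c_bnd n_bnd assms unfolding fits_def by simp
qed

lemma R_bnd: "R < bnd W"
proof -
 have "1 * R <= NX * R" using NX_pos by (intro mult_right_mono) auto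
 then show ?thesis using c_eq c_bnd by linarith
qed

lemma lists_bnd: "n * LM + NN + 1 <= bnd W"
proof -
 have "1 <= c" unfolding c_eq by simp
 then have "(n * LM + NN + 1) * 1 <= (n * LM + NN + 1) * c" by (rule mult_le_mono2)
 then show ?thesis using in_bnd by (simp only: mult_1_right)
qed

lemma in_index:
 assumes "v < n" "l < LM"
 shows "v * LM + l < n * LM" "v * LM + l < bnd W" "v * LM < bnd W"
proof -
 have "(v + 1) * LM <= n * LM" using assms by (intro mult_right_mono) auto
 then show 1: "v * LM + l < n * LM" using assms by simp
 show "v * LM + l < bnd W" using 1 lists_bnd by linarith
 then show "v * LM < bnd W" by linarith
qed

lemma n_LM: "n <= n * LM" unfolding LM_eq by simp

lemma fits_vertex: "u < n ==> 2 <= a ==> a + 3 < 64 ==> fits W c a u"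
 by (rule fits_le) (use n_LM in linarith)+

lemma argmin_load_spec:
 assumes "par s" "regs s 50 = x" "x < NX" "valid n R (vs s x)"
 shows "spec W argmin_load s (50 * real (length (vs s x)) + 50) (%s'. regs s' 51 \<in> set (vs s x) &
 (\<forall>v\<in>set (vs s x). arrs s 42 (regs s' 51) <= arrs s 42 v))"
proof -
 note p = parD[OF assms(1)]
 let ?xs = "vs s x"
 let ?m = "length ?xs"
 have m: "0 < ?m" "?m <= R" "set ?xs \<subseteq> {..<n}" using assms(4) unfolding valid_def by auto
 have lt: "?xs ! j < bnd W" if "j < ?m" for j using m(3) nth_mem[OF that] n_bnd by auto
 let ?A = "%i (s' :: store). regs s' 0 = n & regs s' (Suc 0) = R & regs s' 50 = x & arrs s' = arrs s & regs s' 51 \<in> set ?xs &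
  (\<forall>j<i. arrs s 42 (regs s' 51) <= arrs s 42 (?xs ! j))"
 have x0: "?xs ! 0 = arrs s 48 (x * R)" using verts_nth(1)[of 0 s x R] m(1) verts_nth(2)[of R s x] by simp
 show ?thesis
 unfolding argmin_load_def
 proof (rule spec_assign)
 show "ok W s (Elem 48 (Var 50 \<boxtimes> Var 1))"
  using p assms incidence_lt(3)[OF assms(3)] n_bnd by simp
 let ?s = "s(|regs := (regs s)(51 := ev W s (Elem 48 (Var 50 \<boxtimes> Var 1)))|)"
 have "spec W (For 52 (Elem 49 (Var 50))
   (Assign 53 (Elem 48 (Var 50 \<boxtimes> Var 1 \<boxplus> Var 52)) ;;
   Cond (Elem 42 (Var 53)) (Elem 42 (Var 51)) (Assign 51 (Var 53)) Skip)) ?s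
  (50 * real ?m + 30) (%s'. ?A ?m s' & regs s' 52 = ?m)"
 proof (rule spec_for[where \<tau> = 34])
  have "?xs ! 0 \<in> set ?xs" using m(1) by (rule nth_mem)
  then show "?A 0 (?s(|regs := (regs ?s)(52 := 0)|))" using x0 p assms by simp
 next
  fix i s1 assume "?A i s1"
  then show "ok W s1 (Elem 49 (Var 50)) & ev W s1 (Elem 49 (Var 50)) = ?m"
  using incidence_lt(5)[OF assms(3)] n_bnd by (simp add: verts_nth)
 next
  fix i s1 assume i: "i < ?m" "?A i s1" "regs s1 52 = i"
  have ix: "x * R + i < bnd W" using incidence_lt(2)[OF assms(3)] i m by simp
  have xi: "arrs s 48 (x * R + i) = ?xs ! i" using verts_nth(1)[of i s x R] i verts_nth(2)[of R s x] by simp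
  have "regs s1 51 < bnd W" using i(2) m(3) n_bnd by auto
  then show "spec W (Assign 53 (Elem 48 (Var 50 \<boxtimes> Var 1 \<boxplus> Var 52)) ;;
   Cond (Elem 42 (Var 53)) (Elem 42 (Var 51)) (Assign 51 (Var 53)) Skip) s1 34
  (%s'. regs s' 52 = i & ?A (Suc i) (s'(|regs := (regs s')(52 := Suc i)|)))"
  using i ix incidence_lt(3)[OF assms(3)] lt[OF i(1)] xi n_bnd nth_mem[OF i(1)]
  unfolding spec_def by (auto simp: less_Suc_eq le_less_trans intro: order.trans less_imp_le)
 qed (use m R_bnd in auto)
 then show "spec W (For 52 (Elem 49 (Var 50))
   (Assign 53 (Elem 48 (Var 50 \<boxtimes> Var 1 \<boxplus> Var 52)) ;;
   Cond (Elem 42 (Var 53)) (Elem 42 (Var 51)) (Assign 51 (Var 53)) Skip)) ?s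
  (50 * real ?m + 30) (%s'. regs s' 51 \<in> set ?xs & (\<forall>v\<in>set ?xs. arrs s 42 (regs s' 51) <= arrs s 42 v))"
  by (rule spec_conseq) (auto simp: in_set_conv_nth)
 qed auto
qed

lemma attach_in_spec:
 assumes "par s" "regs s 50 = x" "x < NX" "valid n R (vs s x)" "regs s 54 = l" "l < LM"
 and F: "brep c 10 s F" "\<And>j. j < length (vs s x) ==> F (x * R + j) = None"
 shows "spec W attach_in s (100 * real (length (vs s x)) + 30) (%s'.
 brep c 10 s' (%e. if e div R = x & e mod R < length (vs s x) then Some (vs s x ! (e mod R) * LM + l) else F e) &
 arrs s' 51 = (arrs s 51)(x := l))"
proof -
 note p = parD[OF assms(1)]
 let ?xs = "vs s x"
 let ?m = "length ?xs"
 let ?F = "%i e. if e div R = x & e mod R < i then Some (?xs ! (e mod R) * LM + l) else F e"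
 let ?c = "Assign 60 (Elem 48 (Var 50 \<boxtimes> Var 1 \<boxplus> Var 52) \<boxtimes> Var 5 \<boxplus> Var 54) ;;
  Assign 61 (Var 50 \<boxtimes> Var 1 \<boxplus> Var 52) ;; lpush 10"
 have m: "0 < ?m" "?m <= R" "set ?xs \<subseteq> {..<n}" using assms(4) unfolding valid_def by auto
 let ?A = "%i (s' :: store). par s' & regs s' 50 = x & regs s' 54 = l & arrs s' 48 = arrs s 48 &
  arrs s' 49 = arrs s 49 & arrs s' 51 = arrs s 51 & brep c 10 s' (?F i)"
 have "spec W (For 52 (Elem 49 (Var 50)) ?c) s (100 * real ?m + 20) (%s'. ?A ?m s' & regs s' 52 = ?m)"
 proof (rule spec_for[where \<tau> = 85])
 show "?A 0 (s(|regs := (regs s)(52 := 0)|))" using assms by simp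
 next
 fix i and s1 :: store assume "?A i s1"
 then show "ok W s1 (Elem 49 (Var 50)) & ev W s1 (Elem 49 (Var 50)) = ?m"
  using incidence_lt(5)[OF assms(3)] n_bnd by (simp add: verts_nth)
 next
 fix i and s1 :: store assume i: "i < ?m" "?A i s1" "regs s1 52 = i"
 note q = parD[of s1]
 let ?s = "s1(|regs := (regs s1)(60 := ?xs ! i * LM + l, 61 := x * R + i)|)"
 have ix: "x * R + i < bnd W" "x * R + i < c" using incidence_lt(1,2)[OF assms(3)] i m by simp_all
 have v: "?xs ! i < n" using m(3) nth_mem[OF i(1)] by auto
 have xi: "arrs s 48 (x * R + i) = ?xs ! i" using verts_nth(1)[of i s x R] i verts_nth(2)[of R s x] by simp
 have dm: "(x * R + i) div R = x" "(x * R + i) mod R = i" using i m by auto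
 have upd: "(?F i)(x * R + i := Some (?xs ! i * LM + l)) = ?F (Suc i)"
 proof
  fix e
  have "e = x * R + i \<longleftrightarrow> e div R = x & e mod R = i"
  using dm by (metis mod_div_mult_eq add.commute)
  then show "((?F i)(x * R + i := Some (?xs ! i * LM + l))) e = ?F (Suc i) e"
  using dm by (auto simp: less_Suc_eq)
 qed
 have "spec W (lpush 10) ?s 60 (%s'. brep c 10 s' ((?F i)(x * R + i := Some (?xs ! i * LM + l))))"
 proof (rule bpush_spec)
  show "fits W c 10 (?xs ! i * LM + l)"
  using in_index(1)[OF v assms(6)] by (intro fits_le) auto
  show "?F i (x * R + i) = None" using dm F(2)[OF i(1)] by auto
 qed (use i ix q in auto)
 then have "spec W (lpush 10) ?s 60 (%s'. regs s' 52 = i & ?A (Suc i) (s'(|regs := (regs s')(52 := Suc i)|)))"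
  unfolding upd
 proof (rule spec_conseq)
  fix s' assume "brep c 10 s' (?F (Suc i))" and fr: "frame (lpush 10) ?s s'"
  then show "regs s' 52 = i & ?A (Suc i) (s'(|regs := (regs s')(52 := Suc i)|))"
  using i par_frame[OF fr] by (simp add: frameD(1,2)[OF fr])
 qed simp
 then show "spec W ?c s1 85 (%s'. regs s' 52 = i & ?A (Suc i) (s'(|regs := (regs s')(52 := Suc i)|)))"
  using i q xi ix in_index[OF v assms(6)] incidence_lt(3)[OF assms(3)] n_bnd
  by (intro spec_assign[where T' = 68] spec_assign[where T' = 60]) auto
 qed (use m R_bnd in auto)
 then show ?thesis
 unfolding attach_in_def
 proof (rule spec_seq)
 fix s1 assume "?A ?m s1 & regs s1 52 = ?m"
 then show "spec W (Put 51 (Var 50) (Var 54)) s1 10 (%s'. brep c 10 s' (?F ?m) & arrs s' 51 = (arrs s 51)(x := l))"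
  using incidence_lt(5)[OF assms(3)] n_bnd brep_cong[of "s1(|arrs := (arrs s1)(51 := (arrs s 51)(x := l))|)" 10 s1]
  unfolding spec_def by simp
 qed auto
qed

lemma detach_in_spec:
 assumes "par s" "regs s 50 = x" "x < NX" "valid n R (vs s x)" "arrs s 51 x = l" "l < LM"
 and F: "brep c 10 s F" "\<And>j. j < length (vs s x) ==> F (x * R + j) = Some (vs s x ! j * LM + l)"
 shows "spec W detach_in s (120 * real (length (vs s x)) + 30) (%s'.
 brep c 10 s' (%e. if e div R = x & e mod R < length (vs s x) then None else F e))"
proof -
 note p = parD[OF assms(1)]
 let ?xs = "vs s x"
 let ?m = "length ?xs"
 let ?F = "%i e. if e div R = x & e mod R < i then None else F e"
 let ?c = "Assign 60 (Elem 48 (Var 50 \<boxtimes> Var 1 \<boxplus> Var 52) \<boxtimes> Var 5 \<boxplus> Var 54) ;;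
  Assign 61 (Var 50 \<boxtimes> Var 1 \<boxplus> Var 52) ;; lremove 10"
 have m: "0 < ?m" "?m <= R" "set ?xs \<subseteq> {..<n}" using assms(4) unfolding valid_def by auto
 let ?A = "%i (s' :: store). par s' & regs s' 50 = x & regs s' 54 = l & arrs s' 48 = arrs s 48 &
  arrs s' 49 = arrs s 49 & brep c 10 s' (?F i)"
 let ?s0 = "s(|regs := (regs s)(54 := l)|)"
 have "spec W (For 52 (Elem 49 (Var 50)) ?c) ?s0 (120 * real ?m + 20) (%s'. ?A ?m s' & regs s' 52 = ?m)"
 proof (rule spec_for[where \<tau> = 105])
 show "?A 0 (?s0(|regs := (regs ?s0)(52 := 0)|))" using assms by simp
 next
 fix i and s1 :: store assume "?A i s1"
 then show "ok W s1 (Elem 49 (Var 50)) & ev W s1 (Elem 49 (Var 50)) = ?m"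
  using incidence_lt(5)[OF assms(3)] n_bnd by (simp add: verts_nth)
 next
 fix i and s1 :: store assume i: "i < ?m" "?A i s1" "regs s1 52 = i"
 note q = parD[of s1]
 let ?s = "s1(|regs := (regs s1)(60 := ?xs ! i * LM + l, 61 := x * R + i)|)"
 have ix: "x * R + i < bnd W" "x * R + i < c" using incidence_lt(1,2)[OF assms(3)] i m by simp_all
 have v: "?xs ! i < n" using m(3) nth_mem[OF i(1)] by auto
 have xi: "arrs s 48 (x * R + i) = ?xs ! i" using verts_nth(1)[of i s x R] i verts_nth(2)[of R s x] by simp
 have dm: "(x * R + i) div R = x" "(x * R + i) mod R = i" using i m by auto
 have upd: "(?F i)(x * R + i := None) = ?F (Suc i)"
 proof
  fix e
  have "e = x * R + i \<longleftrightarrow> e div R = x & e mod R = i"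
  using dm by (metis mod_div_mult_eq add.commute)
  then show "((?F i)(x * R + i := None)) e = ?F (Suc i) e"
  using dm by (auto simp: less_Suc_eq)
 qed
 have "spec W (lremove 10) ?s 80 (%s'. brep c 10 s' ((?F i)(x * R + i := None)))"
 proof (rule bremove_spec)
  show "fits W c 10 (?xs ! i * LM + l)"
  using in_index(1)[OF v assms(6)] by (intro fits_le) auto
  show "?F i (x * R + i) = Some (?xs ! i * LM + l)" using dm F(2)[OF i(1)] by auto
 qed (use i ix q in auto)
 then have "spec W (lremove 10) ?s 80 (%s'. regs s' 52 = i & ?A (Suc i) (s'(|regs := (regs s')(52 := Suc i)|)))"
  unfolding upd
 proof (rule spec_conseq)
  fix s' assume "brep c 10 s' (?F (Suc i))" and fr: "frame (lremove 10) ?s s'"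
  then show "regs s' 52 = i & ?A (Suc i) (s'(|regs := (regs s')(52 := Suc i)|))"
  using i par_frame[OF fr] by (simp add: frameD(1,2)[OF fr])
 qed simp
 then show "spec W ?c s1 105 (%s'. regs s' 52 = i & ?A (Suc i) (s'(|regs := (regs s')(52 := Suc i)|)))"
  using i q xi ix in_index[OF v assms(6)] incidence_lt(3)[OF assms(3)] n_bnd
  by (intro spec_assign[where T' = 88] spec_assign[where T' = 80]) auto
 qed (use m R_bnd in auto)
 then have "spec W (For 52 (Elem 49 (Var 50)) ?c) ?s0 (120 * real ?m + 20) (%s'. brep c 10 s' (?F ?m))"
 by (rule spec_conseq) auto
 then show ?thesis
 unfolding detach_in_def using assms(2,5) incidence_lt(5)[OF assms(3)] n_bnd
 by (intro spec_assign[where T' = "120 * real ?m + 20"]) auto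
qed

text \<open>Holes count towards \<open>NX\<close>: a load is at most the number of copies plus a
  hole, so loads and levels stay in range in the middle of a chain, too.\<close>

definition rep :: "store => nat set => nat set => (nat => nat list) => (nat => nat list) => bool" where
 "rep s X H Q1 Q2 \<longleftrightarrow> par s & srep n s & lrep c 14 s Q1 & lrep c 18 s Q2 &
  brep c 10 s (placement R LM X (vs s) (arrs s 51)) &
  orientation n R NX X (vs s) (arrs s 50) (arrs s 42) H Q1 Q2 &
  leveled b X (vs s) (arrs s 51) (arrs s 42) Q1 Q2 & card X + card H <= NX"

lemma repD:
 assumes "rep s X H Q1 Q2"
 shows "par s" "srep n s" "lrep c 14 s Q1" "lrep c 18 s Q2"
 "brep c 10 s (placement R LM X (vs s) (arrs s 51))"
 "orientation n R NX X (vs s) (arrs s 50) (arrs s 42) H Q1 Q2"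
 "leveled b X (vs s) (arrs s 51) (arrs s 42) Q1 Q2" "card X + card H <= NX"
 using assms unfolding rep_def by auto

lemma load_bnd:
 assumes "rep s X H Q1 Q2" "v < n"
 shows "arrs s 42 v <= NX" "arrs s 42 v < LM" "threshold b (arrs s 42 v) < LM"
proof -
 note r = repD[OF assms(1)]
 have "v \<in> H ==> 0 < card H" using orientationD(4)[OF r(6)] finite_subset[of H "{..<n}"] card_gt_0_iff by blast
 then show 1: "arrs s 42 v <= NX" using load_le[OF r(6) assms(2)] r(8) by (auto split: if_splits)
 then show "arrs s 42 v < LM" unfolding LM_eq by simp
 have "arrs s 42 v div b <= arrs s 42 v" by simp
 then show "threshold b (arrs s 42 v) < LM" using 1 unfolding threshold_def LM_eq by linarith
qed

lemma lev_bnd: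
 assumes "rep s X H Q1 Q2" "x \<in> X"
 shows "arrs s 51 x < LM"
proof -
 note r = repD[OF assms(1)]
 have o: "arrs s 50 x \<in> set (vs s x)" "arrs s 50 x < n" using orientationD(3,10)[OF r(6) assms(2)] by auto
 show ?thesis using leveledD(1)[OF r(7) assms(2) o(1)] load_bnd(3)[OF assms(1) o(2)] by linarith
qed

lemma LM_bnd: "LM < bnd W"
proof -
 have "1 * LM <= n * LM" using n_pos by (intro mult_right_mono) auto
 then show ?thesis using lists_bnd by linarith
qed

lemma rep_cong:
 assumes "rep s X H Q1 Q2" "frame C s s'" "10 <= lo C" "wr C \<inter> {10..21} = {}" "wr C \<inter> {40..43} = {}"
 "wr C \<inter> {48..51} = {}"
 shows "rep s' X H Q1 Q2"
proof -
 note f = frameD(2)[OF assms(2)]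
 have "arrs s' a = arrs s a" if "a \<in> {10..21} \<union> {40..43} \<union> {48..51}" for a
 using f that assms(4-6) by blast
 note eq = this
 have "lrep c 14 s' Q1 = lrep c 14 s Q1" "lrep c 18 s' Q2 = lrep c 18 s Q2"
 by (rule lrep_cong; simp add: eq)+
 moreover have "srep n s' = srep n s" by (rule srep_cong; simp add: eq)
 moreover have "vs s' = vs s" by (rule verts_cong; simp add: eq)
 moreover have "brep c 10 s' F = brep c 10 s F" for F by (rule brep_cong; simp add: eq)
 moreover have "arrs s' 50 = arrs s 50" "arrs s' 51 = arrs s 51" "arrs s' 42 = arrs s 42"
 by (simp_all add: eq)
 ultimately show ?thesis using assms(1) par_frame[OF assms(2,3)] unfolding rep_def by simp
qed

lemma rep_regs [simp]:
 "10 <= v ==> rep (s(|regs := f(v := y)|)) X H Q1 Q2 = rep (s(|regs := f|)) X H Q1 Q2"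
 "rep (s(|regs := regs s|)) X H Q1 Q2 = rep s X H Q1 Q2"
 unfolding rep_def by simp_all

lemma detach_spec:
 assumes "rep s X H Q1 Q2" "regs s 50 = x" "x \<in> X" "arrs s 50 x \<notin> H"
 shows "spec W detach s (120 * real (length (vs s x)) + 210)
 (%s'. \<exists>Q1 Q2. rep s' (X - {x}) (insert (arrs s 50 x) H) Q1 Q2)"
proof -
 note r = repD[OF assms(1)] and o = orientationD[OF repD(6)[OF assms(1)]]
 let ?u = "arrs s 50 x"
 have x: "x < NX" "valid n R (vs s x)" "?u < n" using o(1,2,10) assms(3) by auto
 let ?s = "s(|regs := (regs s)(60 := ?u, 61 := x)|)"
 have fits: "fits W c 14 ?u" "fits W c 18 ?u" using fits_vertex[OF x(3)] by simp_all
 have "spec W (lremove 14) ?s 80 (%s'. \<exists>ys. removed x (Q1 ?u) ys & lrep c 14 s' (Q1(?u := ys)))"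
 by (rule lremove_spec) (use r fits parD[OF r(1)] o(6)[of ?u] assms in auto)
 moreover have "spec W (lremove 18 ;; detach_in) s1 (120 * real (length (vs s x)) + 110)
  (%s'. \<exists>Q1 Q2. rep s' (X - {x}) (insert (arrs s 50 x) H) Q1 Q2)"
 if s1: "\<exists>ys. removed x (Q1 ?u) ys & lrep c 14 s1 (Q1(?u := ys))" and fr1: "frame (lremove 14) ?s s1" for s1
 proof -
 obtain ys1 where ys1: "removed x (Q1 ?u) ys1" "lrep c 14 s1 (Q1(?u := ys1))" using s1 by blast
 note f1 = frameD(1,2)[OF fr1]
 have p1: "par s1" using par_frame[OF fr1] r(1) by simp
 have "spec W (lremove 18) s1 80 (%s'. \<exists>ys. removed x (Q2 ?u) ys & lrep c 18 s' (Q2(?u := ys)))"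
  by (rule lremove_spec)
  (use r(4) fits parD[OF p1] o(8)[of ?u] assms lrep_cong[of s1 18 s] in \<open>auto simp: f1\<close>)
 moreover have "spec W detach_in s2 (120 * real (length (vs s x)) + 30)
  (%s'. \<exists>Q1 Q2. rep s' (X - {x}) (insert (arrs s 50 x) H) Q1 Q2)"
  if s2: "\<exists>ys. removed x (Q2 ?u) ys & lrep c 18 s2 (Q2(?u := ys))" and fr2: "frame (lremove 18) s1 s2" for s2
 proof -
  obtain ys2 where ys2: "removed x (Q2 ?u) ys2" "lrep c 18 s2 (Q2(?u := ys2))" using s2 by blast
  note f2 = frameD(1,2)[OF fr2]
  have p2: "par s2" using par_frame[OF fr2] p1 by simp
  have v2: "vs s2 = vs s" by (rule verts_cong) (simp_all add: f1 f2)
  let ?F = "placement R LM X (vs s) (arrs s 51)"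
  have "spec W detach_in s2 (120 * real (length (vs s2 x)) + 30)
  (%s'. brep c 10 s' (%e. if e div R = x & e mod R < length (vs s2 x) then None else ?F e))"
  proof (rule detach_in_spec)
  show "arrs s2 51 x = arrs s 51 x" by (simp add: f1 f2)
  show "arrs s 51 x < LM" by (rule lev_bnd[OF assms(1,3)])
  show "brep c 10 s2 ?F" using r(5) brep_cong[of s2 10 s] by (simp add: f1 f2)
  fix j assume "j < length (vs s2 x)"
  moreover from this have "j < R" using x(2) v2 unfolding valid_def by auto
  ultimately show "?F (x * R + j) = Some (vs s2 x ! j * LM + arrs s 51 x)"
   using assms(3) v2 unfolding placement_def by simp
  qed (use p2 x assms v2 in \<open>auto simp: f1 f2\<close>)
  then show ?thesis
  unfolding v2
  proof (rule spec_conseq)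
  fix s' assume br: "brep c 10 s' (%e. if e div R = x & e mod R < length (vs s x) then None else ?F e)"
   and fr3: "frame detach_in s2 s'"
  note f3 = frameD(1,2)[OF fr3]
  have v3: "vs s' = vs s" unfolding v2[symmetric] by (rule verts_cong) (simp_all add: f3)
  have pl: "(%e. if e div R = x & e mod R < length (vs s x) then None else ?F e) =
   placement R LM (X - {x}) (vs s) (arrs s 51)"
   unfolding placement_def by auto
  have fu: "finite H" "card (insert ?u H) = Suc (card H)"
   using o(4) finite_subset[of H "{..<n}"] assms(4) by auto
  have cX: "card X = Suc (card (X - {x}))" using o(13) assms(3) by (rule card.remove)
  have "rep s' (X - {x}) (insert ?u H) (Q1(?u := ys1)) (Q2(?u := ys2))"
   unfolding rep_def
  proof (intro conjI)
   show "par s'" using par_frame[OF fr3] p2 by simp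
   show "srep n s'" using r(2) srep_cong[of s' s] by (simp add: f1 f2 f3)
   show "lrep c 14 s' (Q1(?u := ys1))" using ys1(2) lrep_cong[of s' 14 s1] by (simp add: f2 f3)
   show "lrep c 18 s' (Q2(?u := ys2))" using ys2(2) lrep_cong[of s' 18 s2] by (simp add: f3)
   show "brep c 10 s' (placement R LM (X - {x}) (vs s') (arrs s' 51))"
   using br unfolding pl v3 by (simp add: f1 f2 f3)
   show "orientation n R NX (X - {x}) (vs s') (arrs s' 50) (arrs s' 42) (insert ?u H) (Q1(?u := ys1)) (Q2(?u := ys2))"
   using orientation_detach[OF r(6) assms(3) refl assms(4) ys1(1) ys2(1)] v3 by (simp add: f1 f2 f3)
   show "leveled b (X - {x}) (vs s') (arrs s' 51) (arrs s' 42) (Q1(?u := ys1)) (Q2(?u := ys2))"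
   using leveled_detach[OF r(7) ys1(1) ys2(1)] v3 by (simp add: f1 f2 f3)
   show "card (X - {x}) + card (insert ?u H) <= NX" using r(8) fu cX by simp
  qed
  then show "\<exists>Q1 Q2. rep s' (X - {x}) (insert (arrs s 50 x) H) Q1 Q2" by blast
  qed simp
 qed
 ultimately show ?thesis by (rule spec_seq) auto
 qed
 ultimately have "spec W (lremove 14 ;; lremove 18 ;; detach_in) ?s (120 * real (length (vs s x)) + 190)
 (%s'. \<exists>Q1 Q2. rep s' (X - {x}) (insert (arrs s 50 x) H) Q1 Q2)"
 by (rule spec_seq) auto
 then show ?thesis
 unfolding detach_def using assms(2) incidence_lt(5)[OF x(1)] n_bnd
 by (intro spec_assign[where T' = "120 * real (length (vs s x)) + 192"]
  spec_assign[where T' = "120 * real (length (vs s x)) + 190"]) auto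
qed

text \<open>The copy receives the current load of \<open>u\<close> as its level, and the last
  premise is the threshold condition for this level at all its vertices.\<close>

lemma attach_spec:
 assumes "rep s X H Q1 Q2" "regs s 50 = x" "x < NX" "x \<notin> X" "valid n R (vs s x)"
 and u: "regs s 55 = u" "u \<in> set (vs s x)" "u \<in> H"
 and th: "\<And>v. v \<in> set (vs s x) ==> arrs s 42 u <= threshold b (arrs s 42 v)"
 shows "spec W attach s (100 * real (length (vs s x)) + 180)
 (%s'. (\<exists>Q1 Q2. rep s' (insert x X) (H - {u}) Q1 Q2) & arrs s' 50 = (arrs s 50)(x := u))"
proof -
 note r = repD[OF assms(1)] and o = orientationD[OF repD(6)[OF assms(1)]]
 have un: "u < n" using u(3) o(4) by auto
 let ?l = "arrs s 42 u"
 let ?s = "s(|arrs := (arrs s)(50 := (arrs s 50)(x := u)), regs := (regs s)(54 := ?l, 60 := u, 61 := x)|)"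
 have fits: "fits W c 14 u" "fits W c 18 u" using fits_vertex[OF un] by simp_all
 have xc: "x < c" "x < bnd W" using incidence_lt(4,5) assms(3) by auto
 have ps: "par ?s" using r(1) by simp
 have "spec W (lpush 14) ?s 60 (%s'. lrep c 14 s' (Q1(u := Q1 u @ [x])))"
 by (rule lpush_spec)
  (use r(3) lrep_cong[of ?s 14 s] fits xc parD[OF ps] o(6) assms(4) in \<open>auto simp del: arrs_only\<close>)
 moreover have "spec W (lpush 18 ;; attach_in) s1 (100 * real (length (vs s x)) + 90)
  (%s'. (\<exists>Q1 Q2. rep s' (insert x X) (H - {u}) Q1 Q2) & arrs s' 50 = (arrs s 50)(x := u))"
 if s1: "lrep c 14 s1 (Q1(u := Q1 u @ [x]))" and fr1: "frame (lpush 14) ?s s1" for s1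
 proof -
 note f1 = frameD(1,2)[OF fr1]
 have p1: "par s1" using par_frame[OF fr1] ps by simp
 have "spec W (lpush 18) s1 60 (%s'. lrep c 18 s' (Q2(u := Q2 u @ [x])))"
  by (rule lpush_spec)
  (use r(4) lrep_cong[of s1 18 s] fits xc parD[OF p1] o(8) assms(4) in \<open>auto simp: f1\<close>)
 moreover have "spec W attach_in s2 (100 * real (length (vs s x)) + 30)
  (%s'. (\<exists>Q1 Q2. rep s' (insert x X) (H - {u}) Q1 Q2) & arrs s' 50 = (arrs s 50)(x := u))"
  if s2: "lrep c 18 s2 (Q2(u := Q2 u @ [x]))" and fr2: "frame (lpush 18) s1 s2" for s2
 proof -
  note f2 = frameD(1,2)[OF fr2]
  have p2: "par s2" using par_frame[OF fr2] p1 by simp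
  have v2: "vs s2 = vs s" by (rule verts_cong) (simp_all add: f1 f2)
  let ?F = "placement R LM X (vs s) (arrs s 51)"
  have "spec W attach_in s2 (100 * real (length (vs s2 x)) + 30)
  (%s'. brep c 10 s' (%e. if e div R = x & e mod R < length (vs s2 x)
   then Some (vs s2 x ! (e mod R) * LM + ?l) else ?F e) & arrs s' 51 = (arrs s2 51)(x := ?l))"
  proof (rule attach_in_spec)
  show "?l < LM" by (rule load_bnd[OF assms(1) un])
  show "brep c 10 s2 ?F" using r(5) brep_cong[of s2 10 s] by (simp add: f1 f2)
  fix j assume "j < length (vs s2 x)"
  moreover from this have "j < R" using assms(5) v2 unfolding valid_def by auto
  ultimately show "?F (x * R + j) = None" using assms(4) unfolding placement_def by simp
  qed (use p2 assms v2 in \<open>auto simp: f1 f2\<close>)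
  then show ?thesis
  unfolding v2
  proof (rule spec_conseq)
  fix s' assume br: "brep c 10 s' (%e. if e div R = x & e mod R < length (vs s x)
   then Some (vs s x ! (e mod R) * LM + ?l) else ?F e) & arrs s' 51 = (arrs s2 51)(x := ?l)"
   and fr3: "frame attach_in s2 s'"
  note f3 = frameD(1,2)[OF fr3]
  have v3: "vs s' = vs s" unfolding v2[symmetric] by (rule verts_cong) (simp_all add: f3)
  have l3: "arrs s' 51 = (arrs s 51)(x := ?l)" using br by (simp add: f1 f2)
  have o3: "arrs s' 50 = (arrs s 50)(x := u)" by (simp add: f1 f2 f3)
  have pl: "(%e. if e div R = x & e mod R < length (vs s x)
   then Some (vs s x ! (e mod R) * LM + ?l) else ?F e) =
   placement R LM (insert x X) (vs s) ((arrs s 51)(x := ?l))"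
   using assms(4) unfolding placement_def by auto
  have fH: "finite H" using o(4) finite_subset[of H "{..<n}"] by auto
  have "rep s' (insert x X) (H - {u}) (Q1(u := Q1 u @ [x])) (Q2(u := Q2 u @ [x]))"
   unfolding rep_def
  proof (intro conjI)
   show "par s'" using par_frame[OF fr3] p2 by simp
   show "srep n s'" using r(2) srep_cong[of s' s] by (simp add: f1 f2 f3)
   show "lrep c 14 s' (Q1(u := Q1 u @ [x]))" using s1 lrep_cong[of s' 14 s1] by (simp add: f2 f3)
   show "lrep c 18 s' (Q2(u := Q2 u @ [x]))" using s2 lrep_cong[of s' 18 s2] by (simp add: f3)
   show "brep c 10 s' (placement R LM (insert x X) (vs s') (arrs s' 51))"
   using conjunct1[OF br] unfolding pl v3 l3 .
   show "orientation n R NX (insert x X) (vs s') (arrs s' 50) (arrs s' 42) (H - {u})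
    (Q1(u := Q1 u @ [x])) (Q2(u := Q2 u @ [x]))"
   using orientation_attach[OF r(6) assms(3-5) u(2,3)] v3 o3 by (simp add: f1 f2 f3)
   show "leveled b (insert x X) (vs s') (arrs s' 51) (arrs s' 42) (Q1(u := Q1 u @ [x])) (Q2(u := Q2 u @ [x]))"
   using leveled_attach[OF r(6,7) assms(4) u(3) th b_pos] v3 l3 by (simp add: f1 f2 f3)
   have "card H = Suc (card (H - {u}))" using fH u(3) by (rule card.remove)
   then show "card (insert x X) + card (H - {u}) <= NX" using r(8) o(13) assms(4) by simp
  qed
  then show "(\<exists>Q1 Q2. rep s' (insert x X) (H - {u}) Q1 Q2) & arrs s' 50 = (arrs s 50)(x := u)"
   using o3 by blast
  qed simp
 qed
 ultimately show ?thesis by (rule spec_seq) auto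
 qed
 ultimately have *: "spec W (lpush 14 ;; lpush 18 ;; attach_in) ?s (100 * real (length (vs s x)) + 150)
 (%s'. (\<exists>Q1 Q2. rep s' (insert x X) (H - {u}) Q1 Q2) & arrs s' 50 = (arrs s 50)(x := u))"
 by (rule spec_seq) auto
 let ?s0 = "s(|arrs := (arrs s)(50 := (arrs s 50)(x := u))|)"
 have "spec W (Put 50 (Var 50) (Var 55)) s 7 (%s'. s' = ?s0)"
 using assms(2) u(1) xc n_bnd unfolding spec_def by simp
 then show ?thesis
 unfolding attach_def
 proof (rule spec_seq)
 fix s' assume "s' = ?s0"
 then show "spec W (Assign 54 (Elem 42 (Var 55)) ;; Assign 60 (Var 55) ;;
  Assign 61 (Var 50) ;; lpush 14 ;; lpush 18 ;; attach_in) s' (100 * real (length (vs s x)) + 170)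
  (%s'. (\<exists>Q1 Q2. rep s' (insert x X) (H - {u}) Q1 Q2) & arrs s' 50 = (arrs s 50)(x := u))"
  using * assms(2) u(1) un n_bnd
  by (auto simp: spec_assign_iff elim!: spec_conseq)
 qed auto
qed

end

text \<open>Inspects the copies that \<open>raise\<close> would refresh. Register 41 tells whether
  one of them should rather be carried by a vertex of clearly smaller load, registers 42 and 43 name
  this copy and this vertex; the last find is kept.\<close>

definition scan :: cmd where
 "scan = Assign 44 (Elem 42 (Var 40)) ;;
  Cond (Lit 4 \<boxtimes> Var 2) (Var 44) (Assign 45 (Lit 4 \<boxtimes> Var 2)) (Assign 45 (Var 44)) ;;
  Assign 41 (Lit 0) ;;
  For 46 (Var 45)
  (Assign 50 (Elem 16 (Var 40 \<boxtimes> Var 9 \<boxplus> (Elem 15 (Var 40) \<boxplus> Var 46) \<odot> Var 9)) ;;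
  argmin_load ;;
  Cond (Elem 42 (Var 51) \<boxplus> Elem 42 (Var 51) \<oslash> Var 2 \<boxplus> Lit 3) (Var 44 \<boxplus> Lit 1)
   (Assign 41 (Lit 1) ;; Assign 42 (Var 50) ;; Assign 43 (Var 51)) Skip)"

definition probe :: cmd where
 "probe = Assign 60 (Var 40 \<boxtimes> Var 5 \<boxplus> Var 47) ;;
  Cond (Lit 0) (Elem 10 (Var 60)) (lfirst 10 ;; Assign 42 (Var 61 \<oslash> Var 1) ;; Assign 41 (Lit 1)) Skip"

text \<open>At a vertex of load \<open>L\<close> all levels are at most
  \<open>threshold b L\<close>, which is at most \<open>threshold b (L - 1) + 2\<close>. A level
  that is too high for load \<open>L - 1\<close> therefore equals
  \<open>threshold b (L - 1) + 1\<close> or \<open>threshold b L\<close>, and two probes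
  suffice.\<close>

definition find_steal :: cmd where
 "find_steal = Assign 47 (Elem 42 (Var 40) \<boxminus> Lit 1) ;; Assign 47 (Var 47 \<boxplus> Var 47 \<oslash> Var 2 \<boxplus> Lit 4) ;;
  Assign 41 (Lit 0) ;; probe ;;
  Assign 47 (Elem 42 (Var 40) \<boxplus> Elem 42 (Var 40) \<oslash> Var 2 \<boxplus> Lit 3) ;; probe"

definition cycle :: "nat => cmd => cmd" where
 "cycle a C = For 46 (Var 45) (Assign 60 (Var 40) ;; lrotate a ;; Assign 50 (Var 61) ;; C)"

definition refresh :: cmd where
 "refresh = detach_in ;; Assign 54 (Var 47) ;; attach_in"

definition raise :: cmd where
 "raise = Assign 47 (Var 44 \<boxplus> Lit 1) ;; cycle 14 refresh ;; Assign 60 (Var 40) ;; inc_load"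

text \<open>Refreshing only those copies whose level exceeds the new load realises the minimum in
  \<open>leveled_lower\<close>.\<close>

definition lower :: cmd where
 "lower = Assign 47 (Elem 42 (Var 40) \<boxminus> Lit 1) ;;
  Cond (Lit 4 \<boxtimes> Var 2) (Var 47) (Assign 45 (Lit 4 \<boxtimes> Var 2)) (Assign 45 (Var 47)) ;;
  cycle 18 (Cond (Var 47) (Elem 51 (Var 50)) refresh Skip) ;; Assign 60 (Var 40) ;; dec_load"

lemma rounds_frame [simp]:
 "lo scan = 41" "wr scan = {}" "pure scan"
 "lo probe = 41" "wr probe = {}" "pure probe"
 "lo find_steal = 41" "wr find_steal = {}" "pure find_steal"
 "lo refresh = 52" "wr refresh = {10, 12, 13, 51}" "pure refresh"
 "lo (cycle a C) = min 46 (lo C)" "wr (cycle a C) = {a + 1, a + 2, a + 3} \<union> wr C" "pure (cycle a C) = pure C"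
 by (auto simp: scan_def probe_def find_steal_def refresh_def cycle_def)

lemma raise_lower_frame [simp]:
 "lo raise = 46" "wr raise = {10, 12, 13, 15, 16, 17, 40, 41, 42, 43, 51}" "pure raise"
 "lo lower = 45" "wr lower = {10, 12, 13, 19, 20, 21, 40, 41, 42, 43, 51}" "pure lower"
 by (auto simp: raise_def lower_def)

text \<open>The quotient grows by at most one together with its argument. This limits the levels
  that a deletion has to probe.\<close>

lemma threshold_step: "0 < b ==> 0 < L ==> threshold b L <= threshold b (L - 1) + 2"
proof -
 assume *: "0 < b" "0 < L"
 then obtain m where m: "L = Suc m" using gr0_implies_Suc by blast
 have "Suc m div b <= (m + b) div b" using * by (intro div_le_mono) linarith
 also have "\<dots> = m div b + 1" using * by simp
 finally show ?thesis unfolding m threshold_def by simp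
qed

section \<open>Scanning the queues, probing the bags and refreshing levels\<close>

context hyper
begin

text \<open>Thresholds are monotone, so the least loaded vertex of each copy decides for all its
  vertices. \<open>M\<close> bounds only the copies carried by \<open>u\<close>; at high loads these
  are smaller than the rank, and the time analysis of insertions depends on that.\<close>

lemma scan_spec:
 assumes "rep s X {} Q1 Q2" "regs s 40 = u" "u < n"
 and M: "\<And>y. y \<in> X ==> arrs s 50 y = u ==> length (vs s y) <= M"
 shows "spec W scan s (4 * real b * (50 * real M + 110) + 60) (%s'.
 regs s' 44 = arrs s 42 u & regs s' 45 = min (4 * b) (arrs s 42 u) &
 (regs s' 41 = 0 & (\<forall>x\<in>set (take (min (4 * b) (arrs s 42 u)) (Q1 u)). \<forall>v\<in>set (vs s x).
  arrs s 42 u + 1 <= threshold b (arrs s 42 v)) \<or>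
  regs s' 41 = 1 & regs s' 42 \<in> X & arrs s 50 (regs s' 42) = u & regs s' 43 \<in> set (vs s (regs s' 42)) &
  (\<forall>v\<in>set (vs s (regs s' 42)). arrs s 42 (regs s' 43) <= arrs s 42 v) &
  threshold b (arrs s 42 (regs s' 43)) <= arrs s 42 u))"
proof -
 note r = repD[OF assms(1)] and o = orientationD[OF repD(6)[OF assms(1)]]
 note p = parD[OF r(1)]
 let ?L = "arrs s 42 u"
 let ?k = "min (4 * b) ?L"
 let ?T = "%v. threshold b (arrs s 42 v)"
 have len: "length (Q1 u) = ?L" using o(9)[OF assms(3)] o(11)[of u] by simp
 have Lb: "?L <= NX" "?L < LM" "?L + 10 < bnd W" using load_bnd[OF assms(1,3)] LM_bnd LM_eq by auto
 let ?A = "%i (s' :: store). par s' & regs s' 40 = u & regs s' 44 = ?L & regs s' 45 = ?k & arrs s' = arrs s &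
  (regs s' 41 = 0 & (\<forall>j<i. \<forall>v\<in>set (vs s (Q1 u ! j)). ?L + 1 <= ?T v) \<or>
  regs s' 41 = 1 & regs s' 42 \<in> X & arrs s 50 (regs s' 42) = u & regs s' 43 \<in> set (vs s (regs s' 42)) &
  (\<forall>v\<in>set (vs s (regs s' 42)). arrs s 42 (regs s' 43) <= arrs s 42 v) & ?T (regs s' 43) <= ?L)"
 let ?C = "Cond (Elem 42 (Var 51) \<boxplus> Elem 42 (Var 51) \<oslash> Var 2 \<boxplus> Lit 3) (Var 44 \<boxplus> Lit 1)
   (Assign 41 (Lit 1) ;; Assign 42 (Var 50) ;; Assign 43 (Var 51)) Skip"
 let ?B = "Assign 50 (Elem 16 (Var 40 \<boxtimes> Var 9 \<boxplus> (Elem 15 (Var 40) \<boxplus> Var 46) \<odot> Var 9)) ;; argmin_load ;; ?C"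
 have body: "spec W ?B s1 (50 * real M + 100) (%s'. regs s' 46 = i & ?A (Suc i) (s'(|regs := (regs s')(46 := Suc i)|)))"
 if i: "i < ?k" "?A i s1" "regs s1 46 = i" for i s1
 proof -
 let ?y = "Q1 u ! i"
 have iL: "i < length (Q1 u)" using i(1) len by simp
 have y: "?y \<in> X" "arrs s 50 ?y = u" using o(6)[of u] nth_mem[OF iL] by auto
 have yN: "?y < NX" using o(1) y by auto
 note ring = r(3)[unfolded lrep_def]
 have h: "arrs s 15 u < c" using ringD(2)[OF ring, of u] by simp
 then have hm: "(arrs s 15 u + i) mod c < c" by simp
 have d: "arrs s 16 (u * c + (arrs s 15 u + i) mod c) = ?y" using ringD(5)[OF ring iL] by simp
 have ic: "i < c" using ring_length[OF ring, of u] iL by simp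
 note fit = fits_vertex[OF assms(3), of 14, simplified]
 have pd: "par s1" "regs s1 40 = u" "arrs s1 = arrs s" "regs s1 9 = c" using i parD by auto
 let ?s = "s1(|regs := (regs s1)(50 := ?y)|)"
 have v1: "vs ?s = vs s" by (rule verts_cong) (simp_all add: pd)
 have "spec W argmin_load ?s (50 * real (length (vs ?s ?y)) + 50) (%s'. regs s' 51 \<in> set (vs ?s ?y) &
  (\<forall>v\<in>set (vs ?s ?y). arrs ?s 42 (regs s' 51) <= arrs ?s 42 v))"
  by (rule argmin_load_spec) (use pd yN o(2)[OF y(1)] v1 in auto)
 then have "spec W (argmin_load ;; ?C) ?s (50 * real M + 78) (%s'. regs s' 46 = i & ?A (Suc i) (s'(|regs := (regs s')(46 := Suc i)|)))"
 proof (rule spec_seq[where V = 28])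
  show "50 * real (length (vs ?s ?y)) + 50 + 28 <= 50 * real M + 78" using M[OF y] v1 by simp
  fix s2 assume m: "regs s2 51 \<in> set (vs ?s ?y) & (\<forall>v\<in>set (vs ?s ?y). arrs ?s 42 (regs s2 51) <= arrs ?s 42 v)"
  and fr: "frame argmin_load ?s s2"
  note f = frameD(1,2)[OF fr]
  have a2: "arrs s2 = arrs s" using pd by (intro ext) (simp add: f)
  have p2: "par s2" using par_frame[OF fr] pd by simp
  let ?v = "regs s2 51"
  have v: "?v \<in> set (vs s ?y)" "\<And>v. v \<in> set (vs s ?y) ==> arrs s 42 ?v <= arrs s 42 v"
  using m v1 pd by auto
  have vn: "?v < n" using v(1) o(2)[OF y(1)] unfolding valid_def by auto
  have vb: "arrs s 42 ?v + arrs s 42 ?v div b + 3 < bnd W"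
  using load_bnd(3)[OF assms(1) vn] LM_bnd unfolding threshold_def by simp
  have all: "?T ?v <= ?T v" if "v \<in> set (vs s ?y)" for v using v(2)[OF that] by (rule threshold_mono)
  show "spec W ?C s2 28 (%s'. regs s' 46 = i & ?A (Suc i) (s'(|regs := (regs s')(46 := Suc i)|)))"
  proof (rule spec_cond[where ?T1.0 = 6])
  show "ok W s2 (Elem 42 (Var 51) \<boxplus> Elem 42 (Var 51) \<oslash> Var 2 \<boxplus> Lit 3)"
   using a2 vn n_bnd vb parD[OF p2] by simp
  show "ok W s2 (Var 44 \<boxplus> Lit 1)" using i Lb n_bnd by (simp add: f)
  next
  assume "ev W s2 (Elem 42 (Var 51) \<boxplus> Elem 42 (Var 51) \<oslash> Var 2 \<boxplus> Lit 3) < ev W s2 (Var 44 \<boxplus> Lit 1)"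
  then have "?T ?v <= ?L" using i a2 parD[OF p2] unfolding threshold_def by (simp add: f)
  then show "spec W (Assign 41 (Lit 1) ;; Assign 42 (Var 50) ;; Assign 43 (Var 51)) s2 6
   (%s'. regs s' 46 = i & ?A (Suc i) (s'(|regs := (regs s')(46 := Suc i)|)))"
   using i a2 p2 y v n_bnd unfolding spec_def by (simp add: f)
  next
  assume "\<not> ev W s2 (Elem 42 (Var 51) \<boxplus> Elem 42 (Var 51) \<oslash> Var 2 \<boxplus> Lit 3) < ev W s2 (Var 44 \<boxplus> Lit 1)"
  then have "?L + 1 <= ?T ?v" using i a2 parD[OF p2] unfolding threshold_def by (simp add: f)
  then have "\<forall>v\<in>set (vs s ?y). ?L + 1 <= ?T v" using all order.trans by blast
  then show "spec W Skip s2 6 (%s'. regs s' 46 = i & ?A (Suc i) (s'(|regs := (regs s')(46 := Suc i)|)))"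
   using i a2 p2 unfolding spec_def by (simp add: f less_Suc_eq)
  qed simp_all
 qed simp
 then show ?thesis
  using pd i(3) d h fitsD(1)[OF fit hm] fitsD(3)[OF fit hm] fitsD(4)[OF fit hm] fitsD(5)[OF fit h ic] n_bnd
  by (auto simp: spec_assign_iff elim!: spec_conseq)
 qed
 let ?s1 = "s(|regs := (regs s)(44 := ?L, 45 := ?k, 41 := 0)|)"
 have F: "spec W (For 46 (Var 45) ?B) ?s1 (4 * real b * (50 * real M + 110) + 20) (%s'. ?A ?k s' & regs s' 46 = ?k)"
 proof (rule spec_for[where \<tau> = "50 * real M + 100" and N = ?k and Inv = ?A])
 show "?A 0 (?s1(|regs := (regs ?s1)(46 := 0)|))" using assms r(1) by simp
 have "real ?k * (50 * real M + 100 + real (cost (Var 45)) + 7) <= 4 * real b * (50 * real M + 110)"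
  by (rule mult_mono) auto
 then show "real ?k * (50 * real M + 100 + real (cost (Var 45)) + 7) + real (cost (Var 45)) + 5 \<le>
  4 * real b * (50 * real M + 110) + 20" by simp
 qed (use body Lb in auto)
 have "spec W (Cond (Lit 4 \<boxtimes> Var 2) (Var 44) (Assign 45 (Lit 4 \<boxtimes> Var 2)) (Assign 45 (Var 44)) ;; Assign 41 (Lit 0) ;;
  For 46 (Var 45) ?B) (s(|regs := (regs s)(44 := ?L)|)) (4 * real b * (50 * real M + 110) + 40)
  (%s'. ?A ?k s' & regs s' 46 = ?k)"
 proof (rule spec_seq)
 show "spec W (Cond (Lit 4 \<boxtimes> Var 2) (Var 44) (Assign 45 (Lit 4 \<boxtimes> Var 2)) (Assign 45 (Var 44)))
  (s(|regs := (regs s)(44 := ?L)|)) 12 (%s'. s' = s(|regs := (regs s)(44 := ?L, 45 := ?k)|))"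
  using p b_bnd unfolding spec_def by (auto simp: min_def)
 fix s' assume "s' = s(|regs := (regs s)(44 := ?L, 45 := ?k)|)"
 then have "s'(|regs := (regs s')(41 := ev W s' (Lit 0))|) = ?s1" by simp
 from F[folded this] show "spec W (Assign 41 (Lit 0) ;; For 46 (Var 45) ?B) s' (4 * real b * (50 * real M + 110) + 22)
  (%s'. ?A ?k s' & regs s' 46 = ?k)"
  by (rule spec_assign[rotated]) (use n_bnd in simp_all)
 qed simp_all
 then have "spec W scan s (4 * real b * (50 * real M + 110) + 60) (%s'. ?A ?k s' & regs s' 46 = ?k)"
 unfolding scan_def using assms(2,3) n_bnd by (auto simp: spec_assign_iff elim!: spec_conseq)
 then show ?thesis
 proof (rule spec_conseq)
 have st: "set (take ?k (Q1 u)) = (!) (Q1 u) ` {..<?k}"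
  using nth_image[of ?k "Q1 u"] len by (simp add: lessThan_atLeast0)
 have iff: "(\<forall>x\<in>set (take ?k (Q1 u)). Pr x) \<longleftrightarrow> (\<forall>j<?k. Pr (Q1 u ! j))" for Pr
  unfolding st by auto
 fix s' assume "?A ?k s' & regs s' 46 = ?k"
 then show "regs s' 44 = ?L & regs s' 45 = ?k &
  (regs s' 41 = 0 & (\<forall>x\<in>set (take ?k (Q1 u)). \<forall>v\<in>set (vs s x). ?L + 1 <= ?T v) \<or>
  regs s' 41 = 1 & regs s' 42 \<in> X & arrs s 50 (regs s' 42) = u & regs s' 43 \<in> set (vs s (regs s' 42)) &
   (\<forall>v\<in>set (vs s (regs s' 42)). arrs s 42 (regs s' 43) <= arrs s 42 v) & ?T (regs s' 43) <= ?L)"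
  unfolding iff by blast
 qed simp
qed

lemma placement_Some:
 assumes "rep s X H Q1 Q2" "u < n" "l < LM"
 shows "placement R LM X (vs s) (arrs s 51) e = Some (u * LM + l) \<longleftrightarrow>
 e div R \<in> X & e mod R < length (vs s (e div R)) & vs s (e div R) ! (e mod R) = u & arrs s 51 (e div R) = l"
 using block_inj[of "arrs s 51 (e div R)" LM l] lev_bnd[OF assms(1), of "e div R"] assms(3)
 unfolding placement_def by auto

lemma probe_spec:
 assumes "rep s X H Q1 Q2" "regs s 40 = u" "u < n" "regs s 47 = l" "l < LM"
 shows "spec W probe s 50 (%s'. if \<exists>y\<in>X. u \<in> set (vs s y) & arrs s 51 y = l
 then regs s' 41 = 1 & regs s' 42 \<in> X & u \<in> set (vs s (regs s' 42)) & arrs s 51 (regs s' 42) = l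
 else regs s' 41 = regs s 41 & regs s' 42 = regs s 42)"
proof -
 note r = repD[OF assms(1)] and o = orientationD[OF repD(6)[OF assms(1)]]
 note p = parD[OF r(1)]
 let ?q = "u * LM + l"
 let ?F = "placement R LM X (vs s) (arrs s 51)"
 let ?s = "s(|regs := (regs s)(60 := ?q)|)"
 let ?E = "\<exists>y\<in>X. u \<in> set (vs s y) & arrs s 51 y = l"
 note F = placement_Some[OF assms(1,3,5)]
 have q: "?q < n * LM" "?q < bnd W" "u * LM < bnd W" using in_index[OF assms(3,5)] by auto
 have fitq: "fits W c 10 ?q" by (rule fits_le) (use q(1) in linarith)+
 have E: "?E \<longleftrightarrow> (\<exists>e. ?F e = Some ?q)"
 proof
 assume ?E
 then obtain y j where y: "y \<in> X" "j < length (vs s y)" "vs s y ! j = u" "arrs s 51 y = l"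
  by (auto simp: in_set_conv_nth)
 then have "j < R" using o(2)[OF y(1)] unfolding valid_def by simp
 then have "?F (y * R + j) = Some ?q" unfolding F using y by simp
 then show "\<exists>e. ?F e = Some ?q" by blast
 next
 assume "\<exists>e. ?F e = Some ?q"
 then show ?E unfolding F using nth_mem by blast
 qed
 have len: "0 < arrs s 10 ?q \<longleftrightarrow> ?E" unfolding E by (rule brep_nonempty[OF r(5)])
 let ?Q = "%s'. if ?E then regs s' 41 = 1 & regs s' 42 \<in> X & u \<in> set (vs s (regs s' 42)) & arrs s 51 (regs s' 42) = l
 else regs s' 41 = regs s 41 & regs s' 42 = regs s 42"
 have "spec W (Cond (Lit 0) (Elem 10 (Var 60)) (lfirst 10 ;; Assign 42 (Var 61 \<oslash> Var 1) ;; Assign 41 (Lit 1)) Skip) ?s 40 ?Q"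
 proof (rule spec_cond[where ?T1.0 = 30])
 assume "ev W ?s (Lit 0) < ev W ?s (Elem 10 (Var 60))"
 then have ex: ?E using len by simp
 then obtain e where e: "?F e = Some ?q" using E by blast
 have "spec W (lfirst 10) ?s 20 (%s'. ?F (regs s' 61) = Some ?q)"
  by (rule bfirst_spec[where e = e]) (use r(5) fitq p e in auto)
 then show "spec W (lfirst 10 ;; Assign 42 (Var 61 \<oslash> Var 1) ;; Assign 41 (Lit 1)) ?s 30 ?Q"
 proof (rule spec_seq[where V = 10])
  fix s1 assume s1: "?F (regs s1 61) = Some ?q" and fr: "frame (lfirst 10) ?s s1"
  have "regs s1 (Suc 0) = R" using p by (simp add: frameD(1)[OF fr])
  then show "spec W (Assign 42 (Var 61 \<oslash> Var 1) ;; Assign 41 (Lit 1)) s1 10 ?Q"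
  using s1[unfolded F] ex nth_mem n_bnd unfolding spec_def by auto
 qed auto
 next
 assume "\<not> ev W ?s (Lit 0) < ev W ?s (Elem 10 (Var 60))"
 then have "\<not> ?E" using len by simp
 then show "spec W Skip ?s 30 ?Q" unfolding spec_def by (simp only: if_False) simp
 qed (use q n_bnd in auto)
 note C = this
 have e: "ev W s (Var 40 \<boxtimes> Var 5 \<boxplus> Var 47) = ?q" using assms(2,4) p by simp
 show ?thesis
 unfolding probe_def
 by (rule spec_assign[OF _ C[folded e]]) (use assms(2,4) p q in simp_all)
qed

lemma find_steal_spec:
 assumes "rep s X H Q1 Q2" "regs s 40 = u" "u < n" and L: "0 < arrs s 42 u"
 shows "spec W find_steal s 200 (%s'.
 regs s' 41 = 0 & (\<forall>y\<in>X. u \<in> set (vs s y) --> arrs s 51 y <= threshold b (arrs s 42 u - 1)) \<or>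
 regs s' 41 = 1 & regs s' 42 \<in> X & u \<in> set (vs s (regs s' 42)) &
  threshold b (arrs s 42 u - 1) < arrs s 51 (regs s' 42))"
proof -
 note r = repD[OF assms(1)]
 note p = parD[OF r(1)]
 let ?L = "arrs s 42 u"
 let ?l1 = "threshold b (?L - 1) + 1" and ?l2 = "threshold b ?L"
 have l2: "?l2 < LM" by (rule load_bnd[OF assms(1,3)])
 have div: "(?L - 1) div b <= ?L div b" by (rule div_le_mono) simp
 then have l1: "?l1 <= ?l2" using L unfolding threshold_def by linarith
 have le: "arrs s 51 y <= ?l2" if "y \<in> X" "u \<in> set (vs s y)" for y
 using leveledD(1)[OF r(7) that] .
 have iff: "threshold b (?L - 1) < arrs s 51 y \<longleftrightarrow> arrs s 51 y = ?l1 \<or> arrs s 51 y = ?l2"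
 if "y \<in> X" "u \<in> set (vs s y)" for y
 using le[OF that] threshold_step[OF b_pos L] l1 by linarith
 let ?Q = "%s'. regs s' 41 = 0 & (\<forall>y\<in>X. u \<in> set (vs s y) --> arrs s 51 y <= threshold b (?L - 1)) \<or>
 regs s' 41 = 1 & regs s' 42 \<in> X & u \<in> set (vs s (regs s' 42)) & threshold b (?L - 1) < arrs s 51 (regs s' 42)"
 let ?P = "%(s' :: store). regs s' 41 = 0 & (\<forall>y\<in>X. u \<in> set (vs s y) --> arrs s 51 y \<noteq> ?l1) \<or>
 regs s' 41 = 1 & regs s' 42 \<in> X & u \<in> set (vs s (regs s' 42)) & threshold b (?L - 1) < arrs s 51 (regs s' 42)"
 let ?s = "s(|regs := (regs s)(47 := ?l1, 41 := 0)|)"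
 let ?r2 = "Assign 47 (Elem 42 (Var 40) \<boxplus> Elem 42 (Var 40) \<oslash> Var 2 \<boxplus> Lit 3) ;; probe"
 have "spec W probe ?s 50 ?P"
 by (rule spec_conseq[OF probe_spec[where u = u and l = ?l1]])
  (use assms l1 l2 in \<open>auto split: if_splits\<close>)
 then have "spec W (probe ;; ?r2) ?s 130 ?Q"
 proof (rule spec_seq[where V = 80])
 fix s1 assume P: "?P s1" and fr: "frame probe ?s s1"
 have a: "arrs s1 = arrs s" by (intro ext) (simp add: frameD(2)[OF fr])
 have v: "vs s1 = vs s" by (rule verts_cong) (simp_all add: a)
 have rp: "rep s1 X H Q1 Q2" by (rule rep_cong[of ?s _ _ _ _ probe]) (use assms(1) fr in auto)
 have u1: "regs s1 40 = u" using assms(2) by (simp add: frameD(1)[OF fr])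
 have b1: "regs s1 2 = b" using parD[OF repD(1)[OF rp]] by simp
 let ?s2 = "s1(|regs := (regs s1)(47 := ?l2)|)"
 have "spec W probe ?s2 50 (%s'. if \<exists>y\<in>X. u \<in> set (vs ?s2 y) & arrs ?s2 51 y = ?l2
  then regs s' 41 = 1 & regs s' 42 \<in> X & u \<in> set (vs ?s2 (regs s' 42)) & arrs ?s2 51 (regs s' 42) = ?l2
  else regs s' 41 = regs ?s2 41 & regs s' 42 = regs ?s2 42)"
  by (rule probe_spec) (use rp assms(3) u1 l2 in auto)
 then have "spec W probe ?s2 50 ?Q"
 proof (rule spec_conseq)
  fix s' assume "if \<exists>y\<in>X. u \<in> set (vs ?s2 y) & arrs ?s2 51 y = ?l2
  then regs s' 41 = 1 & regs s' 42 \<in> X & u \<in> set (vs ?s2 (regs s' 42)) & arrs ?s2 51 (regs s' 42) = ?l2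
  else regs s' 41 = regs ?s2 41 & regs s' 42 = regs ?s2 42"
  then have *: "if \<exists>y\<in>X. u \<in> set (vs s y) & arrs s 51 y = ?l2
  then regs s' 41 = 1 & regs s' 42 \<in> X & u \<in> set (vs s (regs s' 42)) & arrs s 51 (regs s' 42) = ?l2
  else regs s' 41 = regs s1 41 & regs s' 42 = regs s1 42"
  by (simp add: v a cong: if_cong)
  show "?Q s'"
  proof (cases "\<exists>y\<in>X. u \<in> set (vs s y) & arrs s 51 y = ?l2")
  case True
  then have "regs s' 41 = 1" "regs s' 42 \<in> X" "u \<in> set (vs s (regs s' 42))" "arrs s 51 (regs s' 42) = ?l2"
   using * by simp_all
  then show ?thesis using l1 by simp
  next
  case False
  then have eq: "regs s' 41 = regs s1 41" "regs s' 42 = regs s1 42" using * by auto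
  show ?thesis
  proof (cases "regs s1 41 = 1")
   case one: True
   then show ?thesis using P eq by auto
  next
   case zero: False
   then have "\<forall>y\<in>X. u \<in> set (vs s y) --> \<not> threshold b (?L - 1) < arrs s 51 y"
   using P False iff by blast
   then show ?thesis using P zero eq by (simp add: not_less)
  qed
  qed
 qed simp
 then show "spec W ?r2 s1 80 ?Q"
  using u1 b1 a l2 LM_bnd assms(3) n_bnd unfolding threshold_def
  by (auto simp: spec_assign_iff elim!: spec_conseq)
 qed auto
 then have 1: "spec W (Assign 41 (Lit 0) ;; probe ;; ?r2) (s(|regs := (regs s)(47 := ?l1)|)) 140 ?Q"
 by (intro spec_assign[where T' = 130]) (use n_bnd in simp_all)
 have bd: "?L - 1 + (?L - 1) div b + 4 < bnd W" using l1 l2 LM_bnd unfolding threshold_def by linarith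
 let ?e = "Var 47 \<boxplus> Var 47 \<oslash> Var 2 \<boxplus> Lit 4"
 let ?s1 = "s(|regs := (regs s)(47 := ?L - 1)|)"
 have "ev W ?s1 ?e = ?l1" using p unfolding threshold_def by simp
 then have "?s1(|regs := (regs ?s1)(47 := ev W ?s1 ?e)|) = s(|regs := (regs s)(47 := ?l1)|)"
 by (simp only:) simp
 note 2 = 1[folded this]
 have "spec W (Assign 47 ?e ;; Assign 41 (Lit 0) ;; probe ;; ?r2) ?s1 155 ?Q"
 by (rule spec_assign[OF _ 2]) (use bd p n_bnd in simp_all)
 then show ?thesis
 unfolding find_steal_def using assms(2,3) L n_bnd by (subst spec_assign_iff) (auto elim!: spec_conseq)
qed

lemma placement_update:
 assumes "x \<in> X"
 shows "(%e. if e div R = x & e mod R < length (vx x) then Some (vx x ! (e mod R) * LM + l)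
 else if e div R = x & e mod R < length (vx x) then None else placement R LM X vx lev e) =
 placement R LM X vx (lev(x := l))"
 using assms unfolding placement_def by auto

lemma refresh_spec:
 assumes "par s" "regs s 50 = x" "x \<in> X" "x < NX" "valid n R (vs s x)" "regs s 47 = l" "l < LM"
 "arrs s 51 x < LM" "brep c 10 s (placement R LM X (vs s) (arrs s 51))"
 shows "spec W refresh s (220 * real R + 70) (%s'.
 brep c 10 s' (placement R LM X (vs s) ((arrs s 51)(x := l))) & arrs s' 51 = (arrs s 51)(x := l))"
proof -
 let ?m = "length (vs s x)"
 let ?F = "placement R LM X (vs s) (arrs s 51)"
 let ?G = "%e. if e div R = x & e mod R < ?m then None else ?F e"
 have m: "?m <= R" using assms(5) unfolding valid_def by simp
 have "spec W detach_in s (120 * real ?m + 30) (%s'. brep c 10 s' ?G)"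
 proof (rule detach_in_spec[OF assms(1,2,4,5) refl assms(8,9)])
 fix j assume "j < ?m"
 then show "?F (x * R + j) = Some (vs s x ! j * LM + arrs s 51 x)"
  using m assms(3) unfolding placement_def by simp
 qed
 then show ?thesis
 unfolding refresh_def
 proof (rule spec_seq)
 fix s1 assume br: "brep c 10 s1 ?G" and fr: "frame detach_in s s1"
 note f = frameD(1,2)[OF fr]
 have v: "vs s1 = vs s" by (rule verts_cong) (simp_all add: f)
 have p: "par s1" using par_frame[OF fr] assms(1) by simp
 let ?s = "s1(|regs := (regs s1)(54 := l)|)"
 have "spec W attach_in ?s (100 * real (length (vs ?s x)) + 30) (%s'.
  brep c 10 s' (%e. if e div R = x & e mod R < length (vs ?s x) then Some (vs ?s x ! (e mod R) * LM + l) else ?G e) &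
  arrs s' 51 = (arrs ?s 51)(x := l))"
 proof (rule attach_in_spec)
  fix j assume "j < length (vs ?s x)"
  then show "?G (x * R + j) = None" using m v by simp
 qed (use assms p br v in \<open>auto simp: f\<close>)
 moreover have "vs ?s = vs s" using v by simp
 ultimately have "spec W attach_in ?s (100 * real ?m + 30) (%s'.
  brep c 10 s' (%e. if e div R = x & e mod R < ?m then Some (vs s x ! (e mod R) * LM + l) else ?G e) &
  arrs s' 51 = (arrs s 51)(x := l))"
  by (simp only:) (simp add: f)
 then have "spec W attach_in ?s (100 * real ?m + 30) (%s'.
  brep c 10 s' (placement R LM X (vs s) ((arrs s 51)(x := l))) & arrs s' 51 = (arrs s 51)(x := l))"
  by (simp only: placement_update[OF assms(3)])
 then show "spec W (Assign 54 (Var 47) ;; attach_in) s1 (100 * real ?m + 40) (%s'.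
  brep c 10 s' (placement R LM X (vs s) ((arrs s 51)(x := l))) & arrs s' 51 = (arrs s 51)(x := l))"
  using assms(6) by (auto simp: spec_assign_iff f elim!: spec_conseq)
 qed (use m in auto)
qed

text \<open>One rule for both directions: \<open>g\<close> gives the new level in terms of the old
  one, constant for \<open>raise\<close> and a minimum for \<open>lower\<close>. Each round sends
  the head of the queue to its end, so after \<open>k\<close> rounds exactly the first
  \<open>k\<close> copies have been treated.\<close>

lemma cycle_spec:
 assumes "par s" "lrep c a s Q" "a = 14 \<or> a = 18" "u < n" "regs s 40 = u" "regs s 45 = k" "k <= length (Q u)"
 "regs s 47 = l" "k < bnd W"
 and X: "set (Q u) \<subseteq> X"
 and br: "brep c 10 s (placement R LM X (vs s) (arrs s 51))"
 and C: "52 <= lo C" "wr C \<subseteq> {10, 12, 13, 51}"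
  "\<And>s' x. par s' ==> vs s' = vs s ==> regs s' 50 = x ==> x \<in> X ==> regs s' 47 = l ==>
   brep c 10 s' (placement R LM X (vs s) (arrs s' 51)) ==> arrs s' 51 x = arrs s 51 x ==>
   spec W C s' \<tau> (%s''. brep c 10 s'' (placement R LM X (vs s) ((arrs s' 51)(x := g (arrs s 51 x)))) &
   arrs s'' 51 = (arrs s' 51)(x := g (arrs s 51 x)))"
 and \<tau>: "0 <= \<tau>"
 and lev': "lev' = (%x. if x \<in> set (take k (Q u)) then g (arrs s 51 x) else arrs s 51 x)"
 shows "spec W (cycle a C) s (real k * (\<tau> + 110) + 20) (%s'.
 lrep c a s' (Q(u := drop k (Q u) @ take k (Q u))) & brep c 10 s' (placement R LM X (vs s) lev') & arrs s' 51 = lev')"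
proof -
 let ?lev = "%i x. if x \<in> set (take i (Q u)) then g (arrs s 51 x) else arrs s 51 x"
 let ?Q = "%i. Q(u := drop i (Q u) @ take i (Q u))"
 let ?A = "%i (s' :: store). par s' & regs s' 40 = u & regs s' 45 = k & regs s' 47 = l & vs s' = vs s &
 lrep c a s' (?Q i) & brep c 10 s' (placement R LM X (vs s) (?lev i)) & arrs s' 51 = ?lev i"
 let ?R = "lrotate a ;; Assign 50 (Var 61) ;; C"
 have dist: "distinct (Q u)" using ringD(3)[OF assms(2)[unfolded lrep_def]] .
 have a: "2 <= a" "a + 3 < 64" "lo (lrotate a) = 61" using assms(3) by auto
 have body: "spec W (Assign 60 (Var 40) ;; ?R) s1 (\<tau> + 90)
  (%s'. regs s' 46 = i & ?A (Suc i) (s'(|regs := (regs s')(46 := Suc i)|)))"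
 if i: "i < k" "?A i s1" "regs s1 46 = i" for i s1
 proof -
 have iQ: "i < length (Q u)" using i(1) assms(7) by simp
 let ?x = "Q u ! i"
 let ?s = "s1(|regs := (regs s1)(60 := u)|)"
 have x: "?x \<in> X" "?x \<notin> set (take i (Q u))"
 proof -
  show "?x \<in> X" using X nth_mem[OF iQ] by blast
  show "?x \<notin> set (take i (Q u))" using dist iQ by (auto simp: in_set_conv_nth nth_eq_iff_index_eq)
 qed
 have cons: "drop i (Q u) @ take i (Q u) = ?x # (drop (Suc i) (Q u) @ take i (Q u))"
  using Cons_nth_drop_Suc[OF iQ] by simp
 have rot: "drop (Suc i) (Q u) @ take (Suc i) (Q u) = (drop (Suc i) (Q u) @ take i (Q u)) @ [?x]"
  using take_Suc_conv_app_nth[OF iQ] by simp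
 have ps: "par ?s" using i by simp
 have "spec W (lrotate a) ?s 80 (%s'. regs s' 61 = ?x &
  lrep c a s' ((?Q i)(u := (drop (Suc i) (Q u) @ take i (Q u)) @ [?x])))"
  by (rule lrotate_spec)
  (use i fits_vertex[OF assms(4) a(1,2)] parD[OF ps] cons in auto)
 then have "spec W ?R ?s (\<tau> + 86) (%s'. regs s' 46 = i & ?A (Suc i) (s'(|regs := (regs s')(46 := Suc i)|)))"
 proof (rule spec_seq[where V = "\<tau> + 6"])
  fix s2 assume s2: "regs s2 61 = ?x & lrep c a s2 ((?Q i)(u := (drop (Suc i) (Q u) @ take i (Q u)) @ [?x]))"
  and fr: "frame (lrotate a) ?s s2"
  note f = frameD(1)[OF fr, unfolded a(3)]
  have fa: "arrs s2 e = arrs s1 e" if "e \<notin> {15, 16, 17, 19, 20, 21}" for e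
  using frameD(2)[OF fr, of e] that assms(3) by auto
  have l2: "lrep c a s2 (?Q (Suc i))" using s2 rot by simp
  let ?s3 = "s2(|regs := (regs s2)(50 := ?x)|)"
  have v3: "vs ?s3 = vs s" using verts_cong[of s2 s1] i by (simp add: fa)
  have b3: "brep c 10 ?s3 (placement R LM X (vs s) (arrs ?s3 51))"
  using i brep_cong[of s2 10 s1] by (simp add: fa)
  have p3: "par ?s3" using par_frame[OF fr] ps a(3) by simp
  have "spec W C ?s3 \<tau> (%s''. brep c 10 s'' (placement R LM X (vs s) ((arrs ?s3 51)(?x := g (arrs s 51 ?x)))) &
   arrs s'' 51 = (arrs ?s3 51)(?x := g (arrs s 51 ?x)))"
  by (rule C(3)) (use p3 v3 x b3 i in \<open>auto simp: f fa\<close>)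
  moreover have "(arrs ?s3 51)(?x := g (arrs s 51 ?x)) = ?lev (Suc i)"
  using i take_Suc_conv_app_nth[OF iQ] by (auto simp: fa)
  ultimately have "spec W C ?s3 \<tau> (%s''. brep c 10 s'' (placement R LM X (vs s) (?lev (Suc i))) &
   arrs s'' 51 = ?lev (Suc i))" by simp
  then have "spec W C ?s3 \<tau> (%s'. regs s' 46 = i & ?A (Suc i) (s'(|regs := (regs s')(46 := Suc i)|)))"
  proof (rule spec_conseq)
  fix s' assume s': "brep c 10 s' (placement R LM X (vs s) (?lev (Suc i))) & arrs s' 51 = ?lev (Suc i)"
   and fr': "frame C ?s3 s'"
  have f': "regs s' e = regs ?s3 e" if "e < 52" for e using frameD(1)[OF fr', of e] that C(1) by simp
  have fa': "arrs s' e = arrs s2 e" if "e \<notin> {10, 12, 13, 51}" for e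
   using frameD(2)[OF fr', of e] that C(2) by auto
  have "lrep c a s' (?Q (Suc i))" using l2 lrep_cong[of s' a s2] assms(3) by (auto simp: fa')
  moreover have "vs s' = vs s" using v3 verts_cong[of s' s2] by (simp add: fa')
  moreover have "par s'" using par_frame[OF fr'] p3 C(1) by simp
  ultimately show "regs s' 46 = i & ?A (Suc i) (s'(|regs := (regs s')(46 := Suc i)|))"
   using s' i by (simp add: f f')
  qed simp
  then show "spec W (Assign 50 (Var 61) ;; C) s2 (\<tau> + 6) (%s'. regs s' 46 = i & ?A (Suc i) (s'(|regs := (regs s')(46 := Suc i)|)))"
  using s2 \<tau> by (auto simp: spec_assign_iff elim!: spec_conseq)
 qed (use \<tau> in auto)
 then show ?thesis using i \<tau> by (auto simp: spec_assign_iff elim!: spec_conseq)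
 qed
 have "spec W (cycle a C) s (real k * (\<tau> + 110) + 20) (%s'. ?A k s' & regs s' 46 = k)"
 unfolding cycle_def
 proof (rule spec_for[where \<tau> = "\<tau> + 90" and N = k and Inv = ?A])
 show "?A 0 (s(|regs := (regs s)(46 := 0)|))" using assms by simp
 have "real k * (\<tau> + 90 + real (cost (Var 45)) + 7) <= real k * (\<tau> + 110)"
  by (rule mult_left_mono) auto
 then show "real k * (\<tau> + 90 + real (cost (Var 45)) + 7) + real (cost (Var 45)) + 5 <= real k * (\<tau> + 110) + 20"
  by simp
 qed (use body \<tau> assms(9) in auto)
 then show ?thesis
 by (rule spec_conseq) (auto simp: lev')
qed

end

section \<open>Inserting and deleting a copy\<close>

text \<open>Register 30 holds the copy in transit and register 40 a vertex \<open>u\<close> of it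
  with the least load. If \<open>scan\<close> finds a copy of \<open>u\<close> that should go
  elsewhere, the copy in transit takes its place at \<open>u\<close> and the found one travels on.
  No load changes before the final \<open>raise\<close>.\<close>

definition insert_copy :: cmd where
 "insert_copy =
  Assign 50 (Var 30) ;; argmin_load ;; Assign 40 (Var 51) ;; Assign 41 (Lit 1) ;;
  While (Lit 0) (Var 41)
  (scan ;;
  Cond (Lit 0) (Var 41)
   (Assign 31 (Var 42) ;; Assign 32 (Var 43) ;; Assign 50 (Var 42) ;; detach ;;
   Assign 50 (Var 30) ;; Assign 55 (Var 40) ;; attach ;;
   Assign 30 (Var 31) ;; Assign 40 (Var 32)) Skip) ;;
  raise ;; Assign 50 (Var 30) ;; Assign 55 (Var 40) ;; attach"

text \<open>Register 40 is the vertex with the hole. A copy through it whose level is too high for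
  the reduced load fills the hole, and the former owner of that copy inherits it. Once there is no
  such copy, the load may drop.\<close>

definition delete_copy :: cmd where
 "delete_copy =
  Assign 50 (Var 30) ;; Assign 40 (Elem 50 (Var 30)) ;; detach ;; Assign 41 (Lit 1) ;;
  While (Lit 0) (Var 41)
  (find_steal ;;
  Cond (Lit 0) (Var 41)
   (Assign 31 (Elem 50 (Var 42)) ;; Assign 50 (Var 42) ;; detach ;;
   Assign 50 (Var 42) ;; Assign 55 (Var 40) ;; attach ;; Assign 40 (Var 31)) Skip) ;;
  lower"

lemma copy_frame [simp]:
 "lo insert_copy = 30" "wr insert_copy = {10, 12, 13, 14, 15, 16, 17, 18, 20, 21, 40, 41, 42, 43, 50, 51}" "pure insert_copy"
 "lo delete_copy = 31" "wr delete_copy = {10, 12, 13, 14, 16, 17, 18, 19, 20, 21, 40, 41, 42, 43, 50, 51}" "pure delete_copy"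
 by (auto simp: insert_copy_def delete_copy_def)

context hyper
begin

lemma raise_spec:
 assumes "rep s X {} Q1 Q2" "regs s 40 = u" "u < n" "card X < NX"
 and k: "regs s 44 = arrs s 42 u" "regs s 45 = min (4 * b) (arrs s 42 u)"
 and sc: "\<forall>x\<in>set (take (min (4 * b) (arrs s 42 u)) (Q1 u)). \<forall>v\<in>set (vs s x). arrs s 42 u + 1 <= threshold b (arrs s 42 v)"
 shows "spec W raise s (4 * real b * (220 * real R + 180) + 140) (%s'. \<exists>Q1 Q2. rep s' X {u} Q1 Q2)"
proof -
 note r = repD[OF assms(1)] and o = orientationD[OF repD(6)[OF assms(1)]]
 let ?L = "arrs s 42 u"
 let ?k = "min (4 * b) ?L"
 have len: "length (Q1 u) = ?L" using o(9)[OF assms(3)] o(11)[of u] by simp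
 have Lb: "?L <= NX" "?L + 1 < LM" "?L + 1 < bnd W" using load_bnd[OF assms(1,3)] LM_bnd LM_eq by auto
 let ?lev = "%x. if x \<in> set (take ?k (Q1 u)) then ?L + 1 else arrs s 51 x"
 let ?Q1 = "Q1(u := drop ?k (Q1 u) @ take ?k (Q1 u))"
 let ?s = "s(|regs := (regs s)(47 := ?L + 1)|)"
 let ?R = "Assign 60 (Var 40) ;; inc_load"
 have "spec W (cycle 14 refresh) ?s (real ?k * (220 * real R + 70 + 110) + 20) (%s'.
 lrep c 14 s' ?Q1 & brep c 10 s' (placement R LM X (vs ?s) ?lev) & arrs s' 51 = ?lev)"
 proof (rule cycle_spec[where g = "%_. ?L + 1" and l = "?L + 1"])
 fix s' x
 assume *: "par s'" "vs s' = vs ?s" "regs s' 50 = x" "x \<in> X" "regs s' 47 = ?L + 1"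
  "brep c 10 s' (placement R LM X (vs ?s) (arrs s' 51))" "arrs s' 51 x = arrs ?s 51 x"
 have "spec W refresh s' (220 * real R + 70) (%s''.
  brep c 10 s'' (placement R LM X (vs s') ((arrs s' 51)(x := ?L + 1))) & arrs s'' 51 = (arrs s' 51)(x := ?L + 1))"
  by (rule refresh_spec) (use * o(1,2) lev_bnd[OF assms(1) *(4)] Lb in auto)
 then show "spec W refresh s' (220 * real R + 70) (%s''.
  brep c 10 s'' (placement R LM X (vs ?s) ((arrs s' 51)(x := ?L + 1))) & arrs s'' 51 = (arrs s' 51)(x := ?L + 1))"
  unfolding *(2) .
 qed (use assms r o(6)[of u] len Lb b_bnd in auto)
 then have "spec W (cycle 14 refresh ;; ?R) ?s (4 * real b * (220 * real R + 180) + 130) (%s'. \<exists>Q1 Q2. rep s' X {u} Q1 Q2)"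
 proof (rule spec_seq[where V = 105])
 have slack: "y + 20 + 105 <= z + 130" if "y <= z" for y z :: real using that by simp
 show "real ?k * (220 * real R + 70 + 110) + 20 + 105 <= 4 * real b * (220 * real R + 180) + 130"
  by (rule slack, rule mult_mono) auto
 fix s1 assume s1: "lrep c 14 s1 ?Q1 & brep c 10 s1 (placement R LM X (vs ?s) ?lev) & arrs s1 51 = ?lev"
  and fr: "frame (cycle 14 refresh) ?s s1"
 note f = frameD(1,2)[OF fr]
 have p1: "par s1" using par_frame[OF fr] r(1) by simp
 let ?s2 = "s1(|regs := (regs s1)(60 := u)|)"
 have "spec W inc_load ?s2 100 (%s'. srep n s' & arrs s' 42 = (arrs ?s2 42)(u := arrs ?s2 42 u + 1))"
  by (rule inc_load_spec) (use r(2) srep_cong[of s1 s] assms(3) n_bnd Lb in \<open>auto simp: f\<close>)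
 then have "spec W inc_load ?s2 100 (%s'. \<exists>Q1 Q2. rep s' X {u} Q1 Q2)"
 proof (rule spec_conseq)
  fix s' assume s': "srep n s' & arrs s' 42 = (arrs ?s2 42)(u := arrs ?s2 42 u + 1)"
  and fr': "frame inc_load ?s2 s'"
  note f' = frameD(1,2)[OF fr']
  have v: "vs s' = vs s" by (rule verts_cong) (simp_all add: f f')
  have l: "arrs s' 42 = (arrs s 42)(u := ?L + 1)" using s' by (simp add: f)
  have lv: "arrs s' 51 = ?lev" using s1 by (simp add: f')
  have "rep s' X {u} ?Q1 Q2"
  unfolding rep_def
  proof (intro conjI)
  show "par s'" using par_frame[OF fr'] p1 by simp
  show "srep n s'" using s' by simp
  show "lrep c 14 s' ?Q1" using s1 lrep_cong[of s' 14 s1] by (simp add: f')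
  show "lrep c 18 s' Q2" using r(4) lrep_cong[of s' 18 s] by (simp add: f f')
  have "brep c 10 s1 (placement R LM X (vs s) ?lev)" using s1 by simp
  then show "brep c 10 s' (placement R LM X (vs s') (arrs s' 51))"
   unfolding v lv using brep_cong[of s' 10 s1] by (simp add: f')
  have "arrs s' 50 = arrs s 50" by (simp add: f f')
  then show "orientation n R NX X (vs s') (arrs s' 50) (arrs s' 42) {u} ?Q1 Q2"
   using orientation_raise[OF r(6) assms(3), of ?k] unfolding v l by simp
  show "leveled b X (vs s') (arrs s' 51) (arrs s' 42) ?Q1 Q2"
   unfolding v l lv
   by (rule leveled_raise[OF r(6,7) assms(3) _ refl b_pos _ refl]) (use sc in auto)
  show "card X + card {u} <= NX" using assms(4) by simp
  qed
  then show "\<exists>Q1 Q2. rep s' X {u} Q1 Q2" by blast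
 qed simp
 then show "spec W ?R s1 105 (%s'. \<exists>Q1 Q2. rep s' X {u} Q1 Q2)"
  using assms(2) by (auto simp: spec_assign_iff f elim!: spec_conseq)
 qed simp
 then show ?thesis
 unfolding raise_def using k Lb n_bnd by (subst spec_assign_iff) (auto elim!: spec_conseq)
qed

lemma lower_spec:
 assumes "rep s X H Q1 Q2" "regs s 40 = u" "u \<in> H"
 and sc: "\<forall>y\<in>X. u \<in> set (vs s y) --> arrs s 51 y <= threshold b (arrs s 42 u - 1)"
 shows "spec W lower s (4 * real b * (220 * real R + 190) + 160) (%s'. \<exists>Q1 Q2. rep s' X (H - {u}) Q1 Q2)"
proof -
 note r = repD[OF assms(1)] and o = orientationD[OF repD(6)[OF assms(1)]]
 have un: "u < n" using o(4) assms(3) by auto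
 let ?L = "arrs s 42 u"
 let ?k = "min (4 * b) (?L - 1)"
 have len: "?L = Suc (length (Q2 u))" using o(9)[OF un] o(12)[of u] assms(3) by simp
 have Lb: "?L <= NX" "?L < LM" "?L < bnd W" using load_bnd[OF assms(1) un] LM_bnd by auto
 let ?lev = "%x. if x \<in> set (take ?k (Q2 u)) then min (arrs s 51 x) (?L - 1) else arrs s 51 x"
 let ?Q2 = "Q2(u := drop ?k (Q2 u) @ take ?k (Q2 u))"
 let ?s = "s(|regs := (regs s)(47 := ?L - 1, 45 := ?k)|)"
 let ?R = "Assign 60 (Var 40) ;; dec_load"
 let ?C = "Cond (Var 47) (Elem 51 (Var 50)) refresh Skip"
 have "spec W (cycle 18 ?C) ?s (real ?k * (220 * real R + 80 + 110) + 20) (%s'.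
 lrep c 18 s' ?Q2 & brep c 10 s' (placement R LM X (vs ?s) ?lev) & arrs s' 51 = ?lev)"
 proof (rule cycle_spec[where g = "%l. min l (?L - 1)" and l = "?L - 1"])
 fix s' x
 assume *: "par s'" "vs s' = vs ?s" "regs s' 50 = x" "x \<in> X" "regs s' 47 = ?L - 1"
  "brep c 10 s' (placement R LM X (vs ?s) (arrs s' 51))" "arrs s' 51 x = arrs ?s 51 x"
 have xb: "x < NX" "x < bnd W" using o(1) *(4) incidence_lt(5)[of x] by auto
 have ref: "spec W refresh s' (220 * real R + 70) (%s''.
  brep c 10 s'' (placement R LM X (vs s') ((arrs s' 51)(x := ?L - 1))) & arrs s'' 51 = (arrs s' 51)(x := ?L - 1))"
  by (rule refresh_spec) (use * o(1,2) lev_bnd[OF assms(1) *(4)] Lb in auto)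
 let ?P = "%s''. brep c 10 s'' (placement R LM X (vs ?s) ((arrs s' 51)(x := min (arrs ?s 51 x) (?L - 1)))) &
  arrs s'' 51 = (arrs s' 51)(x := min (arrs ?s 51 x) (?L - 1))"
 show "spec W ?C s' (220 * real R + 80) ?P"
 proof (rule spec_cond[where ?T1.0 = "220 * real R + 70"])
  assume "ev W s' (Var 47) < ev W s' (Elem 51 (Var 50))"
  then have "min (arrs ?s 51 x) (?L - 1) = ?L - 1" using * by simp
  then show "spec W refresh s' (220 * real R + 70) ?P" using ref unfolding *(2) by simp
 next
  assume "\<not> ev W s' (Var 47) < ev W s' (Elem 51 (Var 50))"
  then have "(arrs s' 51)(x := min (arrs ?s 51 x) (?L - 1)) = arrs s' 51" using * by auto
  then show "spec W Skip s' (220 * real R + 70) ?P" using *(6) unfolding spec_def by simp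
 qed (use * xb n_bnd in auto)
 qed (use assms r o(8)[of u] len Lb b_bnd un in auto)
 then have "spec W (cycle 18 ?C ;; ?R) ?s (4 * real b * (220 * real R + 190) + 130) (%s'. \<exists>Q1 Q2. rep s' X (H - {u}) Q1 Q2)"
 proof (rule spec_seq[where V = 105])
 have slack: "y + 20 + 105 <= z + 130" if "y <= z" for y z :: real using that by simp
 show "real ?k * (220 * real R + 80 + 110) + 20 + 105 <= 4 * real b * (220 * real R + 190) + 130"
  by (rule slack, rule mult_mono) auto
 fix s1 assume s1: "lrep c 18 s1 ?Q2 & brep c 10 s1 (placement R LM X (vs ?s) ?lev) & arrs s1 51 = ?lev"
  and fr: "frame (cycle 18 ?C) ?s s1"
 note f = frameD(1,2)[OF fr]
 have p1: "par s1" using par_frame[OF fr] r(1) by simp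
 let ?s2 = "s1(|regs := (regs s1)(60 := u)|)"
 have "spec W dec_load ?s2 100 (%s'. srep n s' & arrs s' 42 = (arrs ?s2 42)(u := arrs ?s2 42 u - 1))"
  by (rule dec_load_spec) (use r(2) srep_cong[of s1 s] un n_bnd Lb len in \<open>auto simp: f\<close>)
 then have "spec W dec_load ?s2 100 (%s'. \<exists>Q1 Q2. rep s' X (H - {u}) Q1 Q2)"
 proof (rule spec_conseq)
  fix s' assume s': "srep n s' & arrs s' 42 = (arrs ?s2 42)(u := arrs ?s2 42 u - 1)"
  and fr': "frame dec_load ?s2 s'"
  note f' = frameD(1,2)[OF fr']
  have v: "vs s' = vs s" by (rule verts_cong) (simp_all add: f f')
  have l: "arrs s' 42 = (arrs s 42)(u := ?L - 1)" using s' by (simp add: f)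
  have lv: "arrs s' 51 = ?lev" using s1 by (simp add: f')
  have "rep s' X (H - {u}) Q1 ?Q2"
  unfolding rep_def
  proof (intro conjI)
  show "par s'" using par_frame[OF fr'] p1 by simp
  show "srep n s'" using s' by simp
  show "lrep c 18 s' ?Q2" using s1 lrep_cong[of s' 18 s1] by (simp add: f')
  show "lrep c 14 s' Q1" using r(3) lrep_cong[of s' 14 s] by (simp add: f f')
  have "brep c 10 s1 (placement R LM X (vs s) ?lev)" using s1 by simp
  then show "brep c 10 s' (placement R LM X (vs s') (arrs s' 51))"
   unfolding v lv using brep_cong[of s' 10 s1] by (simp add: f')
  have "arrs s' 50 = arrs s 50" by (simp add: f f')
  then show "orientation n R NX X (vs s') (arrs s' 50) (arrs s' 42) (H - {u}) Q1 ?Q2"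
   using orientation_lower[OF r(6) assms(3), of ?k] unfolding v l by simp
  show "leveled b X (vs s') (arrs s' 51) (arrs s' 42) Q1 ?Q2"
   unfolding v l lv
   by (rule leveled_lower[OF r(6,7) assms(3) refl b_pos _ refl]) (use sc in auto)
  have "card (H - {u}) <= card H" using o(4) finite_subset[of H "{..<n}"] by (intro card_mono) auto
  then show "card X + card (H - {u}) <= NX" using r(8) by simp
  qed
  then show "\<exists>Q1 Q2. rep s' X (H - {u}) Q1 Q2" by blast
 qed simp
 then show "spec W ?R s1 105 (%s'. \<exists>Q1 Q2. rep s' X (H - {u}) Q1 Q2)"
  using assms(2) by (auto simp: spec_assign_iff f elim!: spec_conseq)
 qed simp
 note main = this
 let ?s0 = "s(|regs := (regs s)(47 := ?L - 1)|)"
 have "spec W (Cond (Lit 4 \<boxtimes> Var 2) (Var 47) (Assign 45 (Lit 4 \<boxtimes> Var 2)) (Assign 45 (Var 47)) ;; cycle 18 ?C ;; ?R)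
  ?s0 (4 * real b * (220 * real R + 190) + 150) (%s'. \<exists>Q1 Q2. rep s' X (H - {u}) Q1 Q2)"
 proof (rule spec_seq)
 show "spec W (Cond (Lit 4 \<boxtimes> Var 2) (Var 47) (Assign 45 (Lit 4 \<boxtimes> Var 2)) (Assign 45 (Var 47)))
  ?s0 12 (%s'. s' = s(|regs := (regs s)(47 := ?L - 1, 45 := ?k)|))"
  using parD[OF r(1)] b_bnd unfolding spec_def by (simp add: min_def)
 fix s' assume "s' = s(|regs := (regs s)(47 := ?L - 1, 45 := ?k)|)"
 then show "spec W (cycle 18 ?C ;; ?R) s' (4 * real b * (220 * real R + 190) + 130) (%s'. \<exists>Q1 Q2. rep s' X (H - {u}) Q1 Q2)"
  using main by simp
 qed simp_all
 then show ?thesis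
 unfolding lower_def using assms(2) un n_bnd len by (subst spec_assign_iff) (auto elim!: spec_conseq)
qed

text \<open>The value of \<open>\<Lambda>\<close> in \<open>edge_size_real\<close> for at most
  \<open>NX\<close> copies.\<close>

definition Lam :: real where
 "Lam = 4 * real NX / real R + 6 + real b"

text \<open>5600 is the product of 1400 from \<open>\<kappa>\<close> in the analysis of the chain
  and 4 from \<open>potential\<close>. The second summand covers the final refresh and the constant
  number of other moves.\<close>

definition ins_time :: real where
 "ins_time = 5600 * real b * real b * real R * ln (1 + Lam / real b) + 5000 * real b * real R"

text \<open>The leading coefficient is a cost of \<open>1000 * R\<close> per step times
  \<open>4 * b\<close> steps per unit of the logarithm. A step has no further factor
  \<open>b\<close>, because a deletion scans no queue before its end.\<close>

definition del_time :: real where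
 "del_time = 4000 * real b * real R * ln ((real NX + 2 * real b) / (2 * real b)) + 5000 * real b * real R"

lemma Lam_pos: "0 < Lam"
 unfolding Lam_def using b_pos by (intro add_nonneg_pos) auto

lemma size_bound:
 assumes "rep s X {} Q1 Q2" "card X < NX" "valid n R ys" "\<And>v. v \<in> set ys ==> L <= 4 * arrs s 42 v + 6"
 shows "real (length ys) <= 2 * real R * Lam / (real L + real b + Lam)"
proof (rule edge_size_real[where M = NX])
 show "length ys * L <= 4 * NX + 6 * R"
 using edge_size[OF repD(6)[OF assms(1)] assms(3,4)] assms(2) by simp
qed (use assms(3) b_pos R_pos Lam_def in \<open>auto simp: valid_def\<close>)

text \<open>A round at load \<open>L\<close> costs order \<open>b * S L\<close>, where
  \<open>S L\<close> bounds the size of every copy involved, and the next load \<open>L'\<close>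
  satisfies \<open>threshold b L' <= L\<close>. By \<open>potential_step\<close> the potential drops
  by at least \<open>S L\<close>, so the costs telescope.\<close>

lemma insert_copy_spec:
 assumes rep0: "rep s0 X {} Q1 Q2" and x0: "regs s0 30 = x" "x < NX" "x \<notin> X" "valid n R (vs s0 x)"
 shows "spec W insert_copy s0 ins_time (%s'. \<exists>Q1 Q2. rep s' (insert x X) {} Q1 Q2)"
proof -
 let ?vs = "vs s0"
 define S where "S = (%L. 2 * real R * Lam / (real L + real b + Lam))"
 let ?\<phi> = "%L. potential b R Lam (real L)"
 \<comment> \<open>Of the 1400, the scan takes 640 and the exchange of copies at most 660; the rest
   covers constants, as \<open>b\<close> and \<open>S L\<close> are at least 1.\<close>
 define \<kappa> where "\<kappa> = 1400 * real b"
 have b1: "1 <= real b" "1 <= real R" using b_pos R_pos by auto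
 define Inv where "Inv = (%s. \<exists>Y Q1 Q2. rep s Y {} Q1 Q2 & regs s 30 < NX & regs s 30 \<notin> Y &
  insert (regs s 30) Y = insert x X & vs s = ?vs & valid n R (?vs (regs s 30)) &
  regs s 40 \<in> set (?vs (regs s 30)) & (\<forall>v\<in>set (?vs (regs s 30)). arrs s 42 (regs s 40) <= arrs s 42 v) &
  (regs s 41 = 1 \<or> regs s 41 = 0 & regs s 44 = arrs s 42 (regs s 40) &
  regs s 45 = min (4 * b) (arrs s 42 (regs s 40)) &
  (\<forall>x\<in>set (take (min (4 * b) (arrs s 42 (regs s 40))) (Q1 (regs s 40))). \<forall>v\<in>set (?vs x).
   arrs s 42 (regs s 40) + 1 <= threshold b (arrs s 42 v))))"
 \<comment> \<open>The last scan finds nothing and lowers no potential.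
   \<open>2 * \<kappa> * R\<close> is set aside for it, since \<open>S L <= 2 * R\<close>.\<close>
 define f where "f = (%s :: store. if regs s 41 = 1 then \<kappa> * ?\<phi> (arrs s 42 (regs s 40)) + 2 * \<kappa> * real R + 10 else (10 :: real))"
 have \<phi>0: "0 <= ?\<phi> L" for L by (rule potential_bounds) (use b_pos Lam_pos in auto)
 have S2: "S L <= 2 * real R" "0 < S L" for L
 proof -
 have "2 * real R * Lam <= 2 * real R * (real L + real b + Lam)" by (intro mult_left_mono) auto
 then show "S L <= 2 * real R" unfolding S_def using Lam_pos b_pos by (simp add: field_simps)
 show "0 < S L" unfolding S_def using Lam_pos b_pos R_pos by (simp add: add_pos_pos)
 qed
 have cardY: "card Y < NX" if "rep s Y {} Q1 Q2" "z < NX" "z \<notin> Y" for s Y Q1 Q2 z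
 proof -
 have "Y \<subseteq> {..<NX} - {z}" using orientationD(1)[OF repD(6)[OF that(1)]] that by auto
 then have "card Y <= card ({..<NX} - {z})" by (intro card_mono) auto
 then show ?thesis using that(2) by simp
 qed
 let ?swap = "Assign 31 (Var 42) ;; Assign 32 (Var 43) ;; Assign 50 (Var 42) ;; detach ;;
   Assign 50 (Var 30) ;; Assign 55 (Var 40) ;; attach ;; Assign 30 (Var 31) ;; Assign 40 (Var 32)"
 let ?body = "scan ;; Cond (Lit 0) (Var 41) ?swap Skip"
 have step: "\<exists>T\<ge>0. spec W ?body s T (%s'. Inv s' & f s' + T + real (cost (Lit 0) + cost (Var 41) + 2) <= f s)"
 if I: "Inv s" and nz: "ev W s (Lit 0) < ev W s (Var 41)" for s :: store
 proof -
 obtain Y P1 P2 where Y: "rep s Y {} P1 P2" "regs s 30 < NX" "regs s 30 \<notin> Y"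
  "insert (regs s 30) Y = insert x X" "vs s = ?vs" "valid n R (?vs (regs s 30))"
  "regs s 40 \<in> set (?vs (regs s 30))" "\<And>v. v \<in> set (?vs (regs s 30)) ==> arrs s 42 (regs s 40) <= arrs s 42 v"
  "regs s 41 = 1"
  using I nz unfolding Inv_def by auto
 note r = repD[OF Y(1)] and o = orientationD[OF repD(6)[OF Y(1)]]
 let ?z = "regs s 30" and ?u = "regs s 40"
 let ?L = "arrs s 42 ?u"
 note cY = cardY[OF Y(1-3)]
 have un: "?u < n" using Y(6,7) unfolding valid_def by auto
 \<comment> \<open>The size bound applies to the copy in transit because register 40 is a least
   loaded vertex of it, and to the copies of \<open>u\<close> by
   \<open>scanned_load\<close>.\<close>
 have zS: "real (length (?vs ?z)) <= S ?L"
  unfolding S_def by (rule size_bound[OF Y(1) cY Y(6)]) (use Y(8) in \<open>fastforce intro: trans_le_add1\<close>)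
 have yS: "real (length (?vs y)) <= S ?L" if "y \<in> Y" "arrs s 50 y = ?u" for y
  unfolding S_def
 proof (rule size_bound[OF Y(1) cY])
  show "valid n R (?vs y)" using o(2)[OF that(1)] Y(5) by simp
  fix v assume "v \<in> set (?vs y)"
  then show "?L <= 4 * arrs s 42 v + 6"
  using scanned_load[OF r(6,7) that(1) _ b_pos, of v] that(2) Y(5) by simp
 qed
 have "1 <= length (?vs ?z)" using Y(6) unfolding valid_def by (cases "?vs ?z") auto
 then have S1: "1 <= S ?L" using zS by linarith
 \<comment> \<open>\<open>scan_spec\<close> expects a natural number; rounding down is sound because
   sizes are integers.\<close>
 define M where "M = nat \<lfloor>S ?L\<rfloor>"
 have M: "real M <= S ?L" unfolding M_def using S1 by simp
 have size_M: "length (vs s y) <= M" if "y \<in> Y" "arrs s 50 y = ?u" for y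
  using yS[OF that] Y(5) unfolding M_def by (simp add: le_nat_floor)
 define T where "T = \<kappa> * S ?L - 4"
 have Tbound: "4 * real b * (50 * real M + 110) + 60 + (660 * S ?L) <= T"
 proof -
  have "50 * real M + 110 <= 160 * S ?L" using M S1 by linarith
  then have "4 * real b * (50 * real M + 110) <= 4 * real b * (160 * S ?L)" by (rule mult_left_mono) simp
  then have "4 * real b * (50 * real M + 110) <= 640 * (real b * S ?L)" by simp
  moreover have "1 * S ?L <= real b * S ?L" using b1 S1 by (intro mult_right_mono) auto
  moreover have "\<kappa> * S ?L = 1400 * (real b * S ?L)" unfolding \<kappa>_def by simp
  ultimately show ?thesis using S1 unfolding T_def by linarith
 qed
 have T0: "0 <= T" using Tbound S1 by (smt (verit) mult_nonneg_nonneg of_nat_0_le_iff)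
 let ?Post = "%s'. Inv s' & f s' + T + real (cost (Lit 0) + cost (Var 41) + 2) <= f s"
 have fs: "f s = \<kappa> * ?\<phi> ?L + 2 * \<kappa> * real R + 10" unfolding f_def using Y(9) by simp
 have "\<kappa> * S ?L <= \<kappa> * (2 * real R)" using S2 b1 unfolding \<kappa>_def by (intro mult_left_mono) auto
 moreover have "0 <= \<kappa> * ?\<phi> ?L" using \<phi>0 unfolding \<kappa>_def by simp
 ultimately have f_stop: "10 + T + 4 <= f s" unfolding fs T_def by simp
 have f_go: "\<kappa> * ?\<phi> L' + 2 * \<kappa> * real R + 10 + T + 4 <= f s" if "threshold b L' <= ?L" for L'
 proof -
  have "?\<phi> L' + S ?L <= ?\<phi> ?L" unfolding S_def by (rule potential_step[OF b_pos Lam_pos that])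
  then have "\<kappa> * (?\<phi> L' + S ?L) <= \<kappa> * ?\<phi> ?L" unfolding \<kappa>_def by (intro mult_left_mono) auto
  then show ?thesis unfolding fs T_def by (simp add: algebra_simps)
 qed
 have "spec W ?body s T ?Post"
 proof (rule spec_seq[OF scan_spec[OF Y(1) refl un size_M], where V = "660 * S ?L"])
  fix s1
  assume "regs s1 44 = ?L & regs s1 45 = min (4 * b) ?L &
  (regs s1 41 = 0 & (\<forall>x\<in>set (take (min (4 * b) ?L) (P1 ?u)). \<forall>v\<in>set (vs s x). ?L + 1 <= threshold b (arrs s 42 v)) \<or>
   regs s1 41 = 1 & regs s1 42 \<in> Y & arrs s 50 (regs s1 42) = ?u & regs s1 43 \<in> set (vs s (regs s1 42)) &
   (\<forall>v\<in>set (vs s (regs s1 42)). arrs s 42 (regs s1 43) <= arrs s 42 v) & threshold b (arrs s 42 (regs s1 43)) <= ?L)"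
  and fr: "frame scan s s1"
  note sc = this(1)[unfolded Y(5)]
  note fs1 = frameD(1,2)[OF fr]
  have a1: "arrs s1 = arrs s" by (intro ext) (simp add: fs1)
  have rep1: "rep s1 Y {} P1 P2" by (rule rep_cong[OF Y(1) fr]) auto
  have v1: "vs s1 = ?vs" unfolding Y(5)[symmetric] by (rule verts_cong) (simp_all add: a1)
  have r1: "regs s1 30 = ?z" "regs s1 40 = ?u" by (simp_all add: fs1)
  show "spec W (Cond (Lit 0) (Var 41) ?swap Skip) s1 (660 * S ?L) ?Post"
  proof (rule spec_cond[where ?T1.0 = "655 * S ?L"])
  assume "\<not> ev W s1 (Lit 0) < ev W s1 (Var 41)"
  then have "regs s1 41 = 0" by simp
  then have "Inv s1" unfolding Inv_def using rep1 v1 r1 Y sc a1 by (intro exI[of _ Y] exI[of _ P1] exI[of _ P2]) simp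
  moreover have "f s1 + T + 4 <= f s" using f_stop \<open>regs s1 41 = 0\<close> unfolding f_def by simp
  ultimately show "spec W Skip s1 (655 * S ?L) ?Post" using S1 unfolding spec_def by simp
  next
  assume "ev W s1 (Lit 0) < ev W s1 (Var 41)"
  then have y: "regs s1 41 = 1" "regs s1 42 \<in> Y" "arrs s 50 (regs s1 42) = ?u" "regs s1 43 \<in> set (?vs (regs s1 42))"
   "\<And>v. v \<in> set (?vs (regs s1 42)) ==> arrs s 42 (regs s1 43) <= arrs s 42 v"
   "threshold b (arrs s 42 (regs s1 43)) <= ?L" using sc by auto
  let ?y = "regs s1 42" and ?v = "regs s1 43"
  let ?s2 = "s1(|regs := (regs s1)(31 := ?y, 32 := ?v, 50 := ?y)|)"
  have yv: "valid n R (?vs ?y)" "?y < NX" using o(1,2) y(2) Y(5) by auto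
  have rep2: "rep ?s2 Y {} P1 P2" using rep1 by simp
  let ?rest = "Assign 50 (Var 30) ;; Assign 55 (Var 40) ;; attach ;; Assign 30 (Var 31) ;; Assign 40 (Var 32)"
  have "spec W detach ?s2 (120 * real (length (vs ?s2 ?y)) + 210)
   (%s'. \<exists>Q1 Q2. rep s' (Y - {?y}) (insert (arrs ?s2 50 ?y) {}) Q1 Q2)"
   by (rule detach_spec[OF rep2]) (use y in auto)
  then have "spec W (detach ;; ?rest) ?s2 (640 * S ?L) ?Post"
  proof (rule spec_seq[where V = "300 * S ?L"])
   show "120 * real (length (vs ?s2 ?y)) + 210 + 300 * S ?L <= 640 * S ?L"
   using yS[OF y(2,3)] S1 v1 by simp
   fix s3 assume s3: "\<exists>Q1 Q2. rep s3 (Y - {?y}) (insert (arrs ?s2 50 ?y) {}) Q1 Q2"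
   and fr3: "frame detach ?s2 s3"
   obtain P3 P4 where P3: "rep s3 (Y - {?y}) {?u} P3 P4" using s3 y(3) a1 by auto
   note f3 = frameD(1,2)[OF fr3]
   have a3: "arrs s3 42 = arrs s 42" "arrs s3 50 = arrs s 50" by (simp_all add: f3 a1)
   have v3: "vs s3 = ?vs" using verts_cong[of s3 s1] v1 by (simp add: f3)
   let ?s4 = "s3(|regs := (regs s3)(50 := ?z, 55 := ?u)|)"
   have rep4: "rep ?s4 (Y - {?y}) {?u} P3 P4" using P3 by simp
   have "spec W attach ?s4 (100 * real (length (vs ?s4 ?z)) + 180)
   (%s'. (\<exists>Q1 Q2. rep s' (insert ?z (Y - {?y})) ({?u} - {?u}) Q1 Q2) & arrs s' 50 = (arrs ?s4 50)(?z := ?u))"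
   proof (rule attach_spec[OF rep4])
   fix w assume "w \<in> set (vs ?s4 ?z)"
   then have "?L <= arrs s 42 w" using Y(8) v3 by simp
   then show "arrs ?s4 42 ?u <= threshold b (arrs ?s4 42 w)"
    using a3 unfolding threshold_def by simp
   qed (use Y v3 in auto)
   then have "spec W attach ?s4 (100 * real (length (vs ?s4 ?z)) + 180)
   (%s'. (\<exists>Q1 Q2. rep s' (insert ?z (Y - {?y})) {} Q1 Q2))"
   by (rule spec_conseq) auto
   then have "spec W (attach ;; Assign 30 (Var 31) ;; Assign 40 (Var 32)) ?s4 (290 * S ?L) ?Post"
   proof (rule spec_seq[where V = 5])
   show "100 * real (length (vs ?s4 ?z)) + 180 + 5 <= 290 * S ?L" using zS S1 v3 by simp
   fix s5 assume s5: "\<exists>Q1 Q2. rep s5 (insert ?z (Y - {?y})) {} Q1 Q2" and fr5: "frame attach ?s4 s5"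
   obtain P5 P6 where P5: "rep s5 (insert ?z (Y - {?y})) {} P5 P6" using s5 by blast
   note f5 = frameD(1,2)[OF fr5]
   have a5: "arrs s5 42 = arrs s 42" using a3 by (simp add: f5)
   have v5: "vs s5 = ?vs" using verts_cong[of s5 s3] v3 by (simp add: f5)
   have r5: "regs s5 31 = ?y" "regs s5 32 = ?v" "regs s5 41 = 1" using y(1) by (simp_all add: f5 f3)
   let ?s6 = "s5(|regs := (regs s5)(30 := ?y, 40 := ?v)|)"
   have "Inv ?s6"
    unfolding Inv_def
   proof (intro exI conjI)
    show "rep ?s6 (insert ?z (Y - {?y})) {} P5 P6" using P5 by simp
    show "regs ?s6 30 \<notin> insert ?z (Y - {?y})" using y(2) Y(3) by auto
    show "insert (regs ?s6 30) (insert ?z (Y - {?y})) = insert x X" using y(2) Y(4) by auto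
   qed (use y yv v5 a5 r5 in auto)
   moreover have "f ?s6 + T + 4 <= f s"
    using f_go[OF y(6)] a5 r5 unfolding f_def by simp
   ultimately show "spec W (Assign 30 (Var 31) ;; Assign 40 (Var 32)) s5 5 ?Post"
    using r5 unfolding spec_def by simp
   qed simp
   then show "spec W ?rest s3 (300 * S ?L) ?Post"
   using r1 S1 by (subst spec_assign_iff, subst spec_assign_iff) (auto simp: f3 elim!: spec_conseq)
  qed (use S1 in auto)
  then show "spec W ?swap s1 (655 * S ?L) ?Post"
   using S1 by (subst spec_assign_iff, subst spec_assign_iff, subst spec_assign_iff) (auto elim!: spec_conseq)
  qed (use S1 n_bnd in auto)
 qed (use Tbound S1 in auto)
 then show ?thesis using T0 by blast
 qed
 have loop: "spec W (While (Lit 0) (Var 41) ?body) s (f s) (%s'. Inv s' & \<not> ev W s' (Lit 0) < ev W s' (Var 41))"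
 if "Inv s" for s
 proof (rule spec_while[OF that _ step])
 fix s :: store
 have "0 <= \<kappa> * ?\<phi> (arrs s 42 (regs s 40)) + 2 * \<kappa> * real R" using \<phi>0 unfolding \<kappa>_def by simp
 then show "ok W s (Lit 0) & ok W s (Var 41) & real (cost (Lit 0) + cost (Var 41) + 2) <= f s"
  using n_bnd unfolding f_def by simp
 qed auto
 let ?fin = "Assign 50 (Var 30) ;; Assign 55 (Var 40) ;; attach"
 let ?Q = "%s'. \<exists>Q1 Q2. rep s' (insert x X) {} Q1 Q2"
 have final: "spec W (raise ;; ?fin) s (880 * real b * real R + 720 * real b + 140 + 100 * real R + 190) ?Q"
 if I: "Inv s" and z: "\<not> ev W s (Lit 0) < ev W s (Var 41)" for s
 proof -
 let ?z = "regs s 30" and ?u = "regs s 40"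
 let ?L = "arrs s 42 ?u"
 obtain Y P1 P2 where Y: "rep s Y {} P1 P2" "?z < NX" "?z \<notin> Y"
  "insert ?z Y = insert x X" "vs s = ?vs" "valid n R (?vs ?z)"
  "?u \<in> set (?vs ?z)" "\<And>v. v \<in> set (?vs ?z) ==> ?L <= arrs s 42 v"
  "regs s 44 = ?L" "regs s 45 = min (4 * b) ?L"
  "\<forall>x\<in>set (take (min (4 * b) ?L) (P1 ?u)). \<forall>v\<in>set (?vs x). ?L + 1 <= threshold b (arrs s 42 v)"
  using I z unfolding Inv_def by auto
 have un: "?u < n" using Y(6,7) unfolding valid_def by auto
 have "spec W raise s (4 * real b * (220 * real R + 180) + 140) (%s'. \<exists>Q1 Q2. rep s' Y {?u} Q1 Q2)"
  by (rule raise_spec[OF Y(1) refl un cardY[OF Y(1-3)]]) (use Y in auto)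
 then show ?thesis
 proof (rule spec_seq[where V = "100 * real R + 190"])
  show "4 * real b * (220 * real R + 180) + 140 + (100 * real R + 190) \<le>
  880 * real b * real R + 720 * real b + 140 + 100 * real R + 190" by (simp add: algebra_simps)
  fix s1 assume "\<exists>Q1 Q2. rep s1 Y {?u} Q1 Q2" and fr: "frame raise s s1"
  then obtain P3 P4 where P3: "rep s1 Y {?u} P3 P4" by blast
  note fs1 = frameD(1,2)[OF fr]
  have v1: "vs s1 = ?vs" using verts_cong[of s1 s] Y(5) by (simp add: fs1)
  \<comment> \<open>\<open>raise\<close> writes to the array of loads, so the new loads are
    recovered by counting owned copies: that of \<open>u\<close> has grown by its hole and the
    others are as before.\<close>
  have l1: "arrs s1 42 v = ?L + (if v = ?u then 1 else 0) \<or> ?L <= arrs s1 42 v & v \<noteq> ?u" if "v \<in> set (?vs ?z)" for v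
  proof -
  have vn: "v < n" using that Y(6) unfolding valid_def by auto
  have "{x \<in> Y. arrs s1 50 x = v} = {x \<in> Y. arrs s 50 x = v}" by (simp add: fs1)
  then show ?thesis
   using orientationD(9)[OF repD(6)[OF P3] vn] orientationD(9)[OF repD(6)[OF Y(1)] vn] Y(8)[OF that] by auto
  qed
  let ?s2 = "s1(|regs := (regs s1)(50 := ?z, 55 := ?u)|)"
  have "spec W attach ?s2 (100 * real (length (vs ?s2 ?z)) + 180)
  (%s'. (\<exists>Q1 Q2. rep s' (insert ?z Y) ({?u} - {?u}) Q1 Q2) & arrs s' 50 = (arrs ?s2 50)(?z := ?u))"
  proof (rule attach_spec)
  show "rep ?s2 Y {?u} P3 P4" using P3 by simp
  fix w assume "w \<in> set (vs ?s2 ?z)"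
  then show "arrs ?s2 42 ?u <= threshold b (arrs ?s2 42 w)"
   using l1[of w] l1[of ?u] Y(7) v1 unfolding threshold_def by auto
  qed (use Y v1 in auto)
  moreover have "length (vs ?s2 ?z) <= R" using Y(6) v1 unfolding valid_def by simp
  ultimately have "spec W attach ?s2 (100 * real R + 180) ?Q"
  by (auto elim!: spec_conseq simp: Y(4))
  then show "spec W ?fin s1 (100 * real R + 190) ?Q"
  by (subst spec_assign_iff, subst spec_assign_iff) (auto simp: fs1 elim!: spec_conseq)
 qed simp
 qed
 have pre: "spec W (Assign 50 (Var 30) ;; argmin_load ;; Assign 40 (Var 51) ;; Assign 41 (Lit 1) ;; C) s0 (T + 50 * real R + 60) ?Q"
 if C: "\<And>s. Inv s ==> regs s 41 = 1 ==> spec W C s T ?Q" and T: "0 <= T" for C T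
 proof -
 let ?s = "s0(|regs := (regs s0)(50 := x)|)"
 have "spec W argmin_load ?s (50 * real (length (vs ?s x)) + 50) (%s'. regs s' 51 \<in> set (vs ?s x) &
  (\<forall>v\<in>set (vs ?s x). arrs ?s 42 (regs s' 51) <= arrs ?s 42 v))"
  by (rule argmin_load_spec) (use repD(1)[OF rep0] x0 in auto)
 then have "spec W (argmin_load ;; Assign 40 (Var 51) ;; Assign 41 (Lit 1) ;; C) ?s (T + 50 * real R + 55) ?Q"
 proof (rule spec_seq[where V = "T + 4"])
  show "50 * real (length (vs ?s x)) + 50 + (T + 4) <= T + 50 * real R + 55"
  using x0(4) unfolding valid_def by simp
  fix s1 assume m: "regs s1 51 \<in> set (vs ?s x) & (\<forall>v\<in>set (vs ?s x). arrs ?s 42 (regs s1 51) <= arrs ?s 42 v)"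
  and fr: "frame argmin_load ?s s1"
  note f1 = frameD(1,2)[OF fr]
  have a1: "arrs s1 = arrs s0" by (intro ext) (simp add: f1)
  have rep1: "rep s1 X {} Q1 Q2" by (rule rep_cong[of ?s _ _ _ _ argmin_load]) (use rep0 fr in auto)
  have v1: "vs s1 = ?vs" by (rule verts_cong) (simp_all add: a1)
  let ?s2 = "s1(|regs := (regs s1)(40 := regs s1 51, 41 := 1)|)"
  have "Inv ?s2"
  unfolding Inv_def
  by (intro exI[of _ X] exI[of _ Q1] exI[of _ Q2]) (use rep1 x0 v1 m a1 in \<open>simp add: f1\<close>)
  from C[OF this] show "spec W (Assign 40 (Var 51) ;; Assign 41 (Lit 1) ;; C) s1 (T + 4) ?Q"
  using n_bnd T by (simp add: spec_assign_iff)
 qed (use T in simp)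
 then show ?thesis using x0(1) T by (subst spec_assign_iff) (auto elim!: spec_conseq)
 qed
 let ?l = "4 * real b * real R * ln (1 + Lam / real b)"
 have l0: "0 <= ?l" using Lam_pos b_pos by simp
 let ?T1 = "\<kappa> * ?l + 2 * \<kappa> * real R + 10"
 let ?T2 = "880 * real b * real R + 720 * real b + 140 + 100 * real R + 190"
 have "0 <= \<kappa>" unfolding \<kappa>_def by simp
 then have k0: "0 <= \<kappa> * ?l" "0 <= \<kappa> * real R"
 by (rule mult_nonneg_nonneg[OF _ l0], rule mult_nonneg_nonneg) auto
 have "spec W insert_copy s0 (?T1 + ?T2 + 50 * real R + 60) ?Q"
 unfolding insert_copy_def
 proof (rule pre)
 fix s assume I: "Inv s" "regs s 41 = 1"
 have "f s <= ?T1"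
 proof -
  have "?\<phi> (arrs s 42 (regs s 40)) <= ?l" by (rule potential_bounds) (use b_pos Lam_pos in auto)
  then have "\<kappa> * ?\<phi> (arrs s 42 (regs s 40)) <= \<kappa> * ?l" unfolding \<kappa>_def by (intro mult_left_mono) auto
  then show ?thesis using I(2) unfolding f_def by simp
 qed
 then show "spec W (While (Lit 0) (Var 41) ?body ;; raise ;; ?fin) s (?T1 + ?T2) ?Q"
  by (intro spec_seq[OF loop[OF I(1)], where V = ?T2] final) auto
 qed (use k0 in simp)
 then show ?thesis
 proof (rule spec_conseq)
 have "1 * real R <= real b * real R" "real b * 1 <= real b * real R" "1 * 1 <= real b * real R"
  using b1 by (intro mult_mono; simp)+
 moreover have e1: "\<kappa> * ?l = 5600 * real b * real b * real R * ln (1 + Lam / real b)" unfolding \<kappa>_def by simp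
 moreover have e2: "2 * \<kappa> * real R = 2800 * (real b * real R)" unfolding \<kappa>_def by simp
 ultimately show "?T1 + ?T2 + 50 * real R + 60 <= ins_time" unfolding ins_time_def e1 e2 by linarith
 qed
qed

text \<open>A round costs order \<open>R\<close>, so only the length of the chain matters. By
  \<open>chain_up\<close> the quantity \<open>L + 2 * b\<close> grows in each round by the factor
  \<open>1 + 1 / (2 * b)\<close>, while loads stay at most \<open>NX\<close>; \<open>\<psi>\<close>
  bounds the rounds that remain.\<close>

lemma delete_copy_spec:
 assumes rep0: "rep s0 X {} Q1 Q2" and x0: "regs s0 30 = x" "x \<in> X"
 shows "spec W delete_copy s0 del_time (%s'. \<exists>Q1 Q2. rep s' (X - {x}) {} Q1 Q2)"
proof -
 let ?vs = "vs s0"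
 let ?Y = "X - {x}"
 let ?B = "2 * real b"
 define \<psi> where "\<psi> = (%L :: nat. 2 * ?B * ln ((real NX + ?B) / (real L + ?B)))"
 define \<tau> where "\<tau> = 1000 * real R"
 have b1: "1 <= real b" "1 <= real R" using b_pos R_pos by auto
 have \<psi>_step: "\<psi> L' + 1 <= \<psi> L" if "real L + real L / ?B + 1 <= real L'" for L L'
 proof -
 have "(real L + ?B) * (1 + 1 / ?B) = real L + real L / ?B + 1 + ?B"
  using b1 by (simp add: field_simps)
 then have *: "(real L + ?B) * (1 + 1 / ?B) <= real L' + ?B" using that by linarith
 have pos: "0 < real L + ?B" "0 < real L' + ?B" "0 < real NX + ?B" "0 < 1 + 1 / ?B"
  using b1 by (auto simp: add_nonneg_pos add_pos_nonneg)
 let ?z = "1 / ?B"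
 have "1 - inverse (1 + ?z) <= ln (1 + ?z)"
  using ln_le_minus_one[of "inverse (1 + ?z)"] pos by (simp add: ln_inverse)
 moreover have "1 / (2 * ?B) <= 1 - inverse (1 + ?z)" using b1 by (simp add: field_simps)
 ultimately have "1 / (2 * ?B) <= ln (1 + ?z)" by linarith
 then have "2 * ?B * (1 / (2 * ?B)) <= 2 * ?B * ln (1 + ?z)" using b1 by (intro mult_left_mono) auto
 then have 1: "1 <= 2 * ?B * ln (1 + ?z)" using b1 by simp
 have "ln ((real L + ?B) * (1 + ?z)) <= ln (real L' + ?B)" using * pos by simp
 then have "ln (real L + ?B) + ln (1 + ?z) <= ln (real L' + ?B)" using pos by (simp add: ln_mult_pos)
 then have "2 * ?B * (ln (real L + ?B) + ln (1 + ?z)) <= 2 * ?B * ln (real L' + ?B)"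
  using b1 by (intro mult_left_mono) auto
 moreover have "\<psi> k = 2 * ?B * ln (real NX + ?B) - 2 * ?B * ln (real k + ?B)" for k
  unfolding \<psi>_def using b1 by (subst ln_divide_pos) (auto simp: add_nonneg_pos right_diff_distrib)
 ultimately show ?thesis using 1 by (simp add: distrib_left)
 qed
 have \<psi>0: "0 <= \<psi> L" if "L <= NX" for L
 unfolding \<psi>_def using b1 that by (intro mult_nonneg_nonneg ln_ge_zero) (auto simp: add_nonneg_pos)
 have \<psi>1: "\<psi> L <= \<psi> 0" for L
 proof -
 have "(real NX + ?B) / (real L + ?B) <= (real NX + ?B) / (real 0 + ?B)"
  using b1 by (intro divide_left_mono) auto
 moreover have "0 < (real NX + ?B) / (real L + ?B)" using b1 by (intro divide_pos_pos add_nonneg_pos) auto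
 ultimately have "ln ((real NX + ?B) / (real L + ?B)) <= ln ((real NX + ?B) / (real 0 + ?B))"
  by (metis ln_mono order_less_le_trans)
 then show ?thesis unfolding \<psi>_def using b1 by (intro mult_left_mono) auto
 qed
 define Inv where "Inv = (%s. \<exists>Q1 Q2. rep s ?Y {regs s 40} Q1 Q2 & vs s = ?vs &
  (regs s 41 = 1 \<or> regs s 41 = 0 & (\<forall>y\<in>?Y. regs s 40 \<in> set (?vs y) -->
  arrs s 51 y <= threshold b (arrs s 42 (regs s 40) - 1))))"
 define f where "f = (%s :: store. if regs s 41 = 1 then \<tau> * (\<psi> (arrs s 42 (regs s 40)) + 1) + 10 else (10 :: real))"
 let ?swap = "Assign 31 (Elem 50 (Var 42)) ;; Assign 50 (Var 42) ;; detach ;;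
   Assign 50 (Var 42) ;; Assign 55 (Var 40) ;; attach ;; Assign 40 (Var 31)"
 let ?body = "find_steal ;; Cond (Lit 0) (Var 41) ?swap Skip"
 have unH: "regs s 40 < n" "0 < arrs s 42 (regs s 40)" "arrs s 42 (regs s 40) <= NX"
 if "rep s ?Y {regs s 40} P1 P2" for s P1 P2
 proof -
 show un: "regs s 40 < n" using orientationD(4)[OF repD(6)[OF that]] by auto
 show "0 < arrs s 42 (regs s 40)" using orientationD(9)[OF repD(6)[OF that] un] by simp
 show "arrs s 42 (regs s 40) <= NX" by (rule load_bnd(1)[OF that un])
 qed
 have step: "\<exists>T\<ge>0. spec W ?body s T (%s'. Inv s' & f s' + T + real (cost (Lit 0) + cost (Var 41) + 2) <= f s)"
 if I: "Inv s" and nz: "ev W s (Lit 0) < ev W s (Var 41)" for s :: store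
 proof -
 let ?u = "regs s 40"
 let ?L = "arrs s 42 ?u"
 obtain P1 P2 where Y: "rep s ?Y {?u} P1 P2" "vs s = ?vs" "regs s 41 = 1"
  using I nz unfolding Inv_def by auto
 note r = repD[OF Y(1)] and o = orientationD[OF repD(6)[OF Y(1)]]
 note un = unH[OF Y(1)]
 define T where "T = 990 * real R"
 let ?Post = "%s'. Inv s' & f s' + T + real (cost (Lit 0) + cost (Var 41) + 2) <= f s"
 have fs: "f s = \<tau> * (\<psi> ?L + 1) + 10" unfolding f_def using Y(3) by simp
 have T4: "T + 4 <= \<tau>" "0 <= T" using b1 unfolding T_def \<tau>_def by auto
 have "0 <= \<tau> * \<psi> ?L" using \<psi>0[OF un(3)] b1 unfolding \<tau>_def by simp
 then have f_stop: "10 + T + 4 <= f s" unfolding fs using T4 by (simp add: distrib_left)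
 have f_go: "\<tau> * (\<psi> L' + 1) + 10 + T + 4 <= f s" if "real ?L + real ?L / ?B + 1 <= real L'" for L'
 proof -
  have "\<tau> * (\<psi> L' + 1) <= \<tau> * \<psi> ?L" using \<psi>_step[OF that] b1 unfolding \<tau>_def by (intro mult_left_mono) auto
  then show ?thesis unfolding fs using T4 by (simp add: distrib_left)
 qed
 have "spec W ?body s T ?Post"
 proof (rule spec_seq[OF find_steal_spec[OF Y(1) refl un(1,2)], where V = "780 * real R"])
  fix s1
  assume fi: "regs s1 41 = 0 & (\<forall>y\<in>?Y. ?u \<in> set (vs s y) --> arrs s 51 y <= threshold b (?L - 1)) \<or>
  regs s1 41 = 1 & regs s1 42 \<in> ?Y & ?u \<in> set (vs s (regs s1 42)) &
   threshold b (?L - 1) < arrs s 51 (regs s1 42)"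
  and fr: "frame find_steal s s1"
  note fs1 = frameD(1,2)[OF fr]
  have a1: "arrs s1 = arrs s" by (intro ext) (simp add: fs1)
  have rep1: "rep s1 ?Y {?u} P1 P2" by (rule rep_cong[OF Y(1) fr]) auto
  have v1: "vs s1 = ?vs" unfolding Y(2)[symmetric] by (rule verts_cong) (simp_all add: a1)
  have r1: "regs s1 40 = ?u" by (simp add: fs1)
  show "spec W (Cond (Lit 0) (Var 41) ?swap Skip) s1 (780 * real R) ?Post"
  proof (rule spec_cond[where ?T1.0 = "770 * real R"])
  assume "\<not> ev W s1 (Lit 0) < ev W s1 (Var 41)"
  then have z: "regs s1 41 = 0" by simp
  then have "Inv s1" unfolding Inv_def using rep1 v1 r1 Y fi a1
   by (intro exI[of _ P1] exI[of _ P2]) simp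
  moreover have "f s1 + T + 4 <= f s" using f_stop z unfolding f_def by simp
  ultimately show "spec W Skip s1 (770 * real R) ?Post" unfolding spec_def by simp
  next
  assume "ev W s1 (Lit 0) < ev W s1 (Var 41)"
  then have y: "regs s1 41 = 1" "regs s1 42 \<in> ?Y" "?u \<in> set (?vs (regs s1 42))"
   "threshold b (?L - 1) < arrs s 51 (regs s1 42)" using fi Y(2) by auto
  let ?y = "regs s1 42"
  let ?w = "arrs s 50 ?y"
  have grow: "real ?L + real ?L / ?B + 1 <= real (arrs s 42 ?w)"
   by (rule chain_up[OF r(6,7) y(2,4) b_pos un(2)])
  moreover have "0 <= real ?L / ?B" by simp
  ultimately have "real ?L < real (arrs s 42 ?w)" by linarith
  \<comment> \<open>The owner of the stolen copy has a strictly larger load than \<open>u\<close>,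
    so detaching the copy opens a second, distinct hole before the first one is filled.\<close>
  then have wu: "?w \<noteq> ?u" by auto
  have yv: "valid n R (?vs ?y)" "?y < NX" using o(1,2) y(2) Y(2) by auto
  have len: "length (?vs ?y) <= R" using yv unfolding valid_def by simp
  let ?s2 = "s1(|regs := (regs s1)(31 := ?w, 50 := ?y)|)"
  have rep2: "rep ?s2 ?Y {?u} P1 P2" using rep1 by simp
  let ?rest = "Assign 50 (Var 42) ;; Assign 55 (Var 40) ;; attach ;; Assign 40 (Var 31)"
  have "spec W detach ?s2 (120 * real (length (vs ?s2 ?y)) + 210)
   (%s'. \<exists>Q1 Q2. rep s' (?Y - {?y}) (insert (arrs ?s2 50 ?y) {?u}) Q1 Q2)"
   by (rule detach_spec[OF rep2]) (use y wu a1 in auto)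
  then have "spec W (detach ;; ?rest) ?s2 (740 * real R) ?Post"
  proof (rule spec_seq[where V = "400 * real R"])
   show "120 * real (length (vs ?s2 ?y)) + 210 + 400 * real R <= 740 * real R"
   using len b1 v1 by simp
   fix s3 assume s3: "\<exists>Q1 Q2. rep s3 (?Y - {?y}) (insert (arrs ?s2 50 ?y) {?u}) Q1 Q2"
   and fr3: "frame detach ?s2 s3"
   obtain P3 P4 where P3: "rep s3 (?Y - {?y}) {?w, ?u} P3 P4" using s3 a1 by auto
   note f3 = frameD(1,2)[OF fr3]
   have a3: "arrs s3 42 = arrs s 42" "arrs s3 51 = arrs s 51" by (simp_all add: f3 a1)
   have v3: "vs s3 = ?vs" using verts_cong[of s3 s1] v1 by (simp add: f3)
   let ?s4 = "s3(|regs := (regs s3)(50 := ?y, 55 := ?u)|)"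
   have rep4: "rep ?s4 (?Y - {?y}) {?w, ?u} P3 P4" using P3 by simp
   have "spec W attach ?s4 (100 * real (length (vs ?s4 ?y)) + 180)
   (%s'. (\<exists>Q1 Q2. rep s' (insert ?y (?Y - {?y})) ({?w, ?u} - {?u}) Q1 Q2) & arrs s' 50 = (arrs ?s4 50)(?y := ?u))"
   proof (rule attach_spec[OF rep4])
   \<comment> \<open>The old level of the copy exceeds \<open>threshold b (L - 1)\<close>, which is
     at least \<open>L\<close>. The new level \<open>L\<close> is therefore below the old one, which
     all vertices of the copy tolerate already.\<close>
   fix v assume "v \<in> set (vs ?s4 ?y)"
   then have "arrs s 51 ?y <= threshold b (arrs s 42 v)"
    using leveledD(1)[OF r(7) y(2), of v] v3 Y(2) by simp
   moreover have "?L <= threshold b (?L - 1)" unfolding threshold_def by simp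
   ultimately show "arrs ?s4 42 ?u <= threshold b (arrs ?s4 42 v)"
    using y(4) a3 by simp
   qed (use y(3) yv v3 in auto)
   moreover have e: "insert ?y (?Y - {?y}) = ?Y" "{?w, ?u} - {?u} = {?w}" using y(2) wu by auto
   ultimately have "spec W attach ?s4 (100 * real (length (vs ?s4 ?y)) + 180)
   (%s'. (\<exists>Q1 Q2. rep s' ?Y {?w} Q1 Q2) & arrs s' 50 = (arrs ?s4 50)(?y := ?u))"
   by (simp only: e)
   then have "spec W attach ?s4 (100 * real R + 180) (%s'. \<exists>Q1 Q2. rep s' ?Y {?w} Q1 Q2)"
   by (rule spec_conseq) (use len v3 in simp_all)
   then have "spec W (attach ;; Assign 40 (Var 31)) ?s4 (290 * real R) ?Post"
   proof (rule spec_seq[where V = 3])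
   show "100 * real R + 180 + 3 <= 290 * real R" using b1 by simp
   fix s5 assume s5: "\<exists>Q1 Q2. rep s5 ?Y {?w} Q1 Q2" and fr5: "frame attach ?s4 s5"
   obtain P5 P6 where P5: "rep s5 ?Y {?w} P5 P6" using s5 by blast
   note f5 = frameD(1,2)[OF fr5]
   have a5: "arrs s5 42 = arrs s 42" using a3 by (simp add: f5)
   have v5: "vs s5 = ?vs" using verts_cong[of s5 s3] v3 by (simp add: f5)
   have r5: "regs s5 31 = ?w" "regs s5 41 = 1" using y(1) by (simp_all add: f5 f3)
   let ?s6 = "s5(|regs := (regs s5)(40 := ?w)|)"
   have "Inv ?s6"
    unfolding Inv_def using P5 v5 r5 by (intro exI[of _ P5] exI[of _ P6]) simp
   moreover have "f ?s6 + T + 4 <= f s"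
    using f_go[OF grow] a5 r5 unfolding f_def by simp
   ultimately show "spec W (Assign 40 (Var 31)) s5 3 ?Post"
    using r5 unfolding spec_def by simp
   qed simp
   moreover have "s3(|regs := (regs s3)(50 := regs s3 42, 55 := regs s3 40)|) = ?s4" using r1 by (simp add: f3)
   ultimately show "spec W ?rest s3 (400 * real R) ?Post"
   using b1 by (intro spec_assign[where T' = "395 * real R"] spec_assign[where T' = "290 * real R"]) simp_all
  qed (use b1 in auto)
  then show "spec W ?swap s1 (770 * real R) ?Post"
   using b1 a1 incidence_lt(5)[OF yv(2)] n_bnd
   by (intro spec_assign[where T' = "760 * real R"] spec_assign[where T' = "740 * real R"]) simp_all
  qed (use b1 n_bnd in auto)
 qed (use b1 in \<open>auto simp: T_def\<close>)
 then show ?thesis using T4(2) by blast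
 qed
 have loop: "spec W (While (Lit 0) (Var 41) ?body) s (f s) (%s'. Inv s' & \<not> ev W s' (Lit 0) < ev W s' (Var 41))"
 if "Inv s" for s
 proof (rule spec_while[OF that _ step])
 fix s :: store
 assume "Inv s"
 then have "0 <= \<psi> (arrs s 42 (regs s 40))" using \<psi>0 unH(3) unfolding Inv_def by blast
 then have "0 <= \<tau> * (\<psi> (arrs s 42 (regs s 40)) + 1)" unfolding \<tau>_def by simp
 then show "ok W s (Lit 0) & ok W s (Var 41) & real (cost (Lit 0) + cost (Var 41) + 2) <= f s"
  using n_bnd unfolding f_def by simp
 qed auto
 let ?Q = "%s'. \<exists>Q1 Q2. rep s' ?Y {} Q1 Q2"
 let ?T2 = "880 * real b * real R + 760 * real b + 160"
 have final: "spec W lower s ?T2 ?Q" if I: "Inv s" and z: "\<not> ev W s (Lit 0) < ev W s (Var 41)" for s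
 proof -
 obtain P1 P2 where Y: "rep s ?Y {regs s 40} P1 P2" "vs s = ?vs"
  "\<forall>y\<in>?Y. regs s 40 \<in> set (?vs y) --> arrs s 51 y <= threshold b (arrs s 42 (regs s 40) - 1)"
  using I z unfolding Inv_def by auto
 have "spec W lower s (4 * real b * (220 * real R + 190) + 160)
  (%s'. \<exists>Q1 Q2. rep s' ?Y ({regs s 40} - {regs s 40}) Q1 Q2)"
  by (rule lower_spec[OF Y(1) refl]) (use Y in auto)
 then show ?thesis by (rule spec_conseq) (simp_all add: algebra_simps)
 qed
 note o = orientationD[OF repD(6)[OF rep0]]
 let ?u = "arrs s0 50 x"
 have x: "x < NX" "valid n R (?vs x)" using o(1,2) x0 by auto
 let ?T1 = "\<tau> * (\<psi> 0 + 1) + 10"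
 have T1: "0 <= ?T1" using \<psi>0[of 0] unfolding \<tau>_def by simp
 moreover have "0 <= ?T2" by simp
 ultimately have T12: "0 <= ?T1 + ?T2" "0 <= 5 + ?T1 + ?T2" "0 <= 120 * real R + 220 + ?T1 + ?T2"
 "0 <= 120 * real R + 230 + ?T1 + ?T2" by linarith+
 let ?W = "While (Lit 0) (Var 41) ?body"
 let ?s = "s0(|regs := (regs s0)(50 := x, 40 := ?u)|)"
 have "spec W detach ?s (120 * real (length (vs ?s x)) + 210)
 (%s'. \<exists>Q1 Q2. rep s' ?Y (insert (arrs ?s 50 x) {}) Q1 Q2)"
 by (rule detach_spec[where H = "{}"]) (use rep0 x0 in auto)
 then have "spec W (detach ;; Assign 41 (Lit 1) ;; ?W ;; lower) ?s (120 * real R + 220 + ?T1 + ?T2) ?Q"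
 proof (rule spec_seq[where V = "5 + ?T1 + ?T2"])
 show "120 * real (length (vs ?s x)) + 210 + (5 + ?T1 + ?T2) <= 120 * real R + 220 + ?T1 + ?T2"
  using x(2) unfolding valid_def by simp
 fix s1 assume "\<exists>Q1 Q2. rep s1 ?Y (insert (arrs ?s 50 x) {}) Q1 Q2" and fr: "frame detach ?s s1"
 then obtain P1 P2 where P: "rep s1 ?Y {?u} P1 P2" by auto
 note f1 = frameD(1,2)[OF fr]
 have v1: "vs s1 = ?vs" by (rule verts_cong) (simp_all add: f1)
 let ?s2 = "s1(|regs := (regs s1)(41 := 1)|)"
 have u2: "regs s1 40 = ?u" by (simp add: f1)
 have I: "Inv ?s2" unfolding Inv_def using P v1 u2 by (intro exI[of _ P1] exI[of _ P2]) simp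
 have "\<tau> * (\<psi> (arrs ?s2 42 (regs ?s2 40)) + 1) <= \<tau> * (\<psi> 0 + 1)"
  using \<psi>1 unfolding \<tau>_def by (intro mult_left_mono add_right_mono) auto
 then have "f ?s2 <= ?T1" unfolding f_def by simp
 then have "spec W (?W ;; lower) ?s2 (?T1 + ?T2) ?Q"
  by (intro spec_seq[OF loop[OF I], where V = ?T2] final) auto
 then show "spec W (Assign 41 (Lit 1) ;; ?W ;; lower) s1 (5 + ?T1 + ?T2) ?Q"
  by (intro spec_assign[where T' = "?T1 + ?T2"]) (use n_bnd T12 in simp_all)
 qed (use T12 in auto)
 note base = this
 have "spec W (Assign 40 (Elem 50 (Var 30)) ;; detach ;; Assign 41 (Lit 1) ;; ?W ;; lower)
 (s0(|regs := (regs s0)(50 := x)|)) (120 * real R + 230 + ?T1 + ?T2) ?Q"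
 by (rule spec_assign[where T' = "120 * real R + 220 + ?T1 + ?T2"])
  (use base x0 T12 incidence_lt(5)[OF x(1)] n_bnd in simp_all)
 note base = this
 have "spec W delete_copy s0 (120 * real R + 240 + ?T1 + ?T2) ?Q"
 unfolding delete_copy_def
 by (rule spec_assign[where T' = "120 * real R + 230 + ?T1 + ?T2"]) (use base x0 T12 in simp_all)
 then show ?thesis
 proof (rule spec_conseq)
 have "1 * real R <= real b * real R" "real b * 1 <= real b * real R" "1 * 1 <= real b * real R"
  using b1 by (intro mult_mono; simp)+
 moreover have e1: "\<tau> * (\<psi> 0 + 1) = 4000 * real b * real R * ln ((real NX + 2 * real b) / (2 * real b)) + 1000 * real R"
  unfolding \<tau>_def \<psi>_def by (simp add: algebra_simps)
 ultimately show "120 * real R + 240 + ?T1 + ?T2 <= del_time" unfolding del_time_def e1 by linarith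
 qed
qed

end

section \<open>A trie of hyperedges\<close>

text \<open>A hyperedge is the sorted list of its vertices. \<open>cnt p\<close> is the number of stored lists with the
 nonempty prefix \<open>p\<close>, \<open>nid p\<close> the node of a prefix with positive count, and node 0 the root.\<close>

definition fresh :: "nat => (nat list => nat) => (nat list => nat) => nat set" where
 "fresh N cnt nid = {k. 0 < k & k <= N & k \<notin> nid ` {p. 0 < cnt p}}"

text \<open>Free nodes have zero counters and zero rows of children, so taking one into use needs no
  clearing of \<open>n\<close> cells. The last conjunct closes the live prefixes under
  shortening.\<close>

definition trie :: "nat => nat => (nat => nat) => (nat => nat) => (nat list => nat) => (nat list => nat) => bool" where
 "trie n N ch ref cnt nid \<longleftrightarrow>
  nid [] = 0 & cnt [] = 0 &
  (\<forall>p. 0 < cnt p --> 0 < nid p & nid p <= N & ref (nid p) = cnt p) &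
  (\<forall>p p'. 0 < cnt p --> 0 < cnt p' --> nid p = nid p' --> p = p') &
  (\<forall>p v. (p = [] \<or> 0 < cnt p) --> v < n -->
  ch (nid p * n + v) = (if 0 < cnt (p @ [v]) then nid (p @ [v]) else 0)) &
  (\<forall>k\<in>fresh N cnt nid. ref k = 0 & (\<forall>v<n. ch (k * n + v) = 0)) &
  (\<forall>p v. 0 < cnt (p @ [v]) --> p = [] \<or> 0 < cnt p)"

lemma trieD:
 assumes "trie n N ch ref cnt nid"
 shows "nid [] = 0" "cnt [] = 0" "0 < cnt p ==> 0 < nid p" "0 < cnt p ==> nid p <= N" "0 < cnt p ==> ref (nid p) = cnt p"
 "0 < cnt p ==> 0 < cnt p' ==> nid p = nid p' ==> p = p'"
 "p = [] \<or> 0 < cnt p ==> v < n ==> ch (nid p * n + v) = (if 0 < cnt (p @ [v]) then nid (p @ [v]) else 0)"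
 "k \<in> fresh N cnt nid ==> ref k = 0" "k \<in> fresh N cnt nid ==> v < n ==> ch (k * n + v) = 0"
 "0 < cnt (p @ [v]) ==> p = [] \<or> 0 < cnt p"
proof -
 note a = assms[unfolded trie_def]
 note A = a[THEN conjunct1] a[THEN conjunct2, THEN conjunct1]
 note B = a[THEN conjunct2, THEN conjunct2, THEN conjunct1]
 note C = a[THEN conjunct2, THEN conjunct2, THEN conjunct2, THEN conjunct1]
 note E = a[THEN conjunct2, THEN conjunct2, THEN conjunct2, THEN conjunct2, THEN conjunct1]
 note F = a[THEN conjunct2, THEN conjunct2, THEN conjunct2, THEN conjunct2, THEN conjunct2, THEN conjunct1]
 note G = a[THEN conjunct2, THEN conjunct2, THEN conjunct2, THEN conjunct2, THEN conjunct2, THEN conjunct2]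
 show "nid [] = 0" "cnt [] = 0" by (rule A)+
 show "0 < cnt p ==> 0 < nid p" "0 < cnt p ==> nid p <= N" "0 < cnt p ==> ref (nid p) = cnt p"
 using B by blast+
 show "0 < cnt p ==> 0 < cnt p' ==> nid p = nid p' ==> p = p'" using C by blast
 show "p = [] \<or> 0 < cnt p ==> v < n ==> ch (nid p * n + v) = (if 0 < cnt (p @ [v]) then nid (p @ [v]) else 0)"
 using E by blast
 show "k \<in> fresh N cnt nid ==> ref k = 0" "k \<in> fresh N cnt nid ==> v < n ==> ch (k * n + v) = 0"
 using F by blast+
 show "0 < cnt (p @ [v]) ==> p = [] \<or> 0 < cnt p" by (rule G[rule_format])
qed

lemma trie_node_inj:
 assumes "trie n N ch ref cnt nid" "p = [] \<or> 0 < cnt p" "p' = [] \<or> 0 < cnt p'" "nid p = nid p'"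
 shows "p = p'"
 using trieD(1)[OF assms(1)] trieD(3)[OF assms(1), of p] trieD(3)[OF assms(1), of p']
 trieD(6)[OF assms(1), of p p'] assms(2-4)
 by (cases "p = []"; cases "p' = []") simp_all

lemma trie_inc_old:
 assumes t: "trie n N ch ref cnt nid" and p: "0 < cnt p"
 shows "trie n N ch (ref(nid p := Suc (ref (nid p)))) (cnt(p := Suc (cnt p))) nid"
 "fresh N (cnt(p := Suc (cnt p))) nid = fresh N cnt nid"
proof -
 note d = trieD[OF t]
 have live: "0 < (cnt(p := Suc (cnt p))) x \<longleftrightarrow> 0 < cnt x" for x using p by simp
 show fr: "fresh N (cnt(p := Suc (cnt p))) nid = fresh N cnt nid" unfolding fresh_def live ..
 have nf: "k \<noteq> nid p" if "k \<in> fresh N cnt nid" for k using that p unfolding fresh_def by auto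
 have pn: "p \<noteq> []" using p d(2) by auto
 show "trie n N ch (ref(nid p := Suc (ref (nid p)))) (cnt(p := Suc (cnt p))) nid"
 unfolding trie_def fr live
 proof (intro conjI allI impI ballI)
 show "(cnt(p := Suc (cnt p))) [] = 0" using pn d(2) by simp
 show "(ref(nid p := Suc (ref (nid p)))) (nid x) = (cnt(p := Suc (cnt p))) x" if "0 < cnt x" for x
  using d(5)[OF that] d(6)[OF that p] by auto
 qed (use d nf in auto)
qed

text \<open>The new node is a leaf, as a longer prefix of positive count would force a positive
  count here. The zero row of the free node is therefore already correct.\<close>

lemma trie_inc_new:
 assumes t: "trie n N ch ref cnt nid" and p: "p = [] \<or> 0 < cnt p" "v < n" "cnt (p @ [v]) = 0"
 and k: "k \<in> fresh N cnt nid"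
 shows "trie n N (ch(nid p * n + v := k)) (ref(k := Suc (ref k))) (cnt(p @ [v] := Suc 0)) (nid(p @ [v] := k))"
 "fresh N (cnt(p @ [v] := Suc 0)) (nid(p @ [v] := k)) = fresh N cnt nid - {k}"
proof -
 note d = trieD[OF t]
 let ?q = "p @ [v]"
 have k': "0 < k" "k <= N" "\<And>x. 0 < cnt x ==> nid x \<noteq> k" using k unfolding fresh_def by auto
 show fr: "fresh N (cnt(?q := Suc 0)) (nid(?q := k)) = fresh N cnt nid - {k}"
 proof -
 have "(nid(?q := k)) ` {x. 0 < (cnt(?q := Suc 0)) x} = insert k (nid ` {x. 0 < cnt x})"
  using p(3) by (auto simp: image_iff)
 then show ?thesis unfolding fresh_def by auto
 qed
 have child0: "cnt (?q @ [w]) = 0" for w using d(10)[of ?q w] p(3) by auto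
 have node: "nid x \<noteq> k" if "x = [] \<or> 0 < cnt x" for x using that d(1) k' by auto
 show "trie n N (ch(nid p * n + v := k)) (ref(k := Suc (ref k))) (cnt(?q := Suc 0)) (nid(?q := k))"
 unfolding trie_def fr
 proof (intro conjI allI impI ballI)
 fix x w assume x: "x = [] \<or> 0 < (cnt(?q := Suc 0)) x" and w: "w < n"
 show "(ch(nid p * n + v := k)) ((nid(?q := k)) x * n + w) =
  (if 0 < (cnt(?q := Suc 0)) (x @ [w]) then (nid(?q := k)) (x @ [w]) else 0)"
 proof (cases "x = ?q")
  case True
  have "k * n + w \<noteq> nid p * n + v" using node[OF p(1)] p(2) w by (simp add: block_inj)
  then show ?thesis using True d(9)[OF k w] child0[of w] by simp
 next
  case False
  then have x': "x = [] \<or> 0 < cnt x" using x by auto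
  have "nid x * n + w = nid p * n + v \<longleftrightarrow> x @ [w] = ?q"
  using block_inj[OF w p(2)] trie_node_inj[OF t x' p(1)] by auto
  then show ?thesis using False d(7)[OF x' w] by auto
 qed
 next
 fix j assume j: "j \<in> fresh N cnt nid - {k}"
 then show "(ref(k := Suc (ref k))) j = 0" using d(8) by simp
 fix w assume w: "w < n"
 have "j \<noteq> nid p" using j p(1) d(1) unfolding fresh_def by auto
 then have "j * n + w \<noteq> nid p * n + v" using w p(2) by (simp add: block_inj)
 then show "(ch(nid p * n + v := k)) (j * n + w) = 0" using d(9)[of j w] j w by simp
 next
 fix x w assume "0 < (cnt(?q := Suc 0)) (x @ [w])"
 then show "x = [] \<or> 0 < (cnt(?q := Suc 0)) x" using d(10)[of x w] p(1) by (auto split: if_splits)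
 next
 fix x y assume "0 < (cnt(?q := Suc 0)) x" "0 < (cnt(?q := Suc 0)) y" "(nid(?q := k)) x = (nid(?q := k)) y"
 then show "x = y" using d(6)[of x y] k'(3) by (auto split: if_splits)
 next
 fix x assume "0 < (cnt(?q := Suc 0)) x"
 then show "(ref(k := Suc (ref k))) ((nid(?q := k)) x) = (cnt(?q := Suc 0)) x"
  using d(5)[of x] d(8)[OF k] k'(3)[of x] by (auto split: if_splits)
 qed (use d k' in \<open>auto split: if_splits\<close>)
qed

lemma trie_dec_old:
 assumes t: "trie n N ch ref cnt nid" and p: "1 < cnt p"
 shows "trie n N ch (ref(nid p := ref (nid p) - 1)) (cnt(p := cnt p - 1)) nid"
 "fresh N (cnt(p := cnt p - 1)) nid = fresh N cnt nid"
proof -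
 note d = trieD[OF t]
 have live: "0 < (cnt(p := cnt p - 1)) x \<longleftrightarrow> 0 < cnt x" for x using p by simp
 show fr: "fresh N (cnt(p := cnt p - 1)) nid = fresh N cnt nid" unfolding fresh_def live ..
 have nf: "k \<noteq> nid p" if "k \<in> fresh N cnt nid" for k using that p unfolding fresh_def by auto
 have p0: "0 < cnt p" using p by simp
 have pn: "p \<noteq> []" using p0 d(2) by auto
 show "trie n N ch (ref(nid p := ref (nid p) - 1)) (cnt(p := cnt p - 1)) nid"
 unfolding trie_def fr live
 proof (intro conjI allI impI ballI)
 show "(cnt(p := cnt p - 1)) [] = 0" using pn d(2) by simp
 show "(ref(nid p := ref (nid p) - 1)) (nid x) = (cnt(p := cnt p - 1)) x" if "0 < cnt x" for x
  using d(5)[OF that] d(6)[OF that p0] by auto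
 qed (use d nf in auto)
qed

text \<open>The node is released only as a leaf. Its row of children is then zero, as the invariant
  demands of free nodes.\<close>

lemma trie_dec_last:
 assumes t: "trie n N ch ref cnt nid" and p: "p = [] \<or> 0 < cnt p" "v < n" "cnt (p @ [v]) = 1"
 and leaf: "\<And>w. cnt (p @ [v] @ [w]) = 0"
 shows "trie n N (ch(nid p * n + v := 0)) (ref(nid (p @ [v]) := 0)) (cnt(p @ [v] := 0)) nid"
 "fresh N (cnt(p @ [v] := 0)) nid = insert (nid (p @ [v])) (fresh N cnt nid)"
proof -
 note d = trieD[OF t]
 let ?q = "p @ [v]" and ?k = "nid (p @ [v])"
 have q0: "0 < cnt ?q" using p by simp
 have eq: "nid x = ?k \<longleftrightarrow> x = ?q" if "0 < cnt x" for x using d(6)[OF that q0] by auto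
 show fr: "fresh N (cnt(?q := 0)) nid = insert ?k (fresh N cnt nid)"
 proof -
 have "{x. 0 < (cnt(?q := 0)) x} = {x. 0 < cnt x} - {?q}" by auto
 then have "nid ` {x. 0 < (cnt(?q := 0)) x} = nid ` {x. 0 < cnt x} - {?k}" using eq by auto
 then show ?thesis using d(3,4)[OF q0] unfolding fresh_def by auto
 qed
 have nf: "j \<noteq> nid x" if "j \<in> fresh N cnt nid" "x = [] \<or> 0 < cnt x" for j x
 using that d(1) unfolding fresh_def by auto
 have pq: "nid p \<noteq> ?k" using trie_node_inj[OF t p(1), of ?q] q0 by auto
 have kids: "ch (?k * n + w) = 0" if "w < n" for w using d(7)[of ?q w] q0 that leaf by simp
 show "trie n N (ch(nid p * n + v := 0)) (ref(?k := 0)) (cnt(?q := 0)) nid"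
 unfolding trie_def fr
 proof (intro conjI allI impI ballI)
 fix x w assume x: "x = [] \<or> 0 < (cnt(?q := 0)) x" and w: "w < n"
 then have x': "x = [] \<or> 0 < cnt x" by (auto split: if_splits)
 have "nid x * n + w = nid p * n + v \<longleftrightarrow> x @ [w] = ?q"
  using block_inj[OF w p(2)] trie_node_inj[OF t x' p(1)] by auto
 then show "(ch(nid p * n + v := 0)) (nid x * n + w) =
  (if 0 < (cnt(?q := 0)) (x @ [w]) then nid (x @ [w]) else 0)"
  using d(7)[OF x' w] by auto
 next
 fix j assume j: "j \<in> insert ?k (fresh N cnt nid)"
 then show "(ref(?k := 0)) j = 0" using d(8) by auto
 fix w assume w: "w < n"
 show "(ch(nid p * n + v := 0)) (j * n + w) = 0" using kids[OF w] d(9)[of j w] j w by auto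
 next
 fix x w assume "0 < (cnt(?q := 0)) (x @ [w])"
 then show "x = [] \<or> 0 < (cnt(?q := 0)) x"
  using d(10)[of x w] leaf[of w] by (auto split: if_splits)
 next
 fix x assume "0 < (cnt(?q := 0)) x"
 then show "(ref(?k := 0)) (nid x) = (cnt(?q := 0)) x" using d(5)[of x] eq[of x] by (auto split: if_splits)
 next
 show "(cnt(?q := 0)) [] = 0" using d(2) by simp
 qed (use d in \<open>auto split: if_splits\<close>)
qed

text \<open>Pigeonhole: \<open>nid\<close> embeds the live prefixes into the numbers from 1 to
  \<open>N\<close>, so without a free number there would be at least \<open>N\<close> of
  them.\<close>

lemma fresh_exists:
 assumes t: "trie n N ch ref cnt nid" and "card {p. 0 < cnt p} < N"
 shows "\<exists>k. k \<in> fresh N cnt nid"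
proof (rule ccontr)
 assume "\<nexists>k. k \<in> fresh N cnt nid"
 then have sub: "{1..N} \<subseteq> nid ` {p. 0 < cnt p}" unfolding fresh_def by auto
 have inj: "inj_on nid {p. 0 < cnt p}" using trieD(6)[OF t] by (auto simp: inj_on_def)
 have "nid ` {p. 0 < cnt p} \<subseteq> {1..N}"
 by (rule image_subsetI) (use trieD(3,4)[OF t] in \<open>auto simp: Suc_le_eq\<close>)
 then have fin: "finite {p. 0 < cnt p}" using inj finite_imageD finite_subset by blast
 have "card {1..N} <= card (nid ` {p. 0 < cnt p})" using sub fin by (intro card_mono) auto
 also have "\<dots> <= card {p. 0 < cnt p}" by (rule card_image_le[OF fin])
 finally show False using assms(2) by simp
qed

text \<open>The counts while a hyperedge is being entered, after its first \<open>i\<close>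
  prefixes. Insertion passes through these states upwards, deletion downwards.\<close>

definition add_prefixes :: "(nat list => nat) => nat list => nat => nat list => nat" where
 "add_prefixes cnt xs i p = cnt p + (if p \<noteq> [] & length p <= i & prefix p xs then 1 else 0)"

lemma add_prefixes_0: "add_prefixes cnt xs 0 = cnt"
 by (auto simp: add_prefixes_def)

lemma add_prefixes_Suc:
 assumes "i < length xs"
 shows "add_prefixes cnt xs (Suc i) =
 (add_prefixes cnt xs i)(take i xs @ [xs ! i] := Suc (add_prefixes cnt xs i (take i xs @ [xs ! i])))"
proof -
 have q: "take i xs @ [xs ! i] = take (Suc i) xs" using take_Suc_conv_app_nth[OF assms] by simp
 have "p \<noteq> [] & length p <= Suc i & prefix p xs \<longleftrightarrow>
 p \<noteq> [] & length p <= i & prefix p xs \<or> p = take (Suc i) xs" for p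
 proof -
 have "p = take (Suc i) xs" if "prefix p xs" "length p = Suc i" using that by (auto simp: prefix_def)
 moreover have "take (Suc i) xs \<noteq> []" using assms by (cases xs) auto
 ultimately show ?thesis using assms by (auto simp: le_Suc_eq take_is_prefix)
 qed
 moreover have "\<not> length (take (Suc i) xs) <= i" using assms by simp
 ultimately show ?thesis unfolding q add_prefixes_def by (intro ext) auto
qed

lemma add_prefixes_take:
 assumes "i <= length xs"
 shows "take i xs = [] \<or> 0 < add_prefixes cnt xs i (take i xs)"
 using assms by (auto simp: add_prefixes_def take_is_prefix)

lemma card_add_prefixes:
 assumes "finite {p. 0 < cnt p}"
 shows "finite {p. 0 < add_prefixes cnt xs i p}" "card {p. 0 < add_prefixes cnt xs i p} <= card {p. 0 < cnt p} + i"
proof -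
 have sub: "{p. 0 < add_prefixes cnt xs i p} \<subseteq> {p. 0 < cnt p} \<union> (%j. take j xs) ` {1..i}"
 proof
 fix p assume "p \<in> {p. 0 < add_prefixes cnt xs i p}"
 then have "0 < cnt p \<or> p \<noteq> [] & length p <= i & prefix p xs"
  unfolding add_prefixes_def by (auto split: if_splits)
 then show "p \<in> {p. 0 < cnt p} \<union> (%j. take j xs) ` {1..i}"
 proof
  assume p: "p \<noteq> [] & length p <= i & prefix p xs"
  then have "p = take (length p) xs" by (auto simp: prefix_def)
  moreover have "length p \<in> {1..i}" using p by (cases p) auto
  ultimately show ?thesis by blast
 qed simp
 qed
 show "finite {p. 0 < add_prefixes cnt xs i p}" by (rule finite_subset[OF sub]) (use assms in auto)
 have "card {p. 0 < add_prefixes cnt xs i p} <= card ({p. 0 < cnt p} \<union> (%j. take j xs) ` {1..i})"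
 by (rule card_mono[OF _ sub]) (use assms in auto)
 also have "\<dots> <= card {p. 0 < cnt p} + card ((%j. take j xs) ` {1..i})" by (rule card_Un_le)
 also have "card ((%j. take j xs) ` {1..i}) <= i" using card_image_le[of "{1..i}" "%j. take j xs"] by simp
 finally show "card {p. 0 < add_prefixes cnt xs i p} <= card {p. 0 < cnt p} + i" by simp
qed

text \<open>The empty prefix belongs to the root, which exists permanently, and is given the count
  0.\<close>

definition prefix_count :: "nat list multiset => nat list => nat" where
 "prefix_count M p = (if p = [] then 0 else size {# xs \<in># M. prefix p xs #})"

lemma prefix_count_add: "prefix_count (add_mset xs M) = add_prefixes (prefix_count M) xs (length xs)"
 by (intro ext) (auto simp: prefix_count_def add_prefixes_def dest: prefix_length_le)

lemma size_filter_pos: "0 < size {# x \<in># M. P x #} \<longleftrightarrow> (\<exists>x\<in>#M. P x)"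
 by (induction M) auto

lemma prefix_count_mem: "xs \<in># M ==> xs \<noteq> [] ==> 0 < prefix_count M xs"
 unfolding prefix_count_def by (auto simp: size_filter_pos)

lemma prefix_count_closed: "0 < prefix_count M (p @ q) ==> p = [] \<or> 0 < prefix_count M p"
 unfolding prefix_count_def
 by (auto simp: size_filter_pos split: if_splits dest: append_prefixD)

lemma card_prefix_count:
 assumes "\<And>xs. xs \<in># M ==> length xs <= R"
 shows "finite {p. 0 < prefix_count M p}" "card {p. 0 < prefix_count M p} <= size M * R"
 using assms
proof (induction M)
 case empty
 { case 1 show ?case by (simp add: prefix_count_def) }
 { case 2 show ?case by (simp add: prefix_count_def) }
next
 case (add xs M)
 { case 1 then show ?case unfolding prefix_count_add by (intro card_add_prefixes(1) add.IH(1)) auto }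
 { case 2
 then have "finite {p. 0 < prefix_count M p}" "card {p. 0 < prefix_count M p} <= size M * R" "length xs <= R"
  using add.IH by auto
 then show ?case
  using card_add_prefixes(2)[of "prefix_count M" xs "length xs"] unfolding prefix_count_add by simp }
qed

text \<open>Array 44 holds the children at \<open>node * n + v\<close>, array 45 the counters, array
  46 the hyperedge read from the input, and list 0 of family 24 the free nodes.\<close>

definition trie_insert :: cmd where
 "trie_insert = Assign 40 (Lit 0) ;;
  For 39 (Var 20)
  (Assign 42 (Var 40 \<boxtimes> Var 0 \<boxplus> Elem 46 (Var 39)) ;;
  Cond (Elem 44 (Var 42)) (Lit 1)
   (Assign 60 (Lit 0) ;; lfirst 24 ;; lremove 24 ;; Put 44 (Var 42) (Var 61)) Skip ;;
  Assign 40 (Elem 44 (Var 42)) ;;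
  Put 45 (Var 40) (Elem 45 (Var 40) \<boxplus> Lit 1))"

definition trie_find :: cmd where
 "trie_find = Assign 40 (Lit 0) ;; Put 47 (Lit 0) (Lit 0) ;;
  For 41 (Var 20)
  (Assign 40 (Elem 44 (Var 40 \<boxtimes> Var 0 \<boxplus> Elem 46 (Var 41))) ;;
  Put 47 (Var 41 \<boxplus> Lit 1) (Var 40))"

text \<open>Walks from the end of the path recorded in array 47 towards the root, so that a node
  whose counter drops to zero has no children left.\<close>

definition trie_delete :: cmd where
 "trie_delete =
  For 41 (Var 20)
  (Assign 43 (Var 20 \<boxminus> Var 41 \<boxminus> Lit 1) ;; Assign 61 (Elem 47 (Var 43 \<boxplus> Lit 1)) ;;
  Put 45 (Var 61) (Elem 45 (Var 61) \<boxminus> Lit 1) ;;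
  Cond (Elem 45 (Var 61)) (Lit 1)
   (Put 44 (Elem 47 (Var 43) \<boxtimes> Var 0 \<boxplus> Elem 46 (Var 43)) (Lit 0) ;; Assign 60 (Lit 0) ;; lpush 24) Skip)"

lemma trie_frame [simp]:
 "lo trie_insert = 39" "wr trie_insert = {24, 26, 27, 44, 45}" "pure trie_insert"
 "lo trie_find = 40" "wr trie_find = {47}" "pure trie_find"
 "lo trie_delete = 41" "wr trie_delete = {24, 26, 27, 44, 45}" "pure trie_delete"
 by (auto simp: trie_insert_def trie_find_def trie_delete_def)

lemma spec_put_iff:
 "spec W (Put a i e ;; c) s T Q \<longleftrightarrow> 1 < bnd W & 2 <= a & a < 64 & ok W s i & ok W s e & ev W s i < bnd W &
  real (cost i + cost e + 5) <= T &
  spec W c (s(|arrs := (arrs s)(a := (arrs s a)(ev W s i := ev W s e))|)) (T - real (cost i + cost e + 5)) Q"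
 unfolding spec_def by simp

section \<open>Trie operations on the machine\<close>

context hyper
begin

definition trep :: "store => (nat list => nat) => (nat list => nat) => bool" where
 "trep s cnt nid \<longleftrightarrow> trie n NN (arrs s 44) (arrs s 45) cnt nid &
  brep c 24 s (%k. if k \<in> fresh NN cnt nid then Some 0 else None)"

lemma trep_cong:
 assumes "arrs s' 44 = arrs s 44" "arrs s' 45 = arrs s 45" "arrs s' 24 = arrs s 24" "arrs s' 25 = arrs s 25"
 "arrs s' 26 = arrs s 26" "arrs s' 27 = arrs s 27"
 shows "trep s' cnt nid = trep s cnt nid"
 unfolding trep_def using brep_cong[of s' 24 s] assms by simp

lemma trep_regs [simp]: "trep (s(|regs := f|)) cnt nid = trep s cnt nid"
 by (rule trep_cong) auto

lemma node_bnd: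
 assumes "k <= NN" "v < n"
 shows "k * n + v < bnd W" "k * n < bnd W" "k < bnd W" "k < c"
proof -
 have "(k + 1) * n <= (NN + 1) * n" using assms by (intro mult_right_mono) auto
 also have "\<dots> <= c * (n * LM + NN + 1)" by (rule mult_mono) (use c_eq n_LM in linarith)+
 finally have "k * n + n <= bnd W" using in_bnd by (simp add: mult.commute)
 then show "k * n + v < bnd W" "k * n < bnd W" using assms by linarith+
 show "k < c" using assms c_eq by simp
 then show "k < bnd W" using c_bnd by linarith
qed

lemma trie_step_spec:
 assumes t: "trep s cnt nid" and p: "p = [] \<or> 0 < cnt p" "v < n" and par: "par s"
 and regs: "regs s 40 = nid p" "arrs s 46 (regs s 39) = v" "regs s 39 < bnd W"
 and room: "card {p. 0 < cnt p} < NN" and small: "cnt (p @ [v]) + 1 < bnd W"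
 shows "spec W (Assign 42 (Var 40 \<boxtimes> Var 0 \<boxplus> Elem 46 (Var 39)) ;;
  Cond (Elem 44 (Var 42)) (Lit 1)
   (Assign 60 (Lit 0) ;; lfirst 24 ;; lremove 24 ;; Put 44 (Var 42) (Var 61)) Skip ;;
  Assign 40 (Elem 44 (Var 42)) ;;
  Put 45 (Var 40) (Elem 45 (Var 40) \<boxplus> Lit 1)) s 190
  (%s'. \<exists>nid'. trep s' (cnt(p @ [v] := Suc (cnt (p @ [v])))) nid' & regs s' 40 = nid' (p @ [v]) &
  (\<forall>x. x \<noteq> p @ [v] \<or> 0 < cnt x --> nid' x = nid x))"
proof -
 note d = trieD[OF t[unfolded trep_def, THEN conjunct1]]
 have br: "brep c 24 s (%k. if k \<in> fresh NN cnt nid then Some 0 else None)" using t unfolding trep_def by blast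
 let ?q = "p @ [v]" and ?ix = "nid p * n + v"
 let ?cnt = "cnt(?q := Suc (cnt ?q))"
 let ?s1 = "s(|regs := (regs s)(42 := ?ix)|)"
 have pN: "nid p <= NN" using p d(1,4) by auto
 note ix = node_bnd[OF pN p(2)]
 note pp = parD[OF par]
 have ch: "arrs s 44 ?ix = (if 0 < cnt ?q then nid ?q else 0)" by (rule d(7)[OF p])
 have one: "1 < bnd W" using n_bnd by simp
 let ?C = "Cond (Elem 44 (Var 42)) (Lit 1)
   (Assign 60 (Lit 0) ;; lfirst 24 ;; lremove 24 ;; Put 44 (Var 42) (Var 61)) Skip"
 let ?R = "Assign 40 (Elem 44 (Var 42)) ;; Put 45 (Var 40) (Elem 45 (Var 40) \<boxplus> Lit 1)"
 let ?Q = "%s'. \<exists>nid'. trep s' ?cnt nid' & regs s' 40 = nid' ?q & (\<forall>x. x \<noteq> ?q \<or> 0 < cnt x --> nid' x = nid x)"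
 \<comment> \<open>The state in which both branches meet: the child pointer is set and the counter
   not yet increased.\<close>
 let ?mid = "%s'. \<exists>nid' k. regs s' 42 = ?ix & arrs s' 44 ?ix = k & k = nid' ?q & k <= NN &
 trie n NN (arrs s' 44) ((arrs s' 45)(k := Suc (arrs s' 45 k))) ?cnt nid' & arrs s' 45 k = cnt ?q &
 brep c 24 s' (%k. if k \<in> fresh NN ?cnt nid' then Some 0 else None) &
 (\<forall>x. x \<noteq> ?q \<or> 0 < cnt x --> nid' x = nid x)"
 have "spec W ?C ?s1 140 ?mid"
 proof (rule spec_cond[where ?T1.0 = 130])
 assume "\<not> ev W ?s1 (Elem 44 (Var 42)) < ev W ?s1 (Lit 1)"
 then have pos: "0 < cnt ?q" using ch by (auto split: if_splits)
 have "?mid ?s1"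
  using ch pos trie_inc_old[OF t[unfolded trep_def, THEN conjunct1] pos] br d(4,5)[OF pos]
  by (intro exI[of _ nid] exI[of _ "nid ?q"]) simp
 then show "spec W Skip ?s1 130 ?mid" unfolding spec_def by simp
 next
 assume "ev W ?s1 (Elem 44 (Var 42)) < ev W ?s1 (Lit 1)"
 then have zero: "cnt ?q = 0" using ch d(3)[of ?q] by (auto split: if_splits)
 obtain k0 where k0: "k0 \<in> fresh NN cnt nid"
  using fresh_exists[OF t[unfolded trep_def, THEN conjunct1] room] by blast
 let ?F = "%k. if k \<in> fresh NN cnt nid then Some (0::nat) else None"
 let ?s2 = "?s1(|regs := (regs ?s1)(60 := 0)|)"
 have fit: "fits W c 24 0" by (rule fits_le) auto
 have "spec W (lfirst 24) ?s2 20 (%s'. ?F (regs s' 61) = Some 0)"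
  by (rule bfirst_spec[where e = k0]) (use br fit pp k0 in auto)
 then have "spec W (lfirst 24 ;; lremove 24 ;; Put 44 (Var 42) (Var 61)) ?s2 115 ?mid"
 proof (rule spec_seq[where V = 95])
  fix s3 assume s3: "?F (regs s3 61) = Some 0" and fr3: "frame (lfirst 24) ?s2 s3"
  note f3 = frameD(1,2)[OF fr3]
  let ?k = "regs s3 61"
  have k: "?k \<in> fresh NN cnt nid" using s3 by (auto split: if_splits)
  have "spec W (lremove 24) s3 80 (%s'. brep c 24 s' (?F(?k := None)))"
  by (rule bremove_spec[where q = 0]) (use br fit pp s3 brep_cong[of s3 24 s] in \<open>auto simp: f3\<close>)
  then show "spec W (lremove 24 ;; Put 44 (Var 42) (Var 61)) s3 95 ?mid"
  proof (rule spec_seq[where V = 15])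
  fix s4 assume s4: "brep c 24 s4 (?F(?k := None))" and fr4: "frame (lremove 24) s3 s4"
  note f4 = frameD(1,2)[OF fr4]
  let ?s5 = "s4(|arrs := (arrs s4)(44 := (arrs s4 44)(?ix := ?k))|)"
  note new = trie_inc_new[OF t[unfolded trep_def, THEN conjunct1] p zero k]
  have cnt: "?cnt = cnt(?q := Suc 0)" using zero by simp
  have F: "?F(?k := None) = (%j. if j \<in> fresh NN ?cnt (nid(?q := ?k)) then Some 0 else None)"
   unfolding cnt new(2) by auto
  have kN: "?k <= NN" using k unfolding fresh_def by simp
  have "?mid ?s5"
  proof (intro exI[of _ "nid(?q := ?k)"] exI[of _ ?k] conjI)
   show "brep c 24 ?s5 (%j. if j \<in> fresh NN ?cnt (nid(?q := ?k)) then Some 0 else None)"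
   using s4 unfolding F using brep_cong[of ?s5 24 s4] by simp
   show "trie n NN (arrs ?s5 44) ((arrs ?s5 45)(?k := Suc (arrs ?s5 45 ?k))) ?cnt (nid(?q := ?k))"
   using new(1) unfolding cnt by (simp add: f3 f4)
   show "arrs ?s5 45 ?k = cnt ?q" using d(8)[OF k] zero by (simp add: f3 f4)
  qed (use kN zero in \<open>auto simp: f3 f4\<close>)
  moreover have "regs s4 42 = ?ix" "regs s4 61 = ?k" by (simp_all add: f3 f4)
  ultimately show "spec W (Put 44 (Var 42) (Var 61)) s4 15 ?mid"
   using ix one unfolding spec_def by simp
  qed auto
 qed auto
 then show "spec W (Assign 60 (Lit 0) ;; lfirst 24 ;; lremove 24 ;; Put 44 (Var 42) (Var 61)) ?s1 130 ?mid"
  using one by (intro spec_assign[where T' = 115]) simp_all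
 qed (use ix one in auto)
 then have "spec W (?C ;; ?R) ?s1 170 ?Q"
 proof (rule spec_seq[where V = 30])
 fix s' assume "?mid s'" and fr: "frame ?C ?s1 s'"
 then obtain nid' k where m: "regs s' 42 = ?ix" "arrs s' 44 ?ix = k" "k = nid' ?q" "k <= NN"
  "trie n NN (arrs s' 44) ((arrs s' 45)(k := Suc (arrs s' 45 k))) ?cnt nid'" "arrs s' 45 k = cnt ?q"
  "brep c 24 s' (%k. if k \<in> fresh NN ?cnt nid' then Some 0 else None)"
  "\<forall>x. x \<noteq> ?q \<or> 0 < cnt x --> nid' x = nid x" by blast
 let ?s6 = "s'(|regs := (regs s')(40 := k), arrs := (arrs s')(45 := (arrs s' 45)(k := Suc (arrs s' 45 k)))|)"
 have "trep ?s6 ?cnt nid'" unfolding trep_def using m(5,7) brep_cong[of ?s6 24 s'] by simp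
 then have "?Q ?s6" using m by (intro exI[of _ nid']) simp
 then show "spec W ?R s' 30 ?Q"
  using m ix one small node_bnd(3)[OF m(4) p(2)] unfolding spec_def by simp
 qed auto
 then show ?thesis
 using regs pp p(2) ix one by (intro spec_assign[where T' = 170]) simp_all
qed

lemma trie_insert_spec:
 assumes t: "trep s cnt nid" and par: "par s" and xs: "regs s 20 = length xs" "length xs < bnd W" "set xs \<subseteq> {..<n}"
 "\<And>j. j < length xs ==> arrs s 46 j = xs ! j"
 and room: "finite {p. 0 < cnt p}" "card {p. 0 < cnt p} + length xs <= NN"
 and small: "\<And>p. cnt p + 2 < bnd W"
 shows "spec W trie_insert s (200 * real (length xs) + 20) (%s'. \<exists>nid'. trep s' (add_prefixes cnt xs (length xs)) nid' &
 regs s' 40 = nid' xs & (\<forall>x. 0 < cnt x --> nid' x = nid x))"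
proof -
 let ?m = "length xs"
 let ?B = "Assign 42 (Var 40 \<boxtimes> Var 0 \<boxplus> Elem 46 (Var 39)) ;;
  Cond (Elem 44 (Var 42)) (Lit 1)
   (Assign 60 (Lit 0) ;; lfirst 24 ;; lremove 24 ;; Put 44 (Var 42) (Var 61)) Skip ;;
  Assign 40 (Elem 44 (Var 42)) ;;
  Put 45 (Var 40) (Elem 45 (Var 40) \<boxplus> Lit 1)"
 let ?c = "%i. add_prefixes cnt xs i"
 let ?A = "%i (s' :: store). par s' & regs s' 20 = ?m & arrs s' 46 = arrs s 46 &
 (\<exists>nid'. trep s' (?c i) nid' & regs s' 40 = nid' (take i xs) & (\<forall>x. 0 < cnt x --> nid' x = nid x))"
 let ?s0 = "s(|regs := (regs s)(40 := 0)|)"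
 have body: "spec W ?B s1 190 (%s'. regs s' 39 = i & ?A (Suc i) (s'(|regs := (regs s')(39 := Suc i)|)))"
 if i: "i < ?m" "?A i s1" "regs s1 39 = i" for i s1
 proof -
 obtain nid1 where n1: "trep s1 (?c i) nid1" "regs s1 40 = nid1 (take i xs)" "\<forall>x. 0 < cnt x --> nid1 x = nid x"
  using i by blast
 let ?q = "take i xs @ [xs ! i]"
 have "spec W ?B s1 190 (%s'. \<exists>nid'. trep s' ((?c i)(?q := Suc (?c i ?q))) nid' & regs s' 40 = nid' ?q &
  (\<forall>x. x \<noteq> ?q \<or> 0 < ?c i x --> nid' x = nid1 x))"
 proof (rule trie_step_spec[OF n1(1)])
  show "take i xs = [] \<or> 0 < ?c i (take i xs)" by (rule add_prefixes_take) (use i in simp)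
  show "xs ! i < n" using xs(3) nth_mem[OF i(1)] by auto
  show "card {p. 0 < ?c i p} < NN" using card_add_prefixes(2)[OF room(1), of xs i] room(2) i(1) by linarith
  have "?c i ?q <= cnt ?q + 1" unfolding add_prefixes_def by simp
  then show "?c i ?q + 1 < bnd W" using small[of ?q] by linarith
 qed (use i n1 xs in auto)
 then show ?thesis
 proof (rule spec_conseq)
  fix s' assume "\<exists>nid'. trep s' ((?c i)(?q := Suc (?c i ?q))) nid' & regs s' 40 = nid' ?q &
  (\<forall>x. x \<noteq> ?q \<or> 0 < ?c i x --> nid' x = nid1 x)" and fr: "frame ?B s1 s'"
  then obtain nid2 where n2: "trep s' (?c (Suc i)) nid2" "regs s' 40 = nid2 (take (Suc i) xs)"
  "\<forall>x. x \<noteq> ?q \<or> 0 < ?c i x --> nid2 x = nid1 x"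
  unfolding add_prefixes_Suc[OF i(1)] take_Suc_conv_app_nth[OF i(1)] by blast
  note f = frameD(1,2)[OF fr]
  have "0 < cnt x ==> 0 < ?c i x" for x unfolding add_prefixes_def by simp
  then have old: "\<forall>x. 0 < cnt x --> nid2 x = nid x" using n2(3) n1(3) by metis
  have "regs s' 20 = ?m" "regs s' 39 = i" "arrs s' 46 = arrs s 46" using i by (simp_all add: f)
  moreover have "par s'" using par_frame[OF fr] i by simp
  ultimately show "regs s' 39 = i & ?A (Suc i) (s'(|regs := (regs s')(39 := Suc i)|))"
  using n2(1,2) old by (auto intro!: exI[of _ nid2])
 qed simp
 qed
 have "spec W (For 39 (Var 20) ?B) ?s0 (200 * real ?m + 10) (%s'. ?A ?m s' & regs s' 39 = ?m)"
 proof (rule spec_for[where \<tau> = 190 and N = ?m and Inv = ?A])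
 have "nid [] = 0" using trieD(1) t unfolding trep_def by blast
 then show "?A 0 (?s0(|regs := (regs ?s0)(39 := 0)|))"
  using t par xs unfolding add_prefixes_0 by (auto intro!: exI[of _ nid])
 qed (use body xs in auto)
 note main = this
 have "spec W trie_insert s (200 * real ?m + 20) (%s'. ?A ?m s' & regs s' 39 = ?m)"
 unfolding trie_insert_def
 by (rule spec_assign[where T' = "200 * real ?m + 10"]) (use main n_bnd in simp_all)
 then show ?thesis by (rule spec_conseq) auto
qed

definition path_ok :: "store => (nat list => nat) => nat list => bool" where
 "path_ok s nid xs \<longleftrightarrow> (\<forall>j\<le>length xs. arrs s 47 j = nid (take j xs))"

lemma trie_find_spec:
 assumes t: "trep s cnt nid" and par: "par s" and xs: "regs s 20 = length xs" "length xs + 1 < bnd W" "set xs \<subseteq> {..<n}"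
 "\<And>j. j < length xs ==> arrs s 46 j = xs ! j"
 and live: "\<And>j. 0 < j ==> j <= length xs ==> 0 < cnt (take j xs)"
 shows "spec W trie_find s (50 * real (length xs) + 30) (%s'. path_ok s' nid xs & regs s' 40 = nid xs)"
proof -
 let ?m = "length xs"
 note d = trieD[OF t[unfolded trep_def, THEN conjunct1]]
 let ?B = "Assign 40 (Elem 44 (Var 40 \<boxtimes> Var 0 \<boxplus> Elem 46 (Var 41))) ;; Put 47 (Var 41 \<boxplus> Lit 1) (Var 40)"
 let ?A = "%i (s' :: store). par s' & regs s' 20 = ?m & arrs s' 46 = arrs s 46 & arrs s' 44 = arrs s 44 &
 regs s' 40 = nid (take i xs) & (\<forall>j\<le>i. arrs s' 47 j = nid (take j xs))"
 let ?s0 = "s(|regs := (regs s)(40 := 0), arrs := (arrs s)(47 := (arrs s 47)(0 := 0))|)"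
 have body: "spec W ?B s1 35 (%s'. regs s' 41 = i & ?A (Suc i) (s'(|regs := (regs s')(41 := Suc i)|)))"
 if i: "i < ?m" "?A i s1" "regs s1 41 = i" for i s1
 proof -
 let ?p = "take i xs" and ?v = "xs ! i"
 have v: "?v < n" using xs(3) nth_mem[OF i(1)] by auto
 have p: "?p = [] \<or> 0 < cnt ?p" using live[of i] i(1) by (cases "i = 0") auto
 have q: "take (Suc i) xs = ?p @ [?v]" by (rule take_Suc_conv_app_nth[OF i(1)])
 have "0 < cnt (?p @ [?v])" using live[of "Suc i"] i(1) q by simp
 then have ch: "arrs s 44 (nid ?p * n + ?v) = nid (take (Suc i) xs)" using d(7)[OF p v] q by simp
 have "nid ?p <= NN" using p d(1,4) by auto
 note ix = node_bnd[OF this v]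
 have e: "arrs s1 46 i = ?v" using i xs(4)[OF i(1)] by simp
 let ?k = "nid (take (Suc i) xs)"
 let ?s2 = "s1(|regs := (regs s1)(40 := ?k), arrs := (arrs s1)(47 := (arrs s1 47)(Suc i := ?k))|)"
 have s1: "arrs s1 44 (nid ?p * n + ?v) = ?k" "regs s1 40 = nid ?p" "regs s1 0 = n" "par s1" "regs s1 20 = ?m"
  "arrs s1 46 = arrs s 46" "arrs s1 44 = arrs s 44" "\<forall>j\<le>i. arrs s1 47 j = nid (take j xs)"
  using i(2) ch parD[of s1] by simp_all
 have "\<forall>j\<le>Suc i. arrs ?s2 47 j = nid (take j xs)" using s1(8) by (simp add: le_Suc_eq)
 then have A: "regs ?s2 41 = i & ?A (Suc i) (?s2(|regs := (regs ?s2)(41 := Suc i)|))"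
  using s1 i(3) by simp
 have "i < bnd W" "Suc i < bnd W" "1 < bnd W" using i(1) xs(2) n_bnd by auto
 then have "spec W ?B s1 35 (%s'. s' = ?s2)"
  using s1(1-3) i(3) e ix(1,2) unfolding spec_def by simp
 then show ?thesis
 proof (rule spec_conseq)
  fix s' assume eq: "s' = ?s2"
  show "regs s' 41 = i & ?A (Suc i) (s'(|regs := (regs s')(41 := Suc i)|))" unfolding eq by (rule A)
 qed simp
 qed
 have "spec W (For 41 (Var 20) ?B) ?s0 (50 * real ?m + 10) (%s'. ?A ?m s' & regs s' 41 = ?m)"
 proof (rule spec_for[where \<tau> = 35 and N = ?m and Inv = ?A])
 show "?A 0 (?s0(|regs := (regs ?s0)(41 := 0)|))" using par xs d(1) by simp
 qed (use body xs in auto)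
 then have "spec W trie_find s (50 * real ?m + 30) (%s'. ?A ?m s' & regs s' 41 = ?m)"
 unfolding trie_find_def using n_bnd by (simp add: spec_assign_iff spec_put_iff) (erule spec_conseq; simp)
 then show ?thesis by (rule spec_conseq) (auto simp: path_ok_def)
qed

lemma trie_delete_spec:
 assumes t: "trep s (add_prefixes cnt xs (length xs)) nid" and par: "par s" and path: "path_ok s nid xs"
 and xs: "regs s 20 = length xs" "length xs + 1 < bnd W" "set xs \<subseteq> {..<n}"
  "\<And>j. j < length xs ==> arrs s 46 j = xs ! j"
 and closed: "\<And>p v. 0 < cnt (p @ [v]) ==> p = [] \<or> 0 < cnt p"
 and small: "\<And>p. cnt p + 2 < bnd W"
 shows "spec W trie_delete s (170 * real (length xs) + 20) (%s'. trep s' cnt nid)"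
proof -
 let ?m = "length xs"
 let ?c = "%i. add_prefixes cnt xs i"
 let ?C = "Cond (Elem 45 (Var 61)) (Lit 1)
   (Put 44 (Elem 47 (Var 43) \<boxtimes> Var 0 \<boxplus> Elem 46 (Var 43)) (Lit 0) ;; Assign 60 (Lit 0) ;; lpush 24) Skip"
 let ?B = "Assign 43 (Var 20 \<boxminus> Var 41 \<boxminus> Lit 1) ;; Assign 61 (Elem 47 (Var 43 \<boxplus> Lit 1)) ;;
  Put 45 (Var 61) (Elem 45 (Var 61) \<boxminus> Lit 1) ;; ?C"
 let ?A = "%i (s' :: store). par s' & regs s' 20 = ?m & arrs s' 46 = arrs s 46 & arrs s' 47 = arrs s 47 &
 trep s' (?c (?m - i)) nid"
 have body: "spec W ?B s1 150 (%s'. regs s' 41 = i & ?A (Suc i) (s'(|regs := (regs s')(41 := Suc i)|)))"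
 if i: "i < ?m" "?A i s1" "regs s1 41 = i" for i s1
 proof -
 define j where "j = ?m - i - 1"
 have j: "j < ?m" "?m - i = Suc j" "?m - Suc i = j" using i(1) unfolding j_def by auto
 let ?p = "take j xs" and ?v = "xs ! j"
 let ?q = "?p @ [?v]"
 let ?k = "nid ?q"
 have v: "?v < n" using xs(3) nth_mem[OF j(1)] by auto
 have q: "take (Suc j) xs = ?q" by (rule take_Suc_conv_app_nth[OF j(1)])
 have cS: "?c (Suc j) = (?c j)(?q := Suc (?c j ?q))" by (rule add_prefixes_Suc[OF j(1)])
 then have pred: "?c j = (?c (Suc j))(?q := ?c j ?q)" "?c (Suc j) ?q = Suc (?c j ?q)" by simp_all
 have t1: "trep s1 (?c (Suc j)) nid" using i(2) j(2) by simp
 note tr = t1[unfolded trep_def, THEN conjunct1] and br = t1[unfolded trep_def, THEN conjunct2]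
 note d = trieD[OF tr]
 have q0: "0 < ?c (Suc j) ?q" using pred(2) by simp
 have pne: "?p \<noteq> ?q" by simp
 have p: "?p = [] \<or> 0 < ?c (Suc j) ?p" using d(10)[OF q0] .
 have pN: "nid ?p <= NN" using p d(1,4) by auto
 note ix = node_bnd[OF pN v]
 have k: "?k <= NN" "0 < ?k" using d(3,4)[OF q0] by auto
 note kb = node_bnd[OF k(1) v]
 have path': "arrs s1 47 (Suc j) = ?k" "arrs s1 47 j = nid ?p"
  using path i(2) j(1) q unfolding path_ok_def by (metis Suc_leI, metis less_imp_le)
 have e: "arrs s1 46 j = ?v" using i xs(4)[OF j(1)] by simp
 have ref: "arrs s1 45 ?k = Suc (?c j ?q)" using d(5)[OF q0] pred(2) by simp
 have regs1: "regs s1 20 - regs s1 41 - 1 = j" "regs s1 41 <= regs s1 20" "1 <= regs s1 20 - regs s1 41"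
  using i j_def by auto
 let ?s2 = "s1(|regs := (regs s1)(43 := j, 61 := ?k), arrs := (arrs s1)(45 := (arrs s1 45)(?k := ?c j ?q))|)"
 have one: "1 < bnd W" using n_bnd by simp
 let ?G = "%s'. regs s' 41 = i & par s' & regs s' 20 = ?m & arrs s' 46 = arrs s 46 & arrs s' 47 = arrs s 47 & trep s' (?c j) nid"
 have "spec W ?C ?s2 110 ?G"
 proof (rule spec_cond[where ?T1.0 = 95])
  assume "\<not> ev W ?s2 (Elem 45 (Var 61)) < ev W ?s2 (Lit 1)"
  then have "1 < ?c (Suc j) ?q" using pred(2) by simp
  note old = trie_dec_old[OF tr this]
  have eq: "(?c (Suc j))(?q := ?c (Suc j) ?q - 1) = ?c j" using pred by simp
  have "trep ?s2 (?c j) nid"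
  unfolding trep_def using old[unfolded eq] ref br brep_cong[of ?s2 24 s1] by simp
  then show "spec W Skip ?s2 95 ?G" using i unfolding spec_def by simp
 next
  assume "ev W ?s2 (Elem 45 (Var 61)) < ev W ?s2 (Lit 1)"
  then have z: "?c j ?q = 0" by simp
  then have one': "?c (Suc j) ?q = 1" using pred(2) by simp
  \<comment> \<open>Without \<open>xs\<close> no stored list has this prefix, hence none has a
    longer one, and the longer prefixes of \<open>xs\<close> itself were taken out in earlier
    rounds.\<close>
  have leaf: "?c (Suc j) (?p @ [?v] @ [w]) = 0" for w
  proof -
  have "cnt ?q = 0" using z unfolding add_prefixes_def by simp
  then have "cnt (?q @ [w]) = 0" using closed[of ?q w] by auto
  then show ?thesis using j(1) unfolding add_prefixes_def by simp
  qed
  note last = trie_dec_last[OF tr p v one' leaf]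
  have eq: "(?c (Suc j))(?q := 0) = ?c j" using pred z by metis
  let ?F = "%k. if k \<in> fresh NN (?c (Suc j)) nid then Some (0::nat) else None"
  have F: "?F(?k := Some 0) = (%k. if k \<in> fresh NN (?c j) nid then Some 0 else None)"
  unfolding last(2)[unfolded eq] by auto
  have nfr: "?k \<notin> fresh NN (?c (Suc j)) nid" using q0 unfolding fresh_def by auto
  let ?s3 = "?s2(|arrs := (arrs ?s2)(44 := (arrs s1 44)(nid ?p * n + ?v := 0)), regs := (regs ?s2)(60 := 0)|)"
  have p3: "par ?s3" using i by simp
  have "spec W (lpush 24) ?s3 60 (%s'. brep c 24 s' (?F(?k := Some 0)))"
  proof (rule bpush_spec)
  show "brep c 24 ?s3 ?F" using br brep_cong[of ?s3 24 s1] by simp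
  show "fits W c 24 0" by (rule fits_le) auto
  qed (use kb parD[OF p3] nfr in auto)
  then have "spec W (lpush 24) ?s3 60 ?G"
  proof (rule spec_conseq)
  fix s' assume s': "brep c 24 s' (?F(?k := Some 0))" and fr: "frame (lpush 24) ?s3 s'"
  note f = frameD(1,2)[OF fr]
  have "trep s' (?c j) nid"
   unfolding trep_def using last(1)[unfolded eq] s' z unfolding F by (simp add: f)
  then show "?G s'" using i par_frame[OF fr] p3 by (simp add: f)
  qed simp
  then have tail: "spec W (Assign 60 (Lit 0) ;; lpush 24) (?s2(|arrs := (arrs ?s2)(44 := (arrs s1 44)(nid ?p * n + ?v := 0))|)) 70 ?G"
  using one by (intro spec_assign[where T' = 60]) simp_all
  have put: "spec W (Put 44 (Elem 47 (Var 43) \<boxtimes> Var 0 \<boxplus> Elem 46 (Var 43)) (Lit 0)) ?s2 25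
   (%s'. s' = ?s2(|arrs := (arrs ?s2)(44 := (arrs s1 44)(nid ?p * n + ?v := 0))|))"
  using path' e ix parD[of s1] i j(1) xs(2) one unfolding spec_def by simp
  show "spec W (Put 44 (Elem 47 (Var 43) \<boxtimes> Var 0 \<boxplus> Elem 46 (Var 43)) (Lit 0) ;; Assign 60 (Lit 0) ;; lpush 24) ?s2 95 ?G"
  proof (rule spec_seq[OF put, where V = 70])
  fix s' assume "s' = ?s2(|arrs := (arrs ?s2)(44 := (arrs s1 44)(nid ?p * n + ?v := 0))|)"
  then show "spec W (Assign 60 (Lit 0) ;; lpush 24) s' 70 ?G" using tail by (simp only:)
  qed simp_all
 qed (use kb one in auto)
 then have "spec W ?B s1 150 ?G"
  using regs1 path' ref kb one j(1) xs(2)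
  by (simp add: spec_assign_iff spec_put_iff) (erule spec_conseq; simp)
 then show ?thesis by (rule spec_conseq) (use j(3) in auto)
 qed
 have "spec W trie_delete s (170 * real ?m + 20) (%s'. ?A ?m s' & regs s' 41 = ?m)"
 unfolding trie_delete_def
 proof (rule spec_for[where \<tau> = 150 and N = ?m and Inv = ?A])
 show "?A 0 (s(|regs := (regs s)(41 := 0)|))" using t par xs by simp
 qed (use body xs in auto)
 then show ?thesis by (rule spec_conseq) (auto simp: add_prefixes_0)
qed

end

section \<open>Updates and queries\<close>

definition read_edge :: cmd where
 "read_edge = Input 20 ;; For 21 (Var 20) (Input 22 ;; Put 46 (Var 21) (Var 22))"

definition add_copy :: cmd where
 "add_copy = Assign 60 (Lit 0) ;; lfirst 28 ;; lremove 28 ;; Assign 30 (Var 61) ;; Assign 60 (Var 22) ;; lpush 28 ;;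
  For 24 (Var 20) (Put 48 (Var 30 \<boxtimes> Var 1 \<boxplus> Var 24) (Elem 46 (Var 24))) ;;
  Put 49 (Var 30) (Var 20) ;; insert_copy"

definition remove_copy :: cmd where
 "remove_copy = Assign 60 (Var 22) ;; lfirst 28 ;; lremove 28 ;; Assign 30 (Var 61) ;; Assign 60 (Lit 0) ;; lpush 28 ;;
  delete_copy"

definition insert_edge :: cmd where
 "insert_edge = trie_insert ;; Assign 22 (Var 40) ;; For 23 (Var 4) add_copy"

definition delete_edge :: cmd where
 "delete_edge = trie_find ;; Assign 22 (Var 40) ;; For 23 (Var 4) remove_copy ;; trie_delete"

definition next_level :: cmd where
 "next_level = Cond (Var 25) (Var 26) (Assign 27 (Var 26 \<boxminus> Var 25)) (Assign 27 (Lit 0))"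

text \<open>Position 0 of the order carries the largest load. Registers 26 and 27 hold a level and
  the one a step below it, and the descent goes on while the number of vertices grows by more than
  the factor \<open>1 + 1 / q\<close>.\<close>

definition answer :: cmd where
 "answer = Assign 24 (Elem 42 (Elem 40 (Lit 0))) ;; Assign 25 (Lit 2 \<boxtimes> Var 24 \<oslash> Var 2 \<boxplus> Lit 4) ;;
  Assign 26 (Var 24) ;; Assign 28 (Lit 0) ;; next_level ;;
  While ((Var 3 \<boxplus> Lit 1) \<boxtimes> Elem 43 (Var 26)) (Var 3 \<boxtimes> Elem 43 (Var 27))
  (Assign 26 (Var 27) ;; Assign 28 (Var 28 \<boxplus> Lit 1) ;; next_level) ;;
  Assign 10 (Elem 43 (Var 27))"

lemma edge_frame [simp]:
 "lo read_edge = 20" "wr read_edge = {46}"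
 "lo add_copy = 24" "wr add_copy = {28, 30, 31, 48, 49} \<union> wr insert_copy" "pure add_copy"
 "lo remove_copy = 30" "wr remove_copy = {28, 30, 31} \<union> wr delete_copy" "pure remove_copy"
 "lo insert_edge = 22" "pure insert_edge" "lo delete_edge = 22" "pure delete_edge"
 "lo answer = 10" "wr answer = {}" "pure answer"
 by (auto simp: read_edge_def add_copy_def remove_copy_def insert_edge_def delete_edge_def answer_def next_level_def)

lemma block_div: "j < R ==> (x * R + j) div R = (x :: nat)"
 by simp

lemma frame_assign: "frame (Assign v e) s (s(|regs := (regs s)(v := k)|))"
 unfolding frame_def by simp

lemma read_edge_spec:
 assumes ins: "ins s = length xs # xs @ zs" and b: "length xs < bnd W" "\<And>x. x \<in> set xs ==> x < bnd W" "1 < bnd W"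
 shows "spec W read_edge s (20 * real (length xs) + 20) (%s'. regs s' 20 = length xs &
 (\<forall>k<length xs. arrs s' 46 k = xs ! k) & ins s' = zs & outs s' = outs s)"
proof -
 have W: "x < 2 ^ W" if "x < bnd W" for x using that unfolding bnd_def by (meson div_le_dividend less_le_trans)
 let ?B = "Input 22 ;; Put 46 (Var 21) (Var 22)"
 let ?s1 = "s(|regs := (regs s)(20 := length xs), ins := xs @ zs|)"
 let ?I = "%i (t :: store). regs t 20 = length xs & ins t = drop i xs @ zs & outs t = outs s & (\<forall>k<i. arrs t 46 k = xs ! k)"
 have "spec W (Input 20) s 1 (%t. t = ?s1)" using ins W[OF b(1)] unfolding spec_def by simp
 then show ?thesis
 unfolding read_edge_def
 proof (rule spec_seq[where V = "20 * real (length xs) + 10"])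
 fix s1 assume "s1 = ?s1"
 then have start: "?I 0 (s1(|regs := (regs s1)(21 := 0)|))" by simp
 have "spec W (For 21 (Var 20) ?B) s1 (20 * real (length xs) + 10) (%t. ?I (length xs) t & regs t 21 = length xs)"
 proof (rule spec_for[where \<tau> = 8 and N = "length xs" and Inv = ?I])
  show "?I 0 (s1(|regs := (regs s1)(21 := 0)|))" by (rule start)
  fix i and t :: store assume i: "i < length xs" "?I i t" "regs t 21 = i"
  have it: "ins t = xs ! i # drop (Suc i) xs @ zs" using i by (simp add: Cons_nth_drop_Suc)
  let ?t = "t(|regs := (regs t)(22 := xs ! i), ins := drop (Suc i) xs @ zs, arrs := (arrs t)(46 := (arrs t 46)(i := xs ! i))|)"
  have "i < bnd W" using i(1) b(1) by simp
  then have run: "spec W ?B t 8 (%t'. t' = ?t)"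
  using it i(3) b(3) W[OF b(2)[OF nth_mem[OF i(1)]]] unfolding spec_def by simp
  have post: "regs ?t 21 = i & ?I (Suc i) (?t(|regs := (regs ?t)(21 := Suc i)|))"
  using i by (auto simp: less_Suc_eq)
  show "spec W ?B t 8 (%t. regs t 21 = i & ?I (Suc i) (t(|regs := (regs t)(21 := Suc i)|)))"
  by (rule spec_conseq[OF run order.refl], hypsubst, rule post)
 qed (use b in auto)
 then show "spec W (For 21 (Var 20) ?B) s1 (20 * real (length xs) + 10) (%s'. regs s' 20 = length xs &
  (\<forall>k<length xs. arrs s' 46 k = xs ! k) & ins s' = zs & outs s' = outs s)"
  by (rule spec_conseq) auto
 qed auto
qed

text \<open>Ties the capacities to the problem: \<open>m\<close> hyperedges need at most
  \<open>m * D\<close> copies and have at most \<open>m * R\<close> nonempty prefixes.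
  \<open>b\<close> gets the value that \<open>density_lower\<close> asks for.\<close>

locale densest = hyper +
 fixes m :: nat
 assumes D_pos: "0 < D" and NX_eq: "NX = m * D" and NN_eq: "NN = m * R" and b_eq: "b = 4 * q ^ 2 * h"
 and n_le: "n <= 2 ^ h" and q_ge: "2 <= q" and q_bnd: "(q + 1) * (NX + n + D) < bnd W" and NX_bnd: "4 * NX + 20 < bnd W"
begin

lemma rep_verts:
 assumes "rep s X H Q1 Q2" "par s'" "\<And>x. x \<in> X ==> vs s' x = vs s x"
 and same: "\<And>a. a \<in> {10..21} \<union> {40..43} \<union> {50, 51} ==> arrs s' a = arrs s a"
 shows "rep s' X H Q1 Q2"
proof -
 note r = repD[OF assms(1)]
 have "lrep c 14 s' Q1" "lrep c 18 s' Q2" using r(3,4) lrep_cong[of s' 14 s] lrep_cong[of s' 18 s] by (simp_all add: same)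
 moreover have "srep n s'" using r(2) srep_cong[of s' s] by (simp add: same)
 moreover have a: "arrs s' 50 = arrs s 50" "arrs s' 51 = arrs s 51" "arrs s' 42 = arrs s 42" by (simp_all add: same)
 moreover have "placement R LM X (vs s') (arrs s 51) = placement R LM X (vs s) (arrs s 51)"
 unfolding placement_def by (intro ext) (simp add: assms(3) cong: conj_cong)
 then have "brep c 10 s' (placement R LM X (vs s') (arrs s' 51))"
 using r(5) brep_cong[of s' 10 s] a by (simp add: same)
 moreover have "orientation n R NX X (vs s') (arrs s' 50) (arrs s' 42) H Q1 Q2"
 using r(6) assms(3) unfolding orientation_def a by auto
 moreover have "leveled b X (vs s') (arrs s' 51) (arrs s' 42) Q1 Q2"
 using r(7) assms(3) unfolding leveled_def a by auto
 ultimately show ?thesis using assms(2) r(8) unfolding rep_def by simp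
qed

definition leaves :: "nat set => (nat => nat list) => (nat list => nat) => nat => nat option" where
 "leaves X vx nid x = (if x < NX then Some (if x \<in> X then nid (vx x) else 0) else None)"

text \<open>A hyperedge enters and leaves copy by copy. Here \<open>j\<close> of the
  \<open>D\<close> copies of \<open>xs\<close> are present beyond those of \<open>M\<close>.\<close>

definition copies :: "store => nat list multiset => nat list => nat => (nat list => nat) => nat set => bool" where
 "copies s M xs j nid X \<longleftrightarrow> (\<exists>Q1 Q2. rep s X {} Q1 Q2) & brep c 28 s (leaves X (vs s) nid) &
  (\<forall>x\<in>X. vs s x \<in># add_mset xs M) &
  (\<forall>ys. card {x \<in> X. vs s x = ys} = D * count M ys + (if ys = xs then j else 0)) &
  card X = D * size M + j"

definition tracks :: "store => nat list multiset => (nat list => nat) => nat set => bool" where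
 "tracks s M nid X \<longleftrightarrow> (\<exists>Q1 Q2. rep s X {} Q1 Q2) & brep c 28 s (leaves X (vs s) nid) &
  (\<forall>x\<in>X. vs s x \<in># M) & (\<forall>ys. card {x \<in> X. vs s x = ys} = D * count M ys) & card X = D * size M &
  trep s (prefix_count M) nid & (\<forall>ys\<in>#M. valid n R ys) & size M <= m"

lemma node_fits: "k <= NN ==> fits W c 28 k"
 by (rule fits_le) auto

lemma add_copy_spec:
 assumes cop: "copies s M xs j nid X" and j: "j < D" and M: "size M < m" and xs: "valid n R xs"
 and node: "regs s 22 = nid xs" "\<And>ys. ys \<in># add_mset xs M ==> 0 < nid ys & nid ys <= NN" and buf: "regs s 20 = length xs" "\<And>k. k < length xs ==> arrs s 46 k = xs ! k"
 shows "spec W add_copy s (ins_time + 40 * real R + 230) (%s'. \<exists>X. copies s' M xs (Suc j) nid X)"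
proof -
 obtain Q1 Q2 where rep0: "rep s X {} Q1 Q2" using cop unfolding copies_def by blast
 have br: "brep c 28 s (leaves X (vs s) nid)" and mem: "\<And>x. x \<in> X ==> vs s x \<in># add_mset xs M"
 and cnt: "\<And>ys. card {x \<in> X. vs s x = ys} = D * count M ys + (if ys = xs then j else 0)"
 and cX: "card X = D * size M + j" using cop unfolding copies_def by auto
 note p = repD(1)[OF rep0] and o = orientationD[OF repD(6)[OF rep0]]
 note pp = parD[OF p]
 have one: "1 < bnd W" using n_bnd by simp
 have "D * Suc (size M) <= D * m" using M by (intro mult_le_mono2) simp
 then have "card X < NX" using cX j NX_eq by (simp add: mult.commute)
 then have "\<not> {..<NX} \<subseteq> X" using card_mono[OF o(13), of "{..<NX}"] by auto
 then obtain y0 where y0: "y0 < NX" "y0 \<notin> X" by auto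
 let ?F = "leaves X (vs s) nid"
 let ?s1 = "s(|regs := (regs s)(60 := 0)|)"
 let ?Q = "%s'. \<exists>X. copies s' M xs (Suc j) nid X"
 let ?r4 = "Put 49 (Var 30) (Var 20) ;; insert_copy"
 let ?B = "Put 48 (Var 30 \<boxtimes> Var 1 \<boxplus> Var 24) (Elem 46 (Var 24))"
 let ?r3 = "For 24 (Var 20) ?B ;; ?r4"
 let ?r2 = "Assign 30 (Var 61) ;; Assign 60 (Var 22) ;; lpush 28 ;; ?r3"
 have F0: "?F y0 = Some 0" using y0 unfolding leaves_def by simp
 have it0: "0 <= ins_time" unfolding ins_time_def using Lam_pos b_pos by simp
 have len: "length xs <= R" "0 < length xs" using xs unfolding valid_def by auto
 have "spec W (lfirst 28) ?s1 20 (%s'. ?F (regs s' 61) = Some 0)"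
 by (rule bfirst_spec[where e = y0]) (use br node_fits pp F0 in auto)
 then have "spec W (lfirst 28 ;; lremove 28 ;; ?r2) ?s1 (ins_time + 40 * real R + 220) ?Q"
 proof (rule spec_seq[where V = "ins_time + 40 * real R + 200"])
 fix s2 assume s2: "?F (regs s2 61) = Some 0" and fr2: "frame (lfirst 28) ?s1 s2"
 note f2 = frameD(1,2)[OF fr2]
 let ?x = "regs s2 61"
 have x: "?x < NX" using s2 unfolding leaves_def by (auto split: if_splits)
 have xX: "?x \<notin> X"
 proof
  assume xin: "?x \<in> X"
  then have "nid (vs s ?x) = 0" using s2 x unfolding leaves_def by simp
  then show False using node(2)[OF mem[OF xin]] by simp
 qed
 have xN: "nid xs <= NN" using node(2) by simp
 have xb: "?x < c" "?x < bnd W" "\<And>k. k < R ==> ?x * R + k < bnd W" "?x * R < bnd W"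
  using incidence_lt[OF x] by auto
 have p2: "par s2" using par_frame[OF fr2] p by simp
 have b2: "brep c 28 s2 ?F" using br brep_cong[of s2 28 s] by (simp add: f2)
 have "spec W (lremove 28) s2 80 (%s'. brep c 28 s' (?F(?x := None)))"
  by (rule bremove_spec[where q = 0]) (use b2 node_fits parD[OF p2] s2 in \<open>auto simp: f2\<close>)
 then show "spec W (lremove 28 ;; ?r2) s2 (ins_time + 40 * real R + 200) ?Q"
 proof (rule spec_seq[where V = "ins_time + 40 * real R + 110"])
  fix s3 assume b3: "brep c 28 s3 (?F(?x := None))" and fr3: "frame (lremove 28) s2 s3"
  note f3 = frameD(1,2)[OF fr3]
  have p3: "par s3" using par_frame[OF fr3] p2 by simp
  let ?s4 = "s3(|regs := (regs s3)(30 := ?x, 60 := nid xs)|)"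
  have "spec W (lpush 28) ?s4 60 (%s'. brep c 28 s' ((?F(?x := None))(?x := Some (nid xs))))"
  by (rule bpush_spec) (use b3 node_fits[OF xN] parD[OF p3] xb(1) in \<open>auto simp: f3\<close>)
  then have "spec W (lpush 28 ;; ?r3) ?s4 (ins_time + 40 * real R + 100) ?Q"
  proof (rule spec_seq[where V = "ins_time + 40 * real R + 40"])
  fix s5 assume "brep c 28 s5 ((?F(?x := None))(?x := Some (nid xs)))" and fr5: "frame (lpush 28) ?s4 s5"
  then have b5: "brep c 28 s5 (?F(?x := Some (nid xs)))" by simp
  note f5 = frameD(1,2)[OF fr5]
  have a5: "arrs s5 a = arrs s a" if "a \<notin> {28, 30, 31}" for a using that by (simp add: f5 f3 f2)
  have p5: "par s5" using par_frame[OF fr5] p3 by simp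
  have r5: "regs s5 30 = ?x" "regs s5 20 = length xs" using buf(1) by (simp_all add: f5 f3 f2)
  let ?A = "%i (s' :: store). par s' & regs s' 30 = ?x & regs s' 20 = length xs &
   (\<forall>a. a \<noteq> 48 --> arrs s' a = arrs s5 a) & (\<forall>k<i. arrs s' 48 (?x * R + k) = xs ! k) &
   (\<forall>k. k div R \<noteq> ?x --> arrs s' 48 k = arrs s 48 k)"
  have "spec W (For 24 (Var 20) ?B) s5 (40 * real R + 10) (%s'. ?A (length xs) s' & regs s' 24 = length xs)"
  proof (rule spec_for[where \<tau> = 30 and N = "length xs" and Inv = ?A])
   show "?A 0 (s5(|regs := (regs s5)(24 := 0)|))" using p5 r5 a5 by simp
   fix i and s' :: store assume i: "i < length xs" "?A i s'" "regs s' 24 = i"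
   have iR: "i < R" using i(1) len by simp
   have e: "arrs s' 46 i = xs ! i" using i a5[of 46] buf(2)[OF i(1)] by simp
   let ?t = "s'(|arrs := (arrs s')(48 := (arrs s' 48)(?x * R + i := xs ! i))|)"
   have run: "spec W ?B s' 30 (%t. t = ?t)"
   using i(2,3) e xb(3)[OF iR] xb(4) parD[of s'] one R_bnd iR unfolding spec_def by simp
   have "?x * R + i \<noteq> k" if "k div R \<noteq> ?x" for k using that iR by auto
   then have post: "regs ?t 24 = i & ?A (Suc i) (?t(|regs := (regs ?t)(24 := Suc i)|))"
   using i by (auto simp: less_Suc_eq)
   show "spec W ?B s' 30 (%t. regs t 24 = i & ?A (Suc i) (t(|regs := (regs t)(24 := Suc i)|)))"
   by (rule spec_conseq[OF run order.refl], hypsubst, rule post)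
  next
   show "real (length xs) * (30 + real (cost (Var 20)) + 7) + real (cost (Var 20)) + 5 <= 40 * real R + 10"
   using len by simp
  qed (use len R_bnd in auto)
  then show "spec W ?r3 s5 (ins_time + 40 * real R + 40) ?Q"
  proof (rule spec_seq[where V = "ins_time + 20"])
   fix s6 assume s6: "?A (length xs) s6 & regs s6 24 = length xs"
   let ?s7 = "s6(|arrs := (arrs s6)(49 := (arrs s6 49)(?x := length xs))|)"
   have a7: "arrs ?s7 a = arrs s5 a" if "a \<notin> {48, 49}" for a using s6 that by simp
   have z7: "arrs ?s7 49 = (arrs s 49)(?x := length xs)" using s6 a5[of 49] by simp
   have v7: "vs ?s7 ?x = xs"
   unfolding verts_def using s6 len by (intro nth_equalityI) auto
   have v7': "vs ?s7 y = vs s y" if "y \<in> X" for y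
   proof -
   have "y \<noteq> ?x" using that xX by auto
   moreover have "arrs s 49 y <= R" using o(2)[OF that] unfolding valid_def by (simp add: verts_nth)
   ultimately show ?thesis
    unfolding verts_def z7 using s6 by (intro map_cong) (auto simp: block_div)
   qed
   have rep7: "rep ?s7 X {} Q1 Q2"
   proof (rule rep_verts[OF rep0])
   show "par ?s7" using s6 by simp
   show "arrs ?s7 a = arrs s a" if "a \<in> {10..21} \<union> {40..43} \<union> {50, 51}" for a
   proof -
    have "a \<notin> {48, 49}" "a \<notin> {28, 30, 31}" using that by auto
    then show ?thesis using a7 a5 by simp
   qed
   qed (rule v7')
   have "spec W insert_copy ?s7 ins_time (%s'. \<exists>Q1 Q2. rep s' (insert ?x X) {} Q1 Q2)"
   by (rule insert_copy_spec[OF rep7]) (use s6 x xX xs v7 in auto)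
   then have "spec W insert_copy ?s7 ins_time ?Q"
   proof (rule spec_conseq)
   fix s' assume rep': "\<exists>Q1 Q2. rep s' (insert ?x X) {} Q1 Q2" and fr': "frame insert_copy ?s7 s'"
   note f' = frameD(1,2)[OF fr']
   have v': "vs s' = vs ?s7" by (rule verts_cong) (simp_all add: f')
   have vx: "vs s' ?x = xs" "\<And>y. y \<in> X ==> vs s' y = vs s y" unfolding v' using v7 v7' by auto
   have lv: "leaves (insert ?x X) (vs s') nid = ?F(?x := Some (nid xs))"
    unfolding leaves_def using x by (intro ext) (auto simp: vx)
   have "brep c 28 s' (leaves (insert ?x X) (vs s') nid)"
    unfolding lv using b5 brep_cong[of s' 28 s5] a7 by (simp add: f')
   moreover have "card {y \<in> insert ?x X. vs s' y = ys} = D * count M ys + (if ys = xs then Suc j else 0)" for ys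
   proof -
    have "{y \<in> insert ?x X. vs s' y = ys} = {y \<in> X. vs s y = ys} \<union> (if ys = xs then {?x} else {})"
    using vx by auto
    then show ?thesis using cnt[of ys] o(13) xX by (auto simp: card_insert_if)
   qed
   moreover have "card (insert ?x X) = D * size M + Suc j" using o(13) xX cX by simp
   ultimately have "copies s' M xs (Suc j) nid (insert ?x X)"
    using rep' mem vx unfolding copies_def by auto
   then show "?Q s'" by blast
   qed simp
   then show "spec W ?r4 s6 (ins_time + 20) ?Q"
   using s6 xb one it0 by (simp add: spec_put_iff) (erule spec_conseq; simp)
  qed (use it0 in auto)
  qed (use it0 in auto)
  moreover have "regs s3 61 = ?x" "regs s3 22 = nid xs" using node(1) by (simp_all add: f3 f2)
  ultimately show "spec W ?r2 s3 (ins_time + 40 * real R + 110) ?Q"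
  using it0 by (simp add: spec_assign_iff) (erule spec_conseq; simp)
 qed (use it0 in auto)
 qed (use it0 in auto)
 then show ?thesis
 unfolding add_copy_def using one it0 by (intro spec_assign[where T' = "ins_time + 40 * real R + 220"]) simp_all
qed

text \<open>Different stored hyperedges have different trie nodes, so whichever copy the list of the
  node of \<open>xs\<close> yields is a copy of \<open>xs\<close>.\<close>

lemma remove_copy_spec:
 assumes cop: "copies s M xs (Suc j) nid X" and node: "regs s 22 = nid xs"
 "\<And>ys. ys \<in># add_mset xs M ==> 0 < nid ys & nid ys <= NN"
 and inj: "\<And>ys. ys \<in># add_mset xs M ==> nid ys = nid xs ==> ys = xs"
 shows "spec W remove_copy s (del_time + 180) (%s'. \<exists>X. copies s' M xs j nid X)"
proof -
 obtain Q1 Q2 where rep0: "rep s X {} Q1 Q2" using cop unfolding copies_def by blast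
 have br: "brep c 28 s (leaves X (vs s) nid)" and mem: "\<And>x. x \<in> X ==> vs s x \<in># add_mset xs M"
 and cnt: "\<And>ys. card {x \<in> X. vs s x = ys} = D * count M ys + (if ys = xs then Suc j else 0)"
 and cX: "card X = D * size M + Suc j" using cop unfolding copies_def by auto
 note p = repD(1)[OF rep0] and o = orientationD[OF repD(6)[OF rep0]]
 note pp = parD[OF p]
 have one: "0 < bnd W" using n_bnd by simp
 have "{x \<in> X. vs s x = xs} \<noteq> {}"
 proof
 assume "{x \<in> X. vs s x = xs} = {}"
 then have "card {x \<in> X. vs s x = xs} = 0" by (simp only: card.empty)
 then show False using cnt[of xs] by simp
 qed
 then obtain y0 where y0: "y0 \<in> X" "vs s y0 = xs" by auto
 have xN: "nid xs <= NN" using node(2) by simp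
 let ?F = "leaves X (vs s) nid"
 let ?s1 = "s(|regs := (regs s)(60 := nid xs)|)"
 let ?Q = "%s'. \<exists>X. copies s' M xs j nid X"
 have "y0 < NX" using subsetD[OF o(1) y0(1)] by simp
 then have F0: "?F y0 = Some (nid xs)" using y0 unfolding leaves_def by simp
 let ?r2 = "Assign 30 (Var 61) ;; Assign 60 (Lit 0) ;; lpush 28 ;; delete_copy"
 have "1 <= real NX + 2 * real b" using b_pos by simp
 then have dt0: "0 <= del_time" unfolding del_time_def using b_pos
 by (intro add_nonneg_nonneg mult_nonneg_nonneg ln_ge_zero) (auto simp: le_divide_eq)
 have "spec W (lfirst 28) ?s1 20 (%s'. ?F (regs s' 61) = Some (nid xs))"
 by (rule bfirst_spec[where e = y0]) (use br node_fits[OF xN] pp F0 in auto)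
 then have "spec W (lfirst 28 ;; lremove 28 ;; ?r2) ?s1 (del_time + 175) ?Q"
 proof (rule spec_seq[where V = "del_time + 150"])
 fix s2 assume s2: "?F (regs s2 61) = Some (nid xs)" and fr2: "frame (lfirst 28) ?s1 s2"
 note f2 = frameD(1,2)[OF fr2]
 let ?x = "regs s2 61"
 have x: "?x < NX" using s2 unfolding leaves_def by (auto split: if_splits)
 have xX: "?x \<in> X" using s2 x node(2)[of xs] unfolding leaves_def by (auto split: if_splits)
 have vx: "vs s ?x = xs" using s2 x xX inj[OF mem[OF xX]] unfolding leaves_def by simp
 have xb: "?x < c" using incidence_lt[OF x] by auto
 have p2: "par s2" using par_frame[OF fr2] p by simp
 have b2: "brep c 28 s2 ?F" using br brep_cong[of s2 28 s] by (simp add: f2)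
 have "spec W (lremove 28) s2 80 (%s'. brep c 28 s' (?F(?x := None)))"
  by (rule bremove_spec[where q = "nid xs"]) (use b2 node_fits[OF xN] parD[OF p2] s2 in \<open>auto simp: f2\<close>)
 then show "spec W (lremove 28 ;; ?r2) s2 (del_time + 150) ?Q"
 proof (rule spec_seq[where V = "del_time + 70"])
  fix s3 assume b3: "brep c 28 s3 (?F(?x := None))" and fr3: "frame (lremove 28) s2 s3"
  note f3 = frameD(1,2)[OF fr3]
  have p3: "par s3" using par_frame[OF fr3] p2 by simp
  let ?s4 = "s3(|regs := (regs s3)(30 := ?x, 60 := 0)|)"
  have "spec W (lpush 28) ?s4 60 (%s'. brep c 28 s' ((?F(?x := None))(?x := Some 0)))"
  by (rule bpush_spec) (use b3 node_fits[of 0] parD[OF p3] xb in \<open>auto simp: f3\<close>)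
  then have "spec W (lpush 28 ;; delete_copy) ?s4 (del_time + 62) ?Q"
  proof (rule spec_seq[where V = "del_time"])
  fix s5 assume "brep c 28 s5 ((?F(?x := None))(?x := Some 0))" and fr5: "frame (lpush 28) ?s4 s5"
  then have b5: "brep c 28 s5 (?F(?x := Some 0))" by simp
  note f5 = frameD(1,2)[OF fr5]
  have a5: "arrs s5 a = arrs s a" if "a \<notin> {28, 30, 31}" for a using that by (simp add: f5 f3 f2)
  have p5: "par s5" using par_frame[OF fr5] p3 by simp
  have r5: "regs s5 30 = ?x" by (simp_all add: f5 f3 f2)
  have v5: "vs s5 = vs s" by (rule verts_cong) (simp_all add: a5)
  have rep5: "rep s5 X {} Q1 Q2"
   by (rule rep_verts[OF rep0 p5]) (use v5 a5 in auto)
  have "spec W delete_copy s5 del_time (%s'. \<exists>Q1 Q2. rep s' (X - {?x}) {} Q1 Q2)"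
   by (rule delete_copy_spec[OF rep5 r5 xX])
  then show "spec W delete_copy s5 del_time ?Q"
  proof (rule spec_conseq)
   fix s' assume rep': "\<exists>Q1 Q2. rep s' (X - {?x}) {} Q1 Q2" and fr': "frame delete_copy s5 s'"
   note f' = frameD(1,2)[OF fr']
   have v': "vs s' = vs s" unfolding v5[symmetric] by (rule verts_cong) (simp_all add: f')
   have lv: "leaves (X - {?x}) (vs s') nid = ?F(?x := Some 0)"
   unfolding leaves_def v' using x by (intro ext) auto
   have "brep c 28 s' (leaves (X - {?x}) (vs s') nid)"
   unfolding lv using b5 brep_cong[of s' 28 s5] by (simp add: f')
   moreover have "card {y \<in> X - {?x}. vs s' y = ys} = D * count M ys + (if ys = xs then j else 0)" for ys
   proof (cases "ys = xs")
   case True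
   have "{y \<in> X. vs s y = xs} = insert ?x {y \<in> X - {?x}. vs s' y = xs}" using vx xX v' by auto
   then have "card {y \<in> X. vs s y = xs} = Suc (card {y \<in> X - {?x}. vs s' y = xs})"
    using o(13) by (simp add: card_insert_if)
   then show ?thesis using cnt[of xs] True by simp
   next
   case False
   then have "{y \<in> X - {?x}. vs s' y = ys} = {y \<in> X. vs s y = ys}" using vx v' by auto
   then show ?thesis using cnt[of ys] False by simp
   qed
   moreover have "card (X - {?x}) = D * size M + j" using o(13) xX cX by simp
   ultimately have "copies s' M xs j nid (X - {?x})"
   using rep' mem v' unfolding copies_def by auto
   then show "?Q s'" by blast
  qed simp
  qed (use dt0 in auto)
  moreover have "regs s3 61 = ?x" by (simp_all add: f3 f2)
  ultimately show "spec W ?r2 s3 (del_time + 70) ?Q"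
  using dt0 one by (simp add: spec_assign_iff) (erule spec_conseq; simp)
 qed (use dt0 in auto)
 qed (use dt0 in auto)
 then show ?thesis
 unfolding remove_copy_def using node(1) dt0 by (intro spec_assign[where T' = "del_time + 175"]) simp_all
qed

lemma copies_cong:
 assumes "copies s M xs j nid X" "frame C s s'" "10 <= lo C"
 "wr C \<inter> ({10..21} \<union> {28..31} \<union> {40..43} \<union> {48..51}) = {}"
 shows "copies s' M xs j nid X"
proof -
 have r: "\<exists>Q1 Q2. rep s' X {} Q1 Q2"
 using assms(1) rep_cong[OF _ assms(2,3)] assms(4) unfolding copies_def by blast
 have a: "arrs s' a = arrs s a" if "a \<in> {28..31} \<union> {48..51}" for a
 by (rule frameD(2)[OF assms(2)]) (use that assms(4) in blast)
 have v: "vs s' = vs s" by (rule verts_cong) (simp_all add: a)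
 have "brep c 28 s' F = brep c 28 s F" for F by (rule brep_cong) (simp_all add: a)
 then show ?thesis using assms(1) r unfolding copies_def v by simp
qed

lemma copies_regs:
 assumes "copies s M xs j nid X" "10 <= v"
 shows "copies (s(|regs := (regs s)(v := k)|)) M xs j nid X"
 by (rule copies_cong[OF assms(1) frame_assign[of v "Lit 0"]]) (use assms(2) in auto)

lemma copies_par: "copies s M xs j nid X ==> par s"
 unfolding copies_def using repD(1) by blast

lemma tracks_copies:
 assumes "tracks s M nid X"
 shows "copies s M xs 0 nid X"
 using assms unfolding tracks_def copies_def by auto

lemma tracks_add_copies:
 assumes "tracks s (add_mset xs M) nid X"
 shows "copies s M xs D nid X"
 using assms unfolding tracks_def copies_def by auto

text \<open>\<open>copies\<close> only places the vertex lists in \<open>add_mset xs M\<close>; with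
  \<open>j = 0\<close> the count equation excludes copies of \<open>xs\<close> when
  \<open>xs\<close> is not in \<open>M\<close>.\<close>

lemma copies_tracks:
 assumes "copies s M xs 0 nid X" "trep s (prefix_count M) nid" "\<And>ys. ys \<in># M ==> valid n R ys" "size M <= m"
 shows "tracks s M nid X"
proof -
 have cnt: "card {x \<in> X. vs s x = ys} = D * count M ys" for ys using assms(1) unfolding copies_def by (simp split: if_splits)
 obtain Q1 Q2 where "rep s X {} Q1 Q2" using assms(1) unfolding copies_def by blast
 then have fin: "finite X" using orientationD(13)[OF repD(6)] by blast
 have "vs s x \<in># M" if "x \<in> X" for x
 proof -
 have "{y \<in> X. vs s y = vs s x} \<noteq> {}" using that by blast
 then have "card {y \<in> X. vs s y = vs s x} \<noteq> 0" using fin by (simp add: card_eq_0_iff)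
 then show ?thesis using cnt[of "vs s x"] by (simp add: count_eq_zero_iff[symmetric])
 qed
 then show ?thesis using assms cnt unfolding copies_def tracks_def by simp
qed

lemma copies_add_tracks:
 assumes "copies s M xs D nid X" "trep s (prefix_count (add_mset xs M)) nid"
 "\<And>ys. ys \<in># add_mset xs M ==> valid n R ys" "size M < m"
 shows "tracks s (add_mset xs M) nid X"
 using assms unfolding copies_def tracks_def by simp

lemma prefix_count_bnd:
 assumes "size M <= m"
 shows "prefix_count M p + 2 < bnd W"
proof -
 have "prefix_count M p <= size M" unfolding prefix_count_def by (simp add: size_mset_mono)
 moreover have "m * 1 <= m * D" using D_pos by (intro mult_le_mono2) simp
 ultimately show ?thesis using assms NX_bnd NX_eq by linarith
qed

lemma insert_edge_spec:
 assumes tr: "tracks s M nid X" and M: "size M < m" and xs: "valid n R xs"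
 and buf: "regs s 20 = length xs" "\<And>k. k < length xs ==> arrs s 46 k = xs ! k"
 shows "spec W insert_edge s (real D * (ins_time + 40 * real R + 240) + 200 * real R + 40)
 (%s'. \<exists>nid X. tracks s' (add_mset xs M) nid X)"
proof -
 have val: "valid n R ys" if "ys \<in># add_mset xs M" for ys using tr xs that unfolding tracks_def by auto
 have mem: "\<And>x. x \<in> X ==> vs s x \<in># M" and t: "trep s (prefix_count M) nid" using tr unfolding tracks_def by auto
 have p: "par s" using copies_par[OF tracks_copies[OF tr]] .
 have len: "length xs <= R" "set xs \<subseteq> {..<n}" "xs \<noteq> []" using xs unfolding valid_def by auto
 have it0: "0 <= ins_time" unfolding ins_time_def using Lam_pos b_pos by simp
 let ?\<tau> = "ins_time + 40 * real R + 230"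
 let ?T = "real D * (ins_time + 40 * real R + 238) + 10"
 have T0: "0 <= ?T" using it0 by (intro add_nonneg_nonneg mult_nonneg_nonneg) auto
 have fin: "finite {p. 0 < prefix_count M p}" and cd: "card {p. 0 < prefix_count M p} <= size M * R"
 using card_prefix_count[of M R] val unfolding valid_def by auto
 have "Suc (size M) * R <= m * R" using M by (intro mult_le_mono1) simp
 then have room: "card {p. 0 < prefix_count M p} + length xs <= NN" using cd len NN_eq by simp
 have small: "\<And>p. prefix_count M p + 2 < bnd W" by (rule prefix_count_bnd) (use M in simp)
 have "spec W trie_insert s (200 * real (length xs) + 20) (%s'. \<exists>nid'. trep s' (add_prefixes (prefix_count M) xs (length xs)) nid' &
 regs s' 40 = nid' xs & (\<forall>x. 0 < prefix_count M x --> nid' x = nid x))"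
 by (rule trie_insert_spec[OF t p buf(1) _ len(2) buf(2) fin room small]) (use len R_bnd in auto)
 then show ?thesis
 unfolding insert_edge_def
 proof (rule spec_seq[where V = "?T + 2"])
 fix s2 assume "\<exists>nid'. trep s2 (add_prefixes (prefix_count M) xs (length xs)) nid' &
  regs s2 40 = nid' xs & (\<forall>x. 0 < prefix_count M x --> nid' x = nid x)" and fr: "frame trie_insert s s2"
 then obtain nid' where t2: "trep s2 (prefix_count (add_mset xs M)) nid'" and r40: "regs s2 40 = nid' xs"
  and keep: "\<And>ys. 0 < prefix_count M ys ==> nid' ys = nid ys" unfolding prefix_count_add by blast
 note f = frameD(1,2)[OF fr]
 have live: "0 < prefix_count (add_mset xs M) ys" if "ys \<in># add_mset xs M" for ys
  by (rule prefix_count_mem[OF that]) (use val[OF that] in \<open>simp add: valid_def\<close>)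
 have td: "trie n NN (arrs s2 44) (arrs s2 45) (prefix_count (add_mset xs M)) nid'" using t2 unfolding trep_def by simp
 have node: "0 < nid' ys & nid' ys <= NN" if "ys \<in># add_mset xs M" for ys
  using trieD(3,4)[OF td live[OF that]] by simp
 have "copies s2 M xs 0 nid X" by (rule copies_cong[OF tracks_copies[OF tr] fr]) auto
 \<comment> \<open>The trie may have taken new nodes into use, but the hyperedges stored before keep
   theirs, so their copies are still in the right lists.\<close>
 moreover have "leaves X (vs s2) nid' = leaves X (vs s2) nid"
 proof -
  have v: "vs s2 = vs s" by (rule verts_cong) (simp_all add: f)
  have "nid' (vs s x) = nid (vs s x)" if "x \<in> X" for x
  by (rule keep, rule prefix_count_mem[OF mem[OF that]]) (use val mem[OF that] in \<open>auto simp: valid_def\<close>)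
  then show ?thesis unfolding leaves_def v by (intro ext) simp
 qed
 ultimately have c2: "copies s2 M xs 0 nid' X" unfolding copies_def by simp
 let ?s3 = "s2(|regs := (regs s2)(22 := nid' xs)|)"
 let ?I = "%j (s' :: store). (\<exists>X. copies s' M xs j nid' X) & regs s' 22 = nid' xs & regs s' 20 = length xs &
  (\<forall>k<length xs. arrs s' 46 k = xs ! k) & trep s' (prefix_count (add_mset xs M)) nid'"
 have upd: "?I j (s'(|regs := (regs s')(23 := i)|))" if I: "?I j s'" for i j s'
 proof -
  obtain Y where "copies s' M xs j nid' Y" using I by blast
  from copies_regs[OF this, of 23 i] have ex: "\<exists>X. copies (s'(|regs := (regs s')(23 := i)|)) M xs j nid' X" by (intro exI) simp
  show ?thesis by (intro conjI ex) (use I in \<open>simp_all\<close>)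
 qed
 have c3: "copies ?s3 M xs 0 nid' X" by (rule copies_cong[OF c2 frame_assign[of 22 "Lit 0"]]) auto
 have I0: "?I 0 ?s3" using c3 buf t2 by (auto simp: f)
 have "spec W (For 23 (Var 4) add_copy) ?s3 ?T (%s'. ?I D s' & regs s' 23 = D)"
 proof (rule spec_for[where \<tau> = ?\<tau> and N = D and Inv = ?I])
  show "?I 0 (?s3(|regs := (regs ?s3)(23 := 0)|))" by (rule upd[OF I0])
  show "ok W s' (Var 4) & ev W s' (Var 4) = D" if "?I i s'" for i s'
  using that parD(5)[OF copies_par] by auto
  have "D <= (q + 1) * (NX + n + D)" by simp
  then show "D < bnd W" using q_bnd by linarith
  fix i s' assume i: "i < D" "?I i s'" "regs s' 23 = i"
  then obtain X' where c': "copies s' M xs i nid' X'" by blast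
  have "spec W add_copy s' ?\<tau> (%s'. \<exists>X. copies s' M xs (Suc i) nid' X)"
  by (rule add_copy_spec[OF c' i(1) M xs _ node]) (use i(2) in auto)
  then show "spec W add_copy s' ?\<tau> (%s'. regs s' 23 = i & ?I (Suc i) (s'(|regs := (regs s')(23 := Suc i)|)))"
  proof (rule spec_conseq)
  fix t assume t: "\<exists>X. copies t M xs (Suc i) nid' X" "frame add_copy s' t"
  note g = frameD(1,2)[OF t(2)]
  have "trep t (prefix_count (add_mset xs M)) nid' = trep s' (prefix_count (add_mset xs M)) nid'"
   by (rule trep_cong) (simp_all add: g)
  then have "?I (Suc i) t" using t(1) i(2) by (simp add: g)
  moreover have "regs t 23 = i" using i(3) by (simp add: g)
  ultimately show "regs t 23 = i & ?I (Suc i) (t(|regs := (regs t)(23 := Suc i)|))" using upd by blast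
  qed simp
 qed (use it0 in \<open>auto simp: algebra_simps\<close>)
 then have "spec W (For 23 (Var 4) add_copy) ?s3 ?T (%s'. \<exists>nid X. tracks s' (add_mset xs M) nid X)"
 proof (rule spec_conseq)
  fix s' assume "?I D s' & regs s' 23 = D"
  then show "\<exists>nid X. tracks s' (add_mset xs M) nid X" using copies_add_tracks[OF _ _ val M] by blast
 qed simp
 then show "spec W (Assign 22 (Var 40) ;; For 23 (Var 4) add_copy) s2 (?T + 2) (%s'. \<exists>nid X. tracks s' (add_mset xs M) nid X)"
  using T0 r40 by (simp add: spec_assign_iff) (erule spec_conseq; simp)
 next
 have "200 * real (length xs) <= 200 * real R" using len by simp
 then show "200 * real (length xs) + 20 + (?T + 2) <= real D * (ins_time + 40 * real R + 240) + 200 * real R + 40"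
  by (simp add: algebra_simps)
 qed (use T0 in simp)
qed

text \<open>The trie is reduced last: the node of \<open>xs\<close> names the list of its copies and
  must live until all of them are gone.\<close>

lemma delete_edge_spec:
 assumes tr: "tracks s (add_mset xs M) nid X"
 and buf: "regs s 20 = length xs" "\<And>k. k < length xs ==> arrs s 46 k = xs ! k"
 shows "spec W delete_edge s (real D * (del_time + 190) + 220 * real R + 70) (%s'. \<exists>nid X. tracks s' M nid X)"
proof -
 have val: "valid n R ys" if "ys \<in># add_mset xs M" for ys using tr that unfolding tracks_def by auto
 have t: "trep s (prefix_count (add_mset xs M)) nid" and M: "size M < m" using tr unfolding tracks_def by auto
 have p: "par s" using copies_par[OF tracks_copies[OF tr]] .
 have len: "length xs <= R" "set xs \<subseteq> {..<n}" "xs \<noteq> []" using val[of xs] unfolding valid_def by auto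
 have "R * 1 <= NX * R" using NX_pos by simp
 then have len': "length xs + 1 < bnd W" using len c_eq c_bnd by linarith
 have "1 <= real NX + 2 * real b" using b_pos by simp
 then have dt0: "0 <= del_time" unfolding del_time_def using b_pos
 by (intro add_nonneg_nonneg mult_nonneg_nonneg ln_ge_zero) (auto simp: le_divide_eq)
 let ?\<tau> = "del_time + 180"
 let ?T = "real D * (del_time + 188) + 10"
 let ?Td = "170 * real (length xs) + 20"
 have T0: "0 <= ?T" using dt0 by (intro add_nonneg_nonneg mult_nonneg_nonneg) auto
 have small: "\<And>p. prefix_count M p + 2 < bnd W" by (rule prefix_count_bnd) (use M in simp)
 have live: "0 < prefix_count (add_mset xs M) ys" if "ys \<in># add_mset xs M" for ys
 by (rule prefix_count_mem[OF that]) (use val[OF that] in \<open>simp add: valid_def\<close>)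
 have td: "trie n NN (arrs s 44) (arrs s 45) (prefix_count (add_mset xs M)) nid" using t unfolding trep_def by simp
 have node: "0 < nid ys & nid ys <= NN" if "ys \<in># add_mset xs M" for ys
 using trieD(3,4)[OF td live[OF that]] by simp
 have inj: "ys = xs" if "ys \<in># add_mset xs M" "nid ys = nid xs" for ys
 by (rule trieD(6)[OF td live[OF that(1)] live[of xs] that(2)]) simp
 have path: "0 < prefix_count (add_mset xs M) (take j xs)" if "0 < j" "j <= length xs" for j
 proof -
 have "0 < prefix_count (add_mset xs M) (take j xs @ drop j xs)" using live[of xs] by simp
 then show ?thesis using prefix_count_closed[of "add_mset xs M" "take j xs" "drop j xs"] that by auto
 qed
 have "spec W trie_find s (50 * real (length xs) + 30) (%s'. path_ok s' nid xs & regs s' 40 = nid xs)"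
 by (rule trie_find_spec[OF t p buf(1) len' len(2) buf(2) path])
 then show ?thesis
 unfolding delete_edge_def
 proof (rule spec_seq[where V = "?T + ?Td + 2"])
 fix s2 assume s2: "path_ok s2 nid xs & regs s2 40 = nid xs" and fr: "frame trie_find s s2"
 note f = frameD(1,2)[OF fr]
 let ?s3 = "s2(|regs := (regs s2)(22 := nid xs)|)"
 let ?I = "%j (s' :: store). (\<exists>X. copies s' M xs (D - j) nid X) & regs s' 22 = nid xs & regs s' 20 = length xs &
  (\<forall>k<length xs. arrs s' 46 k = xs ! k) & trep s' (prefix_count (add_mset xs M)) nid & path_ok s' nid xs"
 have pr: "path_ok (s'(|regs := g|)) nid xs = path_ok s' nid xs" for s' g unfolding path_ok_def by simp
 have upd: "?I j (s'(|regs := (regs s')(23 := i)|))" if I: "?I j s'" for i j s'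
 proof -
  obtain Y where "copies s' M xs (D - j) nid Y" using I by blast
  from copies_regs[OF this, of 23 i] have ex: "\<exists>X. copies (s'(|regs := (regs s')(23 := i)|)) M xs (D - j) nid X" by (intro exI) simp
  show ?thesis by (intro conjI ex) (use I in \<open>simp_all add: pr\<close>)
 qed
 have "copies s2 M xs D nid X" by (rule copies_cong[OF tracks_add_copies[OF tr] fr]) auto
 then have c3: "copies ?s3 M xs D nid X" by (rule copies_cong[OF _ frame_assign[of 22 "Lit 0"]]) auto
 have "trep s2 (prefix_count (add_mset xs M)) nid = trep s (prefix_count (add_mset xs M)) nid"
  by (rule trep_cong) (simp_all add: f)
 then have I0: "?I 0 ?s3" using c3 buf t s2 pr by (auto simp: f)
 have "spec W (For 23 (Var 4) remove_copy) ?s3 ?T (%s'. ?I D s' & regs s' 23 = D)"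
 proof (rule spec_for[where \<tau> = ?\<tau> and N = D and Inv = ?I])
  show "?I 0 (?s3(|regs := (regs ?s3)(23 := 0)|))" by (rule upd[OF I0])
  show "ok W s' (Var 4) & ev W s' (Var 4) = D" if "?I i s'" for i s'
  using that parD(5)[OF copies_par] by auto
  have "D <= (q + 1) * (NX + n + D)" by simp
  then show "D < bnd W" using q_bnd by linarith
  fix i s' assume i: "i < D" "?I i s'" "regs s' 23 = i"
  obtain X' where "copies s' M xs (D - i) nid X'" using i(2) by blast
  then have c': "copies s' M xs (Suc (D - Suc i)) nid X'" using i(1) by (simp add: Suc_diff_Suc)
  have "spec W remove_copy s' ?\<tau> (%s'. \<exists>X. copies s' M xs (D - Suc i) nid X)"
  by (rule remove_copy_spec[OF c' _ node inj]) (use i(2) in auto)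
  then show "spec W remove_copy s' ?\<tau> (%s'. regs s' 23 = i & ?I (Suc i) (s'(|regs := (regs s')(23 := Suc i)|)))"
  proof (rule spec_conseq)
  fix t assume t: "\<exists>X. copies t M xs (D - Suc i) nid X" "frame remove_copy s' t"
  note g = frameD(1,2)[OF t(2)]
  have "trep t (prefix_count (add_mset xs M)) nid = trep s' (prefix_count (add_mset xs M)) nid"
   by (rule trep_cong) (simp_all add: g)
  moreover have "path_ok t nid xs = path_ok s' nid xs" unfolding path_ok_def by (simp add: g)
  ultimately have "?I (Suc i) t" using t(1) i(2) by (simp add: g)
  moreover have "regs t 23 = i" using i(3) by (simp add: g)
  ultimately show "regs t 23 = i & ?I (Suc i) (t(|regs := (regs t)(23 := Suc i)|))" using upd by blast
  qed simp
 qed (use dt0 in \<open>auto simp: algebra_simps\<close>)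
 then have "spec W (For 23 (Var 4) remove_copy ;; trie_delete) ?s3 (?T + ?Td) (%s'. \<exists>nid X. tracks s' M nid X)"
 proof (rule spec_seq)
  fix s4 assume "?I D s4 & regs s4 23 = D"
  then obtain X' where c4: "copies s4 M xs 0 nid X'" and t4: "trep s4 (prefix_count (add_mset xs M)) nid"
  and r4: "regs s4 20 = length xs" "\<And>k. k < length xs ==> arrs s4 46 k = xs ! k" "path_ok s4 nid xs" by auto
  have "spec W trie_delete s4 ?Td (%s'. trep s' (prefix_count M) nid)"
  by (rule trie_delete_spec[OF t4[unfolded prefix_count_add] copies_par[OF c4] r4(3,1) len' len(2) r4(2) prefix_count_closed small])
  then show "spec W trie_delete s4 ?Td (%s'. \<exists>nid X. tracks s' M nid X)"
  proof (rule spec_conseq)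
  fix s' assume s': "trep s' (prefix_count M) nid" "frame trie_delete s4 s'"
  have "copies s' M xs 0 nid X'" by (rule copies_cong[OF c4 s'(2)]) auto
  then have "tracks s' M nid X'" by (rule copies_tracks[OF _ s'(1)]) (use val M in auto)
  then show "\<exists>nid X. tracks s' M nid X" by blast
  qed simp
 qed auto
 then show "spec W (Assign 22 (Var 40) ;; For 23 (Var 4) remove_copy ;; trie_delete) s2 (?T + ?Td + 2) (%s'. \<exists>nid X. tracks s' M nid X)"
  using T0 s2 by (simp add: spec_assign_iff)
 next
 have "220 * real (length xs) <= 220 * real R" using len by simp
 then show "50 * real (length xs) + 30 + (?T + ?Td + 2) <= real D * (del_time + 190) + 220 * real R + 70"
  by (simp add: algebra_simps)
 qed (use T0 in simp)
qed

text \<open>Between operations only the cardinality \<open>k\<close> of the answer is kept. It is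
  computed at the end of every update, so that queries merely print. \<open>d\<close> is the level
  at which the descent stopped and \<open>i\<close> the number of its steps.\<close>

definition answered :: "store => nat => bool" where
 "answered s k \<longleftrightarrow> (let \<Delta> = arrs s 42 (arrs s 40 0); st = (2 * \<Delta>) div b + 4 in
  \<exists>d i. d <= \<Delta> & \<Delta> <= d + i * st & i <= q * h & k = arrs s 43 (d - st) & q * k <= (q + 1) * arrs s 43 d)"

text \<open>The number of vertices grows at least by the factor \<open>1 + 1 / q\<close> per round,
  starting from at least 1, and never exceeds \<open>n <= 2 ^ h\<close>. \<open>growth_bound\<close>
  thus limits the rounds to \<open>q * h\<close>.\<close>

lemma answer_spec:
 assumes rep: "rep s X {} Q1 Q2"
 shows "spec W answer s (60 * real (q * h) + 200) (%s'. answered s' (regs s' 10))"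
proof -
 note p = parD[OF repD(1)[OF rep]] and so = sorted_byD[OF repD(2)[OF rep, unfolded srep_def]]
 let ?C = "arrs s 43" and ?\<Delta> = "arrs s 42 (arrs s 40 0)"
 let ?st = "(2 * ?\<Delta>) div b + 4"
 have one: "1 < bnd W" "4 < bnd W" "2 < bnd W" using n_bnd by simp_all
 have \<Delta>: "?\<Delta> <= NX" by (rule load_bnd(1)[OF rep so(1)[OF n_pos]])
 have st: "?st <= 2 * NX + 4" using \<Delta> div_le_dividend[of "2 * ?\<Delta>" b] by linarith
 have bnds: "2 * ?\<Delta> < bnd W" "?st < bnd W" "?\<Delta> < bnd W" using \<Delta> st NX_bnd by linarith+
 have Cn: "?C d <= n" for d by (rule so(5))
 have qC: "(q + 1) * ?C d < bnd W" for d
 proof -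
 have "(q + 1) * ?C d <= (q + 1) * (NX + n + D)" by (intro mult_le_mono2) (use Cn[of d] in linarith)
 then show ?thesis using q_bnd by linarith
 qed
 have qC': "q * ?C d < bnd W" for d using qC[of d] by (simp add: algebra_simps)
 have qq: "q + 1 < bnd W"
 proof -
 have "(q + 1) * 1 <= (q + 1) * (NX + n + D)" by (intro mult_le_mono2) (use n_pos in linarith)
 from le_less_trans[OF this q_bnd] show ?thesis by simp
 qed
 let ?J = "%t :: store. arrs t = arrs s & regs t 3 = q & regs t 24 = ?\<Delta> & regs t 25 = ?st & regs t 26 = ?\<Delta> - regs t 28 * ?st &
  (1 + 1 / real q) ^ regs t 28 <= real (?C (regs t 26))"
 let ?I = "%t :: store. ?J t & regs t 27 = regs t 26 - ?st"
 have ib: "regs t 28 <= q * h" if "?J t" for t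
 by (rule growth_bound[OF _ n_le]) (use that q_ge Cn[of "regs t 26"] in \<open>auto intro: order.trans\<close>)
 have dle: "regs t 26 <= ?\<Delta>" if "?J t" for t using that by linarith
 have dom: "regs t 26 < bnd W" if "?J t" for t using dle[OF that] bnds(3) by linarith
 have nl: "spec W next_level t 10 (%t'. ?I t' & regs t' 28 = regs t 28)" if "?J t" for t
 using that one unfolding spec_def next_level_def by (cases "?st < regs t 26") auto
 let ?G1 = "(Var 3 \<boxplus> Lit 1) \<boxtimes> Elem 43 (Var 26)" and ?G2 = "Var 3 \<boxtimes> Elem 43 (Var 27)"
 let ?B = "Assign 26 (Var 27) ;; Assign 28 (Var 28 \<boxplus> Lit 1) ;; next_level"
 let ?f = "%t :: store. 60 * real (q * h - regs t 28) + 60"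
 let ?E = "%t :: store. ?I t & \<not> (q + 1) * ?C (regs t 26) < q * ?C (regs t 27)"
 have loop: "spec W (While ?G1 ?G2 ?B) t (60 * real (q * h) + 60) ?E" if "?I t" for t
 proof -
 have "spec W (While ?G1 ?G2 ?B) t (?f t) (%t. ?I t & \<not> ev W t ?G1 < ev W t ?G2)"
 proof (rule spec_while)
  show "?I t" by (rule that)
  show "ok W u ?G1 & ok W u ?G2 & real (cost ?G1 + cost ?G2 + 2) <= ?f u" if "?I u" for u
  proof -
  have "arrs u = arrs s" "regs u 3 = q" "regs u 26 < bnd W" "regs u 27 < bnd W" using that dom[of u] by auto
  then show ?thesis using one qC[of "regs u 26"] qC'[of "regs u 27"] qq by simp
  qed
  fix u assume u: "?I u" "ev W u ?G1 < ev W u ?G2"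
  then have less: "(q + 1) * ?C (regs u 26) < q * ?C (regs u 27)" by simp
  let ?u = "u(|regs := (regs u)(26 := regs u 27, 28 := Suc (regs u 28))|)"
  have q0: "0 < q" using q_ge by simp
  have "real ((q + 1) * ?C (regs u 26)) <= real (q * ?C (regs u 27))" using less by (intro of_nat_mono) simp
  then have "(1 + 1 / real q) * real (?C (regs u 26)) <= real (?C (regs u 27))"
  using q0 by (simp add: field_simps)
  moreover have "(1 + 1 / real q) * (1 + 1 / real q) ^ regs u 28 <= (1 + 1 / real q) * real (?C (regs u 26))"
  using u(1) by (intro mult_left_mono) auto
  ultimately have pw: "(1 + 1 / real q) ^ Suc (regs u 28) <= real (?C (regs u 27))" by simp
  have J: "?J ?u" using u(1) pw by simp
  have i: "Suc (regs u 28) <= q * h" using ib[OF J] by simp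
  have "q * h <= q * (4 * q * h)" by simp
  then have "q * h <= b" unfolding b_eq by (simp add: power2_eq_square mult.left_commute)
  then have ub: "Suc (regs u 28) < bnd W" using i b_bnd by linarith
  have "spec W ?B u 20 (%u'. ?I u' & regs u' 28 = Suc (regs u 28))"
  proof -
  have "spec W next_level ?u 10 (%u'. ?I u' & regs u' 28 = Suc (regs u 28))"
   using nl[OF J] by simp
  then show ?thesis using ub one by (simp add: spec_assign_iff) (erule spec_conseq; auto)
  qed
  then have "spec W ?B u 20 (%s'. ?I s' & ?f s' + 20 + real (cost ?G1 + cost ?G2 + 2) <= ?f u)"
  by (rule spec_conseq) (use i in \<open>auto simp: of_nat_diff\<close>)
  then show "\<exists>T\<ge>0. spec W ?B u T (%s'. ?I s' & ?f s' + T + real (cost ?G1 + cost ?G2 + 2) <= ?f u)"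
  by (intro exI[of _ 20] conjI) simp_all
 qed
 then show ?thesis
 proof (rule spec_conseq)
  have "real (q * h - regs t 28) <= real (q * h)" by (intro of_nat_mono) simp
  then show "?f t <= 60 * real (q * h) + 60" by linarith
 qed auto
 qed
 let ?s1 = "s(|regs := (regs s)(24 := ?\<Delta>, 25 := ?st, 26 := ?\<Delta>, 28 := 0)|)"
 have "0 < ?C ?\<Delta>" using so(6)[OF n_pos, of ?\<Delta>] by simp
 then have J1: "?J ?s1" using p by simp
 have "spec W (next_level ;; While ?G1 ?G2 ?B ;; Assign 10 (Elem 43 (Var 27))) ?s1 (60 * real (q * h) + 100)
 (%s'. answered s' (regs s' 10))"
 proof (rule spec_seq[OF nl[OF J1], where V = "60 * real (q * h) + 80"])
 fix s2 assume "?I s2 & regs s2 28 = regs ?s1 28"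
 then have "?I s2" by (rule conjunct1)
 from loop[OF this] show "spec W (While ?G1 ?G2 ?B ;; Assign 10 (Elem 43 (Var 27))) s2 (60 * real (q * h) + 80)
  (%s'. answered s' (regs s' 10))"
 proof (rule spec_seq[where V = 10])
  fix s3 assume s3: "?E s3"
  then have b3: "regs s3 27 < bnd W" using dom[of s3] by linarith
  let ?s4 = "s3(|regs := (regs s3)(10 := ?C (regs s3 27))|)"
  have "answered ?s4 (?C (regs s3 27))"
  unfolding answered_def Let_def
  by (intro exI[of _ "regs s3 26"] exI[of _ "regs s3 28"] conjI) (use s3 ib[of s3] in auto)
  then show "spec W (Assign 10 (Elem 43 (Var 27))) s3 10 (%s'. answered s' (regs s' 10))"
  using b3 one s3 unfolding spec_def by simp
 qed auto
 qed auto
 then show ?thesis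
 unfolding answer_def using one bnds p so(1)[OF n_pos] n_bnd
 by (simp add: spec_assign_iff) (erule spec_conseq; simp)
qed

end

section \<open>The program\<close>

text \<open>The words after the selector are the fixed-point \<open>\<epsilon>\<close>, then
  \<open>n\<close>, \<open>m\<close>, \<open>r\<close>, \<open>w\<close> and the number of
  hyperedges. Register 3 becomes \<open>q\<close>, of order \<open>1 / \<epsilon>\<close>.\<close>

definition setup_input :: cmd where
 "setup_input = Input 11 ;; Input 0 ;; Input 12 ;; Input 13 ;; Input 14 ;; Input 15 ;;
  Assign 16 (Top \<oslash> Var 11 \<boxplus> Lit 2) ;; Assign 3 (Lit 4 \<boxtimes> Var 16) ;; Assign 8 (Lit 1) ;; Assign 16 (Lit 2)"

definition setup_log :: cmd where
 "setup_log = While (Var 16) (Var 0) (Assign 8 (Var 8 \<boxplus> Lit 1) ;; Assign 16 (Lit 2 \<boxtimes> Var 16))"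

definition setup_rank :: cmd where
 "setup_rank = Cond (Var 13) (Var 0) (Assign 1 (Var 13)) (Assign 1 (Var 0))"

text \<open>Register 16 holds \<open>q ^ 2 * h\<close>. Register 4, the number \<open>D\<close> of
  copies, is the smallest one with \<open>D * w > 8 * R * q ^ 2 * h\<close>, which makes the largest
  load as big as \<open>density_lower\<close> needs.\<close>

definition setup_params :: cmd where
 "setup_params = Assign 16 (Var 3 \<boxtimes> Var 3 \<boxtimes> Var 8) ;; Assign 2 (Lit 4 \<boxtimes> Var 16) ;;
  Assign 4 (Lit 8 \<boxtimes> Var 1 \<boxtimes> Var 16 \<oslash> Var 14 \<boxplus> Lit 1) ;; Assign 6 (Var 12 \<boxtimes> Var 4) ;; Assign 7 (Var 12 \<boxtimes> Var 1) ;;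
  Assign 5 (Lit 2 \<boxtimes> Var 6 \<boxplus> Lit 10) ;; Assign 9 (Var 6 \<boxtimes> Var 1 \<boxplus> Var 7 \<boxplus> Lit 1)"

text \<open>While all loads are 0 the identity is a sorted order, and all \<open>n\<close> vertices
  count for level 0. All copy numbers and all trie nodes from 1 on start out free.\<close>

definition fill_tables :: cmd where
 "fill_tables = For 21 (Var 0) (Put 40 (Var 21) (Var 21) ;; Put 41 (Var 21) (Var 21)) ;; Put 43 (Lit 0) (Var 0) ;;
  For 21 (Var 6) (Assign 60 (Lit 0) ;; Assign 61 (Var 21) ;; lpush 28) ;;
  For 21 (Var 7) (Assign 60 (Lit 0) ;; Assign 61 (Var 21 \<boxplus> Lit 1) ;; lpush 24)"

definition load_edges :: cmd where
 "load_edges = For 16 (Var 15) (read_edge ;; insert_edge)"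

definition initialise :: cmd where
 "initialise = setup_input ;; setup_log ;; setup_rank ;; setup_params ;; fill_tables ;; load_edges ;; answer"

definition density_query :: cmd where
 "density_query = Output (Elem 42 (Elem 40 (Lit 0)) \<boxtimes> (Var 3 \<boxminus> Lit 1)) ;; Output ((Var 3 \<boxplus> Lit 1) \<boxtimes> Var 4)"

definition subset_query :: cmd where
 "subset_query = For 21 (Var 10) (Output (Elem 40 (Var 21)))"

definition densest_program :: cmd where
 "densest_program = Input 20 ;; Cond (Var 20) (Lit 1) initialise
  (Cond (Var 20) (Lit 2) (read_edge ;; insert_edge ;; answer)
  (Cond (Var 20) (Lit 3) (read_edge ;; delete_edge ;; answer)
  (Cond (Var 20) (Lit 4) density_query subset_query)))"

lemma spec_cond_iff:
 "spec W (Cond a b c1 c2) s T Q \<longleftrightarrow> ok W s a & ok W s b & real (cost a + cost b + 2) <= T &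
  (if ev W s a < ev W s b then spec W c1 s (T - real (cost a + cost b + 2)) Q
  else spec W c2 s (T - real (cost a + cost b + 2)) Q)"
 unfolding spec_def by simp

lemma lo_fill [simp]: "lo fill_tables = 21" "wr fill_tables = {24, 26, 27, 28, 30, 31, 40, 41, 43}" "pure fill_tables"
 by (auto simp: fill_tables_def lpush_def)

text \<open>The 20 steps pay for reading the selector and for at most four comparisons.\<close>

lemma program_spec:
 assumes ins: "ins s = k # zs" and b: "4 < bnd W" and T: "0 <= T"
 and c: "k = 0 & c = initialise \<or> k = 1 & c = (read_edge ;; insert_edge ;; answer) \<or>
  k = 2 & c = (read_edge ;; delete_edge ;; answer) \<or> k = 3 & c = density_query \<or> k = 4 & c = subset_query"
 and body: "\<And>t. frame (Input 20) s t ==> arrs t = arrs s ==> ins t = zs ==> outs t = outs s ==> spec W c t T Q"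
 shows "spec W densest_program s (T + 20) Q"
proof -
 have "bnd W <= 2 ^ W" unfolding bnd_def by simp
 then have k: "k < 2 ^ W" using b c by auto
 let ?t = "s(|regs := (regs s)(20 := k), ins := zs|)"
 have "spec W (Input 20) s 1 (%t. t = ?t)" using ins k unfolding spec_def by simp
 then show ?thesis
 unfolding densest_program_def
 proof (rule spec_seq[where V = "T + 16"])
 fix t assume t: "t = ?t" and "frame (Input 20) s t"
 then have sp: "spec W c t T Q" by (intro body) simp_all
 have "regs t 20 = k" using t by simp
 have cases: "k = j ==> c = d ==> regs t 20 = j & spec W d t T Q" for j d
  using \<open>regs t 20 = k\<close> sp by simp
 let ?G = "spec W (Cond (Var 20) (Lit 1) initialise
  (Cond (Var 20) (Lit 2) (read_edge ;; insert_edge ;; answer)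
  (Cond (Var 20) (Lit 3) (read_edge ;; delete_edge ;; answer)
  (Cond (Var 20) (Lit 4) density_query subset_query)))) t (T + 16) Q"
 have g0: ?G if "regs t 20 = 0 & spec W initialise t T Q"
  using that b T by (simp add: spec_cond_iff) (erule spec_conseq[OF conjunct2]; simp)
 have g1: ?G if "regs t 20 = 1 & spec W (read_edge ;; insert_edge ;; answer) t T Q"
  using that b T by (simp add: spec_cond_iff) (erule spec_conseq[OF conjunct2]; simp)
 have g2: ?G if "regs t 20 = 2 & spec W (read_edge ;; delete_edge ;; answer) t T Q"
  using that b T by (simp add: spec_cond_iff) (erule spec_conseq[OF conjunct2]; simp)
 have g3: ?G if "regs t 20 = 3 & spec W density_query t T Q"
  using that b T by (simp add: spec_cond_iff)
 have g4: ?G if "regs t 20 = 4 & spec W subset_query t T Q"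
  using that b T by (simp add: spec_cond_iff)
 from c show ?G
  by (elim disjE conjE) (rule g0[OF cases] g1[OF cases] g2[OF cases] g3[OF cases] g4[OF cases]; assumption)+
 qed (use T in auto)
qed

text \<open>The exponent is at least 1, so that \<open>b\<close> is positive for
  \<open>n = 1\<close>, too.\<close>

definition log_bound :: "nat => nat" where
 "log_bound n = (LEAST h. 1 <= h & n <= 2 ^ h)"

lemma log_bound:
 assumes "1 <= n"
 shows "1 <= log_bound n" "n <= 2 ^ log_bound n" "2 ^ log_bound n <= 2 * n"
proof -
 have "n < 2 ^ n" by (rule less_exp)
 then have "1 <= n & n <= 2 ^ n" using assms by simp
 from LeastI[of "%h. 1 <= h & n <= 2 ^ h", OF this]
 show 1: "1 <= log_bound n" "n <= 2 ^ log_bound n" unfolding log_bound_def by auto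
 show "2 ^ log_bound n <= 2 * n"
 proof (cases "log_bound n = 1")
 case True
 then show ?thesis using assms by simp
 next
 case False
 then obtain k where k: "log_bound n = Suc k" "1 <= k" using 1(1) by (cases "log_bound n") auto
 have "\<not> (1 <= k & n <= 2 ^ k)"
  by (rule not_less_Least[of k "%h. 1 <= h & n <= 2 ^ h", folded log_bound_def]) (simp add: k)
 then show ?thesis using k by simp
 qed
qed

lemma setup_spec:
 assumes ins: "ins s = e # n # m # r # w # l # zs"
 and lt: "e < 2 ^ W" "n < 2 ^ W" "m < 2 ^ W" "r < 2 ^ W" "w < 2 ^ W" "l < 2 ^ W" "1 <= n"
 and eqs: "q = 4 * ((2 ^ W - 1) div e + 2)" "h = log_bound n" "R = min r n" "Q = q * q * h" "D = (8 * R * Q) div w + 1"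
 and bnds: "4 < bnd W" "10 < bnd W" "q < bnd W" "2 * n < bnd W" "h < bnd W" "q * q < bnd W" "4 * Q < bnd W" "8 * R < bnd W" "8 * R * Q < bnd W"
  "D < bnd W" "m * D < bnd W" "m * R < bnd W" "2 * (m * D) + 10 < bnd W" "m * D * R < bnd W" "m * D * R + m * R < bnd W"
  "m * D * R + m * R + 1 < bnd W"
 and rest: "\<And>t. regs t 0 = n ==> regs t 1 = R ==> regs t 2 = 4 * Q ==> regs t 3 = q ==> regs t 4 = D ==>
  regs t 5 = 2 * (m * D) + 10 ==> regs t 6 = m * D ==> regs t 7 = m * R ==> regs t 8 = h ==> regs t 9 = m * D * R + m * R + 1 ==>
  regs t 15 = l ==> arrs t = arrs s ==> ins t = zs ==> outs t = outs s ==> spec W c t T P"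
 and T: "0 <= T"
 shows "spec W (setup_input ;; setup_log ;; setup_rank ;; setup_params ;; c) s (T + 40 * real n + 140) P"
proof -
 let ?A = "%t :: store. regs t 0 = n & regs t 12 = m & regs t 13 = r & regs t 14 = w & regs t 15 = l & regs t 3 = q &
 arrs t = arrs s & ins t = zs & outs t = outs s"
 have quarter: "x + 2 < B" if "4 * (x + 2) < B" for x B :: nat using that by simp
 have b: "1 < bnd W" "2 < bnd W" "8 < bnd W" using bnds(2) by linarith+
 have b': "(2 ^ W - 1) div e + 2 < bnd W" by (rule quarter[OF bnds(3)[unfolded eqs(1)]])
 have "spec W setup_input s 30 (%t. ?A t & regs t 8 = 1 & regs t 16 = 2)"
 using ins lt b b' bnds(1,3) unfolding setup_input_def spec_def eqs(1) by simp
 then show ?thesis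
 proof (rule spec_seq[where V = "T + 40 * real n + 110"])
 fix s1 assume s1: "?A s1 & regs s1 8 = 1 & regs s1 16 = 2"
 let ?I = "%t :: store. ?A t & 1 <= regs t 8 & regs t 16 = 2 ^ regs t 8 & (\<forall>i. 1 <= i --> i < regs t 8 --> 2 ^ i < n) & 2 ^ regs t 8 <= 2 * n"
 \<comment> \<open>A linear budget for a logarithmic loop is enough, as the initialisation has no
   time bound to meet.\<close>
 let ?f = "%t :: store. 20 * real (2 * n - regs t 16) + 20"
 let ?B = "Assign 8 (Var 8 \<boxplus> Lit 1) ;; Assign 16 (Lit 2 \<boxtimes> Var 16)"
 have "spec W setup_log s1 (?f s1) (%t. ?I t & \<not> ev W t (Var 16) < ev W t (Var 0))"
  unfolding setup_log_def
 proof (rule spec_while)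
  show "?I s1" using s1 lt(7) by simp
  show "ok W t (Var 16) & ok W t (Var 0) & real (cost (Var 16) + cost (Var 0) + 2) <= ?f t" if "?I t" for t by simp
  fix t assume t: "?I t" "ev W t (Var 16) < ev W t (Var 0)"
  then have less: "2 ^ regs t 8 < n" by simp
  have e2: "regs t 8 < 2 ^ regs t 8" by (rule less_exp)
  have sb: "Suc (regs t 8) < bnd W" "2 * 2 ^ regs t 8 < bnd W" using less e2 bnds(4) by linarith+
  let ?t = "t(|regs := (regs t)(8 := Suc (regs t 8), 16 := 2 * 2 ^ regs t 8)|)"
  have run: "spec W ?B t 8 (%u. u = ?t)" using t(1) sb b unfolding spec_def by simp
  have I: "?I ?t" using t(1) less by (auto simp: less_Suc_eq)
  have "real (2 * n - 2 * 2 ^ regs t 8) + 1 <= real (2 * n - 2 ^ regs t 8)"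
  proof -
  have "2 * n - 2 * 2 ^ regs t 8 + 1 <= 2 * n - 2 ^ regs t 8" using less e2 by linarith
  then show ?thesis using of_nat_mono[of "2 * n - 2 * 2 ^ regs t 8 + 1" "2 * n - 2 ^ regs t 8", where 'a = real] by simp
  qed
  then have f: "?f ?t + 8 + real (cost (Var 16) + cost (Var 0) + 2) <= ?f t" using t(1) by simp
  show "\<exists>T\<ge>0. spec W ?B t T (%s'. ?I s' & ?f s' + T + real (cost (Var 16) + cost (Var 0) + 2) <= ?f t)"
  by (intro exI[of _ 8] conjI, simp, rule spec_conseq[OF run order.refl], hypsubst, intro conjI[OF I f])
 qed
 then have "spec W setup_log s1 (40 * real n + 20) (%t. ?A t & regs t 8 = h)"
 proof (rule spec_conseq)
  have "real (2 * n - regs s1 16) <= real (2 * n)" by (intro of_nat_mono) simp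
  then show "?f s1 <= 40 * real n + 20" by simp
  fix t assume t: "?I t & \<not> ev W t (Var 16) < ev W t (Var 0)"
  have "log_bound n = regs t 8"
  unfolding log_bound_def
  proof (rule Least_equality)
  show "1 <= regs t 8 & n <= 2 ^ regs t 8" using t by simp
  show "regs t 8 <= y" if "1 <= y & n <= 2 ^ y" for y
  proof (rule ccontr)
   assume "\<not> regs t 8 <= y"
   then have "2 ^ y < n" using t that by simp
   then show False using that by simp
  qed
  qed
  then show "?A t & regs t 8 = h" using t eqs(2) by simp
 qed
 then show "spec W (setup_log ;; setup_rank ;; setup_params ;; c) s1 (T + 40 * real n + 110) P"
 proof (rule spec_seq[where V = "T + 90"])
  fix s2 assume s2: "?A s2 & regs s2 8 = h"
  have "spec W setup_rank s2 10 (%t. ?A t & regs t 8 = h & regs t 1 = R)"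
  using s2 unfolding setup_rank_def spec_def eqs(3) by (cases "r < n") simp_all
  then show "spec W (setup_rank ;; setup_params ;; c) s2 (T + 90) P"
  proof (rule spec_seq[where V = "T + 80"])
  fix s3 assume s3: "?A s3 & regs s3 8 = h & regs s3 1 = R"
  let ?K = "%t :: store. regs t 0 = n & regs t 1 = R & regs t 2 = 4 * Q & regs t 3 = q & regs t 4 = D &
   regs t 5 = 2 * (m * D) + 10 & regs t 6 = m * D & regs t 7 = m * R & regs t 8 = h & regs t 9 = m * D * R + m * R + 1 &
   regs t 15 = l & arrs t = arrs s & ins t = zs & outs t = outs s"
  have QQ: "q * q * h = Q" and DD: "(8 * R * Q) div w + 1 = D" using eqs by simp_all
  have Qb: "Q < bnd W" using bnds(7) by linarith
  have mb: "2 * (m * D) < bnd W" using bnds(13) by linarith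
  have "spec W setup_params s3 60 ?K"
   unfolding setup_params_def
   using s3 bnds b QQ DD Qb mb unfolding spec_def by simp
  then show "spec W (setup_params ;; c) s3 (T + 80) P"
   by (rule spec_seq[where V = T]) (use T in \<open>auto intro: rest\<close>)
  qed (use T in auto)
 qed (use T in auto)
 qed (use T in auto)
qed

lemma edge_valid:
 assumes "e \<noteq> {}" "e \<subseteq> {..<n}" "card e <= R"
 shows "valid n R (sorted_list_of_set e)" "encode_edge e = length (sorted_list_of_set e) # sorted_list_of_set e"
 "set (sorted_list_of_set e) = e"
proof -
 have f: "finite e" using assms(2) finite_subset by blast
 then show "valid n R (sorted_list_of_set e)" "set (sorted_list_of_set e) = e"
 using assms unfolding valid_def by (auto simp: sorted_list_of_set_eq_Nil_iff)
 show "encode_edge e = length (sorted_list_of_set e) # sorted_list_of_set e" unfolding encode_edge_def by simp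
qed

lemma count_le_induced: "count E e <= size (induced_edges E e)"
 by (induction E) (auto simp: induced_edges_def)

lemma size_induced:
 assumes "\<And>e. e \<in># E ==> finite e"
 shows "size (filter_mset (%ys. set ys \<subseteq> U) (image_mset sorted_list_of_set E)) = size (induced_edges E U)"
 using assms by (induction E) (auto simp: induced_edges_def)

lemma disjoint_mono: "A \<inter> Z = {} ==> Y \<subseteq> Z ==> A \<inter> Y = {}"
 by blast

section \<open>Specifications of the operations and of the initialisation\<close>

context densest
begin

lemma tracks_cong:
 assumes "tracks s M nid X" "frame C s s'" "10 <= lo C"
 "wr C \<inter> ({10..21} \<union> {24..31} \<union> {40..45} \<union> {48..51}) = {}"
 shows "tracks s' M nid X"
proof -
 have t: "trep s (prefix_count M) nid" and v: "\<And>ys. ys \<in># M ==> valid n R ys" "size M <= m"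
 using assms(1) unfolding tracks_def by auto
 have a: "arrs s' a = arrs s a" if "a \<in> {24..27} \<union> {44, 45}" for a
 by (rule frameD(2)[OF assms(2)]) (use that assms(4) in auto)
 have "{10..21} \<union> {28..31} \<union> {40..43} \<union> {48..51} \<subseteq> {10..21} \<union> {24..31} \<union> {40..45} \<union> {48..51 :: nat}" by auto
 from disjoint_mono[OF assms(4) this] have c: "copies s' M xs 0 nid X" for xs
 by (rule copies_cong[OF tracks_copies[OF assms(1)] assms(2,3)])
 have "trep s' (prefix_count M) nid = trep s (prefix_count M) nid" by (rule trep_cong) (simp_all add: a)
 with t have "trep s' (prefix_count M) nid" by simp
 from copies_tracks[OF c this v] show ?thesis .
qed

lemma tracks_io:
 assumes "tracks s M nid X"
 shows "tracks (s(|ins := i, outs := ys|)) M nid X"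
 by (rule tracks_cong[OF assms, of "Input 20"]) (simp_all add: frame_def)

lemma ins_time_nonneg: "0 <= ins_time"
 unfolding ins_time_def using Lam_pos b_pos by simp

lemma answer_tracks:
 assumes "tracks s M nid X"
 shows "spec W answer s (60 * real (q * h) + 200) (%t. (\<exists>nid X. tracks t M nid X) & answered t (regs t 10) & outs t = outs s)"
proof -
 obtain Q1 Q2 where "rep s X {} Q1 Q2" using assms unfolding tracks_def by blast
 from answer_spec[OF this] show ?thesis
 proof (rule spec_conseq)
 fix t assume t: "answered t (regs t 10)" "frame answer s t"
 have "tracks t M nid X" by (rule tracks_cong[OF assms t(2)]) auto
 moreover have "outs t = outs s" using frameD(4)[OF t(2)] by simp
 ultimately show "(\<exists>nid X. tracks t M nid X) & answered t (regs t 10) & outs t = outs s" using t(1) by blast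
 qed simp
qed

lemma read_tracks:
 assumes tr: "tracks s M nid X" and xs: "valid n R xs" and ins: "ins s = length xs # xs @ zs"
 shows "spec W read_edge s (20 * real R + 20) (%t. tracks t M nid X & regs t 20 = length xs &
 (\<forall>k<length xs. arrs t 46 k = xs ! k) & ins t = zs & outs t = outs s)"
proof -
 have len: "length xs <= R" and el: "\<And>x. x \<in> set xs ==> x < n" using xs unfolding valid_def by auto
 have "spec W read_edge s (20 * real (length xs) + 20) (%t. regs t 20 = length xs &
 (\<forall>k<length xs. arrs t 46 k = xs ! k) & ins t = zs & outs t = outs s)"
 proof (rule read_edge_spec[OF ins])
 show "length xs < bnd W" using len R_bnd by simp
 show "x < bnd W" if "x \<in> set xs" for x using el[OF that] n_bnd by simp
 show "1 < bnd W" using n_bnd by simp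
 qed
 then show ?thesis
 proof (rule spec_conseq)
 fix t assume t: "regs t 20 = length xs & (\<forall>k<length xs. arrs t 46 k = xs ! k) & ins t = zs & outs t = outs s" and fr: "frame read_edge s t"
 have "tracks t M nid X" by (rule tracks_cong[OF tr fr]) auto
 then show "tracks t M nid X & regs t 20 = length xs & (\<forall>k<length xs. arrs t 46 k = xs ! k) & ins t = zs & outs t = outs s"
  using t by blast
 qed (use len in simp)
qed

lemma read_insert_spec:
 assumes tr: "tracks s M nid X" and M: "size M < m" and xs: "valid n R xs" and ins: "ins s = length xs # xs @ zs"
 shows "spec W (read_edge ;; insert_edge) s (real D * (ins_time + 40 * real R + 240) + 220 * real R + 60)
 (%t. (\<exists>nid X. tracks t (add_mset xs M) nid X) & ins t = zs & outs t = outs s)"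
proof (rule spec_seq[OF read_tracks[OF tr xs ins], where V = "real D * (ins_time + 40 * real R + 240) + 200 * real R + 40"])
 fix t assume t: "tracks t M nid X & regs t 20 = length xs & (\<forall>k<length xs. arrs t 46 k = xs ! k) & ins t = zs & outs t = outs s"
 have "spec W insert_edge t (real D * (ins_time + 40 * real R + 240) + 200 * real R + 40) (%s'. \<exists>nid X. tracks s' (add_mset xs M) nid X)"
 by (rule insert_edge_spec[OF _ M xs]) (use t in auto)
 then show "spec W insert_edge t (real D * (ins_time + 40 * real R + 240) + 200 * real R + 40)
 (%t. (\<exists>nid X. tracks t (add_mset xs M) nid X) & ins t = zs & outs t = outs s)"
 by (rule spec_conseq) (use t in \<open>auto simp: frame_def\<close>)
qed (use ins_time_nonneg in \<open>auto intro!: add_nonneg_nonneg mult_nonneg_nonneg\<close>)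

lemma insert_op_spec:
 assumes tr: "tracks s M nid X" and M: "size M < m" and xs: "valid n R xs" and ins: "ins s = length xs # xs"
 shows "spec W (read_edge ;; insert_edge ;; answer) s (real D * (ins_time + 40 * real R + 240) + 220 * real R + 60 * real (q * h) + 300)
 (%t. (\<exists>nid X. tracks t (add_mset xs M) nid X) & answered t (regs t 10) & outs t = outs s)"
proof (rule spec_seq[OF read_tracks[OF tr xs, of "[]"], where V = "real D * (ins_time + 40 * real R + 240) + 200 * real R + 60 * real (q * h) + 250"])
 show "ins s = length xs # xs @ []" using ins by simp
 have T0: "0 <= real D * (ins_time + 40 * real R + 240)" using ins_time_nonneg by (intro mult_nonneg_nonneg) auto
 fix t assume t: "tracks t M nid X & regs t 20 = length xs & (\<forall>k<length xs. arrs t 46 k = xs ! k) & ins t = [] & outs t = outs s"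
 have "spec W insert_edge t (real D * (ins_time + 40 * real R + 240) + 200 * real R + 40) (%s'. \<exists>nid X. tracks s' (add_mset xs M) nid X)"
 by (rule insert_edge_spec[OF _ M xs]) (use t in auto)
 then show "spec W (insert_edge ;; answer) t (real D * (ins_time + 40 * real R + 240) + 200 * real R + 60 * real (q * h) + 250)
 (%t. (\<exists>nid X. tracks t (add_mset xs M) nid X) & answered t (regs t 10) & outs t = outs s)"
 proof (rule spec_seq[where V = "60 * real (q * h) + 200"])
 fix u assume "\<exists>nid X. tracks u (add_mset xs M) nid X" and fr: "frame insert_edge t u"
 then obtain nid' X' where "tracks u (add_mset xs M) nid' X'" by blast
 moreover have "outs u = outs s" using t frameD(4)[OF fr] by simp
 ultimately show "spec W answer u (60 * real (q * h) + 200) (%t. (\<exists>nid X. tracks t (add_mset xs M) nid X) & answered t (regs t 10) & outs t = outs s)"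
  using answer_tracks by fastforce
 qed auto
qed (use ins_time_nonneg in \<open>auto intro!: add_nonneg_nonneg mult_nonneg_nonneg\<close>)

lemma del_time_nonneg: "0 <= del_time"
proof -
 have "1 <= real NX + 2 * real b" using b_pos by simp
 then show ?thesis unfolding del_time_def using b_pos
 by (intro add_nonneg_nonneg mult_nonneg_nonneg ln_ge_zero) (auto simp: le_divide_eq)
qed

lemma delete_op_spec:
 assumes tr: "tracks s (add_mset xs M) nid X" and ins: "ins s = length xs # xs"
 shows "spec W (read_edge ;; delete_edge ;; answer) s (real D * (del_time + 190) + 240 * real R + 60 * real (q * h) + 330)
 (%t. (\<exists>nid X. tracks t M nid X) & answered t (regs t 10) & outs t = outs s)"
proof (rule spec_seq[OF read_tracks[OF tr, of xs "[]"], where V = "real D * (del_time + 190) + 220 * real R + 60 * real (q * h) + 280"])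
 show "valid n R xs" using tr unfolding tracks_def by simp
 show "ins s = length xs # xs @ []" using ins by simp
 fix t assume t: "tracks t (add_mset xs M) nid X & regs t 20 = length xs & (\<forall>k<length xs. arrs t 46 k = xs ! k) & ins t = [] & outs t = outs s"
 have "spec W delete_edge t (real D * (del_time + 190) + 220 * real R + 70) (%s'. \<exists>nid X. tracks s' M nid X)"
 by (rule delete_edge_spec) (use t in auto)
 then show "spec W (delete_edge ;; answer) t (real D * (del_time + 190) + 220 * real R + 60 * real (q * h) + 280)
 (%t. (\<exists>nid X. tracks t M nid X) & answered t (regs t 10) & outs t = outs s)"
 proof (rule spec_seq[where V = "60 * real (q * h) + 200"])
 fix u assume "\<exists>nid X. tracks u M nid X" and fr: "frame delete_edge t u"
 then obtain nid' X' where "tracks u M nid' X'" by blast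
 moreover have "outs u = outs s" using t frameD(4)[OF fr] by simp
 ultimately show "spec W answer u (60 * real (q * h) + 200) (%t. (\<exists>nid X. tracks t M nid X) & answered t (regs t 10) & outs t = outs s)"
  using answer_tracks by fastforce
 qed auto
qed (use del_time_nonneg in \<open>auto intro!: add_nonneg_nonneg mult_nonneg_nonneg\<close>)

lemma density_query_spec:
 assumes tr: "tracks s M nid X" and an: "answered s (regs s 10)"
 shows "spec W density_query s 60 (%t. (\<exists>nid X. tracks t M nid X) & answered t (regs t 10) &
 outs t = outs s @ [arrs s 42 (arrs s 40 0) * (q - 1), (q + 1) * D])"
proof -
 obtain Q1 Q2 where rep: "rep s X {} Q1 Q2" using tr unfolding tracks_def by blast
 note p = parD[OF repD(1)[OF rep]] and so = sorted_byD[OF repD(2)[OF rep, unfolded srep_def]]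
 let ?\<Delta> = "arrs s 42 (arrs s 40 0)"
 have \<Delta>: "?\<Delta> <= NX" by (rule load_bnd(1)[OF rep so(1)[OF n_pos]])
 have "(q - 1) * ?\<Delta> <= (q + 1) * (NX + n + D)" by (intro mult_le_mono) (use \<Delta> in linarith)+
 then have b1: "?\<Delta> * (q - 1) < bnd W" using q_bnd by (simp only: mult.commute)
 have "(q + 1) * D <= (q + 1) * (NX + n + D)" by (intro mult_le_mono) linarith+
 then have b2: "(q + 1) * D < bnd W" using q_bnd by linarith
 have "(q + 1) * 1 <= (q + 1) * (NX + n + D)" by (intro mult_le_mono2) (use n_pos in linarith)
 from le_less_trans[OF this q_bnd] have b3: "q + 1 < bnd W" by simp
 have b4: "1 < bnd W" "arrs s 40 0 < bnd W" using n_bnd so(1)[OF n_pos] by simp_all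
 have "spec W density_query s 60 (%t. t = s(|outs := outs s @ [?\<Delta> * (q - 1), (q + 1) * D]|))"
 unfolding density_query_def spec_def using p b1 b2 b3 b4 q_ge by simp
 then show ?thesis
 proof (rule spec_conseq)
 fix t assume t: "t = s(|outs := outs s @ [?\<Delta> * (q - 1), (q + 1) * D]|)"
 have "tracks t M nid X" by (rule tracks_cong[OF tr, of "Input 20"]) (simp_all add: frame_def t)
 then show "(\<exists>nid X. tracks t M nid X) & answered t (regs t 10) &
  outs t = outs s @ [?\<Delta> * (q - 1), (q + 1) * D]"
  using an unfolding answered_def t by auto
 qed simp
qed

lemma answered_le: "tracks s M nid X ==> answered s k ==> k <= n"
proof -
 assume tr: "tracks s M nid X" and an: "answered s k"
 obtain Q1 Q2 where rep: "rep s X {} Q1 Q2" using tr unfolding tracks_def by blast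
 note so = sorted_byD(5)[OF repD(2)[OF rep, unfolded srep_def]]
 show "k <= n" using an so unfolding answered_def Let_def by auto
qed

lemma subset_query_spec:
 assumes tr: "tracks s M nid X" and an: "answered s (regs s 10)"
 shows "spec W subset_query s (30 * real (regs s 10) + 40) (%t. (\<exists>nid X. tracks t M nid X) & answered t (regs t 10) &
 outs t = outs s @ map (arrs s 40) [0..<regs s 10])"
proof -
 let ?k = "regs s 10"
 have k: "?k < bnd W" "1 < bnd W" using answered_le[OF tr an] n_bnd by simp_all
 let ?I = "%i (t :: store). arrs t = arrs s & regs t 10 = ?k & outs t = outs s @ map (arrs s 40) [0..<i]"
 have "spec W subset_query s (30 * real ?k + 40) (%t. ?I ?k t & regs t 21 = ?k)"
 unfolding subset_query_def
 proof (rule spec_for[where \<tau> = 10 and N = ?k and Inv = ?I])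
 fix i t assume i: "i < ?k" "?I i t" "regs t 21 = i"
 then have "i < bnd W" using k by simp
 then show "spec W (Output (Elem 40 (Var 21))) t 10 (%s'. regs s' 21 = i & ?I (Suc i) (s'(|regs := (regs s')(21 := Suc i)|)))"
  using i k unfolding spec_def by simp
 qed (use k in auto)
 then show ?thesis
 proof (rule spec_conseq)
 fix t assume t: "?I ?k t & regs t 21 = ?k" and fr: "frame subset_query s t"
 have "tracks t M nid X" by (rule tracks_cong[OF tr fr]) (auto simp: subset_query_def)
 then show "(\<exists>nid X. tracks t M nid X) & answered t (regs t 10) & outs t = outs s @ map (arrs s 40) [0..<?k]"
  using t an unfolding answered_def by auto
 qed simp
qed

lemma fill_tables_spec:
 assumes p: "par s" and z: "\<And>a i. arrs s a i = 0"
 shows "spec W fill_tables s (40 * real n + 80 * real NX + 80 * real NN + 60) (%t. tracks t {#} (%_. 0) {})"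
proof -
 have b: "1 < bnd W" "n < bnd W" using n_bnd by simp_all
 let ?B1 = "Put 40 (Var 21) (Var 21) ;; Put 41 (Var 21) (Var 21)"
 let ?B2 = "Assign 60 (Lit 0) ;; Assign 61 (Var 21) ;; lpush 28"
 let ?B3 = "Assign 60 (Lit 0) ;; Assign 61 (Var 21 \<boxplus> Lit 1) ;; lpush 24"
 let ?I1 = "%i t. par t & (\<forall>k<i. arrs t 40 k = k & arrs t 41 k = k)"
 let ?I2 = "%i t. par t & brep c 28 t (%x. if x < i then Some 0 else None)"
 let ?I3 = "%i t. par t & brep c 24 t (%x. if 0 < x & x <= i then Some 0 else None)"
 have br: "brep c a (t(|regs := g|)) F = brep c a t F" for a t g F by (rule brep_cong) simp_all
 have push: "spec W (lpush a) t 60 (%u. brep c a u (F(e := Some 0)))"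
 if "brep c a t F" "par t" "regs t 60 = 0" "regs t 61 = e" "e < c" "F e = None" "a = 28 \<or> a = 24" for a t F e
 proof (rule bpush_spec[OF that(1) _ that(3,4) _ that(5,6)])
 show "fits W c a 0" by (rule fits_le) (use that(7) in auto)
 show "regs t 9 = c" using parD(10)[OF that(2)] .
 qed
 have NXc: "NX < c" and NNc: "NN < c"
 proof -
 have "NX * 1 <= NX * R" using R_pos by (intro mult_le_mono2) simp
 then show "NX < c" "NN < c" using c_eq by linarith+
 qed
 have "spec W (For 21 (Var 0) ?B1) s (30 * real n + 10) (%t. ?I1 n t & regs t 21 = n)"
 proof (rule spec_for[where \<tau> = 14 and N = n and Inv = ?I1])
 fix i t assume i: "i < n" "?I1 i t" "regs t 21 = i"
 then have "i < bnd W" using b by simp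
 then show "spec W ?B1 t 14 (%s'. regs s' 21 = i & ?I1 (Suc i) (s'(|regs := (regs s')(21 := Suc i)|)))"
  using i b unfolding spec_def by (auto simp: less_Suc_eq)
 qed (use p b in \<open>auto simp: parD\<close>)
 then show ?thesis
 unfolding fill_tables_def
 proof (rule spec_seq[where V = "80 * real NX + 80 * real NN + 50"])
 fix s1 assume s1: "?I1 n s1 & regs s1 21 = n" and fr1: "frame (For 21 (Var 0) ?B1) s s1"
 let ?s2 = "s1(|arrs := (arrs s1)(43 := (arrs s1 43)(0 := n))|)"
 have a2: "arrs ?s2 a = arrs s a" if "a \<notin> {40, 41, 43}" for a using that frameD(2)[OF fr1, of a] by simp
 have z43: "arrs ?s2 43 = (%d. if d = 0 then n else 0)" using frameD(2)[OF fr1, of 43] z by (auto simp: fun_eq_iff)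
 have p2: "par ?s2" using s1 by simp
 have e28: "brep c 28 ?s2 (%_. None)" by (rule brep_empty) (use a2 z NXc in auto)
 have "spec W (For 21 (Var 6) ?B2) ?s2 (80 * real NX + 10) (%t. ?I2 NX t & regs t 21 = NX)"
 proof (rule spec_for[where \<tau> = 70 and N = NX and Inv = ?I2])
  show "?I2 0 (?s2(|regs := (regs ?s2)(21 := 0)|))" using p2 e28 by (simp add: br)
  fix i t assume i: "i < NX" "?I2 i t" "regs t 21 = i"
  let ?t = "t(|regs := (regs t)(60 := 0, 61 := i)|)"
  have "spec W (lpush 28) ?t 60 (%u. brep c 28 u ((%x. if x < i then Some 0 else None)(i := Some 0)))"
  by (rule push) (use i NXc in \<open>auto simp: br\<close>)
  then have "spec W (lpush 28) ?t 60 (%s'. regs s' 21 = i & ?I2 (Suc i) (s'(|regs := (regs s')(21 := Suc i)|)))"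
  proof (rule spec_conseq)
  fix u assume u: "brep c 28 u ((%x. if x < i then Some 0 else None)(i := Some 0))" and fr: "frame (lpush 28) ?t u"
  have eq: "(%x. if x < i then Some 0 else None)(i := Some 0) = (%x. if x < Suc i then Some (0 :: nat) else None)"
   by (intro ext) auto
  have "par u" using par_frame[OF fr] i by simp
  moreover have "regs u 21 = i" using frameD(1)[OF fr, of 21] i by simp
  ultimately show "regs u 21 = i & ?I2 (Suc i) (u(|regs := (regs u)(21 := Suc i)|))" using u unfolding eq by (simp add: br)
  qed simp
  then show "spec W ?B2 t 70 (%s'. regs s' 21 = i & ?I2 (Suc i) (s'(|regs := (regs s')(21 := Suc i)|)))"
  using i b unfolding spec_assign_iff by simp (erule spec_conseq; simp)
 qed (use NXc c_bnd in \<open>auto simp: parD\<close>)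
 then have "spec W (For 21 (Var 6) ?B2 ;; For 21 (Var 7) ?B3) ?s2 (80 * real NX + 80 * real NN + 30) (%t. tracks t {#} (%_. 0) {})"
 proof (rule spec_seq[where V = "80 * real NN + 10"])
  fix s3 assume s3: "?I2 NX s3 & regs s3 21 = NX" and fr3: "frame (For 21 (Var 6) ?B2) ?s2 s3"
  have wr28: "wr (For 21 (Var 6) ?B2) = {28, 30, 31}" by (auto simp: lpush_def)
  have a3: "arrs s3 a = arrs ?s2 a" if "a \<notin> {28, 30, 31}" for a using frameD(2)[OF fr3, of a] that unfolding wr28 by simp
  have e24: "brep c 24 s3 (%_. None)" by (rule brep_empty) (use a3 a2 z NXc in auto)
  have "spec W (For 21 (Var 7) ?B3) s3 (80 * real NN + 10) (%t. ?I3 NN t & regs t 21 = NN)"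
  proof (rule spec_for[where \<tau> = 70 and N = NN and Inv = ?I3])
  have eq0: "(%x. if 0 < x & x <= 0 then Some 0 else None) = (%_ :: nat. None :: nat option)" by (auto simp: fun_eq_iff)
  show "?I3 0 (s3(|regs := (regs s3)(21 := 0)|))" unfolding eq0 using s3 e24 by (simp add: br)
  fix i t assume i: "i < NN" "?I3 i t" "regs t 21 = i"
  let ?t = "t(|regs := (regs t)(60 := 0, 61 := Suc i)|)"
  have "spec W (lpush 24) ?t 60 (%u. brep c 24 u ((%x. if 0 < x & x <= i then Some 0 else None)(Suc i := Some 0)))"
   by (rule push) (use i NNc in \<open>auto simp: br\<close>)
  then have "spec W (lpush 24) ?t 60 (%s'. regs s' 21 = i & ?I3 (Suc i) (s'(|regs := (regs s')(21 := Suc i)|)))"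
  proof (rule spec_conseq)
   fix u assume u: "brep c 24 u ((%x. if 0 < x & x <= i then Some 0 else None)(Suc i := Some 0))" and fr: "frame (lpush 24) ?t u"
   have eq: "(%x. if 0 < x & x <= i then Some 0 else None)(Suc i := Some 0) = (%x. if 0 < x & x <= Suc i then Some (0 :: nat) else None)"
   by (intro ext) auto
   have "par u" using par_frame[OF fr] i by simp
   moreover have "regs u 21 = i" using frameD(1)[OF fr, of 21] i by simp
   ultimately show "regs u 21 = i & ?I3 (Suc i) (u(|regs := (regs u)(21 := Suc i)|))" using u unfolding eq by (simp add: br)
  qed simp
  moreover have "Suc i < bnd W" using i NNc c_bnd by linarith
  ultimately show "spec W ?B3 t 70 (%s'. regs s' 21 = i & ?I3 (Suc i) (s'(|regs := (regs s')(21 := Suc i)|)))"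
   using i b unfolding spec_assign_iff by simp (erule spec_conseq; simp)
  qed (use NNc c_bnd in \<open>auto simp: parD\<close>)
  then show "spec W (For 21 (Var 7) ?B3) s3 (80 * real NN + 10) (%t. tracks t {#} (%_. 0) {})"
  proof (rule spec_conseq)
  fix t assume t: "?I3 NN t & regs t 21 = NN" and fr: "frame (For 21 (Var 7) ?B3) s3 t"
  have wr24: "wr (For 21 (Var 7) ?B3) = {24, 26, 27}" by (auto simp: lpush_def)
  have a4: "arrs t a = arrs s3 a" if "a \<notin> {24, 26, 27}" for a using frameD(2)[OF fr, of a] that unfolding wr24 by simp
  have at: "arrs t a = arrs s a" if "a \<notin> {24, 26, 27, 28, 30, 31, 40, 41, 43}" for a using a4 a3 a2 that by auto
  have at2: "arrs t a = arrs s1 a" if "a \<in> {40, 41}" for a using a4[of a] a3[of a] that by auto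
  have at3: "arrs t 43 = (%d. if d = 0 then n else 0)" using a4[of 43] a3[of 43] z43 by simp
  have z42: "arrs t 42 = (%_. 0)" using at[of 42] z by (auto simp: fun_eq_iff)
  have srt: "srep n t"
   unfolding srep_def sorted_by_def at3 z42 using at2 s1 by auto
  have "brep c 10 t (%_. None)" "lrep c 14 t (%_. [])" "lrep c 18 t (%_. [])"
   by (rule brep_empty; use at z NXc in auto)+
  then have "rep t {} {} (%_. []) (%_. [])"
   using t srt unfolding rep_def placement_def orientation_def leveled_def z42 by simp
  moreover have "brep c 28 t (leaves {} (vs t) (%_. 0))"
  proof -
   have "brep c 28 t F = brep c 28 s3 F" for F by (rule brep_cong) (simp_all add: a4)
   then show ?thesis using s3 unfolding leaves_def by (simp cong: if_cong)
  qed
  moreover have "trep t (prefix_count {#}) (%_. 0)"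
  proof -
   have pc: "prefix_count {#} = (%_. 0)" unfolding prefix_count_def by (intro ext) simp
   have "fresh NN (%_. 0) (%_. 0) = {k. 0 < k & k <= NN}" unfolding fresh_def by auto
   then show ?thesis using t at[of 44] at[of 45] z unfolding trep_def trie_def pc by simp
  qed
  ultimately show "tracks t {#} (%_. 0) {}" unfolding tracks_def by auto
  qed simp
 qed auto
 then show "spec W (Put 43 (Lit 0) (Var 0) ;; For 21 (Var 6) ?B2 ;; For 21 (Var 7) ?B3) s1 (80 * real NX + 80 * real NN + 50) (%t. tracks t {#} (%_. 0) {})"
  using b s1 by (simp add: spec_put_iff parD) (erule spec_conseq; simp)
 qed auto
qed

lemma load_edges_spec:
 assumes tr: "tracks s {#} nid X" and ins: "ins s = concat (map encode_edge es)" and len: "regs s 15 = length es" "length es <= m"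
 and es: "\<And>e. e \<in> set es ==> e \<noteq> {} & e \<subseteq> {..<n} & card e <= R"
 shows "spec W load_edges s (real m * (real D * (ins_time + 40 * real R + 240) + 220 * real R + 70) + 10)
 (%t. \<exists>nid X. tracks t (image_mset sorted_list_of_set (mset es)) nid X)"
proof -
 let ?\<tau> = "real D * (ins_time + 40 * real R + 240) + 220 * real R + 60"
 have T0: "0 <= ?\<tau>" using ins_time_nonneg by (intro add_nonneg_nonneg mult_nonneg_nonneg) auto
 let ?I = "%i (t :: store). (\<exists>nid X. tracks t (image_mset sorted_list_of_set (mset (take i es))) nid X) &
 ins t = concat (map encode_edge (drop i es)) & regs t 15 = length es"
 have upd: "?I i (t(|regs := (regs t)(16 := k)|))" if I: "?I i t" for i t k
 proof -
 obtain nid' X' where "tracks t (image_mset sorted_list_of_set (mset (take i es))) nid' X'" using I by blast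
 from tracks_cong[OF this frame_assign[of 16 "Lit 0" t k]]
 have "\<exists>nid X. tracks (t(|regs := (regs t)(16 := k)|)) (image_mset sorted_list_of_set (mset (take i es))) nid X" by auto
 then show ?thesis using I by simp
 qed
 have mb: "length es < bnd W"
 proof -
 have "m * 1 <= m * D" using D_pos by (intro mult_le_mono2) simp
 then show ?thesis using len NX_bnd NX_eq by linarith
 qed
 have "spec W load_edges s (real m * (?\<tau> + 10) + 10) (%t. ?I (length es) t & regs t 16 = length es)"
 unfolding load_edges_def
 proof (rule spec_for[where \<tau> = ?\<tau> and N = "length es" and Inv = ?I])
 have I0: "?I 0 s" using tr ins len by auto
 show "?I 0 (s(|regs := (regs s)(16 := 0)|))" by (rule upd[OF I0])
 fix i t assume i: "i < length es" "?I i t" "regs t 16 = i"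
 obtain nid' X' where tr': "tracks t (image_mset sorted_list_of_set (mset (take i es))) nid' X'" using i(2) by blast
 let ?e = "es ! i" and ?xs = "sorted_list_of_set (es ! i)"
 note e = edge_valid[of ?e n R] es[OF nth_mem[OF i(1)]]
 have d: "drop i es = ?e # drop (Suc i) es" using i(1) by (simp add: Cons_nth_drop_Suc)
 have tk: "mset (take (Suc i) es) = add_mset ?e (mset (take i es))" using i(1) by (simp add: take_Suc_conv_app_nth)
 have it: "ins t = length ?xs # ?xs @ concat (map encode_edge (drop (Suc i) es))"
  using i(2) e unfolding d by simp
 have "size (image_mset sorted_list_of_set (mset (take i es))) < m" using i(1) len by simp
 from read_insert_spec[OF tr' this _ it] e
 have "spec W (read_edge ;; insert_edge) t ?\<tau> (%u. (\<exists>nid X. tracks u (add_mset ?xs (image_mset sorted_list_of_set (mset (take i es)))) nid X) &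
  ins u = concat (map encode_edge (drop (Suc i) es)) & outs u = outs t)" by blast
 then show "spec W (read_edge ;; insert_edge) t ?\<tau> (%s'. regs s' 16 = i & ?I (Suc i) (s'(|regs := (regs s')(16 := Suc i)|)))"
 proof (rule spec_conseq)
  fix u assume u: "(\<exists>nid X. tracks u (add_mset ?xs (image_mset sorted_list_of_set (mset (take i es)))) nid X) &
  ins u = concat (map encode_edge (drop (Suc i) es)) & outs u = outs t" and fr: "frame (read_edge ;; insert_edge) t u"
  note f = frameD(1)[OF fr]
  have "?I (Suc i) u" using u i(2) f[of 15] unfolding tk by simp
  moreover have "regs u 16 = i" using f[of 16] i(3) by simp
  ultimately show "regs u 16 = i & ?I (Suc i) (u(|regs := (regs u)(16 := Suc i)|))" using upd by blast
 qed simp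
 next
 show "real (length es) * (?\<tau> + real (cost (Var 15)) + 7) + real (cost (Var 15)) + 5 <= real m * (?\<tau> + 10) + 10"
 proof -
  have "real (length es) * (?\<tau> + 8) <= real m * (?\<tau> + 10)" using len T0 by (intro mult_mono) auto
  then show ?thesis by simp
 qed
 qed (use mb T0 in auto)
 then show ?thesis
 by (rule spec_conseq) (auto simp: algebra_simps)
qed

section \<open>Correctness of the answers\<close>

lemma count_copies:
 assumes tr: "tracks s M nid X"
 shows "card {x \<in> X. P (vs s x)} = D * size (filter_mset P M)"
proof -
 obtain Q1 Q2 where "rep s X {} Q1 Q2" using tr unfolding tracks_def by blast
 then have fin: "finite X" using orientationD(13)[OF repD(6)] by blast
 have mem: "\<And>x. x \<in> X ==> vs s x \<in># M" and cnt: "\<And>ys. card {x \<in> X. vs s x = ys} = D * count M ys"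
 using tr unfolding tracks_def by auto
 let ?I = "{ys \<in> set_mset M. P ys}"
 have "{x \<in> X. P (vs s x)} = (\<Union>ys\<in>?I. {x \<in> X. vs s x = ys})" using mem by auto
 then have "card {x \<in> X. P (vs s x)} = card (\<Union>ys\<in>?I. {x \<in> X. vs s x = ys})" by (rule arg_cong)
 also have "\<dots> = (\<Sum>ys\<in>?I. card {x \<in> X. vs s x = ys})" using fin by (intro card_UN_disjoint) auto
 also have "\<dots> = D * (\<Sum>ys\<in>?I. count M ys)" by (simp add: cnt sum_distrib_left)
 also have "(\<Sum>ys\<in>?I. count M ys) = size (filter_mset P M)"
 unfolding size_multiset_overloaded_eq by (intro sum.cong) auto
 finally show ?thesis .
qed

text \<open>The maximum density is at most \<open>\<Delta> / D\<close>, where dividing by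
  \<open>D\<close> undoes the copying. The reported fraction \<open>v\<close> is this bound times
  \<open>(q - 1) / (q + 1)\<close>, and the density of the reported set is at least \<open>v\<close>
  by \<open>density_lower\<close>. The same chain of inequalities serves both queries.\<close>

lemma answer_correct:
 fixes \<epsilon> :: real
 assumes tr: "tracks s (image_mset sorted_list_of_set E) nid X" and an: "answered s k" and adm: "admissible n m r w E"
 and R: "R = min r n" and w: "1 <= w" "8 * R * (q * q * h) < D * w" and \<epsilon>: "0 < \<epsilon>" "\<epsilon> < 1" "4 <= real q * \<epsilon>"
 defines "\<Delta> \<equiv> arrs s 42 (arrs s 40 0)" and "S \<equiv> map (arrs s 40) [0..<k]"
 defines "v \<equiv> real (\<Delta> * (q - 1)) / real ((q + 1) * D)"
 shows "distinct S" "set S \<noteq> {}" "set S \<subseteq> {..<n}" "density E (set S) <= max_density {..<n} E"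
 "v <= density E (set S)" "max_density {..<n} E / (1 + \<epsilon>) <= v"
proof -
 obtain Q1 Q2 where rep: "rep s X {} Q1 Q2" using tr unfolding tracks_def by blast
 note srt = repD(2)[OF rep, unfolded srep_def]
 note so = sorted_byD[OF srt] and o = repD(6)[OF rep] and lv = repD(7)[OF rep]
 have load: "arrs s 42 u <= \<Delta>" if "u < n" for u
 proof -
 have "arrs s 41 u < arrs s 43 (arrs s 42 u)" using so(6)[OF so(3)[OF that]] so(4)[OF that] by simp
 then have "0 < arrs s 43 (arrs s 42 u)" by simp
 then show ?thesis using so(6)[OF n_pos] unfolding \<Delta>_def by simp
 qed
 have edge: "e \<noteq> {} & e \<subseteq> {..<n} & card e <= R" if "e \<in># E" for e
 proof -
 have "e \<noteq> {}" "e \<subseteq> {..<n}" using adm that unfolding admissible_def multi_hypergraph_def by auto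
 moreover have "card e <= rank E" unfolding rank_def using that by (intro Max_ge) auto
 moreover have "card e <= n" using card_mono[OF _ \<open>e \<subseteq> {..<n}\<close>] by simp
 ultimately show ?thesis using adm R unfolding admissible_def by auto
 qed
 have fe: "finite e" if "e \<in># E" for e using edge[OF that] finite_subset by blast
 have cp: "card {x \<in> X. set (vs s x) \<subseteq> U} = D * size (induced_edges E U)" for U
 using count_copies[OF tr, of "%ys. set ys \<subseteq> U"] size_induced[OF fe] by simp
 have up: "D * size (induced_edges E U) <= \<Delta> * card U" if "U \<subseteq> {..<n}" for U
 using density_upper[OF o that load] cp by simp
 have upd: "density E U <= real \<Delta> / real D" if U: "U \<subseteq> {..<n}" "U \<noteq> {}" for U
 proof -
 have "0 < card U" using U finite_subset by (auto simp: card_gt_0_iff)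
 moreover have "real (D * size (induced_edges E U)) <= real (\<Delta> * card U)" using up[OF U(1)] by (rule of_nat_mono)
 ultimately show ?thesis unfolding density_def using D_pos by (simp add: field_simps)
 qed
 have "finite {U. U \<subseteq> {..<n} & U \<noteq> {}}" by (rule finite_subset[of _ "Pow {..<n}"]) auto
 then have fin: "finite (density E ` {U. U \<subseteq> {..<n} & U \<noteq> {}})" by (rule finite_imageI)
 have ne: "density E ` {U. U \<subseteq> {..<n} & U \<noteq> {}} \<noteq> {}" using n_pos by auto
 have MD: "max_density {..<n} E <= real \<Delta> / real D"
 unfolding max_density_def
 proof (rule Max.boundedI[OF fin ne])
 fix a assume "a \<in> density E ` {U. U \<subseteq> {..<n} & U \<noteq> {}}"
 then obtain U where "U \<subseteq> {..<n}" "U \<noteq> {}" "a = density E U" by blast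
 then show "a <= real \<Delta> / real D" using upd by simp
 qed
 have "max_multiplicity E \<in> insert 0 (count E ` set_mset E)" unfolding max_multiplicity_def by (intro Max_in) auto
 moreover have "1 <= max_multiplicity E" using adm w unfolding admissible_def by simp
 ultimately obtain e where e: "e \<in># E" "count E e = max_multiplicity E" by auto
 \<comment> \<open>The promised multiplicity makes the largest load big: the at least
   \<open>D * w\<close> copies of one hyperedge are carried by at most \<open>R\<close>
   vertices.\<close>
 have "w <= size (induced_edges E e)" using count_le_induced[of E e] e adm unfolding admissible_def by simp
 then have "D * w <= D * size (induced_edges E e)" by (rule mult_le_mono2)
 also have "\<dots> <= \<Delta> * card e" by (rule up) (use edge[OF e(1)] in blast)
 also have "\<dots> <= \<Delta> * R" using edge[OF e(1)] by (intro mult_le_mono2) blast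
 finally have "8 * R * (q * q * h) < \<Delta> * R" using w(2) by linarith
 then have "(8 * (q * q * h)) * R < \<Delta> * R" by (simp only: mult_ac)
 then have "8 * (q * q * h) < \<Delta>" by simp
 then have big: "8 * q ^ 2 * h <= \<Delta>" by (simp add: power2_eq_square mult.assoc)
 let ?st = "(2 * \<Delta>) div b + 4"
 obtain d i where d: "d <= \<Delta>" "\<Delta> <= d + i * ?st" "i <= q * h" "k = arrs s 43 (d - ?st)" "q * k <= (q + 1) * arrs s 43 d"
 using an unfolding answered_def \<Delta>_def[symmetric] Let_def by blast
 note pre = sorted_by_prefix[OF srt]
 let ?S = "{v. v < n & d - ?st <= arrs s 42 v}"
 have kc: "card ?S = k" using pre(3) d(4) by simp
 have k0: "0 < k" using so(6)[OF n_pos, of "d - ?st"] d(1,4) unfolding \<Delta>_def by simp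
 have S: "set S = ?S" using pre(1)[of "d - ?st"] d(4) unfolding S_def by (auto simp: atLeast0LessThan)
 have "k <= n" using so(5) d(4) by simp
 then have "{0..<k} \<subseteq> {..<n}" by auto
 then show "distinct S" unfolding S_def using inj_on_subset[OF pre(2)] by (simp add: distinct_map)
 show ne': "set S \<noteq> {}" unfolding S_def using k0 by simp
 show sub: "set S \<subseteq> {..<n}" unfolding S by auto
 show "density E (set S) <= max_density {..<n} E" unfolding max_density_def
 by (rule Max_ge[OF fin], rule imageI) (use sub ne' in blast)
 have "q * card ?S <= (q + 1) * card {v. v < n & d <= arrs s 42 v}" using d(5) pre(3) kc by simp
 from density_lower[OF o lv load b_eq b_pos big d(2,3) refl this]
 have "\<Delta> * (q - 1) * k <= (q + 1) * (D * size (induced_edges E (set S)))" unfolding cp kc S .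
 then have "real (\<Delta> * (q - 1) * k) <= real ((q + 1) * (D * size (induced_edges E (set S))))" by (rule of_nat_mono)
 then have ineq: "real (\<Delta> * (q - 1)) * real k <= real ((q + 1) * D) * real (size (induced_edges E (set S)))" by (simp only: of_nat_mult mult.assoc)
 have "0 < (q + 1) * D" using D_pos by simp
 then have pos: "0 < real ((q + 1) * D)" by (simp only: of_nat_0_less_iff)
 have cS: "card (set S) = k" using kc S by simp
 have frac: "x / y <= z / u" if "x * u <= y * z" "0 < y" "0 < u" for x y z u :: real
 using that by (simp add: field_simps)
 show "v <= density E (set S)" unfolding v_def density_def cS by (rule frac[OF ineq pos]) (use k0 in simp)
 have q1: "real (q - 1) = real q - 1" using q_ge by (simp add: of_nat_diff)
 \<comment> \<open>This amounts to \<open>q * \<epsilon> >= 2 + \<epsilon>\<close>, which follows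
   from \<open>q * \<epsilon> >= 4\<close> and \<open>\<epsilon> < 1\<close>.\<close>
 have "(real q + 1) <= (real q - 1) * (1 + \<epsilon>)" using \<epsilon> by (simp add: algebra_simps)
 then have fr: "1 / (1 + \<epsilon>) <= (real q - 1) / (real q + 1)" using \<epsilon> by (simp add: field_simps)
 have quot: "x / u = x * (1 / u)" for x u :: real by simp
 have "max_density {..<n} E / (1 + \<epsilon>) <= (real \<Delta> / real D) / (1 + \<epsilon>)"
 by (rule divide_right_mono[OF MD]) (use \<epsilon> in simp)
 also have "\<dots> = (real \<Delta> / real D) * (1 / (1 + \<epsilon>))" by (rule quot)
 also have "\<dots> <= (real \<Delta> / real D) * ((real q - 1) / (real q + 1))" using fr by (intro mult_left_mono) auto
 also have "\<dots> = v"
 proof -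
 have "real (\<Delta> * (q - 1)) = real \<Delta> * (real q - 1)" "real ((q + 1) * D) = (real q + 1) * real D"
  using q1 by (simp_all add: algebra_simps)
 then show ?thesis unfolding v_def by auto
 qed
 finally show "max_density {..<n} E / (1 + \<epsilon>) <= v" .
qed

end

section \<open>Size of the parameters\<close>

lemma pow_mult_le: "x <= Z ^ i ==> y <= Z ^ j ==> x * y <= Z ^ (i + j)" for x :: nat
 by (simp add: power_add mult_le_mono)

lemma pow_add_le: "x <= Z ^ i ==> y <= Z ^ i ==> 2 <= Z ==> x + y <= Z ^ Suc i" for x :: nat
proof -
 assume a: "x <= Z ^ i" "y <= Z ^ i" "2 <= Z"
 have "2 * Z ^ i <= Z ^ Suc i" unfolding power_Suc using a(3) by (rule mult_le_mono1)
 then show ?thesis using a(1,2) by linarith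
qed

lemma pow_up: "x <= Z ^ i ==> i <= j ==> 2 <= Z ==> x <= Z ^ j" for x :: nat
 using power_increasing[of i j Z] by (meson le_trans one_le_numeral)

text \<open>Exponents of \<open>Z\<close> are added up along the definitions. The largest quantity
  is the space of the incidence bags, at most \<open>Z ^ 32\<close>, so the exponent 37 leaves
  room.\<close>

lemma parameter_bounds:
 fixes n m R w Z q h :: nat
 assumes Z: "8 <= Z" and le: "n <= Z" "m <= Z" "R <= Z" "q <= 16 * Z" "h <= 2 * Z"
 and Qd: "Q = q * q * h" and Dd: "D = (8 * R * Q) div w + 1" and X: "X <= Z ^ 37 ==> X < B" and B: "\<And>x. x <= Z ^ 37 ==> x < B"
 shows "n + 100 < B" "((n * (2 * (m * D) + 10)) + m * R + 1) * (m * D * R + m * R + 1) < B" "2 * (m * D * R + m * R + 1) < B"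
 "4 * (4 * Q) + 4 < B" "(q + 1) * (m * D + n + D) < B" "4 * (m * D) + 20 < B" "8 * R * Q < B" "8 * R < B" "q * q < B"
 "2 * (m * D) + 10 < B" "m * D * R + m * R < B" "m * D * R < B" "m * R < B" "D < B" "2 * n < B" "4 * Z < B" "m < B" "h < B"
proof -
 have Z2: "2 <= Z" using Z by simp
 have l1: "k <= 8 ==> k <= Z ^ 1" for k using Z by simp
 have e: "8 * 8 <= Z ^ 2" using mult_le_mono[OF Z Z] by (simp add: power2_eq_square)
 have n1: "n <= Z ^ 1" "m <= Z ^ 1" "R <= Z ^ 1" using le by simp_all
 have "16 * Z <= Z ^ 2 * Z" using e by (intro mult_le_mono1) linarith
 then have "q <= Z ^ 2 * Z" using le(4) by linarith
 then have q: "q <= Z ^ 3" by (simp add: power3_eq_cube power2_eq_square)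
 have "2 * Z <= Z * Z" using Z by (intro mult_le_mono1) linarith
 then have "h <= Z * Z" using le(5) by linarith
 then have h: "h <= Z ^ 2" by (simp add: power2_eq_square)
 have qq: "q * q <= Z ^ 6" using pow_mult_le[OF q q] by simp
 have Q: "Q <= Z ^ 8" using pow_mult_le[OF qq h] Qd by simp
 have R8: "8 * R <= Z ^ 2" using pow_mult_le[OF l1[of 8] n1(3)] by (simp add: power2_eq_square)
 have RQ: "8 * R * Q <= Z ^ 10" using pow_mult_le[OF R8 Q] by simp
 have "(8 * R * Q) div w <= Z ^ 10" using RQ div_le_dividend le_trans by blast
 moreover have "1 <= Z ^ 10" using Z by simp
 ultimately have D: "D <= Z ^ 11" using pow_add_le[of _ Z 10 1] Z2 Dd by simp
 have mD: "m * D <= Z ^ 12" using pow_mult_le[OF n1(2) D] by simp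
 have mDR: "m * D * R <= Z ^ 13" using pow_mult_le[OF mD n1(3)] by simp
 have mR: "m * R <= Z ^ 2" using pow_mult_le[OF n1(2,3)] by (simp add: power2_eq_square)
 have one: "1 <= Z ^ k" for k using Z by simp
 have s1: "m * D * R + m * R <= Z ^ 14" using pow_add_le[OF mDR pow_up[OF mR _ Z2] Z2] by simp
 have c: "m * D * R + m * R + 1 <= Z ^ 15" using pow_add_le[OF s1 one Z2] by simp
 have mD2: "2 * (m * D) <= Z ^ 13" using pow_mult_le[OF l1[of 2] mD] by simp
 have "10 <= Z ^ 2" using e by simp
 then have "10 <= Z ^ 13" by (rule pow_up) (use Z2 in auto)
 then have LM: "2 * (m * D) + 10 <= Z ^ 14" using pow_add_le[OF mD2 _ Z2] by simp
 have nLM: "n * (2 * (m * D) + 10) <= Z ^ 15" using pow_mult_le[OF n1(1) LM] by simp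
 have s2: "n * (2 * (m * D) + 10) + m * R <= Z ^ 16" using pow_add_le[OF nLM pow_up[OF mR _ Z2] Z2] by simp
 have s3: "n * (2 * (m * D) + 10) + m * R + 1 <= Z ^ 17" using pow_add_le[OF s2 one Z2] by simp
 show "((n * (2 * (m * D) + 10)) + m * R + 1) * (m * D * R + m * R + 1) < B"
 by (rule B[OF pow_up[OF pow_mult_le[OF s3 c] _ Z2]]) simp
 show "2 * (m * D * R + m * R + 1) < B"
 by (rule B[OF pow_up[OF pow_mult_le[OF l1[of 2] c] _ Z2]]) simp_all
 have "8 * 8 * (8 * 8) <= Z ^ (2 + 2)" by (rule pow_mult_le[OF e e])
 then have "100 <= Z ^ 4" by simp
 then have "n + 100 <= Z ^ 5" using pow_add_le[OF pow_up[OF n1(1) _ Z2, of 4] _ Z2] by simp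
 then show "n + 100 < B" by (rule B[OF pow_up[OF _ _ Z2]]) simp
 have Q4: "4 * (4 * Q) <= Z ^ 10" using pow_mult_le[OF l1[of 4] pow_mult_le[OF l1[of 4] Q]] by simp
 have "4 <= Z ^ 10" using pow_up[OF l1[of 4] _ Z2, of 10] by simp
 then have "4 * (4 * Q) + 4 <= Z ^ 11" using pow_add_le[OF Q4 _ Z2] by simp
 then show "4 * (4 * Q) + 4 < B" by (rule B[OF pow_up[OF _ _ Z2]]) simp
 have q1: "q + 1 <= Z ^ 4" using pow_add_le[OF q one Z2] by simp
 have mDn: "m * D + n <= Z ^ 13" using pow_add_le[OF mD pow_up[OF n1(1) _ Z2] Z2] by simp
 have mDnD: "m * D + n + D <= Z ^ 14" using pow_add_le[OF mDn pow_up[OF D _ Z2] Z2] by simp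
 show "(q + 1) * (m * D + n + D) < B"
 by (rule B[OF pow_up[OF pow_mult_le[OF q1 mDnD] _ Z2]]) simp
 have a: "4 * (m * D) <= Z ^ 13" using pow_mult_le[OF l1[of 4] mD] by simp
 have "20 <= Z ^ 2" using e by simp
 then have "20 <= Z ^ 13" by (rule pow_up) (use Z2 in auto)
 then have "4 * (m * D) + 20 <= Z ^ 14" using pow_add_le[OF a _ Z2] by simp
 then show "4 * (m * D) + 20 < B" by (rule B[OF pow_up[OF _ _ Z2]]) simp
 show "8 * R * Q < B" using RQ by (rule B[OF pow_up[OF _ _ Z2]]) simp
 show "8 * R < B" using R8 by (rule B[OF pow_up[OF _ _ Z2]]) simp
 show "q * q < B" using qq by (rule B[OF pow_up[OF _ _ Z2]]) simp
 show "2 * (m * D) + 10 < B" using LM by (rule B[OF pow_up[OF _ _ Z2]]) simp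
 show "m * D * R + m * R < B" using s1 by (rule B[OF pow_up[OF _ _ Z2]]) simp
 show "m * D * R < B" using mDR by (rule B[OF pow_up[OF _ _ Z2]]) simp
 show "m * R < B" using mR by (rule B[OF pow_up[OF _ _ Z2]]) simp
 show "D < B" using D by (rule B[OF pow_up[OF _ _ Z2]]) simp
 show "m < B" using n1(2) by (rule B[OF pow_up[OF _ _ Z2]]) simp
 show "h < B" using h by (rule B[OF pow_up[OF _ _ Z2]]) simp
 have "2 * n <= Z ^ 2" using pow_mult_le[OF l1[of 2] n1(1)] by (simp add: power2_eq_square)
 then show "2 * n < B" by (rule B[OF pow_up[OF _ _ Z2]]) simp
 have "4 * Z <= Z ^ 2" using Z by (simp add: power2_eq_square)
 then show "4 * Z < B" by (rule B[OF pow_up[OF _ _ Z2]]) simp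
qed

text \<open>The program recovers \<open>1 / \<epsilon>\<close> up to a constant from the fixed-point number by dividing
 the largest word by it.\<close>

lemma inverse_precision:
 fixes \<epsilon> :: real
 assumes \<epsilon>: "0 < \<epsilon>" "\<epsilon> < 1" and P: "2 / \<epsilon> <= real P" and e: "e = nat \<lfloor>\<epsilon> * real P\<rfloor>"
 and q: "q = 4 * ((P - 1) div e + 2)"
 shows "4 <= real q * \<epsilon>" "real q <= 16 / \<epsilon>" "0 < e" "e < P"
proof -
 have eP: "2 <= \<epsilon> * real P" using P \<epsilon> by (simp add: field_simps)
 have P2: "2 <= real P" using eP \<epsilon> mult_right_mono[of \<epsilon> 1 "real P"] by simp
 have fl: "real e <= \<epsilon> * real P" "\<epsilon> * real P - 1 < real e" using e eP by linarith+
 then have e1: "1 < real e" using eP by linarith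
 then show e0: "0 < e" by simp
 have "real e < real P" using fl(1) \<epsilon> P2 mult_strict_right_mono[of \<epsilon> 1 "real P"] by linarith
 then show "e < P" by simp
 let ?d = "(P - 1) div e"
 have "?d * e <= P - 1" by simp
 then have "real (?d * e) <= real (P - 1)" by (rule of_nat_mono)
 then have up: "real ?d * real e <= real P" using P2 by simp
 have half: "\<epsilon> * real P <= 2 * real e" using fl(2) e1 eP by linarith
 have "real ?d * (\<epsilon> * real P) <= real ?d * (2 * real e)" using half by (intro mult_left_mono) auto
 also have "\<dots> <= 2 * real P" using up by simp
 finally have "(real ?d * \<epsilon>) * real P <= 2 * real P" by (simp add: mult.assoc)
 then have d: "real ?d * \<epsilon> <= 2" using P2 by simp
 have "real q * \<epsilon> = 4 * (real ?d * \<epsilon>) + 8 * \<epsilon>" unfolding q by (simp add: algebra_simps)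
 then have "real q * \<epsilon> <= 16" using d \<epsilon> by linarith
 then show "real q <= 16 / \<epsilon>" using \<epsilon> by (simp add: field_simps)
 have "P - 1 < (?d + 1) * e" using e0 dividend_less_div_times[of e "P - 1"] by (simp add: algebra_simps)
 then have "P <= (?d + 1) * e" by linarith
 then have "real P <= real ((?d + 1) * e)" by (rule of_nat_mono)
 also have "\<dots> = (real ?d + 1) * real e" by (simp add: algebra_simps)
 also have "\<dots> <= (real ?d + 1) * (\<epsilon> * real P)" using fl(1) by (intro mult_left_mono) auto
 finally have "1 * real P <= ((real ?d + 1) * \<epsilon>) * real P" by (simp add: mult.assoc)
 then have "1 <= (real ?d + 1) * \<epsilon>" using P2 by simp
 then have "4 <= 4 * ((real ?d + 1) * \<epsilon>)" by simp
 also have "\<dots> <= real q * \<epsilon>" unfolding q using \<epsilon> by (simp add: algebra_simps)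
 finally show "4 <= real q * \<epsilon>" .
qed

lemma lg_ge: "1 <= lg x" "ln (real (max 2 x)) <= lg x" "1 <= x ==> ln (real x) <= lg x"
proof -
 have l2: "0 < ln (2 :: real)" "ln (2 :: real) <= 1" using ln_le_minus_one[of 2] by auto
 show "1 <= lg x" unfolding lg_def by (simp add: le_log_iff)
 have "0 <= ln (real (max 2 x))" by simp
 then show b: "ln (real (max 2 x)) <= lg x"
 unfolding lg_def log_def using l2 by (simp add: le_divide_eq mult_left_le)
 show "ln (real x) <= lg x" if "1 <= x"
 by (rule order.trans[OF _ b]) (use that in simp)
qed

lemma doubling_le_lg:
 assumes "2 ^ h <= 2 * n" "1 <= n"
 shows "real h <= 2 * lg n"
proof -
 have "(2 :: real) ^ h <= 2 * real n" using of_nat_mono[OF assms(1), where 'a = real] by simp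
 also have "\<dots> <= 2 * real (max 2 n)" by simp
 finally have "log 2 (2 ^ h) <= log 2 (2 * real (max 2 n))" by (intro log_mono) auto
 also have "\<dots> = 1 + lg n" unfolding lg_def by (subst log_mult) auto
 finally have "real h <= 1 + lg n" by (simp add: log_nat_power)
 then show ?thesis using lg_ge(1)[of n] by linarith
qed

text \<open>Read \<open>g\<close> as \<open>1 / \<epsilon>\<close>, \<open>L\<close> and
  \<open>\<mu>\<close> as the logarithms of \<open>n\<close> and \<open>m\<close>, \<open>A\<close>
  as the maximum in the claimed bound and \<open>l\<close> as \<open>q * h\<close>. Everything is
  compared with \<open>Y\<close>; the dominant term is \<open>b * b * R * \<mu>\<close> with
  \<open>b\<close> of order \<open>g ^ 2 * L\<close>.\<close>

lemma insert_time_bound: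
 fixes g L \<mu> A R r b D T l :: real
 assumes ge: "1 <= g" "1 <= L" "1 <= \<mu>" "1 <= A" "1 <= R" "R <= r" "0 <= b" "0 <= D"
 and b: "b <= 2048 * g ^ 2 * L" and D: "D <= 65 * A" and T: "T <= 33600 * (b * b * R * \<mu>) + 5000 * (b * R)" and l: "l <= 32 * g * L"
 shows "D * (T + 40 * R + 240) + 220 * R + 60 * l + 400 <= 10 ^ 14 * (A * (r * g ^ 4 * L ^ 2 * \<mu>))"
proof -
 define Y where "Y = R * g ^ 4 * L ^ 2 * \<mu>"
 have g4: "1 <= g ^ 4" "g ^ 2 <= g ^ 4" "g <= g ^ 4" using ge(1) power_increasing[of 2 4 g] power_increasing[of 1 4 g] by auto
 have L2: "1 <= L ^ 2" "L <= L ^ 2" using ge(2) power_increasing[of 1 2 L] by auto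
 have gL: "g ^ 2 * L <= g ^ 4 * L ^ 2" "g * L <= g ^ 4 * L ^ 2" "1 * 1 <= g ^ 4 * L ^ 2"
 using g4 L2 ge by (intro mult_mono; simp)+
 let ?P = "g ^ 4 * L ^ 2"
 have P0: "0 <= ?P" using ge by simp
 have RY: "R * ?P <= Y" unfolding Y_def using ge mult_left_mono[of 1 \<mu> "R * ?P"] P0 by (simp add: mult.assoc)
 have PY: "?P <= Y" using RY mult_right_mono[of 1 R ?P] ge P0 by linarith
 have "R * 1 <= R * ?P" using gL(3) ge by (intro mult_left_mono) auto
 then have R: "R <= Y" using RY by linarith
 have one: "1 <= Y" using PY gL(3) by linarith
 have "b * R <= (2048 * g ^ 2 * L) * R" using b ge by (intro mult_right_mono) auto
 also have "\<dots> = 2048 * (R * (g ^ 2 * L))" by simp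
 also have "\<dots> <= 2048 * (R * ?P)" using gL(1) ge by (intro mult_left_mono) auto
 finally have bR: "b * R <= 2048 * Y" using RY by linarith
 have "b * b <= (2048 * g ^ 2 * L) * (2048 * g ^ 2 * L)" using b ge by (intro mult_mono) auto
 also have "\<dots> = 4194304 * ?P" by (simp add: power2_eq_square power4_eq_xxxx)
 finally have "b * b * (R * \<mu>) <= 4194304 * ?P * (R * \<mu>)" using ge by (intro mult_right_mono) auto
 then have bb: "b * b * R * \<mu> <= 4194304 * Y" unfolding Y_def by (simp add: mult_ac)
 \<comment> \<open>The constant is \<open>33600 * 4194304\<close>, rounded up far enough to cover
   the lower order terms.\<close>
 have T': "T + 40 * R + 240 <= 140940000000 * Y" using T bb bR R one by linarith
 have "D * (T + 40 * R + 240) <= D * (140940000000 * Y)" using T' ge by (intro mult_left_mono) auto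
 also have "\<dots> <= (65 * A) * (140940000000 * Y)" using D one by (intro mult_right_mono) auto
 finally have DT: "D * (T + 40 * R + 240) <= 9161100000000 * (A * Y)" by simp
 have "32 * g * L <= 32 * Y" using gL(2) PY by linarith
 then have lY: "60 * l <= 1920 * Y" using l by linarith
 have "1 * Y <= A * Y" using ge one by (intro mult_right_mono) auto
 then have AY: "Y <= A * Y" by simp
 have sum: "U + 220 * R + 60 * l + 400 <= 100000000000000 * V"
 if "U <= 9161100000000 * V" "Y <= V" for U V using that lY R one by linarith
 have ten: "(10 :: real) ^ 14 = 100000000000000" by simp
 have "D * (T + 40 * R + 240) + 220 * R + 60 * l + 400 <= 10 ^ 14 * (A * Y)"
 unfolding ten by (rule sum[OF DT AY])
 also have "\<dots> <= 10 ^ 14 * (A * (r * g ^ 4 * L ^ 2 * \<mu>))" unfolding Y_def using ge by (intro mult_left_mono mult_right_mono) auto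
 finally show ?thesis .
qed

section \<open>Executions\<close>

lemma program_runs:
 assumes sp: "spec W prog s T Q" and rel: "rel W s (|pc = 0, mem = M, inp = xs, outp = []|)"
 shows "\<exists>M' ys t s'. runs W (cc prog 0) M xs M' ys t & real t <= T & Q s' &
 rel W s' (|pc = 0, mem = M', inp = ins s', outp = outs s'|) & outs s' = ys"
proof -
 from runs_wp[OF sp[unfolded spec_def] rel] obtain M' ys t s' p zs where
 r: "runs W (cc prog 0) M xs M' ys t" "real t <= T" "Q s'" "rel W s' (|pc = p, mem = M', inp = zs, outp = ys|)" by blast
 then have "rel W s' (|pc = 0, mem = M', inp = ins s', outp = outs s'|)" "outs s' = ys" unfolding rel_def by auto
 then show ?thesis using r by blast
qed

lemma rel_restart:
 "rel W s (|pc = 0, mem = M, inp = ins s, outp = outs s|) ==>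
 rel W (s(|ins := xs, outs := []|)) (|pc = 0, mem = M, inp = xs, outp = []|)"
 unfolding rel_def by simp

lemma admissible_edge:
 assumes "admissible n m r w E" "e \<in># E"
 shows "e \<noteq> {} & e \<subseteq> {..<n} & card e <= min r n"
proof -
 have e: "e \<noteq> {}" "e \<subseteq> {..<n}" using assms unfolding admissible_def multi_hypergraph_def by auto
 moreover have "card e <= rank E" unfolding rank_def using assms(2) by (intro Max_ge) auto
 moreover have "card e <= n" using card_mono[OF _ e(2)] by simp
 ultimately show ?thesis using assms(1) unfolding admissible_def by auto
qed

lemma admissible_pos:
 assumes adm: "admissible n m r w E" and w: "1 <= w"
 shows "1 <= n" "1 <= m" "1 <= r" "w <= m"
proof -
 have "max_multiplicity E \<in> insert 0 (count E ` set_mset E)" unfolding max_multiplicity_def by (intro Max_in) auto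
 moreover have "w <= max_multiplicity E" using adm unfolding admissible_def by simp
 ultimately obtain e where e: "e \<in># E" "w <= count E e" using w by auto
 have "size (induced_edges E e) <= size E" unfolding induced_edges_def by (simp add: size_filter_mset_lesseq)
 then show "w <= m" using e(2) count_le_induced[of E e] adm unfolding admissible_def by linarith
 then show "1 <= m" using w by linarith
 have f: "e \<noteq> {}" "e \<subseteq> {..<n}" "card e <= min r n" using admissible_edge[OF adm e(1)] by auto
 have "0 < card e" using f finite_subset by (auto simp: card_gt_0_iff)
 then show "1 <= n" "1 <= r" using f(3) by auto
qed

context densest
begin

text \<open>The invariant of reachable memories. Input and output left over from the last run are
  arbitrary, since the next run starts with fresh ones.\<close>

definition good :: "memory => nat set multiset => bool" where
 "good M E \<longleftrightarrow> (\<exists>s nid X. rel W s (|pc = 0, mem = M, inp = ins s, outp = outs s|) &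
  tracks s (image_mset sorted_list_of_set E) nid X & answered s (regs s 10))"

definition op_bound :: "operation => nat => real" where
 "op_bound p \<beta> = (case p of
  Insert e => real D * (ins_time + 40 * real R + 240) + 220 * real R + 60 * real (q * h) + 320
 | Delete e => real D * (del_time + 190) + 240 * real R + 60 * real (q * h) + 350
 | Max_Density => 80
 | Densest_Subset => 30 * real \<beta> + 60)"

lemma op_step:
 fixes \<epsilon> :: real
 assumes good: "good M E" and legal: "legal n m r w p E" and R: "R = min r n"
 and w: "1 <= w" "8 * R * (q * q * h) < D * w" and \<epsilon>: "0 < \<epsilon>" "\<epsilon> < 1" "4 <= real q * \<epsilon>"
 shows "\<exists>M' ys t. runs W (cc densest_program 0) M (encode_op p) M' ys t & real t <= op_bound p (length ys) &
 good M' (apply_op p E) & correct_answer \<epsilon> n E p ys"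
proof -
 obtain s0 nid X where rel0: "rel W s0 (|pc = 0, mem = M, inp = ins s0, outp = outs s0|)"
 and tr0: "tracks s0 (image_mset sorted_list_of_set E) nid X" and an0: "answered s0 (regs s0 10)"
 using good unfolding good_def by blast
 define s where "s = s0(|ins := encode_op p, outs := []|)"
 have rel: "rel W s (|pc = 0, mem = M, inp = encode_op p, outp = []|)" unfolding s_def by (rule rel_restart[OF rel0])
 have tr: "tracks s (image_mset sorted_list_of_set E) nid X" unfolding s_def by (rule tracks_io[OF tr0])
 have an: "answered s (regs s 10)" using an0 unfolding s_def answered_def by simp
 have so: "ins s = encode_op p" "outs s = []" unfolding s_def by simp_all
 have b4: "4 < bnd W" using n_bnd by simp
 let ?Q = "%ys u. (\<exists>nid X. tracks u (image_mset sorted_list_of_set (apply_op p E)) nid X) & answered u (regs u 10) & outs u = ys"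
 have finish: ?thesis if sp: "spec W densest_program s T (?Q ys)" and "T <= op_bound p (length ys)" "correct_answer \<epsilon> n E p ys" for T ys
 proof -
 from program_runs[OF sp rel] obtain M' zs t u where r: "runs W (cc densest_program 0) M (encode_op p) M' zs t" "real t <= T"
  "?Q ys u" "rel W u (|pc = 0, mem = M', inp = ins u, outp = outs u|)" "outs u = zs" by blast
 then have "good M' (apply_op p E)" unfolding good_def by blast
 then show ?thesis using r that(2,3) by (metis order.trans)
 qed
 have body: "\<exists>nid X. tracks t (image_mset sorted_list_of_set E) nid X" if "frame (Input 20) s t" for t
 using tracks_cong[OF tr that] by auto
 have an': "answered t (regs t 10)" if "frame (Input 20) s t" "arrs t = arrs s" for t
 using an frameD(1)[OF that(1), of 10] that(2) unfolding answered_def by simp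
 have adm: "admissible n m r w (apply_op p E)" using legal unfolding legal_def by simp
 show ?thesis
 proof (cases p)
 case (Insert e)
 have eE: "e \<in># apply_op p E" using Insert by simp
 have e: "e \<noteq> {}" "e \<subseteq> {..<n}" "card e <= R" using admissible_edge[OF adm eE] R by simp_all
 note v = edge_valid[OF e]
 have sz: "size (image_mset sorted_list_of_set E) < m" using adm Insert unfolding admissible_def by simp
 have "spec W densest_program s (real D * (ins_time + 40 * real R + 240) + 220 * real R + 60 * real (q * h) + 300 + 20) (?Q [])"
 proof (rule program_spec[where k = 1 and c = "read_edge ;; insert_edge ;; answer"])
  show "ins s = 1 # length (sorted_list_of_set e) # sorted_list_of_set e" using so Insert v by simp
  show "0 <= real D * (ins_time + 40 * real R + 240) + 220 * real R + 60 * real (q * h) + 300"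
  using ins_time_nonneg by (intro add_nonneg_nonneg mult_nonneg_nonneg) auto
  fix t assume t: "frame (Input 20) s t" "arrs t = arrs s" "ins t = length (sorted_list_of_set e) # sorted_list_of_set e" "outs t = outs s"
  from body[OF t(1)] obtain nid' X' where "tracks t (image_mset sorted_list_of_set E) nid' X'" by blast
  from insert_op_spec[OF this sz v(1) t(3)]
  show "spec W (read_edge ;; insert_edge ;; answer) t (real D * (ins_time + 40 * real R + 240) + 220 * real R + 60 * real (q * h) + 300) (?Q [])"
  using t(4) so Insert by simp
 qed (use b4 in auto)
 then show ?thesis by (rule finish) (simp_all add: op_bound_def Insert)
 next
 case (Delete e)
 have eE: "e \<in># E" using legal Delete unfolding legal_def by simp
 define E' where "E' = E - {#e#}"
 have E: "E = add_mset e E'" using eE unfolding E'_def by simp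
 have "valid n R (sorted_list_of_set e)" using tr eE unfolding tracks_def by auto
 then have fe: "finite e"
  unfolding valid_def by (metis sorted_list_of_set.fold_insort_key.infinite)
 have ap: "apply_op p E = E'" using Delete E'_def by simp
 have "spec W densest_program s (real D * (del_time + 190) + 240 * real R + 60 * real (q * h) + 330 + 20) (?Q [])"
 proof (rule program_spec[where k = 2 and c = "read_edge ;; delete_edge ;; answer"])
  show "ins s = 2 # length (sorted_list_of_set e) # sorted_list_of_set e" using so Delete fe by (simp add: encode_edge_def)
  show "0 <= real D * (del_time + 190) + 240 * real R + 60 * real (q * h) + 330"
  using del_time_nonneg by (intro add_nonneg_nonneg mult_nonneg_nonneg) auto
  fix t assume t: "frame (Input 20) s t" "arrs t = arrs s" "ins t = length (sorted_list_of_set e) # sorted_list_of_set e" "outs t = outs s"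
  from body[OF t(1)] obtain nid' X' where "tracks t (add_mset (sorted_list_of_set e) (image_mset sorted_list_of_set E')) nid' X'"
  unfolding E by auto
  from delete_op_spec[OF this t(3)]
  show "spec W (read_edge ;; delete_edge ;; answer) t (real D * (del_time + 190) + 240 * real R + 60 * real (q * h) + 330) (?Q [])"
  using t(4) so ap by simp
 qed (use b4 in auto)
 then show ?thesis by (rule finish) (simp_all add: op_bound_def Delete)
 next
 case Max_Density
 let ?\<Delta> = "arrs s 42 (arrs s 40 0)"
 have a: "admissible n m r w E" using adm Max_Density by simp
 note cor = answer_correct[OF tr an a R w \<epsilon>]
 have "spec W densest_program s (60 + 20) (?Q [?\<Delta> * (q - 1), (q + 1) * D])"
 proof (rule program_spec[where k = 3 and zs = "[]" and c = density_query])
  show "ins s = 3 # []" using so Max_Density by simp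
  fix t assume t: "frame (Input 20) s t" "arrs t = arrs s" "ins t = []" "outs t = outs s"
  from body[OF t(1)] obtain nid' X' where "tracks t (image_mset sorted_list_of_set E) nid' X'" by blast
  from density_query_spec[OF this an'[OF t(1,2)]]
  show "spec W density_query t 60 (?Q [?\<Delta> * (q - 1), (q + 1) * D])" using t so Max_Density by simp
 qed (use b4 in auto)
 then show ?thesis
 proof (rule finish)
  have "(q + 1) * D \<noteq> 0" using D_pos by simp
  then show "correct_answer \<epsilon> n E p [?\<Delta> * (q - 1), (q + 1) * D]"
  unfolding Max_Density correct_answer.simps using cor(4,5,6)
  by (intro exI[of _ "?\<Delta> * (q - 1)"] exI[of _ "(q + 1) * D"] conjI refl) (auto simp del: of_nat_mult)
 qed (simp add: op_bound_def Max_Density)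
 next
 case Densest_Subset
 have a: "admissible n m r w E" using adm Densest_Subset by simp
 note cor = answer_correct[OF tr an a R w \<epsilon>]
 let ?ys = "map (arrs s 40) [0..<regs s 10]"
 have "spec W densest_program s (30 * real (regs s 10) + 40 + 20) (?Q ?ys)"
 proof (rule program_spec[where k = 4 and zs = "[]" and c = subset_query])
  show "ins s = 4 # []" using so Densest_Subset by simp
  fix t assume t: "frame (Input 20) s t" "arrs t = arrs s" "ins t = []" "outs t = outs s"
  have r10: "regs t 10 = regs s 10" using frameD(1)[OF t(1), of 10] by simp
  from body[OF t(1)] obtain nid' X' where "tracks t (image_mset sorted_list_of_set E) nid' X'" by blast
  from subset_query_spec[OF this an'[OF t(1,2)]]
  show "spec W subset_query t (30 * real (regs s 10) + 40) (?Q ?ys)" using t so Densest_Subset r10 by simp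
 qed (use b4 in auto)
 then show ?thesis
 proof (rule finish)
  show "correct_answer \<epsilon> n E p ?ys"
  unfolding Densest_Subset correct_answer.simps using cor order.trans[OF cor(6,5)] by simp
 qed (simp add: op_bound_def Densest_Subset)
 qed
qed

lemma init_step:
 assumes adm: "admissible n m r w (mset es)" and R: "R = min r n"
 and eqs: "q = 4 * ((2 ^ W - 1) div nat \<lfloor>\<epsilon> * 2 ^ W\<rfloor> + 2)" "h = log_bound n" "D = (8 * R * (q * q * h)) div w + 1"
 and lt: "nat \<lfloor>\<epsilon> * 2 ^ W\<rfloor> < 2 ^ W" "r < 2 ^ W" "w < 2 ^ W" "m < bnd W" "q * q < bnd W" "h < bnd W" "q < bnd W"
  "8 * R < bnd W" "8 * R * (q * q * h) < bnd W" "2 * n < bnd W"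
 shows "\<exists>M ys t. runs W (cc densest_program 0) (%_. 0) (encode_init W \<epsilon> n m r w es) M ys t & good M (mset es)"
proof -
 let ?in = "encode_init W \<epsilon> n m r w es" and ?e = "nat \<lfloor>\<epsilon> * 2 ^ W\<rfloor>"
 define s where "s = (|regs = %_. 0, arrs = %_ _. 0, ins = ?in, outs = []|)"
 define zs where "zs = concat (map encode_edge es)"
 have rel: "rel W s (|pc = 0, mem = %_. 0, inp = ?in, outp = []|)" unfolding rel_def s_def by simp
 have es: "e \<noteq> {} & e \<subseteq> {..<n} & card e <= R" if "e \<in> set es" for e
 using admissible_edge[OF adm, of e] that R by simp
 have len: "length es <= m" using adm unfolding admissible_def by simp
 have bW: "bnd W <= 2 ^ W" unfolding bnd_def by simp
 let ?Q = "%u. (\<exists>nid X. tracks u (image_mset sorted_list_of_set (mset es)) nid X) & answered u (regs u 10)"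
 define T1 where "T1 = 60 * real (q * h) + 200"
 define T2 where "T2 = real m * (real D * (ins_time + 40 * real R + 240) + 220 * real R + 70) + 10"
 define T3 where "T3 = 40 * real n + 80 * real NX + 80 * real NN + 60"
 have T: "0 <= T1" "0 <= T2" "0 <= T3" unfolding T1_def T2_def T3_def
 using ins_time_nonneg by (auto intro!: add_nonneg_nonneg mult_nonneg_nonneg)
 have b4: "4 < bnd W" using n_bnd by simp
 have bQ: "4 * (q * q * h) < bnd W" using b_bnd b_eq by (simp add: power2_eq_square mult.assoc)
 have bE: "b = 4 * (q * q * h)" using b_eq by (simp add: power2_eq_square mult.assoc)
 have cE: "c = m * D * R + m * R + 1" using c_eq NX_eq NN_eq by simp
 have LE: "LM = 2 * (m * D) + 10" using LM_eq NX_eq by simp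
 have mE: "NX = m * D" "NN = m * R" using NX_eq NN_eq by simp_all
 have cb: "m * D * R + m * R + 1 < bnd W" using c_bnd cE by linarith
 have Db: "D < bnd W"
 proof -
 have "D <= (q + 1) * (NX + n + D)" by simp
 then show ?thesis using q_bnd by linarith
 qed
 have "spec W densest_program s (T3 + T2 + T1 + 40 * real n + 140 + 20) ?Q"
 proof (rule program_spec[where k = 0 and c = initialise])
 show "ins s = 0 # ?e # n # m # r # w # length es # zs" unfolding s_def zs_def encode_init_def by simp
 fix t :: store assume t: "arrs t = arrs s" "ins t = ?e # n # m # r # w # length es # zs"
 show "spec W initialise t (T3 + T2 + T1 + 40 * real n + 140) ?Q"
  unfolding initialise_def
 proof (rule setup_spec[OF t(2) lt(1) _ _ lt(2,3) _ _ eqs(1,2) R refl eqs(3)])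
  show "n < 2 ^ W" "1 <= n" using n_bnd bW n_pos by linarith+
  show "m < 2 ^ W" "length es < 2 ^ W" using lt(4) bW len by linarith+
  show "4 < bnd W" "10 < bnd W" using n_bnd by linarith+
  show "m * D < bnd W" "2 * (m * D) + 10 < bnd W" using LM_bnd unfolding LE by linarith+
  show "m * R < bnd W" "m * D * R < bnd W" "m * D * R + m * R < bnd W" using cb by linarith+
  show "0 <= T3 + T2 + T1" using T by linarith
  fix u :: store assume u: "regs u 0 = n" "regs u 1 = R" "regs u 2 = 4 * (q * q * h)" "regs u 3 = q" "regs u 4 = D"
  "regs u 5 = 2 * (m * D) + 10" "regs u 6 = m * D" "regs u 7 = m * R" "regs u 8 = h" "regs u 9 = m * D * R + m * R + 1"
  "regs u 15 = length es" "arrs u = arrs t" "ins u = zs"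
  have p: "par u" using u unfolding par_def by (simp add: bE cE LE mE)
  have z: "arrs u a i = 0" for a i using u t unfolding s_def by simp
  have "spec W fill_tables u T3 (%t. tracks t {#} (%_. 0) {})" unfolding T3_def by (rule fill_tables_spec[OF p z])
  then show "spec W (fill_tables ;; load_edges ;; answer) u (T3 + T2 + T1) ?Q"
  proof (rule spec_seq[where V = "T2 + T1"])
  fix u1 assume u1: "tracks u1 {#} (%_. 0) {}" and fr: "frame fill_tables u u1"
  have "ins u1 = concat (map encode_edge es)" using frameD(3)[OF fr] u zs_def by simp
  moreover have "regs u1 15 = length es" using frameD(1)[OF fr, of 15] u by simp
  ultimately have "spec W load_edges u1 T2 (%t. \<exists>nid X. tracks t (image_mset sorted_list_of_set (mset es)) nid X)"
   unfolding T2_def by (intro load_edges_spec[OF u1 _ _ len es])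
  then show "spec W (load_edges ;; answer) u1 (T2 + T1) ?Q"
  proof (rule spec_seq[where V = T1])
   fix u2 assume "\<exists>nid X. tracks u2 (image_mset sorted_list_of_set (mset es)) nid X"
   then obtain nid X where "tracks u2 (image_mset sorted_list_of_set (mset es)) nid X" by blast
   from answer_tracks[OF this] show "spec W answer u2 T1 ?Q" unfolding T1_def by (rule spec_conseq) auto
  qed (use T in auto)
  qed (use T in auto)
 qed (fact lt Db bQ cb)+
 qed (use b4 T in auto)
 from program_runs[OF this rel] obtain M ys t u where r: "runs W (cc densest_program 0) (%_. 0) ?in M ys t"
 "?Q u" "rel W u (|pc = 0, mem = M, inp = ins u, outp = outs u|)" by blast
 then have "good M (mset es)" unfolding good_def by blast
 then show ?thesis using r by blast
qed

text \<open>In \<open>Lam / b\<close> the main term is \<open>4 * m * D / (R * b)\<close>, at most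
  \<open>12 * m\<close> by the bound on \<open>D\<close>, so the logarithm of insertions depends on
  \<open>m\<close> only. For deletions \<open>NX / b\<close> is merely bounded by
  \<open>3 * m * n\<close>, which brings in the logarithm of \<open>n\<close> as well.\<close>

lemma log_terms:
 assumes D: "D <= 3 * (R * b)" and R: "R <= n"
 shows "ln (1 + Lam / real b) <= 6 * lg m" "ln ((real NX + 2 * real b) / (2 * real b)) <= 4 * (lg n * lg m)"
proof -
 have m1: "1 <= m" using NX_pos NX_eq by (cases m) auto
 have NXr: "real NX = real m * real D" using NX_eq by simp
 let ?M = "real (max 2 m)"
 have b1: "1 <= real b" and R1: "1 <= real R" using b_pos R_pos by simp_all
 have D': "real D <= 3 * (real R * real b)" using of_nat_mono[OF D, where 'a = real] by simp
 have DR: "real D / (real R * real b) <= 3" using D' b1 R1 by (simp add: divide_le_eq)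
 have "Lam / real b = 4 * real m * (real D / (real R * real b)) + 6 / real b + 1"
 unfolding Lam_def NXr using b1 R1 by (simp add: field_simps)
 also have "\<dots> <= 4 * real m * 3 + 6 + 1"
 using DR b1 by (intro add_mono mult_left_mono) (auto simp: divide_le_eq)
 finally have "1 + Lam / real b <= 20 * ?M" using m1 by simp
 also have "\<dots> <= 2 ^ 5 * ?M" by simp
 also have "\<dots> <= ?M ^ 5 * ?M" by (intro mult_right_mono power_mono) auto
 finally have le: "1 + Lam / real b <= ?M ^ 6" by (simp add: power_Suc2[symmetric] del: power_Suc)
 have "0 < 1 + Lam / real b" using Lam_pos b1 by (simp add: add_pos_nonneg)
 then have "ln (1 + Lam / real b) <= ln (?M ^ 6)" using le by simp
 also have "\<dots> = 6 * ln ?M" by (simp add: ln_realpow)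
 finally show "ln (1 + Lam / real b) <= 6 * lg m" using lg_ge(2)[of m] by linarith
 have n1: "1 <= n" using n_pos by simp
 have "real m * real D <= real m * (3 * (real R * real b))" using D' by (intro mult_left_mono) auto
 also have "\<dots> <= real m * (3 * (real n * real b))" using R b1 by (intro mult_left_mono mult_right_mono) auto
 finally have mD: "real m * real D <= 3 * (real m * real n) * real b" by (simp add: mult_ac)
 have mn: "1 <= real m * real n" using mult_mono[of 1 "real m" 1 "real n"] m1 n1 by simp
 have "(real NX + 2 * real b) / (2 * real b) <= 3 * (real m * real n)"
 proof -
 have "2 * real b <= 3 * (real m * real n) * real b"
  using mult_right_mono[of 2 "3 * (real m * real n)" "real b"] mn b1 by simp
 then have "real NX + 2 * real b <= 3 * (real m * real n) * (2 * real b)" using mD unfolding NXr by simp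
 then show ?thesis using b1 by (simp add: divide_le_eq)
 qed
 moreover have "0 < (real NX + 2 * real b) / (2 * real b)" using b1 by (intro divide_pos_pos) auto
 ultimately have "ln ((real NX + 2 * real b) / (2 * real b)) <= ln (3 * (real m * real n))" by simp
 also have "\<dots> = ln 3 + ln (real m) + ln (real n)" using m1 n1 by (simp add: ln_mult)
 also have "\<dots> <= 2 + lg m + lg n" using lg_ge(3)[OF m1] lg_ge(3)[OF n1] ln_le_minus_one[of "3 :: real"] by simp
 \<comment> \<open>Both logarithms are at least 1, so \<open>(lg n - 1) * (lg m - 1) >= 0\<close>
   turns their sum into a product.\<close>
 also have "\<dots> <= 4 * (lg n * lg m)"
 proof -
 have "0 <= (lg n - 1) * (lg m - 1)" using lg_ge(1)[of n] lg_ge(1)[of m] by simp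
 then have "lg n + lg m <= lg n * lg m + 1" by (simp add: algebra_simps)
 moreover have "1 * 1 <= lg n * lg m" using lg_ge(1)[of n] lg_ge(1)[of m] by (intro mult_mono) auto
 ultimately show ?thesis by linarith
 qed
 finally show "ln ((real NX + 2 * real b) / (2 * real b)) <= 4 * (lg n * lg m)" .
qed

text \<open>The additional factor \<open>lg n\<close> of a deletion is absorbed by the factor
  \<open>b\<close> that its steps save, as \<open>lg n <= h <= b\<close>.\<close>

lemma time_terms:
 assumes D: "D <= 3 * (R * b)" and R: "R <= n" and h: "1 <= h"
 shows "ins_time <= 33600 * (real b * real b * real R * lg m) + 5000 * (real b * real R)"
 "del_time <= 33600 * (real b * real b * real R * lg m) + 5000 * (real b * real R)"
proof -
 note l = log_terms[OF D R]
 have "5600 * real b * real b * real R * ln (1 + Lam / real b) <= 5600 * real b * real b * real R * (6 * lg m)"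
 using l(1) by (intro mult_left_mono) auto
 then show "ins_time <= 33600 * (real b * real b * real R * lg m) + 5000 * (real b * real R)"
 unfolding ins_time_def by (simp add: mult_ac)
 have "(2 :: nat) ^ 1 <= 2 ^ h" using h by (intro power_increasing) auto
 then have "max 2 n <= 2 ^ h" using n_le by simp
 then have "real (max 2 n) <= real (2 ^ h)" by (rule of_nat_mono)
 then have "real (max 2 n) <= 2 ^ h" by (simp only: of_nat_power of_nat_numeral)
 then have "lg n <= log 2 (2 ^ h)" unfolding lg_def by (intro log_mono) auto
 then have nh: "lg n <= real h" by (simp add: log_nat_power)
 have "1 <= 4 * q ^ 2" using q_ge by simp
 then have "h <= b" unfolding b_eq using mult_le_mono1[of 1 "4 * q ^ 2" h] by simp
 then have nb: "lg n <= real b" using nh by linarith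
 have "4000 * real b * real R * ln ((real NX + 2 * real b) / (2 * real b)) <= 4000 * real b * real R * (4 * (lg n * lg m))"
 using l(2) by (intro mult_left_mono) auto
 also have "\<dots> = lg n * (16000 * real b * real R * lg m)" by simp
 also have "\<dots> <= real b * (16000 * real b * real R * lg m)" using nb lg_ge(1)[of m] by (intro mult_right_mono) auto
 also have "\<dots> <= 33600 * (real b * real b * real R * lg m)" using lg_ge(1)[of m] by (simp add: mult_ac mult_left_mono)
 finally show "del_time <= 33600 * (real b * real b * real R * lg m) + 5000 * (real b * real R)"
 unfolding del_time_def by simp
qed

end

lemma reachable_admissible: "reachable W P \<epsilon> n m r w M E ==> admissible n m r w E"
 by (induction rule: reachable.induct) (auto simp: legal_def)

text \<open>Everything is polynomial in the power \<open>2 ^ l\<close> of two above \<open>n + m + r + 1 / \<epsilon>\<close>, of which a word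
 holds the 40th power.\<close>

lemma program_correct:
 fixes \<epsilon> :: real
 assumes \<epsilon>: "0 < \<epsilon>" "\<epsilon> < 1" and w: "1 <= w" and adm0: "admissible n m r w E0" and W: "W = word_size 40 \<epsilon> n m r"
 shows "maintains_densest W (cc densest_program 0) \<epsilon> n m r w &
 (\<forall>p \<beta> t. op_time W (cc densest_program 0) \<epsilon> n m r w p \<beta> t -->
  real t <= 10 ^ 14 * (case p of
   Insert e => max (64 * real r / \<epsilon>\<^sup>2 * lg n / real w) 1 * (real r / \<epsilon> ^ 4 * (lg n)\<^sup>2 * lg m)
  | Delete e => max (64 * real r / \<epsilon>\<^sup>2 * lg n / real w) 1 * (real r / \<epsilon> ^ 4 * (lg n)\<^sup>2 * lg m)
  | Max_Density => 1
  | Densest_Subset => real \<beta> + lg n))"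
proof -
 \<comment> \<open>The existence of one admissible hypergraph makes \<open>n\<close>,
   \<open>m\<close> and \<open>r\<close> positive and forces \<open>w <= m\<close>, so that
   \<open>w\<close> fits into a word.\<close>
 note pos = admissible_pos[OF adm0 w]
 define l where "l = nat \<lceil>log 2 (real n + real m + real r + 1 / \<epsilon>)\<rceil>"
 define Z :: nat where "Z = 2 ^ l"
 let ?z = "real n + real m + real r + 1 / \<epsilon>"
 have e1: "1 < 1 / \<epsilon>" using \<epsilon> by simp
 have z4: "4 < ?z" using e1 pos by linarith
 have "log 2 ?z <= real l" unfolding l_def by (rule real_nat_ceiling_ge)
 then have "2 powr (log 2 ?z) <= 2 powr real l" by simp
 then have zZ: "?z <= real Z" using z4 unfolding Z_def by (simp add: powr_realpow)
 have "4 < real Z" using z4 zZ by linarith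
 then have "4 < Z" by simp
 then have "2 ^ 2 < (2 :: nat) ^ l" unfolding Z_def by simp
 then have l3: "3 <= l" using power_less_imp_less_exp[of "2 :: nat" 2 l] by simp
 have Z8: "8 <= Z" using power_increasing[OF l3, of "2 :: nat"] unfolding Z_def by simp
 have "real n <= real Z" "real m <= real Z" "real r <= real Z" and eZ: "1 / \<epsilon> <= real Z" using zZ e1 by linarith+
 then have nZ: "n <= Z" "m <= Z" "r <= Z" by simp_all
 have WZ: "2 ^ W = Z ^ 40" unfolding W word_size_def l_def[symmetric] Z_def by (simp add: power_mult[symmetric] mult.commute)
 have Z2: "2 <= Z" using Z8 by simp
 \<comment> \<open>The factor 64 in \<open>bnd\<close> costs two powers of \<open>Z\<close>, as
   \<open>Z >= 8\<close>.\<close>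
 have bnd: "x < bnd W" if "x <= Z ^ 37" for x
 proof -
 have "Z ^ 38 * 64 <= Z ^ 38 * Z ^ 2" using mult_le_mono[OF Z8 Z8] by (intro mult_le_mono2) (simp add: power2_eq_square)
 also have "\<dots> = 2 ^ W" unfolding WZ by (simp add: power_add[symmetric])
 finally have "Z ^ 38 <= bnd W" unfolding bnd_def by (simp add: less_eq_div_iff_mult_less_eq)
 moreover have "Z ^ 37 < Z ^ 38" using Z2 by (intro power_strict_increasing) auto
 ultimately show ?thesis using that by linarith
 qed
 define e where "e = nat \<lfloor>\<epsilon> * 2 ^ W\<rfloor>"
 define q where "q = 4 * ((2 ^ W - 1) div e + 2)"
 define h where "h = log_bound n"
 define R where "R = min r n"
 define Q where "Q = q * q * h"
 define D where "D = (8 * R * Q) div w + 1"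
 have "2 / \<epsilon> <= 2 * real Z" using eZ by simp
 also have "\<dots> <= real (Z ^ 2)" using Z2 by (simp add: power2_eq_square)
 also have "\<dots> <= real (Z ^ 40)" using power_increasing[of 2 40 Z] Z2 by (intro of_nat_mono) simp
 finally have P: "2 / \<epsilon> <= real (2 ^ W :: nat)" unfolding WZ .
 have ee: "e = nat \<lfloor>\<epsilon> * real (2 ^ W :: nat)\<rfloor>" unfolding e_def by simp
 note prec = inverse_precision[OF \<epsilon> P ee q_def]
 have "16 / \<epsilon> <= 16 * real Z" using eZ by simp
 then have "real q <= real (16 * Z)" using prec(2) by simp
 then have qZ: "q <= 16 * Z" by (simp only: of_nat_le_iff)
 note lb = log_bound[OF pos(1), folded h_def]
 have "h < 2 ^ h" by (rule less_exp)
 then have hZ: "h <= 2 * Z" using lb(3) nZ(1) by linarith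
 have RZ: "R <= Z" "R <= n" "1 <= R" "R <= r" unfolding R_def using nZ pos by simp_all
 note pb = parameter_bounds[OF Z8 nZ(1,2) RZ(1) qZ hZ Q_def D_def bnd bnd]
 have q8: "8 <= q" unfolding q_def by simp
 have "1 * 1 * 1 <= Q" unfolding Q_def using q8 lb(1) by (intro mult_le_mono) auto
 then have Q1: "1 <= Q" by simp
 have D1: "0 < D" unfolding D_def by simp
 interpret densest W n R "4 * Q" q h D "m * D" "m * R" "2 * (m * D) + 10" "m * D * R + m * R + 1" m
 proof unfold_locales
 show "0 < n" "0 < R" "0 < 4 * Q" "0 < m * D" "0 < D" using pos RZ Q1 D1 by simp_all
 show "n + 100 < bnd W" by (rule pb(1))
 show "(n * (2 * (m * D) + 10) + m * R + 1) * (m * D * R + m * R + 1) <= bnd W" using pb(2) by (rule less_imp_le)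
 show "2 * (m * D * R + m * R + 1) < bnd W" by (rule pb(3))
 show "4 * (4 * Q) + 4 < bnd W" by (rule pb(4))
 show "4 * Q = 4 * q ^ 2 * h" unfolding Q_def by (simp add: power2_eq_square)
 show "n <= 2 ^ h" by (rule lb(2))
 show "2 <= q" using q8 by simp
 show "(q + 1) * (m * D + n + D) < bnd W" by (rule pb(5))
 show "4 * (m * D) + 20 < bnd W" by (rule pb(6))
 qed simp_all
 let ?P = "cc densest_program 0"
 have bW: "bnd W <= 2 ^ W" unfolding bnd_def by simp
 have Dw: "8 * R * (q * q * h) < D * w"
 using dividend_less_div_times[of w "8 * R * Q"] w unfolding D_def Q_def by (simp add: algebra_simps)
 have rw: "r < 2 ^ W" "w < 2 ^ W" using pb(16,17) nZ pos bW by auto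
 have init: "\<exists>M ys t. runs W ?P (%_. 0) (encode_init W \<epsilon> n m r w es) M ys t & good M (mset es)"
 if "admissible n m r w (mset es)" for es
 by (rule init_step[OF that R_def q_def[unfolded e_def] h_def D_def[unfolded Q_def] prec(4)[unfolded e_def] rw pb(17,9,18)])
  (use pb(7,8,15) bnd qZ pow_up[of q Z 37] in \<open>auto simp: Q_def intro!: le_less_trans[OF _ pb(9)]\<close>)
 note step = op_step[OF _ _ R_def w Dw \<epsilon> prec(1)]
 \<comment> \<open>A reachable memory stems from some run; by \<open>runs_det\<close> this is the
   run that the simulation exhibits.\<close>
 have good: "good M E" if "reachable W ?P \<epsilon> n m r w M E" for M E
 using that
 proof (induction rule: reachable.induct)
 case (init es M ys t)
 then show ?case using \<open>\<And>es. admissible n m r w (mset es) ==> _\<close> runs_det by blast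
 next
 case (oper M E p M' ys t)
 from step[OF oper.IH oper.hyps(2)] obtain M1 y1 t1 where "runs W ?P M (encode_op p) M1 y1 t1" "good M1 (apply_op p E)" by blast
 then show ?case using runs_det[OF oper.hyps(3)] by blast
 qed
 have "maintains_densest W ?P \<epsilon> n m r w"
 unfolding maintains_densest_def using init step[OF good] by blast
 moreover have "real t <= 10 ^ 14 * (case p of
   Insert e => max (64 * real r / \<epsilon>\<^sup>2 * lg n / real w) 1 * (real r / \<epsilon> ^ 4 * (lg n)\<^sup>2 * lg m)
  | Delete e => max (64 * real r / \<epsilon>\<^sup>2 * lg n / real w) 1 * (real r / \<epsilon> ^ 4 * (lg n)\<^sup>2 * lg m)
  | Max_Density => 1
  | Densest_Subset => real \<beta> + lg n)" if op: "op_time W ?P \<epsilon> n m r w p \<beta> t" for p \<beta> t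
 proof -
 obtain M E M' ys where o: "reachable W ?P \<epsilon> n m r w M E" "legal n m r w p E" "runs W ?P M (encode_op p) M' ys t" "\<beta> = length ys"
  using op unfolding op_time_def by blast
 from step[OF good[OF o(1)] o(2)] obtain M1 y1 t1 where
  r1: "runs W ?P M (encode_op p) M1 y1 t1" "real t1 <= op_bound p (length y1)" by blast
 have t: "real t <= op_bound p \<beta>" using runs_det[OF o(3) r1(1)] r1(2) o(4) by simp
 define A where "A = max (64 * real r / \<epsilon>\<^sup>2 * lg n / real w) 1"
 define g where "g = 1 / \<epsilon>"
 have g1: "1 <= g" using e1 unfolding g_def by simp
 have qg: "real q <= 16 * g" using prec(2) unfolding g_def by simp
 have hL: "real h <= 2 * lg n" by (rule doubling_le_lg[OF lb(3) pos(1)])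
 have L1: "1 <= lg n" "1 <= lg m" by (rule lg_ge)+
 have qq: "real q * real q <= (16 * g) * (16 * g)" using qg g1 by (intro mult_mono) auto
 have "real q * real q * real h <= ((16 * g) * (16 * g)) * (2 * lg n)"
  by (rule mult_mono[OF qq hL]) (use g1 in auto)
 also have "\<dots> = 512 * g ^ 2 * lg n" by (simp add: power2_eq_square)
 finally have QL: "real Q <= 512 * g ^ 2 * lg n" unfolding Q_def by simp
 have b: "real (4 * Q) <= 2048 * g ^ 2 * lg n" using QL by linarith
 have "real R * real Q <= real r * (512 * g ^ 2 * lg n)"
  by (rule mult_mono[OF _ QL]) (use RZ in auto)
 from mult_left_mono[OF this, of 8] have RQ8: "8 * (real R * real Q) <= 8 * (real r * (512 * g ^ 2 * lg n))" by (simp only: zero_le_numeral)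
 have e8: "real (8 * R * Q) = 8 * (real R * real Q)" by simp
 have "real (8 * R * Q) <= 8 * (real r * (512 * g ^ 2 * lg n))" unfolding e8 by (rule RQ8)
 \<comment> \<open>Since \<open>8 * 512 = 64 * 64\<close>, the expression inside the claimed maximum
   splits off.\<close>
 also have "\<dots> = 64 * (64 * real r / \<epsilon>\<^sup>2 * lg n)" unfolding g_def by (simp add: power_one_over)
 finally have x: "real (8 * R * Q) <= 64 * (64 * real r / \<epsilon>\<^sup>2 * lg n)" .
 have "(8 * R * Q) div w * w <= 8 * R * Q" by (rule div_times_less_eq_dividend)
 then have "real ((8 * R * Q) div w * w) <= real (8 * R * Q)" by (rule of_nat_mono)
 then have dm: "real ((8 * R * Q) div w) * real w <= real (8 * R * Q)" by (simp only: of_nat_mult)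
 have w0: "0 < real w" using w by simp
 have "real ((8 * R * Q) div w) <= real (8 * R * Q) / real w" unfolding pos_le_divide_eq[OF w0] by (rule dm)
 also have "\<dots> <= 64 * (64 * real r / \<epsilon>\<^sup>2 * lg n) / real w" by (rule divide_right_mono[OF x]) simp
 also have "\<dots> = 64 * (64 * real r / \<epsilon>\<^sup>2 * lg n / real w)" by simp
 also have "\<dots> <= 64 * A" unfolding A_def by (intro mult_left_mono) auto
 finally have Dq: "real ((8 * R * Q) div w) <= 64 * A" .
 have "real D = real ((8 * R * Q) div w) + 1" unfolding D_def by simp
 moreover have A1: "1 <= A" unfolding A_def by simp
 ultimately have DA: "real D <= 65 * A" using Dq by linarith
 \<comment> \<open>Here the division by \<open>w\<close> is given up: the logarithmic terms only
   require \<open>D <= 3 * (R * b)\<close> with \<open>b = 4 * Q\<close>.\<close>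
 have "(8 * R * Q) div w <= 8 * R * Q" by (rule div_le_dividend)
 then have "D <= 8 * (R * Q) + 1" unfolding D_def by (simp add: mult.assoc)
 moreover have "1 * 1 <= R * Q" using RZ Q1 by (intro mult_le_mono) auto
 moreover have "R * (4 * Q) = 4 * (R * Q)" by simp
 ultimately have D3: "D <= 3 * (R * (4 * Q))" by linarith
 note tt = time_terms[OF D3 RZ(2) lb(1)]
 have "real q * real h <= (16 * g) * (2 * lg n)" by (rule mult_mono[OF qg hL]) (use g1 in auto)
 then have ql: "real (q * h) <= 32 * g * lg n" by (simp add: algebra_simps)
 have R': "1 <= real R" "real R <= real r" using RZ by simp_all
 have p0: "0 <= real (4 * Q)" "0 <= real D" by simp_all
 note bd = insert_time_bound[OF g1 L1(1) L1(2) A1 R'(1) R'(2) p0 b DA _ ql]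
 have tgt: "A * (real r * g ^ 4 * (lg n)\<^sup>2 * lg m) =
  max (64 * real r / \<epsilon>\<^sup>2 * lg n / real w) 1 * (real r / \<epsilon> ^ 4 * (lg n)\<^sup>2 * lg m)"
  unfolding A_def g_def by (simp add: power_one_over)
 have le: "x <= B" if "x <= u + 320" "u + 400 <= B" for x u B :: real using that by linarith
 show ?thesis
 proof (cases p)
  case (Insert e)
  have "real t <= real D * (ins_time + 40 * real R + 240) + 220 * real R + 60 * real (q * h) + 320"
  using t unfolding op_bound_def Insert operation.case .
  from le[OF this bd[OF tt(1)]] show ?thesis unfolding Insert operation.case tgt .
 next
  case (Delete e)
  have "1 <= real D" using D1 by simp
  \<comment> \<open>The arithmetic for insertions is reused. Its extra \<open>40 * R + 50\<close>
    per copy covers what a deletion spends more outside the loop over the copies.\<close>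
  then have D1': "1 * (40 * real R + 50) <= real D * (40 * real R + 50)" by (intro mult_right_mono) auto
  have "real t <= real D * (del_time + 190) + 240 * real R + 60 * real (q * h) + 350"
  using t unfolding op_bound_def Delete operation.case .
  also have "\<dots> <= real D * (del_time + 40 * real R + 240) + 220 * real R + 60 * real (q * h) + 320"
  proof -
  have "real D * (del_time + 40 * real R + 240) = real D * (del_time + 190) + real D * (40 * real R + 50)"
   by (simp add: algebra_simps)
  then show ?thesis using D1' RZ(3) by (simp add: algebra_simps)
  qed
  finally have "real t <= real D * (del_time + 40 * real R + 240) + 220 * real R + 60 * real (q * h) + 320" .
  from le[OF this bd[OF tt(2)]] show ?thesis unfolding Delete operation.case tgt .
 next
  case Max_Density
  then show ?thesis using t unfolding op_bound_def by simp
 next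
  case Densest_Subset
  then show ?thesis using t L1(1) unfolding op_bound_def by simp
 qed
 qed
 ultimately show ?thesis by blast
qed

theorem theorem2:
  shows "\<exists>(P :: program) (k :: nat) (C :: real).
    \<forall>(\<epsilon> :: real) (n :: nat) (m :: nat) (r :: nat) (w :: nat). 0 < \<epsilon> \<longrightarrow> \<epsilon> < 1 \<longrightarrow> 1 \<le> w \<longrightarrow>
      (let W = word_size k \<epsilon> n m r in
        maintains_densest W P \<epsilon> n m r w \<and>
        (\<forall>p \<beta> t. op_time W P \<epsilon> n m r w p \<beta> t \<longrightarrow>
          real t \<le> C *
            (case p of
               Insert e \<Rightarrow> max (64 * real r / \<epsilon>\<^sup>2 * lg n / real w) 1 * (real r / \<epsilon> ^ 4 * (lg n)\<^sup>2 * lg m)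
             | Delete e \<Rightarrow> max (64 * real r / \<epsilon>\<^sup>2 * lg n / real w) 1 * (real r / \<epsilon> ^ 4 * (lg n)\<^sup>2 * lg m)
             | Max_Density \<Rightarrow> 1
             | Densest_Subset \<Rightarrow> real \<beta> + lg n)))"
proof (intro exI[of _ "cc densest_program 0"] exI[of _ "40 :: nat"] exI[of _ "10 ^ 14 :: real"] allI impI)
 fix \<epsilon> :: real and n m r w :: nat
 assume \<epsilon>: "0 < \<epsilon>" "\<epsilon> < 1" and w: "1 <= w"
 show "let W = word_size 40 \<epsilon> n m r in
  maintains_densest W (cc densest_program 0) \<epsilon> n m r w &
  (\<forall>p \<beta> t. op_time W (cc densest_program 0) \<epsilon> n m r w p \<beta> t -->
   real t <= 10 ^ 14 *
   (case p of
    Insert e => max (64 * real r / \<epsilon>\<^sup>2 * lg n / real w) 1 * (real r / \<epsilon> ^ 4 * (lg n)\<^sup>2 * lg m)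
    | Delete e => max (64 * real r / \<epsilon>\<^sup>2 * lg n / real w) 1 * (real r / \<epsilon> ^ 4 * (lg n)\<^sup>2 * lg m)
    | Max_Density => 1
    | Densest_Subset => real \<beta> + lg n))"
 proof (cases "\<exists>E0. admissible n m r w E0")
 case True
 then obtain E0 where "admissible n m r w E0" by blast
 from program_correct[OF \<epsilon> w this refl] show ?thesis unfolding Let_def .
 next
 \<comment> \<open>Without an admissible hypergraph nothing can be initialised or reached, and all
   claims are vacuous. This covers degenerate parameters such as \<open>n = 0\<close> or
   \<open>w > m\<close>.\<close>
 case False
 then have "\<not> reachable W P \<epsilon> n m r w M E" for W P M E using reachable_admissible by blast
 then show ?thesis using False unfolding Let_def maintains_densest_def op_time_def by blast
 qed
qed

end
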